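(* Let $X$ be a spectrally negative Lévy process drifting to infinity whose Lévy measure $\Pi$ satisfies $\int_{(-\infty,-1)}x^2\,\Pi(dx)<\infty$ (and, if $X$ is of finite variation, $\Pi$ has no atoms). For $x\in\mathbb{R}$ let $$V(x)=\inf_{\tau\in\mathcal{T}}\mathbb{E}_x\left(\int_0^{\tau}G(X_s)\,ds\right),\qquad G(x)=2\psi'(0+)W(x)-1=2F(x)-1,$$ and $x_0=\inf\{x\in\mathbb{R}:G(x)\ge 0\}$. Then there exists some $a^*\in[x_0,\infty)$ such that, for every $x\in\mathbb{R}$, an optimal stopping time (one attaining the infimum defining $V(x)$) is given by $$\tau^*=\inf\{t\ge 0:V(X_t)=0\}=\inf\{t\ge 0:X_t\ge a^*\}.$$ The optimal stopping level $a^*$ is defined by $$a^*=\inf\{x\in\mathbb{R}:H(x)\ge 1/2\},\qquad H(x)=\int_{[0,x]}F(x-y)\,dF(y).$$ Furthermore, $V$ is a non-decreasing, continuous function satisfying the following. (i) If $X$ is of infinite variation, or of finite variation with $F(0)^2<1/2$, then $a^*>0$ is the median of the distribution function $H$, i.e. the unique value which satisfies $$H(a^* )=\int_{[0,a^*]}F(a^*-y)\,dF(y)=\frac12 .$$ The value function is given by $$V(x)=\left(\frac{2}{\psi'(0+)}\int_x^{a^*}H(y)\,dy-\frac{a^*-x}{\psi'(0+)}\right)\mathbf{1}_{\{x\le a^*\}},\qquad x\in\mathbb{R}.$$ Moreover, there is smooth fit at $a^*$, i.e. $V'(a^*-)=0=V'(a^*+)$. (ii) If $X$ is of finite variation with $F(0)^2\ge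 1/2$, then $a^*=0$ and $$V(x)=\frac{x}{\psi'(0+)}\mathbf{1}_{\{x\le 0\}},\qquad x\in\mathbb{R}.$$ In particular, there is continuous fit at $a^*=0$, i.e. $V(0-)=0$, and there is no smooth fit at $a^*$, i.e. $V'(a^*-)>0$.
   Context: $X=(X_t)_{t\ge0}$ is a spectrally negative Lévy process on a filtered probability space $(\Omega,\mathcal{F},\mathbb{F},\mathbb{P})$, where $\mathbb{F}$ is the (naturally enlarged) filtration generated by $X$; $X_0=0$ under $\mathbb{P}$, and $\mathbb{P}_x$ (expectation $\mathbb{E}_x$) denotes the law of $X$ started from $x$, i.e. of $x+X$ under $\mathbb{P}$. It has Lévy triple $(c,\sigma,\Pi)$ with $c\in\mathbb{R}$, $\sigma\ge0$ and $\Pi$ a measure on $(-\infty,0)$ with $\int_{(-\infty,0)}(1\wedge x^2)\,\Pi(dx)<\infty$; its Laplace exponent is $\psi(\lambda)=\log\mathbb{E}(e^{\lambda X_1})=-c\lambda+\frac12\sigma^2\lambda^2+\int_{(-\infty,0)}(e^{\lambda x}-1-\lambda x\mathbf{1}_{\{x>-1\}})\,\Pi(dx)$, $\lambda\ge0$. "Drifting to infinity" means $\lim_{t\to\infty}X_t=\infty$ a.s., so that $\psi'(0+)=\mathbb{E}(X_1)\in(0,\infty)$. Standing assumption: if $X$ is of finite variation, $\Pi$ has no atoms. $W$ is the scale function of $X$: $W(x)=0$ for $x<0$, and on $[0,\infty)$ $W$ is the continuous function with $\int_0^\infty e^{-\beta x}W(x)\,dx=1/\psi(\beta)$ for $\beta>0$.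 $F$ is the distribution function of $-\underline{X}_\infty=-\inf_{t\ge0}X_t$ under $\mathbb{P}$, i.e. $F(x)=\mathbb{P}(-\inf_{t\ge0}X_t\le x)$; one has $F(x)=\psi'(0+)W(x)$. $H$ is the convolution of $F$ with itself; the integral over $[0,x]$ includes the possible atom of $F$ at $0$, and $H(x)=0$ for $x<0$. $\mathcal{T}$ is the set of all stopping times of $\mathbb{F}$ (the value $+\infty$ is allowed), and $\inf\emptyset=\infty$ for random times. $V'(a\pm)$ denotes the right/left derivative at $a$, and $V(0-)$ the left limit at $0$. *)

theory Defs
  imports "HOL-Probability.Probability"
begin

section \<open>Spectrally negative Levy processes\<close>

text \<open>
  A process is a function \<open>X :: real \<Rightarrow> 'a \<Rightarrow> real\<close> of which only the times
  \<open>t \<ge> 0\<close> matter. Path properties hold almost surely. The law \<open>P\<^sub>x\<close> is rendered as the law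
  of \<open>x + X\<close> under \<open>M\<close>. Events and expectations that involve uncountably many times, or
  stopping times of the enlarged filtration, are evaluated in the completion of \<open>M\<close>, since
  \<open>M\<close> itself is not assumed to be complete.
\<close>

definition cadlag :: "(real \<Rightarrow> real) \<Rightarrow> bool" where
  "cadlag f \<longleftrightarrow>
     (\<forall>t\<ge>0. (f \<longlongrightarrow> f t) (at_right t)) \<and> (\<forall>t>0. \<exists>l. (f \<longlongrightarrow> l) (at_left t))"

definition levy_process :: "'a measure \<Rightarrow> (real \<Rightarrow> 'a \<Rightarrow> real) \<Rightarrow> bool" where
  "levy_process M X \<longleftrightarrow>
     prob_space M \<and>
     (\<forall>t\<ge>0. X t \<in> borel_measurable M) \<and>
     (AE \<omega> in M. X 0 \<omega> = 0) \<and>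
     (AE \<omega> in M. cadlag (\<lambda>t. X t \<omega>)) \<and>
     (\<forall>(n::nat) t. mono t \<and> 0 \<le> t 0 \<longrightarrow>
        prob_space.indep_vars M (\<lambda>_. borel) (\<lambda>i \<omega>. X (t (Suc i)) \<omega> - X (t i) \<omega>) {..<n}) \<and>
     (\<forall>s t. 0 \<le> s \<and> s \<le> t \<longrightarrow>
        distr M borel (\<lambda>\<omega>. X t \<omega> - X s \<omega>) = distr M borel (X (t - s)))"

definition no_positive_jumps :: "(real \<Rightarrow> real) \<Rightarrow> bool" where
  "no_positive_jumps f \<longleftrightarrow> (\<forall>t>0. \<forall>l. (f \<longlongrightarrow> l) (at_left t) \<longrightarrow> f t \<le> l)"

definition spectrally_negative_levy :: "'a measure \<Rightarrow> (real \<Rightarrow> 'a \<Rightarrow> real) \<Rightarrow> bool" where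
  "spectrally_negative_levy M X \<longleftrightarrow>
     levy_process M X \<and> (AE \<omega> in M. no_positive_jumps (\<lambda>t. X t \<omega>))"

definition laplace_exponent :: "'a measure \<Rightarrow> (real \<Rightarrow> 'a \<Rightarrow> real) \<Rightarrow> real \<Rightarrow> real" where
  "laplace_exponent M X \<beta> = ln (\<integral>\<omega>. exp (\<beta> * X 1 \<omega>) \<partial>M)"

text \<open>\<open>\<psi>'(0+)\<close>, the right derivative at \<open>0\<close>.\<close>

definition psi_prime_0 :: "'a measure \<Rightarrow> (real \<Rightarrow> 'a \<Rightarrow> real) \<Rightarrow> real" where
  "psi_prime_0 M X = vector_derivative (laplace_exponent M X) (at_right 0)"

text \<open>
  \<open>(c, \<sigma>, \<nu>)\<close> is the Levy triple of \<open>X\<close>. The measure \<open>\<nu>\<close> on the negative half-line is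
  rendered as a Borel measure on the line that gives no mass to \<open>{0..}\<close>. The triple
  is tied to \<open>X\<close> by its Laplace exponent, whose finiteness has to be required explicitly
  because \<open>laplace_exponent\<close> is total.
\<close>

definition levy_triple ::
  "'a measure \<Rightarrow> (real \<Rightarrow> 'a \<Rightarrow> real) \<Rightarrow> real \<Rightarrow> real \<Rightarrow> real measure \<Rightarrow> bool" where
  "levy_triple M X c \<sigma> \<nu> \<longleftrightarrow>
     0 \<le> \<sigma> \<and> sets \<nu> = sets borel \<and> emeasure \<nu> {0..} = 0 \<and>
     (\<integral>\<^sup>+x. ennreal (min 1 (x\<^sup>2)) \<partial>\<nu>) < \<infinity> \<and>
     (\<forall>\<beta>\<ge>0. integrable M (\<lambda>\<omega>. exp (\<beta> * X 1 \<omega>)) \<and>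
        laplace_exponent M X \<beta> =
          - c * \<beta> + \<sigma>\<^sup>2 * \<beta>\<^sup>2 / 2
          + (\<integral>x. (exp (\<beta> * x) - 1 - \<beta> * x * indicator {-1<..} x) \<partial>\<nu>))"

definition drifts_to_infinity :: "'a measure \<Rightarrow> (real \<Rightarrow> 'a \<Rightarrow> real) \<Rightarrow> bool" where
  "drifts_to_infinity M X \<longleftrightarrow> (AE \<omega> in M. filterlim (\<lambda>t. X t \<omega>) at_top at_top)"

definition bounded_variation_on :: "real set \<Rightarrow> (real \<Rightarrow> real) \<Rightarrow> bool" where
  "bounded_variation_on S f \<longleftrightarrow>
     (\<exists>B. \<forall>(n::nat) t. mono t \<and> range t \<subseteq> S \<longrightarrow> (\<Sum>i<n. \<bar>f (t (Suc i)) - f (t i)\<bar>) \<le> B)"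

text \<open>Infinite variation is the negation of the following.\<close>

definition finite_variation :: "'a measure \<Rightarrow> (real \<Rightarrow> 'a \<Rightarrow> real) \<Rightarrow> bool" where
  "finite_variation M X \<longleftrightarrow> (AE \<omega> in M. \<forall>T\<ge>0. bounded_variation_on {0..T} (\<lambda>t. X t \<omega>))"

definition no_atoms :: "real measure \<Rightarrow> bool" where
  "no_atoms \<nu> \<longleftrightarrow> (\<forall>x. emeasure \<nu> {x} = 0)"

definition scale_function ::
  "'a measure \<Rightarrow> (real \<Rightarrow> 'a \<Rightarrow> real) \<Rightarrow> (real \<Rightarrow> real) \<Rightarrow> bool" where
  "scale_function M X W \<longleftrightarrow>
     (\<forall>x<0. W x = 0) \<and> continuous_on {0..} W \<and>
     (\<forall>\<beta>>0. set_integrable lborel {0..} (\<lambda>x. exp (- \<beta> * x) * W x) \<and>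
        (LINT x:{0..}|lborel. exp (- \<beta> * x) * W x) = 1 / laplace_exponent M X \<beta>)"

text \<open>
  The distribution function \<open>F\<close> of \<open>- inf X\<close>, the infimum being taken in the extended reals,
  and its convolution \<open>H\<close> with itself; \<open>interval_measure F\<close> is the Lebesgue--Stieltjes
  measure \<open>dF\<close>, including the atom \<open>F 0\<close> at \<open>0\<close>.
\<close>

definition F_inf :: "'a measure \<Rightarrow> (real \<Rightarrow> 'a \<Rightarrow> real) \<Rightarrow> real \<Rightarrow> real" where
  "F_inf M X x =
     measure (completion M) {\<omega> \<in> space M. - (INF t\<in>{0..}. ereal (X t \<omega>)) \<le> ereal x}"

definition self_convolution :: "(real \<Rightarrow> real) \<Rightarrow> real \<Rightarrow> real" where
  "self_convolution F x = (LINT y:{0..x}|interval_measure F. F (x - y))"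


section \<open>The optimal stopping problem\<close>

text \<open>
  The filtration is indexed by \<open>[0, \<infinity>]\<close>, so that \<open>stopping_time\<close> applies to random times
  with values in \<open>ennreal\<close>; its condition at time \<open>\<infinity>\<close> is void. Natural enlargement means
  adding all subsets of null sets and passing to right limits.
\<close>

definition null_augmented_filtration ::
  "'a measure \<Rightarrow> (real \<Rightarrow> 'a \<Rightarrow> real) \<Rightarrow> ennreal \<Rightarrow> 'a measure" where
  "null_augmented_filtration M X t =
     sigma (space M)
       ({X s -` B \<inter> space M | s B. 0 \<le> s \<and> ennreal s \<le> t \<and> B \<in> sets borel}
        \<union> null_sets (completion M))"

definition enlarged_filtration ::
  "'a measure \<Rightarrow> (real \<Rightarrow> 'a \<Rightarrow> real) \<Rightarrow> ennreal \<Rightarrow> 'a measure" where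
  "enlarged_filtration M X t =
     sigma (space M) (\<Inter>u\<in>{u. t < u \<or> u = \<infinity>}. sets (null_augmented_filtration M X u))"

text \<open>
  The integral of an extended real function, \<open>\<integral>f\<^sup>+ - \<integral>f\<^sup>-\<close>. It is needed because
  the running cost may be \<open>+\<infinity>\<close>, e.g. for the stopping time \<open>\<infinity>\<close>.
\<close>

definition ext_integral :: "'b measure \<Rightarrow> ('b \<Rightarrow> ereal) \<Rightarrow> ereal" where
  "ext_integral N f =
     enn2ereal (\<integral>\<^sup>+x. e2ennreal (f x) \<partial>N) - enn2ereal (\<integral>\<^sup>+x. e2ennreal (- f x) \<partial>N)"

text \<open>\<open>E\<^sub>x (\<integral>\<^sub>0\<^sup>\<tau> G (X\<^sub>s) ds)\<close>\<close>

definition stopping_cost ::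
  "'a measure \<Rightarrow> (real \<Rightarrow> 'a \<Rightarrow> real) \<Rightarrow> (real \<Rightarrow> real) \<Rightarrow> real \<Rightarrow> ('a \<Rightarrow> ennreal) \<Rightarrow> ereal" where
  "stopping_cost M X G x \<tau> =
     ext_integral (completion M) (\<lambda>\<omega>.
       ext_integral lborel (\<lambda>s.
         ereal (indicator {s. 0 \<le> s \<and> ennreal s \<le> \<tau> \<omega>} s * G (x + X s \<omega>))))"

definition optimal_value ::
  "'a measure \<Rightarrow> (real \<Rightarrow> 'a \<Rightarrow> real) \<Rightarrow> (real \<Rightarrow> real) \<Rightarrow> real \<Rightarrow> ereal" where
  "optimal_value M X G x =
     (INF \<tau>\<in>{\<tau>. stopping_time (enlarged_filtration M X) \<tau>}. stopping_cost M X G x \<tau>)"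

definition optimal_stopping_time ::
  "'a measure \<Rightarrow> (real \<Rightarrow> 'a \<Rightarrow> real) \<Rightarrow> (real \<Rightarrow> real) \<Rightarrow> real \<Rightarrow> ('a \<Rightarrow> ennreal) \<Rightarrow> bool" where
  "optimal_stopping_time M X G x \<tau> \<longleftrightarrow>
     stopping_time (enlarged_filtration M X) \<tau> \<and> stopping_cost M X G x \<tau> = optimal_value M X G x"

definition first_entry :: "real set \<Rightarrow> (real \<Rightarrow> real) \<Rightarrow> ennreal" where
  "first_entry S f = Inf {ennreal t | t. 0 \<le> t \<and> f t \<in> S}"

end

theory Submission
  imports Defs
begin

text \<open>
  Let \<open>m = \<psi>'(0+)\<close>, let \<open>Y\<close> and \<open>Y'\<close> be independent copies of \<open>- inf X\<close>, so that \<open>H\<close> is the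
  distribution function of \<open>Y + Y'\<close>, and put \<open>g x = (2 * E (x - Y - Y')\<^sup>+ - x) / m\<close>. On a dyadic grid \<open>X\<close>
  is a random walk, whose infimum satisfies Lindley's recursion. Letting the mesh tend to \<open>0\<close>, the recursion
  gives \<open>E exp (- \<beta> * Y) = m * \<beta> / \<psi> \<beta>\<close>, hence \<open>F = m * W\<close>, and it shows that
  \<open>z \<mapsto> E (z - Y)\<^sup>+\<close> has the generator \<open>m * indicator {0..}\<close>. So \<open>g\<close> has the generator \<open>G\<close>, and by
  optional stopping, obtained from the same discretisation, the cost of \<open>\<tau>\<close> is
  \<open>E (g (x + X \<tau>)) - g x\<close>.

  The slope of the convex function \<open>g\<close> is \<open>(2 * H - 1) / m\<close>, so \<open>g\<close> is minimal at the median \<open>a\<close> of \<open>H\<close>.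
  For \<open>x \<le> a\<close> the cost is therefore at least \<open>g a - g x\<close>, with equality for the first passage time of
  \<open>a\<close>, since \<open>X\<close> creeps upwards. For \<open>x \<ge> a\<close> the support line of \<open>g\<close> at \<open>x\<close> and Wald's identity show that
  the cost is nonnegative.

  The two cases of the theorem are those of \<open>a > 0\<close> and \<open>a = 0\<close>: if \<open>F 0 > 0\<close>, then \<open>X t - X s \<le> d * (t - s)\<close>
  for some \<open>d\<close>, so \<open>X\<close> is of finite variation.
\<close>


text \<open>A Levy process is given only through increments over deterministic times, so every
  identity is first proved on a dyadic grid, where it is an exact statement about a random walk, and
  the error is controlled as the mesh shrinks. One step of the recursion cuts an amount
  \<open>L\<close> off at zero. The infimum and its restarted copy have the same law, which forces
  \<open>E L = m * mesh\<close> exactly, even before the infimum is known to be integrable. All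
  higher order terms sit in \<open>E (exp (\<beta> * L) - 1 - \<beta> * L)\<close>. That this is
  \<open>o(mesh)\<close> is the analytic core, and it uses exponential moments of arbitrarily high
  order.

  The shape of \<open>g\<close>: adding the second copy \<open>Y'\<close> turns the generator
  \<open>m * indicator {0..}\<close> into \<open>m * F\<close>; the identity function has generator
  \<open>m\<close>; so doubling the one, subtracting the other and dividing by \<open>m\<close>
  gives \<open>2 * F - 1\<close>.

  The quadratic bound on the Laplace exponent, which comes from the second moment of the jumps,
  makes \<open>E Y\<close> finite. Then \<open>g\<close> lies above a line of slope
  \<open>1 / m\<close>, the negative part of every cost has finite mean, and no difference of
  infinities occurs.\<close>

subsection \<open>The Laplace exponent\<close>

lemma exp_minus_one_minus_nonneg: "0 \<le> exp u - 1 - (u::real)"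
  using exp_ge_add_one_self[of u] by linarith

lemma exp_le_quadratic_nonpos:
  fixes u :: real
  assumes "u \<le> 0"
  shows "exp u - 1 - u \<le> u\<^sup>2 / 2"
proof -
  let ?f = "\<lambda>u::real. exp u - 1 - u - u\<^sup>2 / 2"
  have "?f u \<le> ?f 0"
  proof (rule DERIV_nonneg_imp_nondecreasing[OF assms])
    fix x :: real
    show "\<exists>y. (?f has_real_derivative y) (at x) \<and> 0 \<le> y"
      by (rule exI[of _ "exp x - 1 - x"])
         (use exp_minus_one_minus_nonneg[of x] in \<open>auto intro!: derivative_eq_intros\<close>)
  qed
  then show ?thesis by simp
qed

lemma exp_ge_quadratic_nonneg:
  fixes u :: real
  assumes "0 \<le> u"
  shows "u\<^sup>2 / 2 \<le> exp u - 1 - u"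
proof -
  let ?f = "\<lambda>u::real. exp u - 1 - u - u\<^sup>2 / 2"
  have "?f 0 \<le> ?f u"
  proof (rule DERIV_nonneg_imp_nondecreasing[OF assms])
    fix x :: real
    show "\<exists>y. (?f has_real_derivative y) (at x) \<and> 0 \<le> y"
      by (rule exI[of _ "exp x - 1 - x"])
         (use exp_minus_one_minus_nonneg[of x] in \<open>auto intro!: derivative_eq_intros\<close>)
  qed
  then show ?thesis by simp
qed

lemma exp_le_quadratic_nonneg:
  fixes u :: real
  assumes "0 \<le> u"
  shows "exp u - 1 - u \<le> u\<^sup>2 / 2 * exp u"
proof -
  \<comment> \<open>Multiply \<open>1 - x \<le> exp (- x)\<close> by \<open>exp x\<close>. This
    makes the derivative of \<open>?f\<close> below nonnegative.\<close>
  have *: "exp x - 1 \<le> x * exp x" for x :: real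
    using exp_ge_add_one_self[of "-x"] mult_right_mono[of "1 - x" "exp (-x)" "exp x"]
    by (simp add: algebra_simps flip: exp_add)
  let ?f = "\<lambda>u::real. u\<^sup>2 / 2 * exp u - (exp u - 1 - u)"
  have "?f 0 \<le> ?f u"
  proof (rule DERIV_nonneg_imp_nondecreasing[OF assms])
    fix x :: real
    show "\<exists>y. (?f has_real_derivative y) (at x) \<and> 0 \<le> y"
      by (rule exI[of _ "x * exp x + x\<^sup>2 / 2 * exp x - (exp x - 1)"])
         (use *[of x] in \<open>auto intro!: derivative_eq_intros simp: add_nonneg_nonneg\<close>,
          smt (verit) divide_nonneg_pos exp_gt_zero mult_nonneg_nonneg zero_le_power2)
  qed
  then show ?thesis by simp
qed

text \<open>With a finite second moment of \<open>\<nu>\<close> the linear compensation can be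
  extended from the small jumps to all jumps. The remaining integrand
  \<open>exp (\<beta> * x) - 1 - \<beta> * x\<close> lies between \<open>0\<close> and
  \<open>\<beta>^2 * x^2 / 2\<close> for \<open>x < 0\<close>, so \<open>m = J - c\<close> is the
  coefficient of the linear part and \<open>K\<close> is half the total variance rate.\<close>

lemma laplace_exponent_bounds:
  assumes triple: "levy_triple M X c \<sigma> \<nu>"
    and moment: "(\<integral>\<^sup>+x\<in>{..< -1}. ennreal (x\<^sup>2) \<partial>\<nu>) < \<infinity>"
  obtains m K where "0 \<le> K"
    "\<And>\<beta>. 0 \<le> \<beta> \<Longrightarrow> \<beta> * m \<le> laplace_exponent M X \<beta>"
    "\<And>\<beta>. 0 \<le> \<beta> \<Longrightarrow> laplace_exponent M X \<beta> \<le> \<beta> * m + K * \<beta>\<^sup>2"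
proof -
  have [measurable_cong]: "sets \<nu> = sets borel" and null: "emeasure \<nu> {0..} = 0"
    and small: "(\<integral>\<^sup>+x. ennreal (min 1 (x\<^sup>2)) \<partial>\<nu>) < \<infinity>"
    using triple unfolding levy_triple_def by auto
  have "AE x in \<nu>. x \<notin> {0..}"
    by (rule AE_not_in) (use null in \<open>auto simp: null_sets_def \<open>sets \<nu> = sets borel\<close>\<close>)
  then have neg: "AE x in \<nu>. x < 0" by eventually_elim auto
  have "(\<integral>\<^sup>+x. ennreal (x\<^sup>2) \<partial>\<nu>) \<le>
      (\<integral>\<^sup>+x. ennreal (min 1 (x\<^sup>2)) + ennreal (x\<^sup>2) * indicator {..< -1} x \<partial>\<nu>)"
  proof (rule nn_integral_mono_AE, use neg in eventually_elim)
    fix x :: real assume "x < 0"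
    show "ennreal (x\<^sup>2) \<le> ennreal (min 1 (x\<^sup>2)) + ennreal (x\<^sup>2) * indicator {..< -1} x"
    proof (cases "x < -1")
      case False
      then have "x\<^sup>2 \<le> 1" using \<open>x < 0\<close> by (simp add: abs_square_le_1)
      then show ?thesis using False by (simp add: min_def)
    qed auto
  qed
  also have "\<dots> = (\<integral>\<^sup>+x. ennreal (min 1 (x\<^sup>2)) \<partial>\<nu>) + (\<integral>\<^sup>+x\<in>{..< -1}. ennreal (x\<^sup>2) \<partial>\<nu>)"
    by (rule nn_integral_add) auto
  also have "\<dots> < \<infinity>" using small moment by simp
  finally have int_sq: "integrable \<nu> (\<lambda>x. x\<^sup>2)"
    by (intro integrableI_nonneg) auto
  \<comment> \<open>The large jumps, which the triple leaves uncompensated. There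
    \<open>\<bar>x\<bar> \<le> x^2\<close>, so the second moment makes their mean finite.\<close>
  let ?t = "\<lambda>x::real. x * indicator {..-1} x"
  have int_t: "integrable \<nu> ?t"
  proof (rule Bochner_Integration.integrable_bound[OF int_sq])
    show "AE x in \<nu>. norm (?t x) \<le> norm (x\<^sup>2)"
    proof (rule AE_I2)
      fix x :: real
      show "norm (?t x) \<le> norm (x\<^sup>2)"
      proof (cases "x \<le> -1")
        case True
        have "(-x) * 1 \<le> (-x) * (-x)" using True by (intro mult_left_mono) auto
        then show ?thesis using True by (simp add: power2_eq_square)
      qed auto
    qed
  qed simp
  let ?r = "\<lambda>\<beta> x::real. exp (\<beta> * x) - 1 - \<beta> * x"
  have r_le: "?r \<beta> x \<le> \<beta>\<^sup>2 / 2 * x\<^sup>2" if "0 \<le> \<beta>" "x < 0" for \<beta> x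
    using exp_le_quadratic_nonpos[of "\<beta> * x"] that
    by (simp add: mult_nonneg_nonpos power_mult_distrib)
  have int_r: "integrable \<nu> (?r \<beta>)" if "0 \<le> \<beta>" for \<beta>
  proof (rule Bochner_Integration.integrable_bound[of _ "\<lambda>x. \<beta>\<^sup>2 / 2 * x\<^sup>2"])
    show "AE x in \<nu>. norm (?r \<beta> x) \<le> norm (\<beta>\<^sup>2 / 2 * x\<^sup>2)"
      using neg by eventually_elim
        (use r_le[OF that] exp_minus_one_minus_nonneg in \<open>auto simp: abs_of_nonneg\<close>)
  qed (use int_sq in auto)
  define S where "S = (\<integral>x. x\<^sup>2 \<partial>\<nu>)"
  define J where "J = (\<integral>x. ?t x \<partial>\<nu>)"
  have S_nonneg: "0 \<le> S" unfolding S_def by simp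
  have psi: "laplace_exponent M X \<beta> = \<beta> * (J - c) + \<sigma>\<^sup>2 * \<beta>\<^sup>2 / 2 + (\<integral>x. ?r \<beta> x \<partial>\<nu>)"
    if "0 \<le> \<beta>" for \<beta>
  proof -
    have "(\<integral>x. (exp (\<beta> * x) - 1 - \<beta> * x * indicator {-1<..} x) \<partial>\<nu>)
        = (\<integral>x. ?r \<beta> x + \<beta> * ?t x \<partial>\<nu>)"
      by (rule Bochner_Integration.integral_cong) (auto simp: indicator_def)
    also have "\<dots> = (\<integral>x. ?r \<beta> x \<partial>\<nu>) + \<beta> * J"
      unfolding J_def using int_r[OF that] int_t by simp
    finally show ?thesis
      using triple that unfolding levy_triple_def by (simp add: algebra_simps)
  qed
  show thesis
  proof (rule that[of "\<sigma>\<^sup>2 / 2 + S / 2" "J - c"])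
    fix \<beta> :: real assume \<beta>: "0 \<le> \<beta>"
    have "0 \<le> (\<integral>x. ?r \<beta> x \<partial>\<nu>)"
      by (rule integral_nonneg_AE) (use exp_minus_one_minus_nonneg in auto)
    then show "\<beta> * (J - c) \<le> laplace_exponent M X \<beta>"
      unfolding psi[OF \<beta>] by simp
    have "(\<integral>x. ?r \<beta> x \<partial>\<nu>) \<le> (\<integral>x. \<beta>\<^sup>2 / 2 * x\<^sup>2 \<partial>\<nu>)"
      by (rule integral_mono_AE)
         (use int_r[OF \<beta>] int_sq neg r_le[OF \<beta>] in auto)
    also have "\<dots> = \<beta>\<^sup>2 / 2 * S" unfolding S_def by simp
    finally show "laplace_exponent M X \<beta> \<le> \<beta> * (J - c) + (\<sigma>\<^sup>2 / 2 + S / 2) * \<beta>\<^sup>2"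
      unfolding psi[OF \<beta>] by (simp add: algebra_simps)
  qed (use S_nonneg in simp)
qed

lemma psi_prime_0_eqI:
  assumes "\<And>\<beta>. 0 \<le> \<beta> \<Longrightarrow> \<beta> * m \<le> laplace_exponent M X \<beta>"
    and "\<And>\<beta>. 0 \<le> \<beta> \<Longrightarrow> laplace_exponent M X \<beta> \<le> \<beta> * m + K * \<beta>\<^sup>2"
  shows "psi_prime_0 M X = m"
proof -
  let ?\<psi> = "laplace_exponent M X"
  have zero: "?\<psi> 0 = 0" using assms(1)[of 0] assms(2)[of 0] by simp
  have "((\<lambda>y. (?\<psi> y - ?\<psi> 0) / (y - 0)) \<longlongrightarrow> m) (at_right 0)"
  proof (rule real_tendsto_sandwich)
    show "\<forall>\<^sub>F y in at_right 0. m \<le> (?\<psi> y - ?\<psi> 0) / (y - 0)"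
      using eventually_at_right_less[of "0::real"]
      by eventually_elim (use assms(1) zero in \<open>auto simp: field_simps\<close>)
    show "\<forall>\<^sub>F y in at_right 0. (?\<psi> y - ?\<psi> 0) / (y - 0) \<le> m + K * y"
      using eventually_at_right_less[of "0::real"]
      by eventually_elim (use assms(2) zero in \<open>auto simp: field_simps power2_eq_square\<close>)
    show "((\<lambda>y. m + K * y) \<longlongrightarrow> m) (at_right 0)"
      by (auto intro!: tendsto_eq_intros)
  qed auto
  then have "(?\<psi> has_real_derivative m) (at_right 0)"
    by (simp add: has_field_derivative_iff)
  then have "(?\<psi> has_vector_derivative m) (at_right 0)"
    by (simp add: has_real_derivative_iff_has_vector_derivative)
  moreover have "at_right (0::real) \<noteq> bot" by simp
  ultimately show ?thesis
    unfolding psi_prime_0_def by (intro vector_derivative_within)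
qed

subsection \<open>Cadlag paths\<close>

text \<open>Rounds strictly upwards, also when \<open>s\<close> is itself a grid point. The
  approximations therefore stay in \<open>at_right s\<close>, and right-continuity applies without a
  case distinction.\<close>

definition dyadic_above :: "nat \<Rightarrow> real \<Rightarrow> real" where
  "dyadic_above n s = real_of_int (\<lfloor>2 ^ n * s\<rfloor> + 1) / 2 ^ n"

lemma dyadic_above_gt: "s < dyadic_above n s"
  unfolding dyadic_above_def by (simp add: field_simps) linarith

lemma dyadic_above_le: "dyadic_above n s \<le> s + 1 / 2 ^ n"
  unfolding dyadic_above_def by (simp add: field_simps)

lemma dyadic_above_nonneg: "0 \<le> s \<Longrightarrow> 0 \<le> dyadic_above n s"
  using dyadic_above_gt[of s n] by linarith

lemma half_power_tendsto_0: "(\<lambda>n. 1 / 2 ^ n :: real) \<longlonglongrightarrow> 0"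
  using LIMSEQ_power_zero[of "1/2::real"] by (simp add: power_one_over)

lemma dyadic_above_tendsto: "filterlim (\<lambda>n. dyadic_above n s) (at_right s) sequentially"
proof -
  have "(\<lambda>n. dyadic_above n s) \<longlonglongrightarrow> s"
  proof (rule real_tendsto_sandwich[of "\<lambda>_. s" _ _ "\<lambda>n. s + 1 / 2 ^ n"])
    show "(\<lambda>n. s + 1 / 2 ^ n) \<longlonglongrightarrow> s"
      using tendsto_add[OF tendsto_const half_power_tendsto_0, of s] by simp
    show "\<forall>\<^sub>F n in sequentially. s \<le> dyadic_above n s"
      by (intro always_eventually allI less_imp_le dyadic_above_gt)
  qed (simp_all add: dyadic_above_le)
  then show ?thesis
    by (auto simp: filterlim_at dyadic_above_gt less_imp_neq[OF dyadic_above_gt, symmetric] intro!: always_eventually)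
qed

lemma dyadic_above_eq_of_nat:
  assumes "0 \<le> s"
  obtains k :: nat where "dyadic_above n s = real k / 2 ^ n"
proof -
  have "0 \<le> \<lfloor>2 ^ n * s\<rfloor> + 1" using assms by (simp add: zero_le_floor add_nonneg_nonneg)
  then have "dyadic_above n s = real (nat (\<lfloor>2 ^ n * s\<rfloor> + 1)) / 2 ^ n"
    unfolding dyadic_above_def by simp
  then show thesis by (rule that)
qed

lemma cadlag_dyadic_tendsto:
  assumes "cadlag f" "0 \<le> s"
  shows "(\<lambda>n. f (dyadic_above n s)) \<longlonglongrightarrow> f s"
  using assms filterlim_compose[OF _ dyadic_above_tendsto] unfolding cadlag_def by blast

text \<open>The one-sided limits give a bound near every point, and compactness of
  \<open>{0..T}\<close> leaves finitely many of them.\<close>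

lemma cadlag_bounded:
  assumes "cadlag f"
  obtains B where "\<And>t. 0 \<le> t \<Longrightarrow> t \<le> T \<Longrightarrow> \<bar>f t\<bar> \<le> B"
proof -
  have loc: "\<exists>e>0. \<exists>B. \<forall>s\<in>{0..} \<inter> ball t e. \<bar>f s\<bar> \<le> B" if "0 \<le> t" for t
  proof -
    have "(f \<longlongrightarrow> f t) (at_right t)" using assms that unfolding cadlag_def by auto
    then have "\<forall>\<^sub>F s in at_right t. dist (f s) (f t) < 1" by (rule tendstoD) simp
    then obtain b where b: "b > t" "\<And>s. t < s \<Longrightarrow> s < b \<Longrightarrow> dist (f s) (f t) < 1"
      by (auto simp: eventually_at_right_field)
    show ?thesis
    proof (cases "t = 0")
      case True
      show ?thesis
      proof (rule exI[of _ "b - t"], intro exI[of _ "\<bar>f t\<bar> + 1"] conjI ballI)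
        fix s assume "s \<in> {0..} \<inter> ball t (b - t)"
        then have "s = t \<or> t < s \<and> s < b" using True by (auto simp: dist_real_def)
        then show "\<bar>f s\<bar> \<le> \<bar>f t\<bar> + 1" using b(2)[of s] by (auto simp: dist_real_def)
      qed (use b in auto)
    next
      case False
      then obtain l where "(f \<longlongrightarrow> l) (at_left t)" using assms \<open>0 \<le> t\<close> unfolding cadlag_def by force
      then have "\<forall>\<^sub>F s in at_left t. dist (f s) l < 1" by (rule tendstoD) simp
      then obtain a where a: "a < t" "\<And>s. a < s \<Longrightarrow> s < t \<Longrightarrow> dist (f s) l < 1"
        by (auto simp: eventually_at_left_field)
      show ?thesis
      proof (rule exI[of _ "min (b - t) (t - a)"], intro exI[of _ "\<bar>f t\<bar> + \<bar>l\<bar> + 1"] conjI ballI)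
        fix s assume "s \<in> {0..} \<inter> ball t (min (b - t) (t - a))"
        then consider "s = t" | "t < s" "s < b" | "a < s" "s < t" by (fastforce simp: dist_real_def)
        then show "\<bar>f s\<bar> \<le> \<bar>f t\<bar> + \<bar>l\<bar> + 1"
          using b(2)[of s] a(2)[of s] by cases (auto simp: dist_real_def)
      qed (use a b in auto)
    qed
  qed
  then obtain e C where e: "\<And>t. 0 \<le> t \<Longrightarrow> e t > 0"
    and C: "\<And>t s. 0 \<le> t \<Longrightarrow> s \<in> {0..} \<inter> ball t (e t) \<Longrightarrow> \<bar>f s\<bar> \<le> C t"
    by metis
  have "compact {0..T}" by simp
  then obtain D where D: "D \<subseteq> {0..T}" "finite D" "{0..T} \<subseteq> (\<Union>t\<in>D. ball t (e t))"
    by (rule compactE_image[where C="{0..T}" and f="\<lambda>t. ball t (e t)"]) (use e in auto)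
  show thesis
  \<comment> \<open>A sum rather than a maximum, since \<open>D\<close> is empty for negative
    \<open>T\<close>.\<close>
  proof (rule that[of "\<Sum>t\<in>D. \<bar>C t\<bar>"])
    fix t assume "0 \<le> t" "t \<le> T"
    then obtain d where d: "d \<in> D" "t \<in> ball d (e d)" using D(3) by auto
    then have "\<bar>f t\<bar> \<le> C d" using C[of d t] D(1) \<open>0 \<le> t\<close> by auto
    also have "\<dots> \<le> \<bar>C d\<bar>" by simp
    also have "\<dots> \<le> (\<Sum>t\<in>D. \<bar>C t\<bar>)" using d(1) D(2) by (intro member_le_sum) auto
    finally show "\<bar>f t\<bar> \<le> (\<Sum>t\<in>D. \<bar>C t\<bar>)" .
  qed
qed

text \<open>At the infimum \<open>s\<close> of the times with \<open>a \<le> f t\<close>,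
  right-continuity gives \<open>a \<le> f s\<close>. The left limit there is at most
  \<open>a\<close>, and without positive jumps \<open>f s\<close> does not exceed it.\<close>

lemma first_passage_creeps:
  assumes "cadlag f" "no_positive_jumps f" "f 0 < a" "0 \<le> t" "a \<le> f t"
  obtains s where "0 < s" "s \<le> t" "f s = a" "\<And>r. 0 \<le> r \<Longrightarrow> r < s \<Longrightarrow> f r < a"
proof -
  define S where "S = {t. 0 \<le> t \<and> a \<le> f t}"
  define s where "s = Inf S"
  have ne: "S \<noteq> {}" and bdd: "bdd_below S" and "t \<in> S"
    using assms(4,5) unfolding S_def by auto
  have s0: "0 \<le> s" unfolding s_def by (rule cInf_greatest[OF ne]) (auto simp: S_def)
  have "s \<le> t" unfolding s_def by (rule cInf_lower[OF \<open>t \<in> S\<close> bdd])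
  have before: "f r < a" if "0 \<le> r" "r < s" for r
  proof (rule ccontr)
    assume "\<not> f r < a"
    then have "r \<in> S" using that unfolding S_def by auto
    then have "s \<le> r" unfolding s_def by (rule cInf_lower[OF _ bdd])
    then show False using that by simp
  qed
  have ge: "a \<le> f s"
  proof (rule ccontr)
    assume less: "\<not> a \<le> f s"
    have "(f \<longlongrightarrow> f s) (at_right s)" using assms(1) s0 unfolding cadlag_def by auto
    then have "\<forall>\<^sub>F y in at_right s. f y < a" using less by (intro order_tendstoD) auto
    then obtain b where b: "b > s" "\<And>y. s < y \<Longrightarrow> y < b \<Longrightarrow> f y < a"
      by (auto simp: eventually_at_right_field)
    have "b \<le> Inf S"
    proof (rule cInf_greatest[OF ne])
      fix x assume x: "x \<in> S"
      then have "s \<le> x" unfolding s_def by (rule cInf_lower[OF _ bdd])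
      then show "b \<le> x" using x b(2)[of x] less unfolding S_def by (cases "x = s") force+
    qed
    then show False using b(1) unfolding s_def by simp
  qed
  then have "s \<noteq> 0" using assms(3) by auto
  then have s1: "0 < s" using s0 by simp
  then obtain l where l: "(f \<longlongrightarrow> l) (at_left s)" using assms(1) unfolding cadlag_def by auto
  have "l \<le> a"
  proof (rule tendsto_upperbound[OF l])
    show "\<forall>\<^sub>F y in at_left s. f y \<le> a"
      unfolding eventually_at_left_field
      by (rule exI[of _ 0]) (use s1 before in \<open>auto intro: less_imp_le\<close>)
  qed simp
  moreover have "f s \<le> l" using assms(2) s1 l unfolding no_positive_jumps_def by auto
  ultimately have "f s = a" using ge by simp
  then show thesis using that[OF s1 \<open>s \<le> t\<close>] before by blast
qed

subsection \<open>Uniqueness of Laplace transforms\<close>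

text \<open>The substitution \<open>t = exp (- x)\<close> turns the transforms at the integers into
  the moments of a signed measure on \<open>{0..1}\<close>. If these vanish, so does the integral of
  every polynomial, and by Stone-Weierstrass that of every continuous function.\<close>

lemma laplace_moments_zero:
  fixes w :: "real \<Rightarrow> real"
  assumes int: "integrable lborel w" and supp: "\<And>x. x < 0 \<Longrightarrow> w x = 0"
    and zero: "\<And>n::nat. (\<integral>x. exp (- real n * x) * w x \<partial>lborel) = 0"
    and cont: "continuous_on UNIV \<phi>"
  shows "(\<integral>x. \<phi> (exp (- x)) * w x \<partial>lborel) = 0"
proof -
  let ?W = "\<integral>x. \<bar>w x\<bar> \<partial>lborel"
  have [measurable]: "w \<in> borel_measurable borel" using int by (auto dest: borel_measurable_integrable)
  have [measurable]: "\<phi> \<in> borel_measurable borel" using cont by (rule borel_measurable_continuous_onI)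
  have range: "w x \<noteq> 0 \<Longrightarrow> exp (- x) \<in> {0..1}" for x using supp[of x] by force
  have bnd_int: "integrable lborel (\<lambda>x. h (exp (- x)) * w x)"
    if [measurable]: "h \<in> borel_measurable borel" and B: "\<And>t. t \<in> {0..1} \<Longrightarrow> \<bar>h t\<bar> \<le> B"
    for h :: "real \<Rightarrow> real" and B
  proof (rule Bochner_Integration.integrable_bound[of _ "\<lambda>x. B * w x"])
    show "AE x in lborel. norm (h (exp (- x)) * w x) \<le> norm (B * w x)"
    proof (rule AE_I2)
      fix x show "norm (h (exp (- x)) * w x) \<le> norm (B * w x)"
      proof (cases "w x = 0")
        case False
        show ?thesis using B[OF range[OF False]]
          by (auto simp: abs_mult intro!: mult_right_mono)
      qed simp
    qed
  qed (use int in auto)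
  have small: "\<bar>\<integral>x. \<phi> (exp (- x)) * w x \<partial>lborel\<bar> \<le> e * ?W" if "e > 0" for e
  proof -
    have "\<exists>p. real_polynomial_function p \<and> (\<forall>x\<in>{0..1::real}. \<bar>\<phi> x - p x\<bar> < e)"
      using Stone_Weierstrass_real_polynomial_function[of "{0..1}" \<phi> e] cont that
      by (metis compact_Icc continuous_on_subset top_greatest)
    then obtain p where "real_polynomial_function p" and p: "\<And>x. x\<in>{0..1} \<Longrightarrow> \<bar>\<phi> x - p x\<bar> < e"
      by auto
    then obtain a n where pa: "p = (\<lambda>x. \<Sum>i\<le>n. a i * x ^ i)"
      by (auto simp: real_polynomial_function_iff_sum)
    have int_term: "integrable lborel (\<lambda>x. exp (- real i * x) * w x)" for i
      using bnd_int[of "\<lambda>t. t ^ i" 1]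
      by (simp add: power_le_one exp_of_nat_mult[symmetric] abs_of_nonneg)
    have "(\<integral>x. p (exp (- x)) * w x \<partial>lborel)
        = (\<integral>x. (\<Sum>i\<le>n. a i * (exp (- real i * x) * w x)) \<partial>lborel)"
      by (rule Bochner_Integration.integral_cong)
         (auto simp: pa sum_distrib_right exp_of_nat_mult[symmetric] mult.assoc)
    also have "\<dots> = (\<Sum>i\<le>n. a i * (\<integral>x. exp (- real i * x) * w x \<partial>lborel))"
      by (subst Bochner_Integration.integral_sum) (use int_term in auto)
    also have "\<dots> = 0" using zero by simp
    finally have p0: "(\<integral>x. p (exp (- x)) * w x \<partial>lborel) = 0" .
    have pm [measurable]: "p \<in> borel_measurable borel" unfolding pa by measurable
    have "continuous_on {0..1} \<phi>" "continuous_on {0..1} p"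
      using cont continuous_on_subset unfolding pa by (blast, intro continuous_intros)
    then have "bounded (\<phi> ` {0..1})" "bounded (p ` {0..1})"
      by (auto intro!: compact_imp_bounded compact_continuous_image)
    then obtain B1 B2 where B1: "\<And>t. t \<in> {0..1} \<Longrightarrow> \<bar>\<phi> t\<bar> \<le> B1"
      and B2: "\<And>t. t \<in> {0..1} \<Longrightarrow> \<bar>p t\<bar> \<le> B2"
      unfolding bounded_iff by (metis imageI real_norm_def)
    have i1: "integrable lborel (\<lambda>x. \<phi> (exp (- x)) * w x)"
      by (rule bnd_int) (use B1 in auto)
    have i2: "integrable lborel (\<lambda>x. p (exp (- x)) * w x)"
      by (rule bnd_int) (use B2 in auto)
    have "\<bar>\<integral>x. \<phi> (exp (- x)) * w x \<partial>lborel\<bar>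
        = \<bar>(\<integral>x. \<phi> (exp (- x)) * w x - p (exp (- x)) * w x \<partial>lborel)\<bar>"
      using i1 i2 p0 by simp
    also have "\<dots> \<le> (\<integral>x. \<bar>\<phi> (exp (- x)) * w x - p (exp (- x)) * w x\<bar> \<partial>lborel)"
      using integral_norm_bound[of lborel "\<lambda>x. \<phi> (exp (- x)) * w x - p (exp (- x)) * w x"] by simp
    also have "\<dots> \<le> (\<integral>x. e * \<bar>w x\<bar> \<partial>lborel)"
    proof (rule integral_mono)
      fix x
      show "\<bar>\<phi> (exp (- x)) * w x - p (exp (- x)) * w x\<bar> \<le> e * \<bar>w x\<bar>"
      proof (cases "w x = 0")
        case False
        show ?thesis using p[OF range[OF False]]
          by (auto simp: abs_mult left_diff_distrib[symmetric] intro!: mult_right_mono)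
      qed simp
    qed (use i1 i2 int in auto)
    finally show ?thesis by simp
  qed
  \<comment> \<open>\<open>C\<close> may be \<open>0\<close>, so the estimate is applied with
    \<open>e = \<bar>I\<bar> / (2 * (C + 1))\<close>.\<close>
  have tiny: "I = 0" if "\<And>e. 0 < e \<Longrightarrow> \<bar>I\<bar> \<le> e * C" "0 \<le> C" for I C :: real
  proof (rule ccontr)
    assume "I \<noteq> 0"
    then have "\<bar>I\<bar> \<le> \<bar>I\<bar> / (2 * (C + 1)) * C"
      using that(2) by (intro that(1)) auto
    also have "\<dots> < \<bar>I\<bar>" using \<open>I \<noteq> 0\<close> that(2) by (simp add: field_simps add_nonneg_pos)
    finally show False by simp
  qed
  show ?thesis by (rule tiny[OF small]) auto
qed

text \<open>A right-continuous \<open>D\<close> that is positive at \<open>x\<close> stays positive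
  on some \<open>(x, b)\<close>. A continuous function of \<open>exp (- y)\<close> that is positive
  exactly on that interval would have a positive integral against \<open>D\<close>.\<close>

lemma laplace_transform_zero_nonpos:
  fixes D :: "real \<Rightarrow> real"
  assumes int: "\<And>\<beta>. 0 < \<beta> \<Longrightarrow> set_integrable lborel {0..} (\<lambda>x. exp (- \<beta> * x) * D x)"
    and zero: "\<And>\<beta>. 0 < \<beta> \<Longrightarrow> (LINT x:{0..}|lborel. exp (- \<beta> * x) * D x) = 0"
    and cont: "\<And>x. 0 \<le> x \<Longrightarrow> (D \<longlongrightarrow> D x) (at_right x)"
    and "0 \<le> x"
  shows "D x \<le> 0"
proof (rule ccontr)
  assume "\<not> D x \<le> 0"
  then have "\<forall>\<^sub>F y in at_right x. 0 < D y"
    using cont[OF \<open>0 \<le> x\<close>] by (intro order_tendstoD) auto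
  then obtain b where b: "b > x" "\<And>y. x < y \<Longrightarrow> y < b \<Longrightarrow> 0 < D y"
    by (auto simp: eventually_at_right_field)
  \<comment> \<open>The factor \<open>exp (- y)\<close> makes \<open>w\<close> integrable and turns
    its \<open>n\<close>-th moment into the transform of \<open>D\<close> at \<open>n + 1\<close>,
    which is a positive argument even for \<open>n = 0\<close>.\<close>
  define w where "w y = indicator {0..} y * (exp (- y) * D y)" for y
  \<comment> \<open>A tent over the interval from \<open>exp (- b)\<close> to
    \<open>exp (- x)\<close>, zero outside.\<close>
  define \<phi> where "\<phi> t = max 0 (min (t - exp (- b)) (exp (- x) - t))" for t :: real
  have int_w: "integrable lborel w"
    using int[of 1] unfolding set_integrable_def w_def by simp
  have "(\<integral>y. \<phi> (exp (- y)) * w y \<partial>lborel) = 0"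
  proof (rule laplace_moments_zero[OF int_w])
    show "continuous_on UNIV \<phi>" unfolding \<phi>_def by (intro continuous_intros)
    fix n :: nat
    have "(\<integral>y. exp (- real n * y) * w y \<partial>lborel) = (LINT y:{0..}|lborel. exp (- (real n + 1) * y) * D y)"
      unfolding set_lebesgue_integral_def w_def
      by (intro Bochner_Integration.integral_cong) (auto simp: algebra_simps simp flip: exp_add)
    then show "(\<integral>y. exp (- real n * y) * w y \<partial>lborel) = 0" using zero[of "real n + 1"] by simp
  qed (auto simp: w_def)
  have pos: "\<phi> (exp (- y)) > 0 \<longleftrightarrow> x < y \<and> y < b" for y
  proof -
    have "\<phi> (exp (- y)) > 0 \<longleftrightarrow> 0 < min (exp (- y) - exp (- b)) (exp (- x) - exp (- y))"
      unfolding \<phi>_def less_max_iff_disj by (metis less_irrefl)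
    also have "\<dots> \<longleftrightarrow> x < y \<and> y < b" by (simp only: min_less_iff_conj diff_gt_0_iff_gt exp_less_cancel_iff neg_less_iff_less conj_commute)
    finally show ?thesis .
  qed
  have nonneg: "0 \<le> \<phi> (exp (- y)) * w y" for y
  proof (cases "x < y \<and> y < b")
    case True
    then have "0 < D y" using b by auto
    moreover have "0 \<le> \<phi> (exp (- y))" unfolding \<phi>_def by simp
    ultimately show ?thesis unfolding w_def by simp
  next
    case False
    moreover have "0 \<le> \<phi> (exp (- y))" unfolding \<phi>_def by simp
    ultimately have "\<phi> (exp (- y)) = 0" using pos[of y] by linarith
    then show ?thesis by simp
  qed
  have "integrable lborel (\<lambda>y. \<phi> (exp (- y)) * w y)"
  proof (rule Bochner_Integration.integrable_bound[OF int_w])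
    have [measurable]: "w \<in> borel_measurable borel" using int_w by (auto dest: borel_measurable_integrable)
    show "(\<lambda>y. \<phi> (exp (- y)) * w y) \<in> borel_measurable lborel" unfolding \<phi>_def by measurable
    have le: "\<bar>\<phi> (exp (- y))\<bar> \<le> 1" if "0 \<le> y" for y
    proof -
      have "exp (- y) \<le> 1" "exp (- b) > 0" using that by auto
      then have "exp (- y) - exp (- b) \<le> 1" by linarith
      then have "\<phi> (exp (- y)) \<le> 1" "0 \<le> \<phi> (exp (- y))"
        unfolding \<phi>_def by (auto intro: min.coboundedI1)
      then show ?thesis by simp
    qed
    show "AE y in lborel. norm (\<phi> (exp (- y)) * w y) \<le> norm (w y)"
    proof (rule AE_I2)
      fix y show "norm (\<phi> (exp (- y)) * w y) \<le> norm (w y)"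
        using le[of y] mult_right_mono[OF le, of y "\<bar>w y\<bar>"]
        by (cases "0 \<le> y") (auto simp: abs_mult w_def)
    qed
  qed
  then have "AE y in lborel. \<phi> (exp (- y)) * w y = 0"
    using integral_nonneg_eq_0_iff_AE nonneg \<open>(\<integral>y. \<phi> (exp (- y)) * w y \<partial>lborel) = 0\<close> by blast
  then have "AE y in lborel. y \<notin> {x<..<b}"
  proof eventually_elim
    fix y assume "\<phi> (exp (- y)) * w y = 0"
    then show "y \<notin> {x<..<b}"
      using pos[of y] b(2)[of y] \<open>0 \<le> x\<close> by (auto simp: w_def)
  qed
  then have "emeasure lborel {x<..<b} = 0"
    by (subst (asm) AE_iff_measurable[of "{x<..<b}"]) auto
  then show False using b(1) by simp
qed

lemma laplace_transform_zero:
  fixes D :: "real \<Rightarrow> real"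
  assumes int: "\<And>\<beta>. 0 < \<beta> \<Longrightarrow> set_integrable lborel {0..} (\<lambda>x. exp (- \<beta> * x) * D x)"
    and zero: "\<And>\<beta>. 0 < \<beta> \<Longrightarrow> (LINT x:{0..}|lborel. exp (- \<beta> * x) * D x) = 0"
    and cont: "\<And>x. 0 \<le> x \<Longrightarrow> (D \<longlongrightarrow> D x) (at_right x)"
    and "0 \<le> x"
  shows "D x = 0"
proof -
  have "D x \<le> 0" using assms by (rule laplace_transform_zero_nonpos)
  moreover have "- D x \<le> 0"
  proof (rule laplace_transform_zero_nonpos[of "\<lambda>x. - D x"])
    fix \<beta> :: real assume "0 < \<beta>"
    then show "set_integrable lborel {0..} (\<lambda>x. exp (- \<beta> * x) * - D x)"
      and "(LINT x:{0..}|lborel. exp (- \<beta> * x) * - D x) = 0"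
      using int[of \<beta>] zero[of \<beta>] by (auto simp: set_integral_uminus set_integrable_def set_lebesgue_integral_def)
  qed (use cont \<open>0 \<le> x\<close> in \<open>auto intro: tendsto_minus\<close>)
  ultimately show ?thesis by simp
qed

subsection \<open>Integrated distribution functions\<close>

lemma (in real_distribution) integrable_pos_part_diff:
  assumes "integrable M (\<lambda>w. w)"
  shows "integrable M (\<lambda>w. max 0 (x - w))"
  by (rule Bochner_Integration.integrable_max) (use assms in auto)

text \<open>Integrates the pointwise bounds \<open>(b - a) * indicator {..a} w\<close> and
  \<open>(b - a) * indicator {..b} w\<close> of the difference of the positive parts. These secant
  bounds carry the convexity used later, without any differentiability.\<close>

lemma (in real_distribution) pos_part_diff_bounds:
  assumes int: "integrable M (\<lambda>w. w)" and "a \<le> b"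
  shows "(b - a) * cdf M a \<le> (\<integral>w. max 0 (b - w) \<partial>M) - (\<integral>w. max 0 (a - w) \<partial>M)"
    and "(\<integral>w. max 0 (b - w) \<partial>M) - (\<integral>w. max 0 (a - w) \<partial>M) \<le> (b - a) * cdf M b"
proof -
  note i = integrable_pos_part_diff[OF int]
  have c: "cdf M x = (\<integral>w. indicator {..x} w \<partial>M)" for x
    by (simp add: cdf_def)
  have ii: "integrable M (\<lambda>w. indicator {..x} w :: real)" for x
    by (rule integrable_real_indicator) (auto simp: emeasure_eq_measure)
  have "(b - a) * cdf M a = (\<integral>w. (b - a) * indicator {..a} w \<partial>M)" unfolding c by simp
  also have "\<dots> \<le> (\<integral>w. max 0 (b - w) - max 0 (a - w) \<partial>M)"
    by (rule integral_mono) (use i ii \<open>a \<le> b\<close> in \<open>auto simp: indicator_def\<close>)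
  finally show "(b - a) * cdf M a \<le> (\<integral>w. max 0 (b - w) \<partial>M) - (\<integral>w. max 0 (a - w) \<partial>M)"
    using i by simp
  have "(\<integral>w. max 0 (b - w) - max 0 (a - w) \<partial>M) \<le> (\<integral>w. (b - a) * indicator {..b} w \<partial>M)"
    by (rule integral_mono) (use i ii \<open>a \<le> b\<close> in \<open>auto simp: indicator_def\<close>)
  also have "\<dots> = (b - a) * cdf M b" unfolding c by simp
  finally show "(\<integral>w. max 0 (b - w) \<partial>M) - (\<integral>w. max 0 (a - w) \<partial>M) \<le> (b - a) * cdf M b"
    using i by simp
qed

text \<open>Fubini for the region \<open>a \<le> y \<le> b\<close>, \<open>w \<le> y\<close>, whose
  section at \<open>w\<close> is the interval from \<open>max a w\<close> to
  \<open>b\<close>.\<close>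

lemma (in real_distribution) integral_cdf:
  assumes int: "integrable M (\<lambda>w. w)" and "a \<le> b"
  shows "(LINT y:{a..b}|lborel. cdf M y) = (\<integral>w. max 0 (b - w) \<partial>M) - (\<integral>w. max 0 (a - w) \<partial>M)"
proof -
  interpret P: pair_sigma_finite lborel M
    by unfold_locales
  let ?f = "\<lambda>(y, w). indicator {a..b} y * indicator {..y} w :: real"
  have f2: "?f = (\<lambda>p. indicator {p. a \<le> fst p \<and> fst p \<le> b \<and> snd p \<le> fst p} p)"
    by (auto simp: indicator_def fun_eq_iff)
  have m: "{p::real\<times>real. a \<le> fst p \<and> fst p \<le> b \<and> snd p \<le> fst p} \<in> sets (lborel \<Otimes>\<^sub>M M)"
  proof -
    have "{p \<in> space (lborel \<Otimes>\<^sub>M M). a \<le> fst p \<and> fst p \<le> b \<and> snd p \<le> fst p} \<in> sets (lborel \<Otimes>\<^sub>M M)"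
      by measurable
    then show ?thesis by (simp add: space_pair_measure)
  qed
  have "emeasure (lborel \<Otimes>\<^sub>M M) {p. a \<le> fst p \<and> fst p \<le> b \<and> snd p \<le> fst p}
      \<le> emeasure (lborel \<Otimes>\<^sub>M M) ({a..b} \<times> UNIV)"
    by (rule emeasure_mono) auto
  also have "\<dots> < \<infinity>"
    using emeasure_space_1 \<open>a \<le> b\<close> by (simp add: emeasure_pair_measure_Times ennreal_mult_less_top)
  finally have "integrable (lborel \<Otimes>\<^sub>M M) ?f"
    unfolding f2 by (intro integrable_real_indicator m) auto
  then have "(\<integral>w. (\<integral>y. ?f (y, w) \<partial>lborel) \<partial>M) = (\<integral>y. (\<integral>w. ?f (y, w) \<partial>M) \<partial>lborel)"
    by (intro P.Fubini_integral) (simp add: case_prod_beta)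
  also have "(\<integral>y. (\<integral>w. ?f (y, w) \<partial>M) \<partial>lborel) = (LINT y:{a..b}|lborel. cdf M y)"
    unfolding set_lebesgue_integral_def by (simp add: cdf_def)
  also have "(\<integral>w. (\<integral>y. ?f (y, w) \<partial>lborel) \<partial>M) = (\<integral>w. max 0 (b - w) - max 0 (a - w) \<partial>M)"
  proof (rule Bochner_Integration.integral_cong[OF refl])
    fix w
    have "(\<integral>y. ?f (y, w) \<partial>lborel) = (\<integral>y. indicator {max a w..b} y \<partial>lborel)"
      by (rule Bochner_Integration.integral_cong) (auto simp: indicator_def)
    then show "(\<integral>y. ?f (y, w) \<partial>lborel) = max 0 (b - w) - max 0 (a - w)"
      using \<open>a \<le> b\<close> by (cases "max a w \<le> b") (auto simp: max_def split: if_splits)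
  qed
  finally show ?thesis
    using integrable_pos_part_diff[OF int] by simp
qed

subsection \<open>Markov property\<close>

text \<open>The path properties are required for every \<open>\<omega>\<close>, so that pathwise
  suprema and limits need no exceptional sets. A process having them almost surely is brought into
  this form at the end, by a modification on the completed space.\<close>

locale snlp = prob_space M for M :: "'a measure" +
  fixes X :: "real \<Rightarrow> 'a \<Rightarrow> real"
  assumes X_measurable: "\<And>t. 0 \<le> t \<Longrightarrow> X t \<in> borel_measurable M"
    and X_0: "\<And>\<omega>. \<omega> \<in> space M \<Longrightarrow> X 0 \<omega> = 0"
    and X_cadlag: "\<And>\<omega>. \<omega> \<in> space M \<Longrightarrow> cadlag (\<lambda>t. X t \<omega>)"
    and X_no_positive_jumps: "\<And>\<omega>. \<omega> \<in> space M \<Longrightarrow> no_positive_jumps (\<lambda>t. X t \<omega>)"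
    and X_at_top: "\<And>\<omega>. \<omega> \<in> space M \<Longrightarrow> filterlim (\<lambda>t. X t \<omega>) at_top at_top"
    and X_indep: "\<And>n t. mono t \<Longrightarrow> 0 \<le> t 0 \<Longrightarrow>
      indep_vars (\<lambda>_. borel) (\<lambda>i \<omega>. X (t (Suc i)) \<omega> - X (t i) \<omega>) {..<n::nat}"
    and X_stationary: "\<And>s t. 0 \<le> s \<Longrightarrow> s \<le> t \<Longrightarrow>
      distr M borel (\<lambda>\<omega>. X t \<omega> - X s \<omega>) = distr M borel (X (t - s))"
begin

lemma X_measurable_comp [measurable (raw)]:
  "0 \<le> t \<Longrightarrow> (\<lambda>\<omega>. X t \<omega>) \<in> borel_measurable M"
  using X_measurable by simp

text \<open>Contains the null sets but no right limits are taken. Right-continuity of the filtration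
  is accounted for by \<open>random_time\<close>, which asks for the events
  \<open>\<tau> < t\<close>.\<close>

definition past :: "real \<Rightarrow> 'a measure" where
  "past t = sigma (space M)
     ({X s -` B \<inter> space M | s B. 0 \<le> s \<and> s \<le> t \<and> B \<in> sets borel} \<union> null_sets M)"

lemma past_gen_sub:
  "{X s -` B \<inter> space M | s B. 0 \<le> s \<and> s \<le> t \<and> B \<in> sets borel} \<union> null_sets M \<subseteq> Pow (space M)"
  using sets.sets_into_space by auto

lemma space_past [simp]: "space (past t) = space M"
  unfolding past_def by (rule space_measure_of[OF past_gen_sub])

lemma sets_past: "sets (past t) = sigma_sets (space M)
    ({X s -` B \<inter> space M | s B. 0 \<le> s \<and> s \<le> t \<and> B \<in> sets borel} \<union> null_sets M)"
  unfolding past_def by (rule sets_measure_of[OF past_gen_sub])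

lemma sets_past_subset: "sets (past t) \<subseteq> events"
  unfolding sets_past
  by (rule sets.sigma_sets_subset) (auto intro!: measurable_sets[OF X_measurable])

lemma sets_past_mono: "s \<le> t \<Longrightarrow> sets (past s) \<subseteq> sets (past t)"
  unfolding sets_past
  by (intro sigma_sets_mono' Un_mono order_refl Collect_mono impI) (metis order_trans)

lemma measurable_past_imp: "f \<in> past t \<rightarrow>\<^sub>M S \<Longrightarrow> f \<in> M \<rightarrow>\<^sub>M S"
  using sets_past_subset[of t] by (auto simp: measurable_def)

lemma null_sets_past: "N \<in> null_sets M \<Longrightarrow> N \<in> sets (past t)"
  unfolding sets_past by (rule sigma_sets.Basic) simp

lemma X_measurable_past: "0 \<le> s \<Longrightarrow> s \<le> t \<Longrightarrow> X s \<in> borel_measurable (past t)"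
  by (rule measurableI) (auto simp: sets_past intro!: sigma_sets.Basic)

definition grid_incr :: "real \<Rightarrow> real \<Rightarrow> nat \<Rightarrow> 'a \<Rightarrow> nat \<Rightarrow> real" where
  "grid_incr t h n \<omega> = (\<lambda>k\<in>{..<n}. X (t + real (Suc k) * h) \<omega> - X (t + real k * h) \<omega>)"

lemma grid_incr_measurable [measurable]:
  "0 \<le> t \<Longrightarrow> 0 \<le> h \<Longrightarrow> grid_incr t h n \<in> M \<rightarrow>\<^sub>M PiM {..<n} (\<lambda>_. borel)"
  unfolding grid_incr_def by (intro measurable_restrict) measurable

lemma distr_grid_incr:
  assumes "0 \<le> t" "0 \<le> h" "0 < n"
  shows "distr M (PiM {..<n} (\<lambda>_. borel)) (grid_incr t h n) = PiM {..<n} (\<lambda>_. distr M borel (X h))"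
proof -
  let ?T = "\<lambda>k::nat. t + real k * h"
  have "mono ?T" using \<open>0 \<le> h\<close> by (auto intro!: monoI mult_right_mono)
  then have "indep_vars (\<lambda>_. borel) (\<lambda>i \<omega>. X (?T (Suc i)) \<omega> - X (?T i) \<omega>) {..<n}"
    using \<open>0 \<le> t\<close> by (intro X_indep) auto
  then have "distr M (PiM {..<n} (\<lambda>_. borel)) (grid_incr t h n) =
      PiM {..<n} (\<lambda>k. distr M borel (\<lambda>\<omega>. X (?T (Suc k)) \<omega> - X (?T k) \<omega>))"
    unfolding grid_incr_def
    by (subst (asm) indep_vars_iff_distr_eq_PiM') (use assms in auto)
  also have "\<dots> = PiM {..<n} (\<lambda>_. distr M borel (X h))"
  proof (rule PiM_cong[OF refl])
    fix k assume "k \<in> {..<n}"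
    show "distr M borel (\<lambda>\<omega>. X (?T (Suc k)) \<omega> - X (?T k) \<omega>) = distr M borel (X h)"
      by (subst X_stationary) (use assms in \<open>auto simp: algebra_simps\<close>)
  qed
  finally show ?thesis .
qed

text \<open>Independence is available only for the increments along one increasing sequence of
  times. So the observation times of the cylinder are sorted and continued by the grid; the past
  event is then a function of the first \<open>p\<close> increments and the future event one of the
  next \<open>n\<close>.\<close>

lemma cylinder_indep_grid_incr:
  assumes S: "finite S" "S \<subseteq> {0..t}" "\<And>s. s \<in> S \<Longrightarrow> B s \<in> sets borel"
    and "0 \<le> t" "0 \<le> h" "0 < n" and C: "C \<in> sets (PiM {..<n} (\<lambda>_. borel))"
  shows "prob ({\<omega>\<in>space M. \<forall>s\<in>S. X s \<omega> \<in> B s} \<inter> {\<omega>\<in>space M. grid_incr t h n \<omega> \<in> C})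
    = prob {\<omega>\<in>space M. \<forall>s\<in>S. X s \<omega> \<in> B s} * prob {\<omega>\<in>space M. grid_incr t h n \<omega> \<in> C}"
proof -
  \<comment> \<open>With \<open>0\<close> included the values of \<open>X\<close> are partial sums
    of increments; with \<open>t\<close> included the grid starts exactly at index
    \<open>p\<close>.\<close>
  define L where "L = sorted_list_of_set (S \<union> {0, t})"
  have fin: "finite (S \<union> {0, t})" using S by auto
  have setL: "set L = S \<union> {0, t}" and sorted: "sorted L" and lenL: "0 < length L"
    unfolding L_def using fin
    by (simp_all only: set_sorted_list_of_set sorted_sorted_list_of_set length_sorted_list_of_set card_gt_0_iff) auto
  define p where "p = length L - 1"
  have len: "length L = Suc p" using lenL unfolding p_def by simp
  have L_range: "0 \<le> L ! i" "L ! i \<le> t" if "i \<le> p" for i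
    using nth_mem[of i L] setL S(2) \<open>0 \<le> t\<close> len that by (auto simp: subset_iff)
  have L0: "L ! 0 = 0"
  proof -
    obtain i where "i < length L" "L ! i = 0" using setL by (metis in_set_conv_nth UnCI insertI1)
    then have "L ! 0 \<le> 0" using sorted_nth_mono[OF sorted, of 0 i] by simp
    then show ?thesis using L_range(1)[of 0] by simp
  qed
  have Lp: "L ! p = t"
  proof -
    obtain i where "i < length L" "L ! i = t" using setL by (metis in_set_conv_nth UnCI insertI1 insertI2)
    then have "t \<le> L ! p" using sorted_nth_mono[OF sorted, of i p] len by simp
    then show ?thesis using L_range(2)[of p] by simp
  qed
  \<comment> \<open>The sorted observation times up to index \<open>p\<close>, then steps of length
    \<open>h\<close> from \<open>t\<close> on.\<close>
  define T where "T i = (if i \<le> p then L ! i else t + real (i - p) * h)" for i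
  have "T i \<le> T j" if "i \<le> j" for i j
  proof (cases "j \<le> p")
    case True then show ?thesis using that sorted_nth_mono[OF sorted, of i j] len by (auto simp: T_def)
  next
    case False
    show ?thesis
    proof (cases "i \<le> p")
      case True
      then have "L ! i \<le> t" by (rule L_range)
      also have "\<dots> \<le> t + real (j - p) * h" using \<open>0 \<le> h\<close> by simp
      finally show ?thesis using True False by (simp add: T_def)
    next
      case False
      then show ?thesis using \<open>\<not> j \<le> p\<close> that \<open>0 \<le> h\<close> by (auto simp: T_def intro!: mult_right_mono)
    qed
  qed
  then have monoT: "mono T" by (rule monoI)
  have T0: "T 0 = 0" using L0 by (simp add: T_def)
  have Tp: "T (p + k) = t + real k * h" for k using Lp by (auto simp: T_def)
  define \<xi> where "\<xi> i \<omega> = X (T (Suc i)) \<omega> - X (T i) \<omega>" for i \<omega>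
  have ind: "indep_vars (\<lambda>_. borel) \<xi> {..<p + n}"
    using X_indep[OF monoT, of "p + n"] T0 unfolding \<xi>_def by simp
  have rv: "indep_var (PiM {..<p} (\<lambda>_. borel)) (\<lambda>\<omega>. restrict (\<lambda>i. \<xi> i \<omega>) {..<p})
      (PiM {p..<p+n} (\<lambda>_. borel)) (\<lambda>\<omega>. restrict (\<lambda>i. \<xi> i \<omega>) {p..<p+n})"
    by (rule indep_var_restrict[OF ind]) auto
  have tele: "X (L ! i) \<omega> = (\<Sum>j<i. \<xi> j \<omega>)" if "i \<le> p" "\<omega> \<in> space M" for i \<omega>
  proof -
    have "(\<Sum>j<i. \<xi> j \<omega>) = X (T i) \<omega> - X (T 0) \<omega>"
      unfolding \<xi>_def by (rule sum_lessThan_telescope)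
    then show ?thesis using that X_0 T0 by (simp add: T_def)
  qed
  let ?A = "{\<omega>\<in>space M. \<forall>s\<in>S. X s \<omega> \<in> B s}"
  let ?E = "{\<omega>\<in>space M. grid_incr t h n \<omega> \<in> C}"
  define I where "I = {i. i \<le> p \<and> L ! i \<in> S}"
  define CA where "CA = {f \<in> space (PiM {..<p} (\<lambda>_. borel::real measure)). \<forall>i\<in>I. (\<Sum>j<i. f j) \<in> B (L ! i)}"
  have CA: "CA \<in> sets (PiM {..<p} (\<lambda>_. borel))"
  proof -
    have "finite I" unfolding I_def by simp
    moreover have "(\<lambda>f. \<Sum>j<i. f j) -` B (L ! i) \<inter> space (PiM {..<p} (\<lambda>_. borel))
        \<in> sets (PiM {..<p} (\<lambda>_. borel::real measure))" if "i \<in> I" for i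
      by (rule measurable_sets[of _ _ borel])
         (use that S(3) in \<open>auto simp: I_def intro!: borel_measurable_sum measurable_component_singleton\<close>)
    ultimately have "{f \<in> space (PiM {..<p} (\<lambda>_. borel::real measure)). (\<Sum>j<i. f j) \<in> B (L ! i)}
        \<in> sets (PiM {..<p} (\<lambda>_. borel))" if "i \<in> I" for i
      using that by (simp add: vimage_def Int_def conj_commute)
    then show ?thesis unfolding CA_def using \<open>finite I\<close> by (intro sets.sets_Collect_finite_All) auto
  qed
  define R where "R f = (\<lambda>k\<in>{..<n}. f (p + k))" for f :: "nat \<Rightarrow> real"
  have Rm: "R \<in> PiM {p..<p+n} (\<lambda>_. borel) \<rightarrow>\<^sub>M PiM {..<n} (\<lambda>_. borel)"
    unfolding R_def by (intro measurable_restrict measurable_component_singleton) auto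
  define CE where "CE = R -` C \<inter> space (PiM {p..<p+n} (\<lambda>_. borel::real measure))"
  have CE: "CE \<in> sets (PiM {p..<p+n} (\<lambda>_. borel))"
    unfolding CE_def using Rm C by (rule measurable_sets)
  have A_eq: "?A = (\<lambda>\<omega>. restrict (\<lambda>i. \<xi> i \<omega>) {..<p}) -` CA \<inter> space M"
  proof -
    have "(\<forall>s\<in>S. X s \<omega> \<in> B s) \<longleftrightarrow> restrict (\<lambda>i. \<xi> i \<omega>) {..<p} \<in> CA" if w: "\<omega> \<in> space M" for \<omega>
    proof -
      have "restrict (\<lambda>i. \<xi> i \<omega>) {..<p} \<in> CA \<longleftrightarrow> (\<forall>i\<in>I. (\<Sum>j<i. \<xi> j \<omega>) \<in> B (L ! i))"
      proof -
        have "(\<Sum>j<i. restrict (\<lambda>i. \<xi> i \<omega>) {..<p} j) = (\<Sum>j<i. \<xi> j \<omega>)" if "i \<in> I" for i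
          using that unfolding I_def by (intro sum.cong) auto
        then show ?thesis unfolding CA_def space_PiM by auto
      qed
      also have "\<dots> \<longleftrightarrow> (\<forall>i\<in>I. X (L ! i) \<omega> \<in> B (L ! i))"
        using tele w unfolding I_def by auto
      also have "\<dots> \<longleftrightarrow> (\<forall>s\<in>S. X s \<omega> \<in> B s)"
      proof -
        have "S = (!) L ` I"
        proof (intro equalityI subsetI)
          fix s assume "s \<in> S"
          then obtain i where "i < length L" "L ! i = s" using setL by (metis in_set_conv_nth UnCI)
          then show "s \<in> (!) L ` I" using \<open>s \<in> S\<close> len unfolding I_def by force
        qed (auto simp: I_def)
        then show ?thesis by auto
      qed
      finally show ?thesis by simp
    qed
    then show ?thesis by auto
  qed
  have E_eq: "?E = (\<lambda>\<omega>. restrict (\<lambda>i. \<xi> i \<omega>) {p..<p+n}) -` CE \<inter> space M"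
  proof -
    have "R (restrict (\<lambda>i. \<xi> i \<omega>) {p..<p+n}) = grid_incr t h n \<omega>" for \<omega>
    proof (rule ext)
      fix k
      show "R (restrict (\<lambda>i. \<xi> i \<omega>) {p..<p+n}) k = grid_incr t h n \<omega> k"
        using Tp[of k] Tp[of "Suc k"] by (simp add: R_def grid_incr_def \<xi>_def)
    qed
    then show ?thesis unfolding CE_def by (auto simp: space_PiM)
  qed
  have "?A \<inter> ?E = (\<lambda>\<omega>. (restrict (\<lambda>i. \<xi> i \<omega>) {..<p}, restrict (\<lambda>i. \<xi> i \<omega>) {p..<p+n})) -` (CA \<times> CE) \<inter> space M"
    unfolding A_eq E_eq by auto
  then show ?thesis
    using indep_varD[OF rv CA CE] unfolding A_eq[symmetric] E_eq[symmetric] by simp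
qed

text \<open>The cylinders together with the null sets form an intersection-stable generator of
  \<open>past t\<close>, so independence extends from them to the whole sigma-algebra. Stationarity
  moves the grid increments from \<open>t\<close> to \<open>0\<close>.\<close>

lemma past_indep_grid_incr:
  assumes A: "A \<in> sets (past t)" and "0 \<le> t" "0 \<le> h" "0 < n"
    and C: "C \<in> sets (PiM {..<n} (\<lambda>_. borel))"
  shows "prob (A \<inter> {\<omega>\<in>space M. grid_incr t h n \<omega> \<in> C})
    = prob A * prob {\<omega>\<in>space M. grid_incr 0 h n \<omega> \<in> C}"
proof -
  let ?E = "\<lambda>C. {\<omega>\<in>space M. grid_incr t h n \<omega> \<in> C}"
  define G where "G = {{\<omega>\<in>space M. \<forall>s\<in>S. X s \<omega> \<in> B s} | S B.
    finite S \<and> S \<subseteq> {0..t} \<and> (\<forall>s\<in>S. B s \<in> sets (borel::real measure))}"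
  define V where "V = {(?E C) | C. C \<in> sets (PiM {..<n} (\<lambda>_. borel))}"
  have V_ev: "V \<subseteq> events" unfolding V_def using assms(2,3) by auto
  have G_ev: "G \<subseteq> events"
  proof
    fix A assume "A \<in> G"
    then obtain S B where *: "A = {\<omega>\<in>space M. \<forall>s\<in>S. X s \<omega> \<in> B s}" "finite S" "S \<subseteq> {0..t}"
      "\<And>s. s\<in>S \<Longrightarrow> B s \<in> sets (borel::real measure)" unfolding G_def by auto
    have "{\<omega>\<in>space M. X s \<omega> \<in> B s} \<in> events" if "s \<in> S" for s
    proof -
      have "{\<omega>\<in>space M. X s \<omega> \<in> B s} = X s -` B s \<inter> space M" by auto
      also have "\<dots> \<in> events" using *(3,4) that by (intro measurable_sets[OF X_measurable]) auto
      finally show ?thesis .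
    qed
    then show "A \<in> events" unfolding *(1) using *(2) by (intro sets.sets_Collect_finite_All) auto
  qed
  have ind: "indep_set (G \<union> null_sets M) V"
  proof (rule indep_setI)
    fix a b assume a: "a \<in> G \<union> null_sets M" and b: "b \<in> V"
    show "prob (a \<inter> b) = prob a * prob b"
    proof (cases "a \<in> null_sets M")
      case True
      then have "a \<inter> b \<in> null_sets M" using b V_ev by (intro null_set_Int2) auto
      then show ?thesis using True by (auto dest!: measure_eq_0_null_sets)
    next
      case False
      then obtain S B where "a = {\<omega>\<in>space M. \<forall>s\<in>S. X s \<omega> \<in> B s}" "finite S" "S \<subseteq> {0..t}"
        "\<And>s. s\<in>S \<Longrightarrow> B s \<in> sets (borel::real measure)" using a unfolding G_def by auto
      moreover obtain C where "b = (?E C)" "C \<in> sets (PiM {..<n} (\<lambda>_. borel))"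
        using b unfolding V_def by auto
      ultimately show ?thesis using cylinder_indep_grid_incr[of S t B h n C] assms by simp
    qed
  qed (use V_ev G_ev in auto)
  have G_Int: "a \<inter> b \<in> G" if "a \<in> G" "b \<in> G" for a b
  proof -
    from that obtain S1 B1 S2 B2 where
      1: "a = {\<omega>\<in>space M. \<forall>s\<in>S1. X s \<omega> \<in> B1 s}" "finite S1" "S1 \<subseteq> {0..t}"
        "\<forall>s\<in>S1. B1 s \<in> sets (borel::real measure)" and
      2: "b = {\<omega>\<in>space M. \<forall>s\<in>S2. X s \<omega> \<in> B2 s}" "finite S2" "S2 \<subseteq> {0..t}"
        "\<forall>s\<in>S2. B2 s \<in> sets (borel::real measure)" unfolding G_def by auto
    let ?B = "\<lambda>s. (if s \<in> S1 then B1 s else UNIV) \<inter> (if s \<in> S2 then B2 s else UNIV)"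
    have "a \<inter> b = {\<omega>\<in>space M. \<forall>s\<in>S1 \<union> S2. X s \<omega> \<in> ?B s}" unfolding 1(1) 2(1) by auto
    moreover have "\<forall>s\<in>S1 \<union> S2. ?B s \<in> sets (borel::real measure)" using 1(4) 2(4) by auto
    moreover have "finite (S1 \<union> S2)" "S1 \<union> S2 \<subseteq> {0..t}" using 1 2 by auto
    ultimately show ?thesis
      unfolding G_def by (intro CollectI exI[of _ "S1 \<union> S2"] exI[of _ ?B] conjI)
  qed
  have "Int_stable (G \<union> null_sets M)"
  proof (rule Int_stableI)
    fix a b assume "a \<in> G \<union> null_sets M" "b \<in> G \<union> null_sets M"
    then show "a \<inter> b \<in> G \<union> null_sets M"
      using G_Int[of a b] null_set_Int1[of b M a] null_set_Int2[of a M b] G_ev by (auto simp: Int_commute)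
  qed
  moreover have "Int_stable V"
  proof (rule Int_stableI)
    fix a b assume "a \<in> V" "b \<in> V"
    then obtain C1 C2 where "a = {\<omega>\<in>space M. grid_incr t h n \<omega> \<in> C1}" "b = {\<omega>\<in>space M. grid_incr t h n \<omega> \<in> C2}"
      "C1 \<in> sets (PiM {..<n} (\<lambda>_. borel))" "C2 \<in> sets (PiM {..<n} (\<lambda>_. borel))"
      unfolding V_def by auto
    then have "a \<inter> b = {\<omega>\<in>space M. grid_incr t h n \<omega> \<in> C1 \<inter> C2}" "C1 \<inter> C2 \<in> sets (PiM {..<n} (\<lambda>_. borel))"
      by auto
    then show "a \<inter> b \<in> V" unfolding V_def by blast
  qed
  ultimately have "indep_set (sigma_sets (space M) (G \<union> null_sets M)) (sigma_sets (space M) V)"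
    by (rule indep_set_sigma_sets[OF ind])
  moreover have "A \<in> sigma_sets (space M) (G \<union> null_sets M)"
  proof -
    have "{X s -` B \<inter> space M | s B. 0 \<le> s \<and> s \<le> t \<and> B \<in> sets borel} \<subseteq> G"
    proof
      fix a assume "a \<in> {X s -` B \<inter> space M | s B. 0 \<le> s \<and> s \<le> t \<and> B \<in> sets borel}"
      then obtain s B where "a = X s -` B \<inter> space M" "0 \<le> s" "s \<le> t" "B \<in> sets borel" by auto
      then show "a \<in> G" unfolding G_def
        by (intro CollectI exI[of _ "{s}"] exI[of _ "\<lambda>_. B"]) auto
    qed
    then have "sets (past t) \<subseteq> sigma_sets (space M) (G \<union> null_sets M)"
      unfolding sets_past by (intro sigma_sets_mono') auto
    then show ?thesis using A by auto
  qed
  moreover have "(?E C) \<in> sigma_sets (space M) V"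
    unfolding V_def using C by (intro sigma_sets.Basic) auto
  ultimately have "prob (A \<inter> (?E C))
      = prob A * prob (?E C)"
    by (rule indep_setD)
  also have "prob {\<omega>\<in>space M. grid_incr s h n \<omega> \<in> C}
      = measure (PiM {..<n} (\<lambda>_. distr M borel (X h))) C" if "0 \<le> s" for s
    using measure_distr[OF grid_incr_measurable, of s h C n] distr_grid_incr[of s h n] assms that
    by (simp add: vimage_def Int_def conj_commute)
  then have "prob (?E C) = prob {\<omega>\<in>space M. grid_incr 0 h n \<omega> \<in> C}"
    using \<open>0 \<le> t\<close> by simp
  finally show ?thesis .
qed

lemma past_indep_grid_inf:
  assumes A: "A \<in> sets (past t)" and "0 \<le> t" "0 \<le> h" "0 < n"
  shows "prob {\<omega>\<in>A. \<forall>k\<le>n. X t \<omega> - X (t + real k * h) \<omega> \<le> y}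
    = prob A * prob {\<omega>\<in>space M. \<forall>k\<le>n. - X (real k * h) \<omega> \<le> y}"
proof -
  define C where "C = {f \<in> space (PiM {..<n} (\<lambda>_. borel::real measure)). \<forall>k\<le>n. - (\<Sum>j<k. f j) \<le> y}"
  have C: "C \<in> sets (PiM {..<n} (\<lambda>_. borel))"
  proof -
    have "(\<lambda>f. \<Sum>j<k. f j) \<in> borel_measurable (PiM {..<n} (\<lambda>_. borel::real measure))" if "k \<le> n" for k
      using that by (intro borel_measurable_sum measurable_component_singleton) auto
    then have "{f \<in> space (PiM {..<n} (\<lambda>_. borel::real measure)). - (\<Sum>j<k. f j) \<le> y} \<in> sets (PiM {..<n} (\<lambda>_. borel))"
      if "k \<le> n" for k using that by measurable
    then have "{f \<in> space (PiM {..<n} (\<lambda>_. borel::real measure)). \<forall>k\<in>{..n}. - (\<Sum>j<k. f j) \<le> y} \<in> sets (PiM {..<n} (\<lambda>_. borel))"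
      by (intro sets.sets_Collect_finite_All) auto
    then show ?thesis unfolding C_def by (simp add: Ball_def)
  qed
  have eq: "grid_incr s h n \<omega> \<in> C \<longleftrightarrow> (\<forall>k\<le>n. X s \<omega> - X (s + real k * h) \<omega> \<le> y)" for s \<omega>
  proof -
    have "(\<Sum>j<k. grid_incr s h n \<omega> j) = X (s + real k * h) \<omega> - X s \<omega>" if "k \<le> n" for k
    proof -
      have "(\<Sum>j<k. grid_incr s h n \<omega> j) = (\<Sum>j<k. X (s + real (Suc j) * h) \<omega> - X (s + real j * h) \<omega>)"
        unfolding grid_incr_def using that by (intro sum.cong) auto
      also have "\<dots> = X (s + real k * h) \<omega> - X (s + real 0 * h) \<omega>"
        by (rule sum_lessThan_telescope)
      finally show ?thesis by simp
    qed
    moreover have "grid_incr s h n \<omega> \<in> space (PiM {..<n} (\<lambda>_. borel::real measure))"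
      unfolding grid_incr_def space_PiM by auto
    ultimately show ?thesis unfolding C_def by auto
  qed
  have "A \<subseteq> space M" using sets.sets_into_space[OF A] by simp
  then have "{\<omega>\<in>A. \<forall>k\<le>n. X t \<omega> - X (t + real k * h) \<omega> \<le> y} = A \<inter> {\<omega>\<in>space M. grid_incr t h n \<omega> \<in> C}"
    unfolding eq by auto
  moreover have "{\<omega>\<in>space M. \<forall>k\<le>n. - X (real k * h) \<omega> \<le> y} = {\<omega>\<in>space M. grid_incr 0 h n \<omega> \<in> C}"
    unfolding eq using X_0 by auto
  ultimately show ?thesis using past_indep_grid_incr[OF assms C] by simp
qed

text \<open>The past enters through an arbitrary measurable \<open>U\<close>, so that
  \<open>U\<close> can later be the pair of an indicator and the current position. This is the form
  in which the Markov property is used under a stopping event.\<close>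

lemma past_indep_incr:
  assumes U: "U \<in> past t \<rightarrow>\<^sub>M S" and "0 \<le> t" "0 \<le> r"
  shows "distr M (S \<Otimes>\<^sub>M borel) (\<lambda>\<omega>. (U \<omega>, X (t + r) \<omega> - X t \<omega>)) = distr M S U \<Otimes>\<^sub>M distr M borel (X r)"
proof -
  have [measurable]: "U \<in> M \<rightarrow>\<^sub>M S" using U by (rule measurable_past_imp)
  let ?D = "\<lambda>\<omega>. X (t + r) \<omega> - X t \<omega>"
  have [measurable]: "X t \<in> borel_measurable M" "X (t + r) \<in> borel_measurable M"
    using assms X_measurable by auto
  interpret R: prob_space "distr M borel (X r)"
    by (rule prob_space_distr) (use assms X_measurable in auto)
  interpret D: prob_space "distr M S U" by (rule prob_space_distr) measurable
  show ?thesis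
  proof (rule pair_measure_eqI[symmetric])
    fix A B assume A: "A \<in> sets (distr M S U)" and B: "B \<in> sets (distr M borel (X r))"
    let ?a = "U -` A \<inter> space M" and ?b = "?D -` B \<inter> space M"
    have aP: "?a \<in> sets (past t)" using measurable_sets[OF U, of A] A by simp
    define C where "C = (\<lambda>f. f 0) -` B \<inter> space (PiM {..<1::nat} (\<lambda>_. borel::real measure))"
    have C: "C \<in> sets (PiM {..<1} (\<lambda>_. borel))"
      unfolding C_def using B by (intro measurable_sets[of _ _ borel] measurable_component_singleton) auto
    have eq: "?b = {\<omega>\<in>space M. grid_incr t r 1 \<omega> \<in> C}"
      unfolding C_def grid_incr_def space_PiM by auto
    \<comment> \<open>The whole space as past event gives the probability of the future event
      alone.\<close>
    have "prob (space M \<inter> ?b) = prob (space M) * prob {\<omega>\<in>space M. grid_incr 0 r 1 \<omega> \<in> C}"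
      unfolding eq by (rule past_indep_grid_incr) (use assms C sets.top[of "past t"] in auto)
    then have "prob ?b = prob {\<omega>\<in>space M. grid_incr 0 r 1 \<omega> \<in> C}"
      by (simp add: prob_space Int_absorb1)
    then have prod: "prob (?a \<inter> ?b) = prob ?a * prob ?b"
      using past_indep_grid_incr[OF aP, of r 1 C] assms C unfolding eq by simp
    have "emeasure (distr M S U) A * emeasure (distr M borel (X r)) B
        = emeasure (distr M S U) A * emeasure (distr M borel ?D) B"
      using X_stationary[of t "t + r"] assms by simp
    also have "\<dots> = ennreal (prob ?a) * ennreal (prob ?b)"
      using A B by (subst (1 2) emeasure_distr) (auto simp: emeasure_eq_measure)
    also have "\<dots> = ennreal (prob (?a \<inter> ?b))" unfolding prod by (simp add: ennreal_mult)
    also have "?a \<inter> ?b = (\<lambda>\<omega>. (U \<omega>, ?D \<omega>)) -` (A \<times> B) \<inter> space M" by auto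
    also have "ennreal (prob \<dots>) = emeasure (distr M (S \<Otimes>\<^sub>M borel) (\<lambda>\<omega>. (U \<omega>, ?D \<omega>))) (A \<times> B)"
      using A B by (subst emeasure_distr) (auto simp: emeasure_eq_measure)
    finally show "emeasure (distr M S U) A * emeasure (distr M borel (X r)) B
      = emeasure (distr M (S \<Otimes>\<^sub>M borel) (\<lambda>\<omega>. (U \<omega>, ?D \<omega>))) (A \<times> B)" .
  next
    show "sets (distr M S U \<Otimes>\<^sub>M distr M borel (X r)) = sets (distr M (S \<Otimes>\<^sub>M borel) (\<lambda>\<omega>. (U \<omega>, ?D \<omega>)))"
      by (simp only: sets_distr) (rule sets_pair_measure_cong, simp_all only: sets_distr)
  qed (fact D.sigma_finite_measure_axioms R.sigma_finite_measure_axioms)+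
qed

lemma markov_nn_integral:
  assumes U: "U \<in> past t \<rightarrow>\<^sub>M S" and "0 \<le> t" "0 \<le> r"
    and f [measurable]: "f \<in> borel_measurable (S \<Otimes>\<^sub>M borel)"
  shows "(\<integral>\<^sup>+\<omega>. f (U \<omega>, X (t + r) \<omega> - X t \<omega>) \<partial>M) = (\<integral>\<^sup>+\<omega>. \<integral>\<^sup>+\<omega>'. f (U \<omega>, X r \<omega>') \<partial>M \<partial>M)"
proof -
  have [measurable]: "U \<in> M \<rightarrow>\<^sub>M S" using U by (rule measurable_past_imp)
  have [measurable]: "X t \<in> borel_measurable M" "X (t + r) \<in> borel_measurable M" "X r \<in> borel_measurable M"
    using assms X_measurable by auto
  interpret R: prob_space "distr M borel (X r)" by (rule prob_space_distr) measurable
  have "(\<integral>\<^sup>+\<omega>. f (U \<omega>, X (t + r) \<omega> - X t \<omega>) \<partial>M)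
      = (\<integral>\<^sup>+p. f p \<partial>(distr M S U \<Otimes>\<^sub>M distr M borel (X r)))"
    unfolding past_indep_incr[OF assms(1-3), symmetric] by (subst nn_integral_distr) auto
  also have "\<dots> = (\<integral>\<^sup>+u. \<integral>\<^sup>+y. f (u, y) \<partial>distr M borel (X r) \<partial>distr M S U)"
    by (rule R.nn_integral_fst[symmetric]) measurable
  also have "\<dots> = (\<integral>\<^sup>+u. \<integral>\<^sup>+\<omega>'. f (u, X r \<omega>') \<partial>M \<partial>distr M S U)"
    by (intro nn_integral_cong) (subst nn_integral_distr, auto)
  also have "\<dots> = (\<integral>\<^sup>+\<omega>. \<integral>\<^sup>+\<omega>'. f (U \<omega>, X r \<omega>') \<partial>M \<partial>M)"
    by (subst nn_integral_distr) auto
  finally show ?thesis .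
qed

lemma markov_integral:
  fixes f :: "'s \<times> real \<Rightarrow> real"
  assumes U: "U \<in> past t \<rightarrow>\<^sub>M S" and "0 \<le> t" "0 \<le> r"
    and f [measurable]: "f \<in> borel_measurable (S \<Otimes>\<^sub>M borel)"
    and int: "integrable M (\<lambda>\<omega>. f (U \<omega>, X (t + r) \<omega> - X t \<omega>))"
  shows "(\<integral>\<omega>. f (U \<omega>, X (t + r) \<omega> - X t \<omega>) \<partial>M) = (\<integral>\<omega>. \<integral>\<omega>'. f (U \<omega>, X r \<omega>') \<partial>M \<partial>M)"
proof -
  have [measurable]: "U \<in> M \<rightarrow>\<^sub>M S" using U by (rule measurable_past_imp)
  have [measurable]: "X t \<in> borel_measurable M" "X (t + r) \<in> borel_measurable M" "X r \<in> borel_measurable M"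
    using assms X_measurable by auto
  interpret R: prob_space "distr M borel (X r)" by (rule prob_space_distr) measurable
  interpret D: prob_space "distr M S U" by (rule prob_space_distr) measurable
  interpret P: pair_sigma_finite "distr M S U" "distr M borel (X r)" ..
  note law = past_indep_incr[OF assms(1-3)]
  have "integrable (distr M (S \<Otimes>\<^sub>M borel) (\<lambda>\<omega>. (U \<omega>, X (t + r) \<omega> - X t \<omega>))) f"
    by (subst integrable_distr_eq) (use int in auto)
  then have i: "integrable (distr M S U \<Otimes>\<^sub>M distr M borel (X r)) f"
    unfolding law .
  have "(\<integral>\<omega>. f (U \<omega>, X (t + r) \<omega> - X t \<omega>) \<partial>M) = (\<integral>p. f p \<partial>(distr M S U \<Otimes>\<^sub>M distr M borel (X r)))"
    unfolding law[symmetric] by (subst integral_distr) auto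
  also have "\<dots> = (\<integral>u. \<integral>y. f (u, y) \<partial>distr M borel (X r) \<partial>distr M S U)"
    using P.integral_fst'[OF i] by simp
  also have "\<dots> = (\<integral>u. \<integral>\<omega>'. f (u, X r \<omega>') \<partial>M \<partial>distr M S U)"
    by (intro Bochner_Integration.integral_cong refl) (subst integral_distr, auto)
  also have "\<dots> = (\<integral>\<omega>. \<integral>\<omega>'. f (U \<omega>, X r \<omega>') \<partial>M \<partial>M)"
    by (subst integral_distr) auto
  finally show ?thesis .
qed

end

subsection \<open>The overall infimum\<close>

lemma exp_diff_quotient_mono:
  fixes x :: real
  assumes "0 < a" "a \<le> b"
  shows "(exp (a * x) - 1) / a \<le> (exp (b * x) - 1) / b"
proof -
  have "exp ((1 - a / b) *\<^sub>R 0 + (a / b) *\<^sub>R (b * x)) \<le> (1 - a / b) * exp 0 + (a / b) * exp (b * x)"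
    by (rule convex_onD[OF exp_convex]) (use assms in auto)
  then have "exp (a * x) - 1 \<le> (a / b) * (exp (b * x) - 1)"
    using assms by (simp add: algebra_simps)
  then show ?thesis using assms by (simp add: field_simps)
qed

lemma exp_diff_quotient_tendsto:
  "((\<lambda>a. (exp (a * x) - 1) / a) \<longlongrightarrow> x) (at_right (0::real))"
proof -
  have "((\<lambda>a. exp (a * x)) has_real_derivative x) (at 0)"
    by (auto intro!: derivative_eq_intros)
  then have "((\<lambda>a. (exp (a * x) - exp (0 * x)) / (a - 0)) \<longlongrightarrow> x) (at 0)"
    unfolding has_field_derivative_iff .
  then show ?thesis by (auto intro: filterlim_mono[OF _ order_refl] simp: at_within_le_at)
qed

lemma half_power_at_right_0: "filterlim (\<lambda>n. 1 / 2 ^ n :: real) (at_right 0) sequentially"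
  using half_power_tendsto_0 by (auto simp: filterlim_at intro!: always_eventually)

text \<open>Neither \<open>A\<close> nor \<open>B\<close> need be integrable, only the difference.
  Clipping at \<open>k\<close> is 1-Lipschitz, so the differences of the clipped variables, whose
  means vanish by equality in law, are dominated by \<open>\<bar>A - B\<bar>\<close>. The infimum is
  used here before its mean is known to be finite.\<close>

lemma (in prob_space) same_distr_diff_integral_zero:
  fixes A B :: "'a \<Rightarrow> real"
  assumes [measurable]: "A \<in> borel_measurable M" "B \<in> borel_measurable M"
    and eq: "distr M borel A = distr M borel B"
    and int: "integrable M (\<lambda>\<omega>. A \<omega> - B \<omega>)"
  shows "(\<integral>\<omega>. A \<omega> - B \<omega> \<partial>M) = 0"
proof -
  define c where "c k x = max (- real k) (min (real k) x)" for k and x :: real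
  have [measurable]: "c k \<in> borel_measurable borel" for k unfolding c_def by measurable
  have ci: "integrable M (\<lambda>\<omega>. c k (f \<omega>))" if [measurable]: "f \<in> borel_measurable M" for k f
    by (rule integrable_const_bound[of _ "real k"]) (auto simp: c_def)
  have "(\<integral>\<omega>. c k (A \<omega>) - c k (B \<omega>) \<partial>M) = 0" for k
  proof -
    have "(\<integral>\<omega>. c k (A \<omega>) \<partial>M) = (\<integral>x. c k x \<partial>distr M borel A)" by (subst integral_distr) auto
    also have "\<dots> = (\<integral>\<omega>. c k (B \<omega>) \<partial>M)" unfolding eq by (subst integral_distr) auto
    finally show ?thesis using ci by simp
  qed
  moreover have "(\<lambda>k. \<integral>\<omega>. c k (A \<omega>) - c k (B \<omega>) \<partial>M) \<longlonglongrightarrow> (\<integral>\<omega>. A \<omega> - B \<omega> \<partial>M)"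
  proof (rule integral_dominated_convergence[where w="\<lambda>\<omega>. \<bar>A \<omega> - B \<omega>\<bar>"])
    show "AE \<omega> in M. (\<lambda>k. c k (A \<omega>) - c k (B \<omega>)) \<longlonglongrightarrow> A \<omega> - B \<omega>"
    proof (rule AE_I2, rule tendsto_eventually)
      fix \<omega>
      obtain N :: nat where N: "\<bar>A \<omega>\<bar> \<le> N" "\<bar>B \<omega>\<bar> \<le> N"
        using real_nat_ceiling_ge[of "max \<bar>A \<omega>\<bar> \<bar>B \<omega>\<bar>"] by (meson max.bounded_iff)
      show "\<forall>\<^sub>F k in sequentially. c k (A \<omega>) - c k (B \<omega>) = A \<omega> - B \<omega>"
        using eventually_ge_at_top[of N]
      proof eventually_elim
        case (elim k)
        then have "real N \<le> real k" by simp
        then show ?case using N unfolding c_def by linarith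
      qed
    qed
    show "AE \<omega> in M. norm (c k (A \<omega>) - c k (B \<omega>)) \<le> \<bar>A \<omega> - B \<omega>\<bar>" for k
      by (rule AE_I2) (auto simp: c_def)
  qed (use int in auto)
  ultimately have "(\<lambda>k::nat. 0::real) \<longlonglongrightarrow> (\<integral>\<omega>. A \<omega> - B \<omega> \<partial>M)" by simp
  then show ?thesis by (simp add: LIMSEQ_const_iff)
qed

abbreviation mesh :: "nat \<Rightarrow> real" where "mesh n \<equiv> 1 / 2 ^ n"

lemma dyadic_above_mesh:
  assumes "0 \<le> s"
  obtains k :: nat where "dyadic_above n s = real k * mesh n"
  using dyadic_above_eq_of_nat[OF assms, of n] by auto

context snlp
begin

definition inf_neg :: "'a \<Rightarrow> real" where
  "inf_neg \<omega> = (SUP t\<in>{0..}. - X t \<omega>)"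

definition grid_inf_neg :: "nat \<Rightarrow> 'a \<Rightarrow> real" where
  "grid_inf_neg n \<omega> = (SUP k::nat. - X (real k * mesh n) \<omega>)"

text \<open>The same supremum for the path restarted at the first grid time: equal in law to
  \<open>grid_inf_neg n\<close> and independent of \<open>X (mesh n)\<close>.\<close>

definition grid_inf_neg_shift :: "nat \<Rightarrow> 'a \<Rightarrow> real" where
  "grid_inf_neg_shift n \<omega> = (SUP k::nat. X (mesh n) \<omega> - X (mesh n + real k * mesh n) \<omega>)"

lemma X_bounded_below:
  assumes "\<omega> \<in> space M"
  obtains B where "\<And>t. 0 \<le> t \<Longrightarrow> - X t \<omega> \<le> B"
proof -
  have "\<forall>\<^sub>F t in at_top. 0 \<le> X t \<omega>"
    using X_at_top[OF assms] by (auto simp: filterlim_at_top)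
  then obtain T where T: "\<And>t. T \<le> t \<Longrightarrow> 0 \<le> X t \<omega>" by (auto simp: eventually_at_top_linorder)
  obtain B where B: "\<And>t. 0 \<le> t \<Longrightarrow> t \<le> T \<Longrightarrow> \<bar>X t \<omega>\<bar> \<le> B"
    using cadlag_bounded[OF X_cadlag[OF assms]] by blast
  show thesis
  proof (rule that[of "\<bar>B\<bar>"])
    fix t :: real assume "0 \<le> t"
    then show "- X t \<omega> \<le> \<bar>B\<bar>" using T[of t] B[of t] by linarith
  qed
qed

lemma bdd_above_neg_X: "\<omega> \<in> space M \<Longrightarrow> bdd_above ((\<lambda>t. - X t \<omega>) ` {0..})"
  by (rule X_bounded_below) (auto intro!: bdd_aboveI2)

lemma grid_point_nonneg [simp]: "0 \<le> real k * mesh n" by simp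

lemma bdd_above_grid: "\<omega> \<in> space M \<Longrightarrow> bdd_above (range (\<lambda>k::nat. - X (real k * mesh n) \<omega>))"
  by (rule X_bounded_below, assumption, rule bdd_aboveI2) (use grid_point_nonneg in blast)

lemma bdd_above_grid_shift:
  assumes "\<omega> \<in> space M"
  shows "bdd_above (range (\<lambda>k::nat. X (mesh n) \<omega> - X (mesh n + real k * mesh n) \<omega>))"
proof -
  obtain B where B: "\<And>t. 0 \<le> t \<Longrightarrow> - X t \<omega> \<le> B" using X_bounded_below[OF assms] by blast
  then have "X (mesh n) \<omega> - X (mesh n + real k * mesh n) \<omega> \<le> X (mesh n) \<omega> + B" for k :: nat
    using B[of "mesh n + real k * mesh n"] by simp
  then show ?thesis by (rule bdd_aboveI2)
qed

lemma inf_neg_ge: "\<omega> \<in> space M \<Longrightarrow> 0 \<le> t \<Longrightarrow> - X t \<omega> \<le> inf_neg \<omega>"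
  unfolding inf_neg_def by (rule cSUP_upper) (auto intro: bdd_above_neg_X)

lemma inf_neg_le: "(\<And>t. 0 \<le> t \<Longrightarrow> - X t \<omega> \<le> B) \<Longrightarrow> inf_neg \<omega> \<le> B"
  unfolding inf_neg_def by (rule cSUP_least) auto

lemma grid_inf_neg_ge: "\<omega> \<in> space M \<Longrightarrow> - X (real k * mesh n) \<omega> \<le> grid_inf_neg n \<omega>"
  unfolding grid_inf_neg_def by (rule cSUP_upper[OF UNIV_I bdd_above_grid])

lemma grid_inf_neg_le: "(\<And>k::nat. - X (real k * mesh n) \<omega> \<le> B) \<Longrightarrow> grid_inf_neg n \<omega> \<le> B"
  unfolding grid_inf_neg_def by (rule cSUP_least) auto

lemma grid_inf_neg_le_iff:
  "\<omega> \<in> space M \<Longrightarrow> grid_inf_neg n \<omega> \<le> B \<longleftrightarrow> (\<forall>k::nat. - X (real k * mesh n) \<omega> \<le> B)"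
  unfolding grid_inf_neg_def by (subst cSUP_le_iff[OF _ bdd_above_grid]) simp_all

lemma grid_inf_neg_nonneg: "\<omega> \<in> space M \<Longrightarrow> 0 \<le> grid_inf_neg n \<omega>"
  using grid_inf_neg_ge[of \<omega> 0 n] X_0 by simp

lemma inf_neg_nonneg: "\<omega> \<in> space M \<Longrightarrow> 0 \<le> inf_neg \<omega>"
  using inf_neg_ge[of \<omega> 0] X_0 by simp

lemma grid_inf_neg_le_inf_neg: "\<omega> \<in> space M \<Longrightarrow> grid_inf_neg n \<omega> \<le> inf_neg \<omega>"
  by (rule grid_inf_neg_le) (auto intro: inf_neg_ge)

lemma incseq_grid_inf_neg:
  assumes "\<omega> \<in> space M"
  shows "incseq (\<lambda>n. grid_inf_neg n \<omega>)"
proof (rule incseq_SucI, rule grid_inf_neg_le)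
  fix n k
  show "- X (real k * mesh n) \<omega> \<le> grid_inf_neg (Suc n) \<omega>"
    using grid_inf_neg_ge[OF assms, of "2 * k" "Suc n"] by simp
qed

lemma grid_inf_neg_tendsto:
  assumes w: "\<omega> \<in> space M"
  shows "(\<lambda>n. grid_inf_neg n \<omega>) \<longlonglongrightarrow> inf_neg \<omega>"
proof -
  obtain L where L: "(\<lambda>n. grid_inf_neg n \<omega>) \<longlonglongrightarrow> L" and le: "\<And>n. grid_inf_neg n \<omega> \<le> L"
    by (rule incseq_convergent[OF incseq_grid_inf_neg[OF w], of "inf_neg \<omega>"])
       (use grid_inf_neg_le_inf_neg[OF w] in auto)
  have "inf_neg \<omega> \<le> L"
  proof (rule inf_neg_le)
    fix t :: real assume t: "0 \<le> t"
    have "(\<lambda>n. - X (dyadic_above n t) \<omega>) \<longlonglongrightarrow> - X t \<omega>"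
      using cadlag_dyadic_tendsto[OF X_cadlag[OF w] t] by (rule tendsto_minus)
    then show "- X t \<omega> \<le> L"
    proof (rule LIMSEQ_le_const2, intro exI allI impI)
      fix n :: nat
      obtain k :: nat where "dyadic_above n t = real k * mesh n" using dyadic_above_mesh[OF t] by blast
      then show "- X (dyadic_above n t) \<omega> \<le> L"
        using grid_inf_neg_ge[OF w, of k n] le[of n] by simp
    qed
  qed
  moreover have "L \<le> inf_neg \<omega>"
    using L by (rule LIMSEQ_le_const2) (use grid_inf_neg_le_inf_neg[OF w] in auto)
  ultimately show ?thesis using L by simp
qed

lemma grid_inf_neg_measurable [measurable]: "grid_inf_neg n \<in> borel_measurable M"
  unfolding grid_inf_neg_def by (rule borel_measurable_cSUP[OF _ _ bdd_above_grid]) auto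

lemma grid_inf_neg_shift_measurable [measurable]: "grid_inf_neg_shift n \<in> borel_measurable M"
  unfolding grid_inf_neg_shift_def
  by (rule borel_measurable_cSUP[OF _ _ bdd_above_grid_shift]) auto

lemma inf_neg_measurable [measurable]: "inf_neg \<in> borel_measurable M"
  by (rule borel_measurable_LIMSEQ_real[OF grid_inf_neg_tendsto grid_inf_neg_measurable])

lemma grid_inf_neg_shift_nonneg:
  assumes "\<omega> \<in> space M" shows "0 \<le> grid_inf_neg_shift n \<omega>"
proof -
  have "X (mesh n) \<omega> - X (mesh n + real 0 * mesh n) \<omega> \<le> grid_inf_neg_shift n \<omega>"
    unfolding grid_inf_neg_shift_def by (rule cSUP_upper[OF _ bdd_above_grid_shift[OF assms]]) simp
  then show ?thesis by simp
qed

text \<open>First-step decomposition of the supremum: grid time \<open>0\<close> contributes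
  \<open>0\<close>, and the later grid times contribute the restarted supremum minus the first
  step.\<close>

lemma grid_inf_neg_lindley:
  assumes w: "\<omega> \<in> space M"
  shows "grid_inf_neg n \<omega> = max 0 (grid_inf_neg_shift n \<omega> - X (mesh n) \<omega>)"
proof (rule antisym)
  have up: "X (mesh n) \<omega> - X (mesh n + real k * mesh n) \<omega> \<le> grid_inf_neg_shift n \<omega>" for k :: nat
    unfolding grid_inf_neg_shift_def by (rule cSUP_upper[OF _ bdd_above_grid_shift[OF w]]) simp
  show "grid_inf_neg n \<omega> \<le> max 0 (grid_inf_neg_shift n \<omega> - X (mesh n) \<omega>)"
  proof (rule grid_inf_neg_le)
    fix k
    show "- X (real k * mesh n) \<omega> \<le> max 0 (grid_inf_neg_shift n \<omega> - X (mesh n) \<omega>)"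
    proof (cases k)
      case 0 then show ?thesis using X_0[OF w] by simp
    next
      case (Suc j)
      have "real k * mesh n = mesh n + real j * mesh n" unfolding Suc by (simp add: field_simps)
      then show ?thesis using up[of j] by simp
    qed
  qed
  have "grid_inf_neg_shift n \<omega> \<le> grid_inf_neg n \<omega> + X (mesh n) \<omega>"
    unfolding grid_inf_neg_shift_def
  proof (rule cSUP_least)
    fix k :: nat
    have "mesh n + real k * mesh n = real (Suc k) * mesh n" by (simp add: field_simps)
    then show "X (mesh n) \<omega> - X (mesh n + real k * mesh n) \<omega> \<le> grid_inf_neg n \<omega> + X (mesh n) \<omega>"
      using grid_inf_neg_ge[OF w, of "Suc k" n] by simp
  qed simp
  then show "max 0 (grid_inf_neg_shift n \<omega> - X (mesh n) \<omega>) \<le> grid_inf_neg n \<omega>"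
    using grid_inf_neg_nonneg[OF w] by simp
qed

text \<open>The finite-horizon events decrease to the infinite-horizon one, so independence passes
  to the limit by continuity from above.\<close>

lemma past_indep_grid_inf_neg:
  assumes A: "A \<in> sets (past t)" and "0 \<le> t"
  shows "prob {\<omega>\<in>A. \<forall>k::nat. X t \<omega> - X (t + real k * mesh n) \<omega> \<le> y} = prob A * prob {\<omega>\<in>space M. grid_inf_neg n \<omega> \<le> y}"
proof -
  have [measurable]: "A \<in> sets M" using A sets_past_subset by auto
  let ?a = "\<lambda>N. {\<omega>\<in>A. \<forall>k\<le>N. X t \<omega> - X (t + real k * mesh n) \<omega> \<le> y}"
  let ?b = "\<lambda>N. {\<omega>\<in>space M. \<forall>k\<le>N. - X (real k * mesh n) \<omega> \<le> y}"
  have A_sub: "A \<subseteq> space M" using sets.sets_into_space[of A M] by simp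
  have am: "?a N \<in> events" for N :: nat
  proof -
    have "{\<omega>\<in>space M. X t \<omega> - X (t + real k * mesh n) \<omega> \<le> y} \<in> events" for k :: nat
      using X_measurable[of t] X_measurable[of "t + real k * mesh n"] \<open>0 \<le> t\<close> by simp
    then have "{\<omega>\<in>space M. \<forall>k\<in>{..N}. X t \<omega> - X (t + real k * mesh n) \<omega> \<le> y} \<in> events"
      by (intro sets.sets_Collect_finite_All) auto
    moreover have "?a N = A \<inter> {\<omega>\<in>space M. \<forall>k\<in>{..N}. X t \<omega> - X (t + real k * mesh n) \<omega> \<le> y}"
      using A_sub by auto
    ultimately show ?thesis by simp
  qed
  have bm: "?b N \<in> events" for N :: nat
  proof -
    have "{\<omega>\<in>space M. - X (real k * mesh n) \<omega> \<le> y} \<in> events" for k :: nat by measurable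
    then have "{\<omega>\<in>space M. \<forall>k\<in>{..N}. - X (real k * mesh n) \<omega> \<le> y} \<in> events"
      by (intro sets.sets_Collect_finite_All) auto
    then show ?thesis by (simp add: Ball_def)
  qed
  have "(\<lambda>N. prob (?a N)) \<longlonglongrightarrow> prob (\<Inter>N. ?a N)"
    by (intro finite_Lim_measure_decseq decseq_SucI image_subsetI am) (auto simp only: le_SucI)
  also have "(\<Inter>N. ?a N) = {\<omega>\<in>A. \<forall>k::nat. X t \<omega> - X (t + real k * mesh n) \<omega> \<le> y}"
    by auto
  \<comment> \<open>The finite-horizon statement needs a positive number of steps, hence the index
    \<open>Suc N\<close>.\<close>
  finally have 1: "(\<lambda>N. prob (?a (Suc N))) \<longlonglongrightarrow> prob {\<omega>\<in>A. \<forall>k::nat. X t \<omega> - X (t + real k * mesh n) \<omega> \<le> y}"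
    by (rule LIMSEQ_Suc)
  have "(\<lambda>N. prob (?b N)) \<longlonglongrightarrow> prob (\<Inter>N. ?b N)"
    by (intro finite_Lim_measure_decseq decseq_SucI image_subsetI bm) (auto simp only: le_SucI)
  also have "(\<Inter>N. ?b N) = {\<omega>\<in>space M. grid_inf_neg n \<omega> \<le> y}"
    using grid_inf_neg_le_iff[of _ n y] by blast
  finally have "(\<lambda>N. prob A * prob (?b (Suc N))) \<longlonglongrightarrow> prob A * prob {\<omega>\<in>space M. grid_inf_neg n \<omega> \<le> y}"
    by (intro tendsto_mult_left) (rule LIMSEQ_Suc)
  then have "(\<lambda>N. prob (?a (Suc N))) \<longlonglongrightarrow> prob A * prob {\<omega>\<in>space M. grid_inf_neg n \<omega> \<le> y}"
    using past_indep_grid_inf[OF A \<open>0 \<le> t\<close>, of "mesh n"] by simp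
  then show ?thesis using 1 LIMSEQ_unique by blast
qed

text \<open>Refining the grid makes the events decrease, and right-continuity of the paths
  identifies their intersection with the condition at all real times.\<close>

lemma past_indep_inf_neg:
  assumes A: "A \<in> sets (past t)" and "0 \<le> t"
  shows "prob {\<omega>\<in>A. \<forall>r\<ge>0. X t \<omega> - X (t + r) \<omega> \<le> y} = prob A * prob {\<omega>\<in>space M. inf_neg \<omega> \<le> y}"
    and "{\<omega>\<in>A. \<forall>r\<ge>0. X t \<omega> - X (t + r) \<omega> \<le> y} \<in> events"
proof -
  have A_M: "A \<in> events" using A sets_past_subset by auto
  have A_sub: "A \<subseteq> space M" using sets.sets_into_space[OF A_M] .
  let ?a = "\<lambda>n. {\<omega>\<in>A. \<forall>k::nat. X t \<omega> - X (t + real k * mesh n) \<omega> \<le> y}"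
  let ?b = "\<lambda>n. {\<omega>\<in>space M. grid_inf_neg n \<omega> \<le> y}"
  have am: "?a n \<in> events" for n
  proof -
    have "?a n = A \<inter> (\<Inter>k. {\<omega>\<in>space M. X t \<omega> - X (t + real k * mesh n) \<omega> \<le> y})"
      using A_sub by auto
    also have "\<dots> \<in> events" using A_M \<open>0 \<le> t\<close> by (intro sets.Int sets.countable_INT) auto
    finally show ?thesis .
  qed
  have double: "real k * mesh n = real (2 * k) * mesh (Suc n)" for k n by simp
  have "?a (Suc n) \<subseteq> ?a n" for n
  proof (intro subsetI CollectI conjI allI)
    fix \<omega> k assume w: "\<omega> \<in> ?a (Suc n)"
    then have "X t \<omega> - X (t + real (2 * k) * mesh (Suc n)) \<omega> \<le> y" by blast
    then show "X t \<omega> - X (t + real k * mesh n) \<omega> \<le> y" unfolding double[of k n] .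
  qed auto
  then have da: "decseq ?a" by (rule decseq_SucI)
  have db: "decseq ?b" using incseq_grid_inf_neg by (force simp: decseq_def incseq_def intro: order_trans)
  have ia: "(\<Inter>n. ?a n) = {\<omega>\<in>A. \<forall>r\<ge>0. X t \<omega> - X (t + r) \<omega> \<le> y}" (is "?L = ?R")
  proof (intro equalityI subsetI)
    fix \<omega> assume w: "\<omega> \<in> ?L"
    then have wA: "\<omega> \<in> A" by auto
    then have wM: "\<omega> \<in> space M" using A_sub by auto
    have "X t \<omega> - X (t + r) \<omega> \<le> y" if r: "0 \<le> r" for r
    proof -
      have "filterlim (\<lambda>n. t + dyadic_above n r) (at_right (t + r)) sequentially"
      proof -
        have "(\<lambda>n. t + dyadic_above n r) \<longlonglongrightarrow> t + r"
          using dyadic_above_tendsto[of r] by (intro tendsto_add tendsto_const) (simp add: filterlim_at)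
        then show ?thesis
          by (auto simp: filterlim_at dyadic_above_gt less_imp_neq[OF dyadic_above_gt, symmetric] intro!: always_eventually)
      qed
      moreover have "((\<lambda>s. X s \<omega>) \<longlongrightarrow> X (t + r) \<omega>) (at_right (t + r))"
        using X_cadlag[OF wM] \<open>0 \<le> t\<close> r unfolding cadlag_def by simp
      ultimately have "(\<lambda>n. X (t + dyadic_above n r) \<omega>) \<longlonglongrightarrow> X (t + r) \<omega>"
        by (rule filterlim_compose[rotated])
      then have "(\<lambda>n. X t \<omega> - X (t + dyadic_above n r) \<omega>) \<longlonglongrightarrow> X t \<omega> - X (t + r) \<omega>"
        by (intro tendsto_diff tendsto_const)
      then show ?thesis
      proof (rule LIMSEQ_le_const2, intro exI allI impI)
        fix n :: nat
        obtain k :: nat where "dyadic_above n r = real k * mesh n" using dyadic_above_mesh[OF r] by blast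
        then show "X t \<omega> - X (t + dyadic_above n r) \<omega> \<le> y" using w by auto
      qed
    qed
    then show "\<omega> \<in> ?R" using wA by auto
  next
    fix \<omega> assume "\<omega> \<in> ?R"
    then show "\<omega> \<in> ?L" by simp
  qed
  have ib: "(\<Inter>n. ?b n) = {\<omega>\<in>space M. inf_neg \<omega> \<le> y}"
  proof (intro equalityI subsetI)
    fix \<omega> assume "\<omega> \<in> (\<Inter>n. ?b n)"
    then have "\<omega> \<in> space M" "\<And>n. grid_inf_neg n \<omega> \<le> y" by auto
    then show "\<omega> \<in> {\<omega>\<in>space M. inf_neg \<omega> \<le> y}"
      using LIMSEQ_le_const2[OF grid_inf_neg_tendsto] by auto
  next
    fix \<omega> assume "\<omega> \<in> {\<omega>\<in>space M. inf_neg \<omega> \<le> y}"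
    then show "\<omega> \<in> (\<Inter>n. ?b n)" using grid_inf_neg_le_inf_neg[of \<omega>] order_trans by blast
  qed
  have "(\<lambda>n. prob (?a n)) \<longlonglongrightarrow> prob (\<Inter>n. ?a n)"
    by (intro finite_Lim_measure_decseq da image_subsetI am)
  moreover have "(\<lambda>n. prob (?b n)) \<longlonglongrightarrow> prob (\<Inter>n. ?b n)"
    by (intro finite_Lim_measure_decseq db image_subsetI) measurable
  then have "(\<lambda>n. prob (?a n)) \<longlonglongrightarrow> prob A * prob (\<Inter>n. ?b n)"
    unfolding past_indep_grid_inf_neg[OF assms] by (rule tendsto_mult_left)
  ultimately show "prob {\<omega>\<in>A. \<forall>r\<ge>0. X t \<omega> - X (t + r) \<omega> \<le> y} = prob A * prob {\<omega>\<in>space M. inf_neg \<omega> \<le> y}"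
    unfolding ia ib by (rule LIMSEQ_unique)
  have "(\<Inter>n. ?a n) \<in> events" using am by (intro sets.countable_INT) auto
  then show "{\<omega>\<in>A. \<forall>r\<ge>0. X t \<omega> - X (t + r) \<omega> \<le> y} \<in> events" unfolding ia .
qed

lemma grid_shift_le_iff:
  assumes "\<omega> \<in> space M"
  shows "grid_inf_neg_shift n \<omega> \<le> y \<longleftrightarrow> (\<forall>k::nat. X (mesh n) \<omega> - X (mesh n + real k * mesh n) \<omega> \<le> y)"
  unfolding grid_inf_neg_shift_def
  by (subst cSUP_le_iff) (use bdd_above_grid_shift[OF assms] in auto)

lemma distr_grid_inf_neg_shift: "distr M borel (grid_inf_neg_shift n) = distr M borel (grid_inf_neg n)"
proof (rule cdf_unique)
  show "real_distribution (distr M borel (grid_inf_neg_shift n))" "real_distribution (distr M borel (grid_inf_neg n))"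
    by (auto intro!: real_distribution_distr)
  show "cdf (distr M borel (grid_inf_neg_shift n)) = cdf (distr M borel (grid_inf_neg n))"
  proof (rule ext)
    fix y
    have "cdf (distr M borel (grid_inf_neg_shift n)) y = prob {\<omega>\<in>space M. grid_inf_neg_shift n \<omega> \<le> y}"
      unfolding cdf_def by (subst measure_distr) (auto simp: vimage_def Int_def conj_commute)
    also have "\<dots> = prob {\<omega>\<in>space M. \<forall>k::nat. X (mesh n) \<omega> - X (mesh n + real k * mesh n) \<omega> \<le> y}"
      by (intro arg_cong[where f=prob]) (auto simp: grid_shift_le_iff)
    also have "\<dots> = prob {\<omega>\<in>space M. grid_inf_neg n \<omega> \<le> y}"
      using past_indep_grid_inf_neg[of "space M" "mesh n" n y] sets.top[of "past (mesh n)"] by (simp add: prob_space)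
    also have "\<dots> = cdf (distr M borel (grid_inf_neg n)) y"
      unfolding cdf_def by (subst measure_distr) (auto simp: vimage_def Int_def conj_commute)
    finally show "cdf (distr M borel (grid_inf_neg_shift n)) y = cdf (distr M borel (grid_inf_neg n)) y" .
  qed
qed

text \<open>The previous independence statement treats only the events
  \<open>grid_inf_neg_shift n \<le> y\<close>. These form an intersection-stable generator, which is
  enough for the joint law to be a product.\<close>

lemma indep_grid_step:
  "distr M (borel \<Otimes>\<^sub>M borel) (\<lambda>\<omega>. (X (mesh n) \<omega>, grid_inf_neg_shift n \<omega>))
    = distr M borel (X (mesh n)) \<Otimes>\<^sub>M distr M borel (grid_inf_neg n)"
proof -
  let ?d = "mesh n" and ?Z = "grid_inf_neg_shift n"
  have [measurable]: "X ?d \<in> borel_measurable M" by (rule X_measurable) simp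
  let ?E = "{?Z -` A \<inter> space M | A. A \<in> range (\<lambda>a. {..a::real})}"
  have ind: "indep_set {X ?d -` A \<inter> space M | A. A \<in> sets borel} ?E"
  proof (rule indep_setI)
    fix a b assume "a \<in> {X ?d -` A \<inter> space M | A. A \<in> sets borel}" "b \<in> ?E"
    then obtain A y where a: "a = X ?d -` A \<inter> space M" "A \<in> sets borel" and b: "b = ?Z -` {..y} \<inter> space M"
      by auto
    have aP: "a \<in> sets (past ?d)"
      using measurable_sets[OF X_measurable_past[of ?d ?d] a(2)] a(1) by simp
    have "a \<inter> b = {\<omega>\<in>a. \<forall>k::nat. X ?d \<omega> - X (?d + real k * ?d) \<omega> \<le> y}"
      unfolding b a(1) using grid_shift_le_iff[of _ n y] by auto
    then have "prob (a \<inter> b) = prob a * prob {\<omega>\<in>space M. grid_inf_neg n \<omega> \<le> y}"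
      using past_indep_grid_inf_neg[OF aP, of n y] by simp
    also have "prob {\<omega>\<in>space M. grid_inf_neg n \<omega> \<le> y} = cdf (distr M borel (grid_inf_neg n)) y"
      unfolding cdf_def by (subst measure_distr) (auto simp: vimage_def Int_def conj_commute)
    also have "\<dots> = prob b"
      unfolding b distr_grid_inf_neg_shift[symmetric] cdf_def by (subst measure_distr) auto
    finally show "prob (a \<inter> b) = prob a * prob b" .
  qed auto
  have "indep_set (sigma_sets (space M) {X ?d -` A \<inter> space M | A. A \<in> sets borel}) (sigma_sets (space M) ?E)"
  proof (rule indep_set_sigma_sets[OF ind])
    show "Int_stable {X ?d -` A \<inter> space M | A. A \<in> sets borel}"
    proof (rule Int_stableI, clarify)
      fix A B :: "real set" assume "A \<in> sets borel" "B \<in> sets borel"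
      then show "\<exists>C. (X ?d -` A \<inter> space M) \<inter> (X ?d -` B \<inter> space M) = X ?d -` C \<inter> space M \<and> C \<in> sets borel"
        by (intro exI[of _ "A \<inter> B"]) auto
    qed
    show "Int_stable ?E"
    proof (rule Int_stableI)
      fix a b assume "a \<in> ?E" "b \<in> ?E"
      then obtain u v where "a = ?Z -` {..u} \<inter> space M" "b = ?Z -` {..v} \<inter> space M" by auto
      then have "a \<inter> b = ?Z -` {..min u v} \<inter> space M" by auto
      then show "a \<inter> b \<in> ?E" by auto
    qed
  qed
  moreover have "sigma_sets (space M) ?E = sigma_sets (space M) {?Z -` A \<inter> space M | A. A \<in> sets borel}"
  proof -
    have b: "sets (borel::real measure) = sigma_sets UNIV (range (\<lambda>a. {..a}))"
      unfolding borel_eq_atMost by simp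
    have "{?Z -` A \<inter> space M | A. A \<in> sets borel} = sigma_sets (space M) ?E"
      unfolding b by (rule sigma_sets_vimage_commute) auto
    moreover have "sigma_sets (space M) (sigma_sets (space M) ?E) = sigma_sets (space M) ?E"
      by (rule sigma_sets_sigma_sets_eq) auto
    ultimately show ?thesis by simp
  qed
  ultimately have "indep_var borel (X ?d) borel ?Z"
    unfolding indep_var_eq by simp
  then show ?thesis
    unfolding indep_var_distribution_eq distr_grid_inf_neg_shift by simp
qed

lemma lindley_integral:
  fixes f :: "real \<times> real \<Rightarrow> real"
  assumes f [measurable]: "f \<in> borel_measurable (borel \<Otimes>\<^sub>M borel)"
    and int: "integrable M (\<lambda>\<omega>. f (X (mesh n) \<omega>, grid_inf_neg_shift n \<omega>))"
  shows "(\<integral>\<omega>. f (X (mesh n) \<omega>, grid_inf_neg_shift n \<omega>) \<partial>M)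
    = (\<integral>\<omega>. \<integral>\<omega>'. f (X (mesh n) \<omega>, grid_inf_neg n \<omega>') \<partial>M \<partial>M)"
proof -
  have [measurable]: "X (mesh n) \<in> borel_measurable M" by (rule X_measurable) simp
  interpret R: prob_space "distr M borel (X (mesh n))" by (rule prob_space_distr) measurable
  interpret D: prob_space "distr M borel (grid_inf_neg n)" by (rule prob_space_distr) measurable
  interpret P: pair_sigma_finite "distr M borel (X (mesh n))" "distr M borel (grid_inf_neg n)" ..
  have "integrable (distr M (borel \<Otimes>\<^sub>M borel) (\<lambda>\<omega>. (X (mesh n) \<omega>, grid_inf_neg_shift n \<omega>))) f"
    by (subst integrable_distr_eq) (use int in auto)
  then have i: "integrable (distr M borel (X (mesh n)) \<Otimes>\<^sub>M distr M borel (grid_inf_neg n)) f"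
    unfolding indep_grid_step .
  have "(\<integral>\<omega>. f (X (mesh n) \<omega>, grid_inf_neg_shift n \<omega>) \<partial>M)
      = (\<integral>p. f p \<partial>(distr M borel (X (mesh n)) \<Otimes>\<^sub>M distr M borel (grid_inf_neg n)))"
    unfolding indep_grid_step[symmetric] by (subst integral_distr) auto
  also have "\<dots> = (\<integral>u. \<integral>y. f (u, y) \<partial>distr M borel (grid_inf_neg n) \<partial>distr M borel (X (mesh n)))"
    using P.integral_fst'[OF i] by simp
  also have "\<dots> = (\<integral>u. \<integral>\<omega>'. f (u, grid_inf_neg n \<omega>') \<partial>M \<partial>distr M borel (X (mesh n)))"
    by (intro Bochner_Integration.integral_cong refl) (subst integral_distr, auto)
  also have "\<dots> = (\<integral>\<omega>. \<integral>\<omega>'. f (X (mesh n) \<omega>, grid_inf_neg n \<omega>') \<partial>M \<partial>M)"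
    by (subst integral_distr) auto
  finally show ?thesis .
qed

end

subsection \<open>Law of the overall infimum\<close>

text \<open>Positivity of the mean \<open>m\<close> is not assumed: it follows from the drift to
  infinity in \<open>m_pos\<close>.\<close>

locale snlp_exp = snlp +
  fixes \<psi> :: "real \<Rightarrow> real" and m K :: real
  assumes psi_integrable: "\<And>\<beta>. 0 \<le> \<beta> \<Longrightarrow> integrable M (\<lambda>\<omega>. exp (\<beta> * X 1 \<omega>))"
    and psi_exp: "\<And>\<beta>. 0 \<le> \<beta> \<Longrightarrow> (\<integral>\<omega>. exp (\<beta> * X 1 \<omega>) \<partial>M) = exp (\<psi> \<beta>)"
    and psi_ge: "\<And>\<beta>. 0 \<le> \<beta> \<Longrightarrow> \<beta> * m \<le> \<psi> \<beta>"
    and psi_le: "\<And>\<beta>. 0 \<le> \<beta> \<Longrightarrow> \<psi> \<beta> \<le> \<beta> * m + K * \<beta>\<^sup>2"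
    and K_nonneg: "0 \<le> K"
begin

section \<open>Exponential moments and mean at dyadic times\<close>

lemma exp_moment_add:
  assumes "0 \<le> s" "0 \<le> r"
  shows "(\<integral>\<^sup>+\<omega>. ennreal (exp (\<beta> * X (s + r) \<omega>)) \<partial>M)
    = (\<integral>\<^sup>+\<omega>. ennreal (exp (\<beta> * X s \<omega>)) \<partial>M) * (\<integral>\<^sup>+\<omega>. ennreal (exp (\<beta> * X r \<omega>)) \<partial>M)"
proof -
  have [measurable]: "X s \<in> borel_measurable M" "X r \<in> borel_measurable M" using assms X_measurable by auto
  have "(\<integral>\<^sup>+\<omega>. ennreal (exp (\<beta> * X (s + r) \<omega>)) \<partial>M)
      = (\<integral>\<^sup>+\<omega>. \<integral>\<^sup>+\<omega>'. ennreal (exp (\<beta> * (X s \<omega> + X r \<omega>'))) \<partial>M \<partial>M)"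
    using markov_nn_integral[OF X_measurable_past assms, of s "\<lambda>p. ennreal (exp (\<beta> * (fst p + snd p)))"] assms
    by simp
  also have "\<dots> = (\<integral>\<^sup>+\<omega>. \<integral>\<^sup>+\<omega>'. ennreal (exp (\<beta> * X s \<omega>)) * ennreal (exp (\<beta> * X r \<omega>')) \<partial>M \<partial>M)"
    by (simp add: distrib_left exp_add ennreal_mult)
  also have "\<dots> = (\<integral>\<^sup>+\<omega>. ennreal (exp (\<beta> * X s \<omega>)) \<partial>M) * (\<integral>\<^sup>+\<omega>. ennreal (exp (\<beta> * X r \<omega>)) \<partial>M)"
    by (simp add: nn_integral_cmult nn_integral_multc)
  finally show ?thesis .
qed

lemma exp_moment_mult:
  assumes "0 \<le> r"
  shows "(\<integral>\<^sup>+\<omega>. ennreal (exp (\<beta> * X (real k * r) \<omega>)) \<partial>M) = (\<integral>\<^sup>+\<omega>. ennreal (exp (\<beta> * X r \<omega>)) \<partial>M) ^ k"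
proof (induction k)
  case 0
  have "(\<integral>\<^sup>+\<omega>. ennreal (exp (\<beta> * X 0 \<omega>)) \<partial>M) = (\<integral>\<^sup>+\<omega>. 1 \<partial>M)"
    by (rule nn_integral_cong) (simp add: X_0)
  then show ?case by (simp add: emeasure_space_1)
next
  case (Suc k)
  have "real (Suc k) * r = real k * r + r" by (simp add: algebra_simps)
  then show ?case using exp_moment_add[of "real k * r" r \<beta>] assms Suc by (simp add: mult.commute)
qed

text \<open>The \<open>2 ^ n\<close>-th power of the moment at time \<open>mesh n\<close> is the
  known moment at time \<open>1\<close>, and a nonnegative root is unique. In \<open>ennreal\<close>
  the same power also excludes an infinite moment.\<close>

lemma exp_moment_nn:
  assumes "0 \<le> \<beta>"
  shows "(\<integral>\<^sup>+\<omega>. ennreal (exp (\<beta> * X (real k * mesh n) \<omega>)) \<partial>M) = ennreal (exp (real k * mesh n * \<psi> \<beta>))"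
proof -
  let ?e = "\<integral>\<^sup>+\<omega>. ennreal (exp (\<beta> * X (mesh n) \<omega>)) \<partial>M"
  have "(\<integral>\<^sup>+\<omega>. ennreal (exp (\<beta> * X (real (2 ^ n) * mesh n) \<omega>)) \<partial>M) = ?e ^ (2 ^ n)"
    by (rule exp_moment_mult) simp
  moreover have "(\<integral>\<^sup>+\<omega>. ennreal (exp (\<beta> * X 1 \<omega>)) \<partial>M) = ennreal (exp (\<psi> \<beta>))"
    using psi_exp[OF assms] psi_integrable[OF assms] by (subst nn_integral_eq_integral) auto
  ultimately have pow: "?e ^ (2 ^ n) = ennreal (exp (\<psi> \<beta>))" by simp
  have "?e \<noteq> \<infinity>"
  proof
    assume "?e = \<infinity>"
    then have "?e ^ (2 ^ n) = \<infinity>" by (simp add: top_power_ennreal)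
    then show False using pow by simp
  qed
  then obtain c where c: "?e = ennreal c" "0 \<le> c" by (cases ?e) auto
  then have "c ^ (2 ^ n) = exp (\<psi> \<beta>)" using pow by (simp add: ennreal_power)
  also have "\<dots> = exp (mesh n * \<psi> \<beta>) ^ (2 ^ n)" by (subst exp_of_nat_mult[symmetric]) simp
  finally have "c = exp (mesh n * \<psi> \<beta>)"
    using c(2) by (subst (asm) power_eq_iff_eq_base) auto
  then have e: "?e = ennreal (exp (mesh n * \<psi> \<beta>))" using c by simp
  have "(\<integral>\<^sup>+\<omega>. ennreal (exp (\<beta> * X (real k * mesh n) \<omega>)) \<partial>M) = ?e ^ k"
    by (rule exp_moment_mult) simp
  also have "\<dots> = ennreal (exp (mesh n * \<psi> \<beta>) ^ k)" unfolding e by (simp add: ennreal_power)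
  also have "exp (mesh n * \<psi> \<beta>) ^ k = exp (real k * mesh n * \<psi> \<beta>)"
    by (subst exp_of_nat_mult[symmetric]) (simp add: mult.assoc)
  finally show ?thesis .
qed

lemma exp_moment:
  assumes "0 \<le> \<beta>"
  shows "integrable M (\<lambda>\<omega>. exp (\<beta> * X (real k * mesh n) \<omega>))"
    and "(\<integral>\<omega>. exp (\<beta> * X (real k * mesh n) \<omega>) \<partial>M) = exp (real k * mesh n * \<psi> \<beta>)"
proof -
  have [measurable]: "X (real k * mesh n) \<in> borel_measurable M" by (rule X_measurable) simp
  show i: "integrable M (\<lambda>\<omega>. exp (\<beta> * X (real k * mesh n) \<omega>))"
    by (rule integrableI_nonneg) (use exp_moment_nn[OF assms, of k n] in auto)
  have "ennreal (\<integral>\<omega>. exp (\<beta> * X (real k * mesh n) \<omega>) \<partial>M) = ennreal (exp (real k * mesh n * \<psi> \<beta>))"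
    using exp_moment_nn[OF assms, of k n] i by (subst (asm) nn_integral_eq_integral) auto
  then show "(\<integral>\<omega>. exp (\<beta> * X (real k * mesh n) \<omega>) \<partial>M) = exp (real k * mesh n * \<psi> \<beta>)"
    by (subst (asm) ennreal_inj) auto
qed

text \<open>Differentiates the exponential moment at \<open>0\<close>. As the exponent decreases to
  \<open>0\<close>, the quotients \<open>(exp (b * x) - 1) / b\<close> decrease to \<open>x\<close>
  by convexity, so monotone convergence yields integrability and value together. The bounds on
  \<open>\<psi>\<close> squeeze the limit of the means.\<close>

lemma X_mean:
  shows X_integrable: "integrable M (X (real k * mesh n))"
    and X_expectation: "(\<integral>\<omega>. X (real k * mesh n) \<omega> \<partial>M) = real k * mesh n * m"
proof -
  let ?r = "real k * mesh n"
  have [measurable]: "X ?r \<in> borel_measurable M" by (rule X_measurable) simp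
  define f where "f i \<omega> = - ((exp (mesh i * X ?r \<omega>) - 1) / mesh i)" for i \<omega>
  have f_int: "integrable M (f i)" for i
    unfolding f_def using exp_moment(1)[of "mesh i" k n] by auto
  have f_val: "(\<integral>\<omega>. f i \<omega> \<partial>M) = - ((exp (?r * \<psi> (mesh i)) - 1) / mesh i)" for i
  proof -
    have "(\<integral>\<omega>. f i \<omega> \<partial>M) = - (((\<integral>\<omega>. exp (mesh i * X ?r \<omega>) \<partial>M) - 1) / mesh i)"
      unfolding f_def using exp_moment(1)[of "mesh i" k n]
      by (simp add: prob_space integral_divide_zero)
    then show ?thesis using exp_moment(2)[of "mesh i" k n] by simp
  qed
  have mono: "mono (\<lambda>i. f i \<omega>)" for \<omega>
  proof (rule incseq_SucI)
    fix i
    show "f i \<omega> \<le> f (Suc i) \<omega>"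
      unfolding f_def using exp_diff_quotient_mono[of "mesh (Suc i)" "mesh i" "X ?r \<omega>"]
      by (simp add: field_simps)
  qed
  have lim: "(\<lambda>i. f i \<omega>) \<longlonglongrightarrow> - X ?r \<omega>" for \<omega>
    unfolding f_def
    by (intro tendsto_minus filterlim_compose[OF exp_diff_quotient_tendsto half_power_at_right_0])
  have "(\<lambda>i. (exp (?r * \<psi> (mesh i)) - 1) / mesh i) \<longlonglongrightarrow> ?r * m"
  proof (rule real_tendsto_sandwich[of "\<lambda>_. ?r * m" _ _ "\<lambda>i. (exp (?r * (mesh i * m + K * (mesh i)\<^sup>2)) - 1) / mesh i"])
    show "\<forall>\<^sub>F i in sequentially. ?r * m \<le> (exp (?r * \<psi> (mesh i)) - 1) / mesh i"
    proof (rule always_eventually, rule allI)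
      fix i
      have "?r * (mesh i * m) \<le> ?r * \<psi> (mesh i)" by (intro mult_left_mono psi_ge) auto
      also have "\<dots> \<le> exp (?r * \<psi> (mesh i)) - 1" using exp_ge_add_one_self[of "?r * \<psi> (mesh i)"] by linarith
      finally have "(?r * m) * mesh i \<le> exp (?r * \<psi> (mesh i)) - 1" by (simp add: mult_ac)
      then show "?r * m \<le> (exp (?r * \<psi> (mesh i)) - 1) / mesh i"
        by (subst pos_le_divide_eq) auto
    qed
    show "\<forall>\<^sub>F i in sequentially. (exp (?r * \<psi> (mesh i)) - 1) / mesh i
        \<le> (exp (?r * (mesh i * m + K * (mesh i)\<^sup>2)) - 1) / mesh i"
    proof (rule always_eventually, rule allI)
      fix i
      have "?r * \<psi> (mesh i) \<le> ?r * (mesh i * m + K * (mesh i)\<^sup>2)" by (intro mult_left_mono psi_le) auto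
      then show "(exp (?r * \<psi> (mesh i)) - 1) / mesh i \<le> (exp (?r * (mesh i * m + K * (mesh i)\<^sup>2)) - 1) / mesh i"
        by (intro divide_right_mono diff_right_mono) auto
    qed
    have "((\<lambda>b. exp (?r * (b * m + K * b\<^sup>2))) has_real_derivative ?r * m) (at 0)"
      by (auto intro!: derivative_eq_intros)
    then have "((\<lambda>b. (exp (?r * (b * m + K * b\<^sup>2)) - 1) / b) \<longlongrightarrow> ?r * m) (at 0)"
      unfolding has_field_derivative_iff by simp
    moreover have "filterlim mesh (at 0) sequentially"
      using half_power_tendsto_0 by (auto simp: filterlim_at intro!: always_eventually)
    ultimately show "(\<lambda>i. (exp (?r * (mesh i * m + K * (mesh i)\<^sup>2)) - 1) / mesh i) \<longlonglongrightarrow> ?r * m"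
      by (rule filterlim_compose)
  qed simp
  then have lim_int: "(\<lambda>i. \<integral>\<omega>. f i \<omega> \<partial>M) \<longlonglongrightarrow> - (?r * m)"
    unfolding f_val by (rule tendsto_minus)
  have "integrable M (\<lambda>\<omega>. - X ?r \<omega>)" "(\<integral>\<omega>. - X ?r \<omega> \<partial>M) = - (?r * m)"
    by (rule integrable_monotone_convergence[OF f_int _ _ lim_int]
             integral_monotone_convergence[OF f_int _ _ lim_int]; use mono lim in auto)+
  then show "integrable M (X ?r)" "(\<integral>\<omega>. X ?r \<omega> \<partial>M) = ?r * m"
    by auto
qed

text \<open>The amount that the recursion cuts off at \<open>0\<close> in one step (the idle time,
  in the language of queues): it equals
  \<open>grid_inf_neg n - grid_inf_neg_shift n + X (mesh n)\<close>.\<close>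

definition lindley_loss :: "nat \<Rightarrow> 'a \<Rightarrow> real" where
  "lindley_loss n \<omega> = max 0 (X (mesh n) \<omega> - grid_inf_neg_shift n \<omega>)"

lemma X_mesh_measurable [measurable]: "X (mesh n) \<in> borel_measurable M"
  by (rule X_measurable) simp

lemma lindley_loss_measurable [measurable]: "lindley_loss n \<in> borel_measurable M"
  unfolding lindley_loss_def by measurable

lemma X_mesh_mean: "integrable M (X (mesh n))" "(\<integral>\<omega>. X (mesh n) \<omega> \<partial>M) = mesh n * m"
  using X_mean[of 1 n] by auto

lemma exp_moment_mesh:
  assumes "0 \<le> \<beta>"
  shows "integrable M (\<lambda>\<omega>. exp (\<beta> * X (mesh n) \<omega>))"
    "(\<integral>\<omega>. exp (\<beta> * X (mesh n) \<omega>) \<partial>M) = exp (mesh n * \<psi> \<beta>)"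
  using exp_moment[OF assms, of 1 n] by auto

lemma lindley_loss_nonneg: "0 \<le> lindley_loss n \<omega>" unfolding lindley_loss_def by simp

lemma lindley_loss_le: "\<omega> \<in> space M \<Longrightarrow> lindley_loss n \<omega> \<le> max 0 (X (mesh n) \<omega>)"
  unfolding lindley_loss_def using grid_inf_neg_shift_nonneg[of \<omega> n] by auto

lemma lindley_loss_abs_le: "\<omega> \<in> space M \<Longrightarrow> \<bar>lindley_loss n \<omega>\<bar> \<le> \<bar>X (mesh n) \<omega>\<bar>"
  using lindley_loss_le[of \<omega> n] lindley_loss_nonneg[of n \<omega>] by linarith

text \<open>The loss minus \<open>X (mesh n)\<close> is the difference of two variables with the
  same law, and this difference is integrable. So its mean is \<open>0\<close>, although the two
  variables are not yet known to have finite means.\<close>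

lemma lindley_loss_mean:
  shows lindley_loss_integrable: "integrable M (lindley_loss n)"
    and lindley_loss_expectation: "(\<integral>\<omega>. lindley_loss n \<omega> \<partial>M) = mesh n * m"
proof -
  show i: "integrable M (lindley_loss n)"
    by (rule Bochner_Integration.integrable_bound[OF X_mesh_mean(1)[of n]])
       (auto intro!: AE_I2 lindley_loss_abs_le)
  have eq: "grid_inf_neg n \<omega> - grid_inf_neg_shift n \<omega> = lindley_loss n \<omega> - X (mesh n) \<omega>" if "\<omega> \<in> space M" for \<omega>
    using grid_inf_neg_lindley[OF that, of n] unfolding lindley_loss_def by auto
  have "integrable M (\<lambda>\<omega>. grid_inf_neg n \<omega> - grid_inf_neg_shift n \<omega>)"
    by (subst Bochner_Integration.integrable_cong[OF refl eq]) (use i X_mesh_mean in auto)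
  then have "(\<integral>\<omega>. grid_inf_neg n \<omega> - grid_inf_neg_shift n \<omega> \<partial>M) = 0"
    by (intro same_distr_diff_integral_zero) (auto simp: distr_grid_inf_neg_shift)
  then have "(\<integral>\<omega>. lindley_loss n \<omega> - X (mesh n) \<omega> \<partial>M) = 0"
    by (subst (asm) Bochner_Integration.integral_cong[OF refl eq]) auto
  then show "(\<integral>\<omega>. lindley_loss n \<omega> \<partial>M) = mesh n * m"
    using i X_mesh_mean[of n] by simp
qed

lemma m_nonneg: "0 \<le> m"
proof -
  have "0 \<le> (\<integral>\<omega>. lindley_loss 0 \<omega> \<partial>M)" by (intro integral_nonneg_AE) (simp add: lindley_loss_nonneg)
  then show ?thesis using lindley_loss_expectation[of 0] by simp
qed

text \<open>The part of the exponential moment of the loss beyond first order. It has to vanish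
  faster than the mesh.\<close>

definition lindley_error :: "nat \<Rightarrow> real \<Rightarrow> real" where
  "lindley_error n \<beta> = (\<integral>\<omega>. exp (\<beta> * lindley_loss n \<omega>) - 1 - \<beta> * lindley_loss n \<omega> \<partial>M)"

lemma exp_lindley_loss_integrable:
  assumes "0 \<le> \<beta>"
  shows "integrable M (\<lambda>\<omega>. exp (\<beta> * lindley_loss n \<omega>))"
proof (rule Bochner_Integration.integrable_bound[of _ "\<lambda>\<omega>. 1 + exp (\<beta> * X (mesh n) \<omega>)"])
  show "AE \<omega> in M. norm (exp (\<beta> * lindley_loss n \<omega>)) \<le> norm (1 + exp (\<beta> * X (mesh n) \<omega>))"
  proof (rule AE_I2)
    fix \<omega> assume w: "\<omega> \<in> space M"
    have "exp (\<beta> * lindley_loss n \<omega>) \<le> exp (\<beta> * max 0 (X (mesh n) \<omega>))"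
      using lindley_loss_le[OF w, of n] assms by (simp add: mult_left_mono)
    also have "\<dots> \<le> 1 + exp (\<beta> * X (mesh n) \<omega>)" by (cases "X (mesh n) \<omega> \<le> 0") (auto simp: max_def)
    finally show "norm (exp (\<beta> * lindley_loss n \<omega>)) \<le> norm (1 + exp (\<beta> * X (mesh n) \<omega>))" by simp
  qed
qed (use exp_moment_mesh[OF assms] in auto)

lemma lindley_error_integrable:
  "0 \<le> \<beta> \<Longrightarrow> integrable M (\<lambda>\<omega>. exp (\<beta> * lindley_loss n \<omega>) - 1 - \<beta> * lindley_loss n \<omega>)"
  using exp_lindley_loss_integrable lindley_loss_integrable by auto

lemma lindley_error_nonneg: "0 \<le> lindley_error n \<beta>"
  unfolding lindley_error_def using exp_minus_one_minus_nonneg by (intro integral_nonneg_AE AE_I2) auto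

text \<open>Losses up to \<open>\<epsilon>\<close> are treated by the quadratic bound, where one
  factor is replaced by \<open>\<epsilon>\<close> and the other is left for the mean. A loss above
  \<open>\<epsilon>\<close> is at most \<open>X (mesh n)\<close>, and an exponential Chebyshev bound
  with the larger exponent \<open>l\<close> applies.\<close>

lemma lindley_error_le:
  assumes "0 < \<epsilon>" "0 \<le> \<beta>" "\<beta> \<le> l"
  shows "lindley_error n \<beta> \<le> \<beta>\<^sup>2 / 2 * \<epsilon> * exp (\<beta> * \<epsilon>) * (mesh n * m) + exp (mesh n * \<psi> l - (l - \<beta>) * \<epsilon>)"
proof -
  let ?L = "lindley_loss n" and ?c = "\<beta>\<^sup>2 / 2 * \<epsilon> * exp (\<beta> * \<epsilon>)"
  have "0 \<le> l" using assms by simp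
  have "lindley_error n \<beta> \<le> (\<integral>\<omega>. ?c * ?L \<omega> + exp (l * X (mesh n) \<omega>) * exp (- ((l - \<beta>) * \<epsilon>)) \<partial>M)"
    unfolding lindley_error_def
  proof (rule integral_mono)
    fix \<omega> assume w: "\<omega> \<in> space M"
    show "exp (\<beta> * ?L \<omega>) - 1 - \<beta> * ?L \<omega> \<le> ?c * ?L \<omega> + exp (l * X (mesh n) \<omega>) * exp (- ((l - \<beta>) * \<epsilon>))"
    proof (cases "?L \<omega> \<le> \<epsilon>")
      case True
      have "exp (\<beta> * ?L \<omega>) - 1 - \<beta> * ?L \<omega> \<le> (\<beta> * ?L \<omega>)\<^sup>2 / 2 * exp (\<beta> * ?L \<omega>)"
        using assms lindley_loss_nonneg by (intro exp_le_quadratic_nonneg) auto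
      also have "\<dots> = \<beta>\<^sup>2 / 2 * ?L \<omega> * (?L \<omega> * exp (\<beta> * ?L \<omega>))"
        by (simp add: power2_eq_square)
      also have "\<dots> \<le> \<beta>\<^sup>2 / 2 * ?L \<omega> * (\<epsilon> * exp (\<beta> * \<epsilon>))"
        using True assms lindley_loss_nonneg[of n \<omega>] by (intro mult_left_mono mult_mono) (auto simp: mult_left_mono)
      finally show ?thesis by (simp add: mult_ac add_increasing2)
    next
      case False
      then have L: "\<epsilon> < ?L \<omega>" by simp
      then have LX: "?L \<omega> \<le> X (mesh n) \<omega>" using lindley_loss_le[OF w, of n] assms(1) by (auto simp: max_def split: if_splits)
      have "exp (\<beta> * ?L \<omega>) - 1 - \<beta> * ?L \<omega> \<le> exp (\<beta> * ?L \<omega>)"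
        using mult_nonneg_nonneg[OF assms(2) lindley_loss_nonneg[of n \<omega>]] by linarith
      also have "\<dots> \<le> exp (l * X (mesh n) \<omega> + (- ((l - \<beta>) * \<epsilon>)))"
      proof -
        have "\<beta> * ?L \<omega> \<le> \<beta> * X (mesh n) \<omega>" using LX assms by (intro mult_left_mono) auto
        moreover have "(l - \<beta>) * \<epsilon> \<le> (l - \<beta>) * X (mesh n) \<omega>" using L LX assms by (intro mult_left_mono) auto
        ultimately show ?thesis by (simp add: algebra_simps)
      qed
      finally have "exp (\<beta> * ?L \<omega>) - 1 - \<beta> * ?L \<omega> \<le> exp (l * X (mesh n) \<omega>) * exp (- ((l - \<beta>) * \<epsilon>))"
        unfolding exp_add .
      moreover have "0 \<le> ?c * ?L \<omega>" using assms lindley_loss_nonneg[of n \<omega>] by auto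
      ultimately show ?thesis by linarith
    qed
  qed (use lindley_error_integrable[OF assms(2)] lindley_loss_integrable exp_moment_mesh(1)[OF \<open>0 \<le> l\<close>] in auto)
  also have "\<dots> = ?c * (mesh n * m) + exp (mesh n * \<psi> l) * exp (- ((l - \<beta>) * \<epsilon>))"
    using lindley_loss_integrable lindley_loss_expectation exp_moment_mesh[OF \<open>0 \<le> l\<close>] by simp
  also have "exp (mesh n * \<psi> l) * exp (- ((l - \<beta>) * \<epsilon>)) = exp (mesh n * \<psi> l - (l - \<beta>) * \<epsilon>)"
    by (simp only: exp_add[symmetric] diff_conv_add_uminus)
  finally show ?thesis .
qed

text \<open>The increment over a mesh interval may be of order \<open>sqrt (mesh n)\<close>, hence the choice of the
  exponent \<open>l = \<beta> + sqrt (2 ^ n)\<close>, for which \<open>mesh n * \<psi> l\<close> stays bounded.\<close>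

lemma lindley_error_small:
  assumes "0 \<le> \<beta>"
  shows "(\<lambda>n. lindley_error n \<beta> / mesh n) \<longlonglongrightarrow> 0"
proof (rule tendstoI)
  fix \<eta> :: real assume "0 < \<eta>"
  have "((\<lambda>\<epsilon>. \<beta>\<^sup>2 / 2 * \<epsilon> * exp (\<beta> * \<epsilon>) * m) \<longlongrightarrow> 0) (at_right 0)"
    by (auto intro!: tendsto_eq_intros)
  then have "\<forall>\<^sub>F \<epsilon> in at_right 0. \<beta>\<^sup>2 / 2 * \<epsilon> * exp (\<beta> * \<epsilon>) * m < \<eta> / 2"
    using \<open>0 < \<eta>\<close> by (intro order_tendstoD) auto
  then have "\<forall>\<^sub>F \<epsilon> in at_right 0. 0 < \<epsilon> \<and> \<beta>\<^sup>2 / 2 * \<epsilon> * exp (\<beta> * \<epsilon>) * m < \<eta> / 2"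
    using eventually_at_right_less[of "0::real"] by eventually_elim auto
  then obtain \<epsilon> where e: "0 < \<epsilon>" "\<beta>\<^sup>2 / 2 * \<epsilon> * exp (\<beta> * \<epsilon>) * m < \<eta> / 2"
    using eventually_happens trivial_limit_at_right_real by blast
  \<comment> \<open>Because \<open>1 \<le> s n\<close>, the bound of \<open>psi_le\<close> at
    \<open>\<beta> + s n\<close> is at most \<open>(s n)^2\<close> times this constant.\<close>
  define C where "C = \<beta> * m + m + K * (\<beta> + 1)\<^sup>2"
  define s where "s n = sqrt (2 ^ n)" for n :: nat
  have s2: "(s n)\<^sup>2 = 2 ^ n" and s1: "1 \<le> s n" for n unfolding s_def by auto
  have bnd: "mesh n * \<psi> (\<beta> + s n) \<le> C" for n
  proof -
    let ?s = "s n"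
    have sq: "?s \<le> ?s\<^sup>2" "1 \<le> ?s\<^sup>2" using s1[of n] by (auto simp: power2_eq_square mult_le_cancel_left1 intro: order_trans)
    have "\<psi> (\<beta> + ?s) \<le> (\<beta> + ?s) * m + K * (\<beta> + ?s)\<^sup>2" using psi_le[of "\<beta> + ?s"] assms s1[of n] by simp
    also have "\<dots> \<le> (\<beta> * ?s\<^sup>2 + ?s\<^sup>2) * m + K * (\<beta> * ?s + ?s)\<^sup>2"
    proof (intro add_mono mult_mono mult_left_mono power_mono)
      show "\<beta> \<le> \<beta> * ?s\<^sup>2" "\<beta> \<le> \<beta> * ?s" using assms sq s1[of n] by (auto simp: mult_le_cancel_left1)
    qed (use assms sq s1[of n] m_nonneg K_nonneg in auto)
    also have "\<dots> = ?s\<^sup>2 * C" unfolding C_def by (simp add: algebra_simps power2_eq_square)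
    finally have "\<psi> (\<beta> + ?s) \<le> 2 ^ n * C" unfolding s2 .
    then show ?thesis by (simp add: field_simps)
  qed
  have "filterlim (\<lambda>n. s n * \<epsilon>) at_top sequentially"
  proof -
    have "filterlim (\<lambda>n. 2 ^ n :: real) at_top sequentially"
      by (rule filterlim_at_infinity_imp_filterlim_at_top[OF filterlim_realpow_sequentially_gt1]) auto
    then have "filterlim s at_top sequentially"
      unfolding s_def by (rule filterlim_compose[OF sqrt_at_top])
    then have "filterlim (\<lambda>n. \<epsilon> * s n) at_top sequentially"
      using e(1) by (intro filterlim_tendsto_pos_mult_at_top[OF tendsto_const])
    then show ?thesis by (simp only: mult.commute)
  qed
  \<comment> \<open>Division by the mesh costs a factor \<open>2 ^ n = (s n)^2\<close>, which the
    decay of \<open>exp (- s n * \<epsilon>)\<close> absorbs.\<close>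
  then have "(\<lambda>n. (s n * \<epsilon>) ^ 2 / exp (s n * \<epsilon>)) \<longlonglongrightarrow> 0"
    by (rule filterlim_compose[OF tendsto_power_div_exp_0])
  then have "(\<lambda>n. exp C / \<epsilon>\<^sup>2 * ((s n * \<epsilon>) ^ 2 / exp (s n * \<epsilon>))) \<longlonglongrightarrow> 0"
    by (rule tendsto_mult_right_zero)
  then have "\<forall>\<^sub>F n in sequentially. exp C / \<epsilon>\<^sup>2 * ((s n * \<epsilon>) ^ 2 / exp (s n * \<epsilon>)) < \<eta> / 2"
    using \<open>0 < \<eta>\<close> by (intro order_tendstoD) auto
  then show "\<forall>\<^sub>F n in sequentially. dist (lindley_error n \<beta> / mesh n) 0 < \<eta>"
  proof eventually_elim
    case (elim n)
    have "lindley_error n \<beta> \<le> \<beta>\<^sup>2 / 2 * \<epsilon> * exp (\<beta> * \<epsilon>) * (mesh n * m) + exp (mesh n * \<psi> (\<beta> + s n) - s n * \<epsilon>)"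
      using lindley_error_le[OF e(1) assms, of "\<beta> + s n" n] s1[of n] by simp
    also have "\<dots> \<le> \<beta>\<^sup>2 / 2 * \<epsilon> * exp (\<beta> * \<epsilon>) * (mesh n * m) + exp (C - s n * \<epsilon>)"
      using bnd[of n] by simp
    finally have "lindley_error n \<beta> / mesh n \<le> (\<beta>\<^sup>2 / 2 * \<epsilon> * exp (\<beta> * \<epsilon>) * (mesh n * m) + exp (C - s n * \<epsilon>)) / mesh n"
      by (rule divide_right_mono) simp
    also have "\<dots> = \<beta>\<^sup>2 / 2 * \<epsilon> * exp (\<beta> * \<epsilon>) * m + 2 ^ n * exp (C - s n * \<epsilon>)"
      by (simp add: field_simps)
    also have "2 ^ n * exp (C - s n * \<epsilon>) = exp C / \<epsilon>\<^sup>2 * ((s n * \<epsilon>) ^ 2 / exp (s n * \<epsilon>))"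
      using e(1) by (simp add: exp_diff power_mult_distrib s2)
    finally have "lindley_error n \<beta> / mesh n < \<eta>" using elim e(2) by linarith
    moreover have "0 \<le> lindley_error n \<beta> / mesh n" using lindley_error_nonneg by simp
    ultimately show ?case by (simp add: dist_real_def)
  qed
qed

text \<open>Computes the mean of \<open>exp (\<beta> * (X - Z))\<close>, for one step
  \<open>X\<close> and the restarted supremum \<open>Z\<close>, in two ways. Independence gives a
  product. Pointwise it equals \<open>exp (- \<beta> * Y) + exp (\<beta> * L) - 1\<close>, since at
  most one of the new supremum \<open>Y\<close> and the loss \<open>L\<close> is nonzero.\<close>

lemma grid_laplace:
  assumes "0 \<le> \<beta>"
  shows "(exp (mesh n * \<psi> \<beta>) - 1) * (\<integral>\<omega>. exp (- \<beta> * grid_inf_neg n \<omega>) \<partial>M) = \<beta> * (mesh n * m) + lindley_error n \<beta>"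
proof -
  let ?Y = "grid_inf_neg n" and ?Z = "grid_inf_neg_shift n" and ?x = "X (mesh n)" and ?L = "lindley_loss n"
  have iY: "integrable M (\<lambda>\<omega>. exp (- \<beta> * ?Y \<omega>))"
    by (rule integrable_const_bound[of _ 1]) (use assms grid_inf_neg_nonneg in \<open>auto intro!: AE_I2\<close>)
  have pt: "exp (\<beta> * (?x \<omega> - ?Z \<omega>)) = exp (- \<beta> * ?Y \<omega>) + exp (\<beta> * ?L \<omega>) - 1" if "\<omega> \<in> space M" for \<omega>
    unfolding grid_inf_neg_lindley[OF that, of n] lindley_loss_def by (auto simp: max_def algebra_simps)
  have int: "integrable M (\<lambda>\<omega>. exp (\<beta> * (?x \<omega> - ?Z \<omega>)))"
    by (subst Bochner_Integration.integrable_cong[OF refl pt])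
       (use iY exp_lindley_loss_integrable[OF assms] in auto)
  have "(\<integral>\<omega>. exp (\<beta> * (?x \<omega> - ?Z \<omega>)) \<partial>M) = (\<integral>\<omega>. \<integral>\<omega>'. exp (\<beta> * (?x \<omega> - ?Y \<omega>')) \<partial>M \<partial>M)"
    using lindley_integral[of "\<lambda>p. exp (\<beta> * (fst p - snd p))" n] int by simp
  also have "\<dots> = (\<integral>\<omega>. \<integral>\<omega>'. exp (\<beta> * ?x \<omega>) * exp (- \<beta> * ?Y \<omega>') \<partial>M \<partial>M)"
    by (simp add: right_diff_distrib exp_diff exp_minus divide_inverse)
  also have "\<dots> = exp (mesh n * \<psi> \<beta>) * (\<integral>\<omega>. exp (- \<beta> * ?Y \<omega>) \<partial>M)"
    using exp_moment_mesh(2)[OF assms, of n] by simp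
  finally have 1: "(\<integral>\<omega>. exp (\<beta> * (?x \<omega> - ?Z \<omega>)) \<partial>M) = exp (mesh n * \<psi> \<beta>) * (\<integral>\<omega>. exp (- \<beta> * ?Y \<omega>) \<partial>M)" .
  have "(\<integral>\<omega>. exp (\<beta> * (?x \<omega> - ?Z \<omega>)) \<partial>M) = (\<integral>\<omega>. exp (- \<beta> * ?Y \<omega>) + (exp (\<beta> * ?L \<omega>) - 1 - \<beta> * ?L \<omega>) + \<beta> * ?L \<omega> \<partial>M)"
    by (rule Bochner_Integration.integral_cong[OF refl]) (simp add: pt)
  also have "\<dots> = (\<integral>\<omega>. exp (- \<beta> * ?Y \<omega>) \<partial>M) + lindley_error n \<beta> + \<beta> * (mesh n * m)"
    unfolding lindley_error_def
    by (subst Bochner_Integration.integral_add Bochner_Integration.integral_add;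
        use iY lindley_error_integrable[OF assms, of n] lindley_loss_integrable[of n] lindley_loss_expectation[of n] in simp)
  finally show ?thesis unfolding 1 by (simp add: algebra_simps)
qed

text \<open>The generalised Pollaczek-Khinchine formula, obtained from the grid identity after
  division by the mesh. It is stated without a quotient because positivity of
  \<open>\<psi> \<beta>\<close> is derived from it.\<close>

lemma laplace_inf_neg:
  assumes "0 \<le> \<beta>"
  shows "\<psi> \<beta> * (\<integral>\<omega>. exp (- \<beta> * inf_neg \<omega>) \<partial>M) = \<beta> * m"
proof -
  have "(\<lambda>n. \<integral>\<omega>. exp (- \<beta> * grid_inf_neg n \<omega>) \<partial>M) \<longlonglongrightarrow> (\<integral>\<omega>. exp (- \<beta> * inf_neg \<omega>) \<partial>M)"
  proof (rule integral_dominated_convergence[where w="\<lambda>_. 1"])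
    show "AE \<omega> in M. (\<lambda>n. exp (- \<beta> * grid_inf_neg n \<omega>)) \<longlonglongrightarrow> exp (- \<beta> * inf_neg \<omega>)"
      by (rule AE_I2) (intro tendsto_intros grid_inf_neg_tendsto)
    show "AE \<omega> in M. norm (exp (- \<beta> * grid_inf_neg n \<omega>)) \<le> 1" for n
      using assms grid_inf_neg_nonneg by (auto intro!: AE_I2)
  qed auto
  moreover have "(\<lambda>n. (exp (mesh n * \<psi> \<beta>) - 1) / mesh n) \<longlonglongrightarrow> \<psi> \<beta>"
    by (rule filterlim_compose[OF exp_diff_quotient_tendsto half_power_at_right_0])
  ultimately have 1: "(\<lambda>n. (exp (mesh n * \<psi> \<beta>) - 1) / mesh n * (\<integral>\<omega>. exp (- \<beta> * grid_inf_neg n \<omega>) \<partial>M))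
      \<longlonglongrightarrow> \<psi> \<beta> * (\<integral>\<omega>. exp (- \<beta> * inf_neg \<omega>) \<partial>M)"
    by (intro tendsto_mult)
  have "(exp (mesh n * \<psi> \<beta>) - 1) / mesh n * (\<integral>\<omega>. exp (- \<beta> * grid_inf_neg n \<omega>) \<partial>M) = \<beta> * m + lindley_error n \<beta> / mesh n" for n
    using grid_laplace[OF assms, of n] by (simp add: field_simps)
  moreover have "(\<lambda>n. \<beta> * m + lindley_error n \<beta> / mesh n) \<longlonglongrightarrow> \<beta> * m + 0"
    by (intro tendsto_add tendsto_const lindley_error_small[OF assms])
  ultimately show ?thesis using 1 LIMSEQ_unique by fastforce
qed

lemma exp_inf_neg_integrable:
  "0 \<le> \<beta> \<Longrightarrow> integrable M (\<lambda>\<omega>. exp (- \<beta> * inf_neg \<omega>))"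
  by (rule integrable_const_bound[of _ 1]) (use inf_neg_nonneg in \<open>auto intro!: AE_I2\<close>)

lemma laplace_inf_neg_pos:
  assumes "0 \<le> \<beta>"
  shows "0 < (\<integral>\<omega>. exp (- \<beta> * inf_neg \<omega>) \<partial>M)"
proof -
  have "0 \<le> (\<integral>\<omega>. exp (- \<beta> * inf_neg \<omega>) \<partial>M)" by (intro integral_nonneg_AE) simp
  moreover have "(\<integral>\<omega>. exp (- \<beta> * inf_neg \<omega>) \<partial>M) \<noteq> 0"
  proof
    assume "(\<integral>\<omega>. exp (- \<beta> * inf_neg \<omega>) \<partial>M) = 0"
    then have "AE \<omega> in M. exp (- \<beta> * inf_neg \<omega>) = 0"
      using exp_inf_neg_integrable[OF assms] by (subst (asm) integral_nonneg_eq_0_iff_AE) auto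
    then have "AE \<omega> in M. False" by eventually_elim simp
    then show False by simp
  qed
  ultimately show ?thesis by linarith
qed

text \<open>If \<open>m\<close> were \<open>0\<close>, the preceding identity would give
  \<open>\<psi> = 0\<close> on the half-line. Then \<open>exp (j * X k)\<close> has mean
  \<open>1\<close> for every \<open>j\<close>, hence \<open>X k \<le> 1\<close> almost surely for
  all integers \<open>k\<close>, against the drift to infinity.\<close>

lemma m_pos: "0 < m"
proof (rule ccontr)
  let ?A = "\<lambda>k. {\<omega>\<in>space M. 1 < X (real k) \<omega>}"
  assume "\<not> 0 < m"
  then have m0: "m = 0" using m_nonneg by simp
  have psi0: "\<psi> \<beta> = 0" if "0 \<le> \<beta>" for \<beta>
    using laplace_inf_neg[OF that] laplace_inf_neg_pos[OF that] m0 by simp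
  have "AE \<omega> in M. X (real k) \<omega> \<le> 1" for k
  proof -
    have Xk [measurable]: "X (real k) \<in> borel_measurable M" by (rule X_measurable) simp
    have "prob (?A k) \<le> exp (- real j)" for j
    proof -
      have e: "integrable M (\<lambda>\<omega>. exp (real j * X (real k) \<omega>))" "(\<integral>\<omega>. exp (real j * X (real k) \<omega>) \<partial>M) = 1"
        using exp_moment[of "real j" k 0] psi0[of "real j"] by auto
      have "prob (?A k) = (\<integral>\<omega>. indicator (?A k) \<omega> \<partial>M)"
        by simp
      also have "\<dots> \<le> (\<integral>\<omega>. exp (- real j) * exp (real j * X (real k) \<omega>) \<partial>M)"
      proof (rule integral_mono)
        fix \<omega>
        show "indicator (?A k) \<omega> \<le> exp (- real j) * exp (real j * X (real k) \<omega>)"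
          using mult_left_mono[of 1 "X (real k) \<omega>" "real j"]
          by (auto simp: indicator_def exp_add[symmetric])
      qed (use e in \<open>auto intro!: integrable_real_indicator simp: emeasure_eq_measure\<close>)
      also have "\<dots> = exp (- real j)" using e by simp
      finally show ?thesis .
    qed
    moreover have "(\<lambda>j. exp (- real j)) \<longlonglongrightarrow> 0"
      by (rule filterlim_compose[OF exp_at_bot]) (simp add: filterlim_uminus_at_bot filterlim_real_sequentially)
    ultimately have "prob (?A k) \<le> 0"
      by (intro LIMSEQ_le_const[where a="prob _"]) auto
    then have "prob (?A k) = 0" by (simp add: measure_le_0_iff)
    then show ?thesis
      by (intro AE_I[of _ _ "(?A k)"]) (auto simp: emeasure_eq_measure)
  qed
  then have "AE \<omega> in M. \<forall>k::nat. X (real k) \<omega> \<le> 1" by (simp add: AE_all_countable)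
  then have "AE \<omega> in M. False"
  proof (rule AE_mp, intro AE_I2 impI)
    fix \<omega> assume w: "\<omega> \<in> space M" and le: "\<forall>k::nat. X (real k) \<omega> \<le> 1"
    have "filterlim (\<lambda>k. X (real k) \<omega>) at_top sequentially"
      by (rule filterlim_compose[OF X_at_top[OF w] filterlim_real_sequentially])
    then have "\<forall>\<^sub>F k in sequentially. 2 \<le> X (real k) \<omega>" by (simp add: filterlim_at_top)
    then obtain k where "2 \<le> X (real k) \<omega>" using eventually_happens by force
    moreover have "X (real k) \<omega> \<le> 1" using le by blast
    ultimately show False by linarith
  qed
  then show False by simp
qed

lemma psi_pos: "0 < \<beta> \<Longrightarrow> 0 < \<psi> \<beta>"
  using psi_ge[of \<beta>] m_pos mult_pos_pos[of \<beta> m] by linarith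

lemma laplace_inf_neg_eq: "0 < \<beta> \<Longrightarrow> (\<integral>\<omega>. exp (- \<beta> * inf_neg \<omega>) \<partial>M) = \<beta> * m / \<psi> \<beta>"
  using laplace_inf_neg[of \<beta>] psi_pos[of \<beta>] by (simp add: field_simps)

text \<open>The quotients \<open>(1 - E exp (- h * Y)) / h\<close> equal
  \<open>(\<psi> h - h * m) / (\<psi> h * h)\<close>, and the two bounds on \<open>\<psi>\<close>
  keep this below \<open>K / m\<close>. Fatou's lemma does the rest.\<close>

lemma inf_neg_integrable: "integrable M inf_neg"
proof (rule integrableI_nonneg)
  show "AE \<omega> in M. 0 \<le> inf_neg \<omega>" using inf_neg_nonneg by (auto intro!: AE_I2)
  define f where "f i \<omega> = - ((exp (mesh i * - inf_neg \<omega>) - 1) / mesh i)" for i \<omega>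
  have f_nonneg: "0 \<le> f i \<omega>" if "\<omega> \<in> space M" for i \<omega>
    using inf_neg_nonneg[OF that] unfolding f_def by (simp add: field_simps)
  have f_int: "integrable M (f i)" for i
    unfolding f_def using exp_inf_neg_integrable[of "mesh i"] by simp
  have "(\<integral>\<omega>. f i \<omega> \<partial>M) \<le> K / m" for i
  proof -
    have "(\<integral>\<omega>. f i \<omega> \<partial>M) = (1 - mesh i * m / \<psi> (mesh i)) / mesh i"
      unfolding f_def using exp_inf_neg_integrable[of "mesh i"] laplace_inf_neg_eq[of "mesh i"]
      by (simp add: prob_space algebra_simps)
    also have "\<dots> = (\<psi> (mesh i) - mesh i * m) / (\<psi> (mesh i) * mesh i)"
      using psi_pos[of "mesh i"] by (simp add: field_simps)
    also have "\<dots> \<le> (K * (mesh i)\<^sup>2) / ((mesh i * m) * mesh i)"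
      using psi_le[of "mesh i"] psi_ge[of "mesh i"] m_pos K_nonneg
      by (intro frac_le mult_right_mono) auto
    also have "\<dots> = K / m" by (simp add: power2_eq_square)
    finally show ?thesis .
  qed
  then have le: "(\<integral>\<^sup>+\<omega>. ennreal (f i \<omega>) \<partial>M) \<le> ennreal (K / m)" for i
    by (subst nn_integral_eq_integral) (use f_int f_nonneg in \<open>auto intro!: ennreal_leI AE_I2\<close>)
  have "(\<integral>\<^sup>+\<omega>. ennreal (inf_neg \<omega>) \<partial>M) = (\<integral>\<^sup>+\<omega>. liminf (\<lambda>i. ennreal (f i \<omega>)) \<partial>M)"
  proof (rule nn_integral_cong)
    fix \<omega>
    have "(\<lambda>i. f i \<omega>) \<longlonglongrightarrow> - (- inf_neg \<omega>)"
      unfolding f_def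
      by (intro tendsto_minus filterlim_compose[OF exp_diff_quotient_tendsto half_power_at_right_0])
    then have "(\<lambda>i. ennreal (f i \<omega>)) \<longlonglongrightarrow> ennreal (inf_neg \<omega>)" by (intro tendsto_ennrealI) simp
    then show "ennreal (inf_neg \<omega>) = liminf (\<lambda>i. ennreal (f i \<omega>))"
      by (simp add: lim_imp_Liminf)
  qed
  also have "\<dots> \<le> liminf (\<lambda>i. \<integral>\<^sup>+\<omega>. ennreal (f i \<omega>) \<partial>M)"
    by (rule nn_integral_liminf) (use f_int in \<open>auto dest: borel_measurable_integrable\<close>)
  also have "\<dots> \<le> liminf (\<lambda>i. ennreal (K / m))"
    by (rule Liminf_mono) (use le in auto)
  also have "\<dots> < \<infinity>" by (simp add: Liminf_const)
  finally show "(\<integral>\<^sup>+\<omega>. ennreal (inf_neg \<omega>) \<partial>M) < \<infinity>" .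
qed auto

end

subsection \<open>Occupation of half-lines\<close>

lemma max_0_diff_le:
  fixes z w :: real
  assumes "0 \<le> w"
  shows "max 0 (z - w) \<le> max 0 z" "norm (max 0 (z - w)) \<le> \<bar>z\<bar>"
  using assms by (auto simp: max_def)

lemma dyadic_above_eqI:
  assumes "real j * mesh n \<le> s" "s < real (Suc j) * mesh n"
  shows "dyadic_above n s = real (Suc j) * mesh n"
proof -
  have "\<lfloor>2 ^ n * s\<rfloor> = int j"
    using assms by (subst floor_eq_iff) (auto simp: field_simps)
  then show ?thesis unfolding dyadic_above_def by simp
qed

lemma has_integral_dyadic_step:
  "has_bochner_integral lborel (\<lambda>s. indicator {0..<real N * mesh n} s * e (dyadic_above n s))
     (mesh n * (\<Sum>j<N. e (real (Suc j) * mesh n)) :: real)"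
proof (induction N)
  case 0 then show ?case by (simp add: has_bochner_integral_zero)
next
  case (Suc N)
  have "has_bochner_integral lborel (\<lambda>s. indicator {real N * mesh n..<real (Suc N) * mesh n} s * e (real (Suc N) * mesh n))
      (mesh n * e (real (Suc N) * mesh n))"
  proof -
    have "has_bochner_integral lborel (indicator {real N * mesh n..<real (Suc N) * mesh n} :: real \<Rightarrow> real)
        (measure lborel {real N * mesh n..<real (Suc N) * mesh n})"
      by (rule has_bochner_integral_real_indicator) (auto simp: divide_right_mono)
    moreover have "measure lborel {real N * mesh n..<real (Suc N) * mesh n} = mesh n"
      by (simp add: field_simps)
    ultimately show ?thesis using has_bochner_integral_mult_left by fastforce
  qed
  from has_bochner_integral_add[OF Suc this]
  have "has_bochner_integral lborel (\<lambda>s. indicator {0..<real N * mesh n} s * e (dyadic_above n s)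
      + indicator {real N * mesh n..<real (Suc N) * mesh n} s * e (real (Suc N) * mesh n))
     (mesh n * (\<Sum>j<Suc N. e (real (Suc j) * mesh n)))"
    by (simp add: distrib_left)
  moreover have "indicator {0..<real N * mesh n} s * e (dyadic_above n s)
      + indicator {real N * mesh n..<real (Suc N) * mesh n} s * e (real (Suc N) * mesh n)
      = indicator {0..<real (Suc N) * mesh n} s * e (dyadic_above n s)" for s
  proof -
    define a b where "a = real N * mesh n" and "b = real (Suc N) * mesh n"
    have "0 \<le> a" "a \<le> b" unfolding a_def b_def by (simp_all add: field_simps)
    moreover have "a \<le> s \<Longrightarrow> s < b \<Longrightarrow> dyadic_above n s = b"
      unfolding a_def b_def by (rule dyadic_above_eqI)
    ultimately show ?thesis unfolding a_def[symmetric] b_def[symmetric] by (auto simp: indicator_def)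
  qed
  ultimately show ?case by simp
qed

text \<open>Riemann sums with right endpoints are exactly integrals of
  \<open>e (dyadic_above n s)\<close>. So convergence along the dyadic approximations from the right
  suffices, and dominated convergence applies.\<close>

lemma riemann_dyadic:
  fixes e :: "real \<Rightarrow> real"
  assumes lim: "\<And>s. 0 \<le> s \<Longrightarrow> (\<lambda>n. e (dyadic_above n s)) \<longlonglongrightarrow> e s"
    and bnd: "\<And>s. 0 \<le> s \<Longrightarrow> \<bar>e s\<bar> \<le> B"
  shows "(\<lambda>i. mesh (k + i) * (\<Sum>j<2 ^ i. e (real j * mesh (k + i)))) \<longlonglongrightarrow> (LINT s:{0..<mesh k}|lborel. e s)"
proof -
  let ?f = "\<lambda>i s. indicator {0..<mesh k} s * e (dyadic_above (k + i) s)"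
  have N: "real (2 ^ i) * mesh (k + i) = mesh k" for i by (simp add: power_add)
  have B: "0 \<le> B" using bnd[of 0] by simp
  have hb: "has_bochner_integral lborel (?f i) (mesh (k + i) * (\<Sum>j<2 ^ i. e (real (Suc j) * mesh (k + i))))" for i
    using has_integral_dyadic_step[of "2 ^ i" "k + i" e] unfolding N .
  have fm: "?f i \<in> borel_measurable lborel" for i
    using hb[of i] by (auto dest: has_bochner_integral_implies_finite_norm borel_measurable_has_bochner_integral)
  have pt: "(\<lambda>i. ?f i s) \<longlonglongrightarrow> indicator {0..<mesh k} s * e s" for s
  proof (cases "0 \<le> s")
    case True
    have "(\<lambda>i. e (dyadic_above (i + k) s)) \<longlonglongrightarrow> e s"
      using lim[OF True] by (rule LIMSEQ_ignore_initial_segment)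
    then show ?thesis by (intro tendsto_mult_left) (simp add: add.commute)
  qed simp
  have "(\<lambda>i. \<integral>s. ?f i s \<partial>lborel) \<longlonglongrightarrow> (\<integral>s. indicator {0..<mesh k} s * e s \<partial>lborel)"
  proof (rule integral_dominated_convergence[where w="\<lambda>s. B * indicator {0..<mesh k} s"])
    show "(\<lambda>s. indicator {0..<mesh k} s * e s) \<in> borel_measurable lborel"
      by (rule borel_measurable_LIMSEQ_real[OF pt fm])
    show "AE s in lborel. norm (?f i s) \<le> B * indicator {0..<mesh k} s" for i
      using bnd dyadic_above_nonneg B by (intro AE_I2) (auto simp: indicator_def)
    show "integrable lborel (\<lambda>s. B * indicator {0..<mesh k} s :: real)"
      by (intro integrable_mult_right integrable_real_indicator) auto
  qed (use fm pt in auto)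
  then have "(\<lambda>i. mesh (k + i) * (\<Sum>j<2 ^ i. e (real (Suc j) * mesh (k + i)))) \<longlonglongrightarrow> (LINT s:{0..<mesh k}|lborel. e s)"
    unfolding has_bochner_integral_integral_eq[OF hb] set_lebesgue_integral_def by simp
  \<comment> \<open>Passing from right to left endpoints changes the sum by one telescoped term
    times the mesh.\<close>
  moreover have "(\<lambda>i. mesh (k + i) * (e 0 - e (mesh k))) \<longlonglongrightarrow> 0 * (e 0 - e (mesh k))"
    by (intro tendsto_mult tendsto_const)
       (use LIMSEQ_ignore_initial_segment[OF half_power_tendsto_0, of k] in \<open>simp add: add.commute\<close>)
  moreover have "mesh (k + i) * (\<Sum>j<2 ^ i. e (real (Suc j) * mesh (k + i))) + mesh (k + i) * (e 0 - e (mesh k))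
      = mesh (k + i) * (\<Sum>j<2 ^ i. e (real j * mesh (k + i)))" for i
  proof -
    have "(\<Sum>j<2 ^ i. e (real (Suc j) * mesh (k + i)) - e (real j * mesh (k + i)))
        = e (real (2 ^ i) * mesh (k + i)) - e (real 0 * mesh (k + i))"
      by (rule sum_lessThan_telescope)
    then have "(\<Sum>j<2 ^ i. e (real (Suc j) * mesh (k + i))) - (\<Sum>j<2 ^ i. e (real j * mesh (k + i))) = e (mesh k) - e 0"
      unfolding sum_subtractf N by simp
    then have "(\<Sum>j<2 ^ i. e (real (Suc j) * mesh (k + i))) + (e 0 - e (mesh k)) = (\<Sum>j<2 ^ i. e (real j * mesh (k + i)))"
      by linarith
    then show ?thesis by (simp only: distrib_left[symmetric])
  qed
  ultimately show ?thesis
    using tendsto_add by fastforce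
qed

context snlp
begin

text \<open>Constant continuation to negative times gives a function that is jointly measurable on
  the whole line, as Fubini needs.\<close>

definition traj :: "real \<Rightarrow> 'a \<Rightarrow> real" where "traj s \<omega> = X (max 0 s) \<omega>"

lemma traj_eq: "0 \<le> s \<Longrightarrow> traj s \<omega> = X s \<omega>" unfolding traj_def by simp

text \<open>A pointwise limit of \<open>X\<close> evaluated at \<open>dyadic_above\<close>, which
  takes only countably many values on each level.\<close>

lemma traj_jointly_measurable: "(\<lambda>p. traj (fst p) (snd p)) \<in> borel_measurable (borel \<Otimes>\<^sub>M M)"
proof (rule borel_measurable_LIMSEQ_real)
  fix p :: "real \<times> 'a" assume p: "p \<in> space (borel \<Otimes>\<^sub>M M)"
  show "(\<lambda>n. X (real (nat (\<lfloor>2 ^ n * max 0 (fst p)\<rfloor> + 1)) * mesh n) (snd p)) \<longlonglongrightarrow> traj (fst p) (snd p)"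
  proof -
    have w: "snd p \<in> space M" using p by (auto simp: space_pair_measure)
    have "real (nat (\<lfloor>2 ^ n * max 0 (fst p)\<rfloor> + 1)) * mesh n = dyadic_above n (max 0 (fst p))" for n
      unfolding dyadic_above_def by (simp add: add_nonneg_nonneg)
    then show ?thesis
      using cadlag_dyadic_tendsto[OF X_cadlag[OF w], of "max 0 (fst p)"] unfolding traj_def by simp
  qed
next
  fix n
  have [measurable]: "(\<lambda>p. X (real k * mesh n) (snd p)) \<in> borel_measurable (borel \<Otimes>\<^sub>M M)" for k :: nat
    using measurable_compose[OF measurable_snd X_measurable[of "real k * mesh n"]] by simp
  show "(\<lambda>p::real \<times> 'a. X (real (nat (\<lfloor>2 ^ n * max 0 (fst p)\<rfloor> + 1)) * mesh n) (snd p)) \<in> borel_measurable (borel \<Otimes>\<^sub>M M)"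
    by (rule measurable_compose_countable[where f="\<lambda>k p. X (real k * mesh n) (snd p)"]) measurable
qed

lemma traj_measurable [measurable (raw)]:
  assumes "f \<in> borel_measurable N" "g \<in> N \<rightarrow>\<^sub>M M"
  shows "(\<lambda>x. traj (f x) (g x)) \<in> borel_measurable N"
  using measurable_compose[OF measurable_Pair[OF assms] traj_jointly_measurable] by simp

end

context snlp_exp
begin

definition grid_potential :: "nat \<Rightarrow> real \<Rightarrow> real" where
  "grid_potential n z = (\<integral>\<omega>. max 0 (z - grid_inf_neg n \<omega>) \<partial>M)"

definition potential :: "real \<Rightarrow> real" where
  "potential z = (\<integral>\<omega>. max 0 (z - inf_neg \<omega>) \<partial>M)"

lemma grid_potential_integrable: "integrable M (\<lambda>\<omega>. max 0 (z - grid_inf_neg n \<omega>))"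
  by (rule integrable_const_bound[of _ "\<bar>z\<bar>"]) (auto simp del: real_norm_def intro!: AE_I2 max_0_diff_le(2) grid_inf_neg_nonneg)

lemma potential_integrable: "integrable M (\<lambda>\<omega>. max 0 (z - inf_neg \<omega>))"
  by (rule integrable_const_bound[of _ "\<bar>z\<bar>"]) (auto simp del: real_norm_def intro!: AE_I2 max_0_diff_le(2) inf_neg_nonneg)

lemma grid_potential_bounds: "0 \<le> grid_potential n z" "grid_potential n z \<le> max 0 z"
proof -
  show "0 \<le> grid_potential n z" unfolding grid_potential_def by (intro integral_nonneg_AE) simp
  have "grid_potential n z \<le> (\<integral>\<omega>. max 0 z \<partial>M)"
    unfolding grid_potential_def
    by (intro integral_mono grid_potential_integrable max_0_diff_le(1) grid_inf_neg_nonneg) auto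
  then show "grid_potential n z \<le> max 0 z" by (simp add: prob_space)
qed

lemma potential_bounds: "0 \<le> potential z" "potential z \<le> max 0 z"
proof -
  show "0 \<le> potential z" unfolding potential_def by (intro integral_nonneg_AE) simp
  have "potential z \<le> (\<integral>\<omega>. max 0 z \<partial>M)"
    unfolding potential_def
    by (intro integral_mono potential_integrable max_0_diff_le(1) inf_neg_nonneg) auto
  then show "potential z \<le> max 0 z" by (simp add: prob_space)
qed

lemma grid_potential_mono: "z \<le> z' \<Longrightarrow> grid_potential n z \<le> grid_potential n z'"
  unfolding grid_potential_def by (rule integral_mono) (use grid_potential_integrable in auto)

lemma potential_mono: "z \<le> z' \<Longrightarrow> potential z \<le> potential z'"
  unfolding potential_def by (rule integral_mono) (use potential_integrable in auto)

lemma potential_le_add: "z \<le> z' \<Longrightarrow> potential z' \<le> potential z + (z' - z)"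
proof -
  assume "z \<le> z'"
  then have "potential z' \<le> (\<integral>\<omega>. max 0 (z - inf_neg \<omega>) + (z' - z) \<partial>M)"
    unfolding potential_def by (intro integral_mono) (use potential_integrable in auto)
  then show ?thesis unfolding potential_def using potential_integrable by (simp add: prob_space)
qed

lemma grid_potential_measurable [measurable]: "grid_potential n \<in> borel_measurable borel"
  by (rule borel_measurable_mono) (auto intro: monoI grid_potential_mono)

lemma potential_measurable [measurable]: "potential \<in> borel_measurable borel"
  by (rule borel_measurable_mono) (auto intro: monoI potential_mono)

lemma grid_potential_tendsto: "(\<lambda>n. grid_potential n z) \<longlonglongrightarrow> potential z"
  unfolding grid_potential_def potential_def
proof (rule integral_dominated_convergence[where w="\<lambda>_. \<bar>z\<bar>"])
  show "AE \<omega> in M. (\<lambda>n. max 0 (z - grid_inf_neg n \<omega>)) \<longlonglongrightarrow> max 0 (z - inf_neg \<omega>)"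
    by (intro AE_I2 tendsto_max tendsto_diff tendsto_const grid_inf_neg_tendsto)
  show "AE \<omega> in M. norm (max 0 (z - grid_inf_neg n \<omega>)) \<le> \<bar>z\<bar>" for n
    by (intro AE_I2 max_0_diff_le(2) grid_inf_neg_nonneg)
qed auto

lemma grid_potential_X_integrable:
  "integrable M (\<lambda>\<omega>. grid_potential n (z + X (real j * mesh i) \<omega>))"
proof (rule Bochner_Integration.integrable_bound[of _ "\<lambda>\<omega>. \<bar>z\<bar> + \<bar>X (real j * mesh i) \<omega>\<bar>"])
  have [measurable]: "X (real j * mesh i) \<in> borel_measurable M" by (rule X_measurable) simp
  show "(\<lambda>\<omega>. grid_potential n (z + X (real j * mesh i) \<omega>)) \<in> borel_measurable M" by measurable
  have le: "\<bar>grid_potential n y\<bar> \<le> \<bar>y\<bar>" for y using grid_potential_bounds[of n y] by auto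
  show "AE \<omega> in M. norm (grid_potential n (z + X (real j * mesh i) \<omega>)) \<le> norm (\<bar>z\<bar> + \<bar>X (real j * mesh i) \<omega>\<bar>)"
    by (intro AE_I2) (use le abs_triangle_ineq order_trans in fastforce)
qed (use X_integrable[of j i] in auto)

lemma potential_X_integrable: "integrable M (\<lambda>\<omega>. potential (z + X (real j * mesh i) \<omega>))"
proof (rule Bochner_Integration.integrable_bound[of _ "\<lambda>\<omega>. \<bar>z\<bar> + \<bar>X (real j * mesh i) \<omega>\<bar>"])
  have [measurable]: "X (real j * mesh i) \<in> borel_measurable M" by (rule X_measurable) simp
  show "(\<lambda>\<omega>. potential (z + X (real j * mesh i) \<omega>)) \<in> borel_measurable M" by measurable
  have le: "\<bar>potential y\<bar> \<le> \<bar>y\<bar>" for y using potential_bounds[of y] by auto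
  show "AE \<omega> in M. norm (potential (z + X (real j * mesh i) \<omega>)) \<le> norm (\<bar>z\<bar> + \<bar>X (real j * mesh i) \<omega>\<bar>)"
    by (intro AE_I2) (use le abs_triangle_ineq order_trans in fastforce)
qed (use X_integrable[of j i] in auto)

text \<open>By the recursion, one step raises the mean potential by the mean of \<open>?D\<close>:
  the whole loss if \<open>0 \<le> z\<close>, and the part of it exceeding \<open>- z\<close>
  otherwise. In the first case the gain is exactly \<open>mesh n * m\<close>. For
  \<open>z < - \<epsilon>\<close> only losses above \<open>\<epsilon>\<close> count; they are at
  most \<open>L^2 / \<epsilon>\<close>, and \<open>L^2 / 2 \<le> exp L - 1 - L\<close>, which
  explains the factor \<open>2 / \<epsilon>\<close>.\<close>

lemma grid_potential_step:
  assumes "0 < \<epsilon>"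
  shows "mesh n * m * indicator {0..} z \<le> (\<integral>\<omega>. grid_potential n (z + X (mesh n) \<omega>) \<partial>M) - grid_potential n z"
    and "(\<integral>\<omega>. grid_potential n (z + X (mesh n) \<omega>) \<partial>M) - grid_potential n z
      \<le> mesh n * m * indicator {-\<epsilon>..} z + 2 / \<epsilon> * lindley_error n 1"
proof -
  let ?Y = "grid_inf_neg n" and ?Z = "grid_inf_neg_shift n" and ?x = "X (mesh n)" and ?L = "lindley_loss n"
  let ?D = "\<lambda>\<omega>. if 0 \<le> z then ?L \<omega> else max 0 (z + ?L \<omega>)"
  have int1: "integrable M (\<lambda>\<omega>. max 0 (z + ?x \<omega> - ?Z \<omega>))"
  proof (rule Bochner_Integration.integrable_bound[of _ "\<lambda>\<omega>. \<bar>z\<bar> + \<bar>?x \<omega>\<bar>"])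
    show "AE \<omega> in M. norm (max 0 (z + ?x \<omega> - ?Z \<omega>)) \<le> norm (\<bar>z\<bar> + \<bar>?x \<omega>\<bar>)"
      using grid_inf_neg_shift_nonneg[of _ n] by (intro AE_I2) (force simp: max_def)
  qed (use X_mesh_mean(1)[of n] in auto)
  have "(\<integral>\<omega>. max 0 (z + ?x \<omega> - ?Z \<omega>) \<partial>M) = (\<integral>\<omega>. \<integral>\<omega>'. max 0 (z + ?x \<omega> - ?Y \<omega>') \<partial>M \<partial>M)"
    using lindley_integral[of "\<lambda>p. max 0 (z + fst p - snd p)" n] int1 by simp
  then have 1: "(\<integral>\<omega>. grid_potential n (z + ?x \<omega>) \<partial>M) = (\<integral>\<omega>. max 0 (z + ?x \<omega> - ?Z \<omega>) \<partial>M)"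
    unfolding grid_potential_def by simp
  have iL: "integrable M ?L" "(\<integral>\<omega>. ?L \<omega> \<partial>M) = mesh n * m"
    by (rule lindley_loss_integrable lindley_loss_expectation)+
  have iD: "integrable M (\<lambda>\<omega>. max 0 (z + ?L \<omega>))"
    by (intro Bochner_Integration.integrable_max Bochner_Integration.integrable_add iL) auto
  have "(\<integral>\<omega>. grid_potential n (z + ?x \<omega>) \<partial>M) - grid_potential n z = (\<integral>\<omega>. max 0 (z + ?x \<omega> - ?Z \<omega>) - max 0 (z - ?Y \<omega>) \<partial>M)"
    unfolding 1 unfolding grid_potential_def using int1 grid_potential_integrable by simp
  also have "\<dots> = (\<integral>\<omega>. ?D \<omega> \<partial>M)"
  proof (rule Bochner_Integration.integral_cong[OF refl])
    fix \<omega> assume w: "\<omega> \<in> space M"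
    show "max 0 (z + ?x \<omega> - ?Z \<omega>) - max 0 (z - ?Y \<omega>) = ?D \<omega>"
      unfolding grid_inf_neg_lindley[OF w, of n] lindley_loss_def by (auto simp: max_def)
  qed
  finally have D: "(\<integral>\<omega>. grid_potential n (z + ?x \<omega>) \<partial>M) - grid_potential n z = (\<integral>\<omega>. ?D \<omega> \<partial>M)" .
  have D0: "0 \<le> (\<integral>\<omega>. ?D \<omega> \<partial>M)"
    by (intro integral_nonneg_AE AE_I2) (simp add: lindley_loss_nonneg)
  show "mesh n * m * indicator {0..} z \<le> (\<integral>\<omega>. grid_potential n (z + X (mesh n) \<omega>) \<partial>M) - grid_potential n z"
    unfolding D using D0 iL by (cases "0 \<le> z") auto
  have err0: "0 \<le> 2 / \<epsilon> * lindley_error n 1" using assms lindley_error_nonneg by simp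
  show "(\<integral>\<omega>. grid_potential n (z + X (mesh n) \<omega>) \<partial>M) - grid_potential n z
      \<le> mesh n * m * indicator {-\<epsilon>..} z + 2 / \<epsilon> * lindley_error n 1"
  proof (cases "-\<epsilon> \<le> z")
    case True
    have "(\<integral>\<omega>. ?D \<omega> \<partial>M) \<le> (\<integral>\<omega>. ?L \<omega> \<partial>M)"
      using lindley_loss_nonneg[of n] by (cases "0 \<le> z") (auto intro!: integral_mono iL iD)
    then show ?thesis unfolding D using True err0 iL(2) by simp
  next
    case False
    have "(\<integral>\<omega>. ?D \<omega> \<partial>M) \<le> (\<integral>\<omega>. 2 / \<epsilon> * (exp (1 * ?L \<omega>) - 1 - 1 * ?L \<omega>) \<partial>M)"
    proof (rule integral_mono)
      fix \<omega>
      have L0: "0 \<le> ?L \<omega>" by (rule lindley_loss_nonneg)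
      have q: "(?L \<omega>)\<^sup>2 / 2 \<le> exp (1 * ?L \<omega>) - 1 - 1 * ?L \<omega>" using exp_ge_quadratic_nonneg[OF L0] by simp
      have "?D \<omega> \<le> (?L \<omega>)\<^sup>2 / \<epsilon>"
      proof (cases "?L \<omega> \<le> \<epsilon>")
        case True
        then have "?D \<omega> = 0" using False assms by (auto simp: max_def)
        then show ?thesis using assms by simp
      next
        case gt: False
        have "?D \<omega> \<le> ?L \<omega>" using False assms L0 by (auto simp: max_def)
        also have "?L \<omega> * \<epsilon> \<le> ?L \<omega> * ?L \<omega>" using gt L0 by (intro mult_left_mono) auto
        then have "?L \<omega> \<le> (?L \<omega>)\<^sup>2 / \<epsilon>" using assms by (simp add: field_simps power2_eq_square)
        finally show ?thesis .
      qed
      also have "\<dots> = 2 / \<epsilon> * ((?L \<omega>)\<^sup>2 / 2)" by simp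
      also have "\<dots> \<le> 2 / \<epsilon> * (exp (1 * ?L \<omega>) - 1 - 1 * ?L \<omega>)"
        using q assms by (intro mult_left_mono) auto
      finally show "?D \<omega> \<le> 2 / \<epsilon> * (exp (1 * ?L \<omega>) - 1 - 1 * ?L \<omega>)" .
    next
      show "integrable M ?D" by (cases "0 \<le> z") (simp_all add: iL iD)
      show "integrable M (\<lambda>\<omega>. 2 / \<epsilon> * (exp (1 * ?L \<omega>) - 1 - 1 * ?L \<omega>))"
        by (intro integrable_mult_right lindley_error_integrable) simp
    qed
    also have "\<dots> = 2 / \<epsilon> * lindley_error n 1"
      unfolding lindley_error_def by (rule integral_mult_right_zero)
    finally show ?thesis unfolding D using False by simp
  qed
qed

lemma indicator_X_integrable [intro]:
  assumes "0 \<le> s"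
  shows "integrable M (\<lambda>\<omega>. indicator {c..} (z + X s \<omega>) :: real)"
proof -
  have [measurable]: "X s \<in> borel_measurable M" by (rule X_measurable[OF assms])
  show ?thesis by (rule integrable_const_bound[of _ 1]) auto
qed

lemma grid_potential_iterate:
  assumes "0 < \<epsilon>"
  shows "mesh n * m * (\<Sum>i<j. \<integral>\<omega>. indicator {0..} (z + X (real i * mesh n) \<omega>) \<partial>M)
      \<le> (\<integral>\<omega>. grid_potential n (z + X (real j * mesh n) \<omega>) \<partial>M) - grid_potential n z"
    and "(\<integral>\<omega>. grid_potential n (z + X (real j * mesh n) \<omega>) \<partial>M) - grid_potential n z
      \<le> mesh n * m * (\<Sum>i<j. \<integral>\<omega>. indicator {-\<epsilon>..} (z + X (real i * mesh n) \<omega>) \<partial>M)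
        + real j * (2 / \<epsilon> * lindley_error n 1)"
proof -
  let ?T = "\<lambda>j. \<integral>\<omega>. grid_potential n (z + X (real j * mesh n) \<omega>) \<partial>M"
  let ?Q = "\<lambda>y. \<integral>\<omega>. grid_potential n (y + X (mesh n) \<omega>) \<partial>M"
  have T0: "?T 0 = grid_potential n z"
  proof -
    have "?T 0 = (\<integral>\<omega>. grid_potential n z \<partial>M)"
      by (rule Bochner_Integration.integral_cong[OF refl]) (simp add: X_0)
    then show ?thesis by (simp add: prob_space)
  qed
  have Q_int: "integrable M (\<lambda>\<omega>. grid_potential n (y + X (mesh n) \<omega>))" for y
    using grid_potential_X_integrable[of n y 1 n] by simp
  have Q_mono: "y \<le> y' \<Longrightarrow> ?Q y \<le> ?Q y'" for y y'
    by (rule integral_mono[OF Q_int Q_int]) (simp add: grid_potential_mono)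
  have Qm [measurable]: "?Q \<in> borel_measurable borel"
    by (rule borel_measurable_mono) (auto intro!: monoI Q_mono)
  have T_Suc: "?T (Suc j) = (\<integral>\<omega>. ?Q (z + X (real j * mesh n) \<omega>) \<partial>M)" for j
  proof -
    have eq: "real (Suc j) * mesh n = real j * mesh n + mesh n" by (simp add: field_simps)
    have gi: "integrable M (\<lambda>\<omega>. grid_potential n (z + X (real j * mesh n + mesh n) \<omega>))"
      unfolding eq[symmetric] by (rule grid_potential_X_integrable)
    have "(\<integral>\<omega>. (\<lambda>p. grid_potential n (z + fst p + snd p)) (X (real j * mesh n) \<omega>, X (real j * mesh n + mesh n) \<omega> - X (real j * mesh n) \<omega>) \<partial>M)
       = (\<integral>\<omega>. \<integral>\<omega>'. (\<lambda>p. grid_potential n (z + fst p + snd p)) (X (real j * mesh n) \<omega>, X (mesh n) \<omega>') \<partial>M \<partial>M)"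
      by (rule markov_integral[where t="real j * mesh n" and S=borel])
         (use gi in \<open>auto intro!: X_measurable_past\<close>)
    then show ?thesis unfolding eq by simp
  qed
  let ?\<xi> = "\<lambda>j \<omega>. z + X (real j * mesh n) \<omega>"
  let ?I = "\<lambda>c j. \<integral>\<omega>. indicator {c..} (?\<xi> j \<omega>) \<partial>M"
  have Xj [measurable]: "X (real j * mesh n) \<in> borel_measurable M" for j :: nat by (rule X_measurable) simp
  have QX_int: "integrable M (\<lambda>\<omega>. ?Q (?\<xi> j \<omega>))" for j
  proof (rule Bochner_Integration.integrable_bound[of _ "\<lambda>\<omega>. grid_potential n (?\<xi> j \<omega>) + (mesh n * m + 2 / \<epsilon> * lindley_error n 1)"])
    show "AE \<omega> in M. norm (?Q (?\<xi> j \<omega>)) \<le> norm (grid_potential n (?\<xi> j \<omega>) + (mesh n * m + 2 / \<epsilon> * lindley_error n 1))"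
    proof (rule AE_I2)
      fix \<omega>
      have "0 \<le> ?Q (?\<xi> j \<omega>)" by (intro integral_nonneg_AE AE_I2 grid_potential_bounds)
      moreover have "?Q (?\<xi> j \<omega>) \<le> grid_potential n (?\<xi> j \<omega>) + (mesh n * m + 2 / \<epsilon> * lindley_error n 1)"
      proof -
        have "mesh n * m * indicator {-\<epsilon>..} (?\<xi> j \<omega>) \<le> mesh n * m * 1"
          using m_pos by (intro mult_left_mono) (auto simp: indicator_def)
        then show ?thesis using grid_potential_step(2)[OF assms, of n "?\<xi> j \<omega>"] by linarith
      qed
      ultimately show "norm (?Q (?\<xi> j \<omega>)) \<le> norm (grid_potential n (?\<xi> j \<omega>) + (mesh n * m + 2 / \<epsilon> * lindley_error n 1))"
        by simp
    qed
  qed (use grid_potential_X_integrable[of n z j n] in auto)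
  have step: "mesh n * m * ?I 0 j \<le> ?T (Suc j) - ?T j"
    "?T (Suc j) - ?T j \<le> mesh n * m * ?I (-\<epsilon>) j + 2 / \<epsilon> * lindley_error n 1" for j
  proof -
    note ints = QX_int[of j] grid_potential_X_integrable[of n z j n]
    have dif: "?T (Suc j) - ?T j = (\<integral>\<omega>. ?Q (?\<xi> j \<omega>) - grid_potential n (?\<xi> j \<omega>) \<partial>M)"
      unfolding T_Suc using ints by simp
    have "mesh n * m * ?I 0 j = (\<integral>\<omega>. mesh n * m * indicator {0..} (?\<xi> j \<omega>) \<partial>M)" by simp
    also have "\<dots> \<le> (\<integral>\<omega>. ?Q (?\<xi> j \<omega>) - grid_potential n (?\<xi> j \<omega>) \<partial>M)"
      using ints
      by (intro integral_mono integrable_mult_right indicator_X_integrable Bochner_Integration.integrable_diff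
          grid_potential_step(1)[OF assms]) auto
    finally show "mesh n * m * ?I 0 j \<le> ?T (Suc j) - ?T j" unfolding dif .
    have "(\<integral>\<omega>. ?Q (?\<xi> j \<omega>) - grid_potential n (?\<xi> j \<omega>) \<partial>M)
        \<le> (\<integral>\<omega>. mesh n * m * indicator {-\<epsilon>..} (?\<xi> j \<omega>) + 2 / \<epsilon> * lindley_error n 1 \<partial>M)"
      using ints
      by (intro integral_mono integrable_mult_right indicator_X_integrable Bochner_Integration.integrable_diff
          Bochner_Integration.integrable_add grid_potential_step(2)[OF assms]) auto
    also have "\<dots> = mesh n * m * ?I (-\<epsilon>) j + 2 / \<epsilon> * lindley_error n 1"
      by (subst Bochner_Integration.integral_add)
         (auto simp: prob_space intro!: integrable_mult_right indicator_X_integrable simp del: times_divide_eq_left)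
    finally show "?T (Suc j) - ?T j \<le> mesh n * m * ?I (-\<epsilon>) j + 2 / \<epsilon> * lindley_error n 1" unfolding dif .
  qed
  have tele: "?T j - grid_potential n z = (\<Sum>i<j. ?T (Suc i) - ?T i)"
    unfolding T0[symmetric] by (rule sum_lessThan_telescope[symmetric])
  show "mesh n * m * (\<Sum>i<j. ?I 0 i) \<le> ?T j - grid_potential n z"
    unfolding tele sum_distrib_left by (intro sum_mono step)
  have "?T j - grid_potential n z \<le> (\<Sum>i<j. mesh n * m * ?I (-\<epsilon>) i + 2 / \<epsilon> * lindley_error n 1)"
    unfolding tele by (intro sum_mono step)
  then show "?T j - grid_potential n z \<le> mesh n * m * (\<Sum>i<j. ?I (-\<epsilon>) i) + real j * (2 / \<epsilon> * lindley_error n 1)"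
    by (simp add: sum.distrib sum_distrib_left)
qed

lemma grid_potential_X_tendsto:
  "(\<lambda>n. \<integral>\<omega>. grid_potential n (z + X (mesh k) \<omega>) \<partial>M) \<longlonglongrightarrow> (\<integral>\<omega>. potential (z + X (mesh k) \<omega>) \<partial>M)"
proof (rule integral_dominated_convergence[where w="\<lambda>\<omega>. \<bar>z\<bar> + \<bar>X (mesh k) \<omega>\<bar>"])
  have le: "\<bar>grid_potential n y\<bar> \<le> \<bar>y\<bar>" for n y using grid_potential_bounds[of n y] by auto
  show "AE \<omega> in M. norm (grid_potential n (z + X (mesh k) \<omega>)) \<le> \<bar>z\<bar> + \<bar>X (mesh k) \<omega>\<bar>" for n
    by (intro AE_I2) (use le abs_triangle_ineq order_trans in fastforce)
qed (use X_mesh_mean grid_potential_tendsto in auto)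

text \<open>A continuous substitute for \<open>indicator {0..}\<close>: convergence of the Riemann
  sums needs right-continuity of the expectation in time, which right-continuous paths provide only
  for a continuous integrand.\<close>

definition ramp :: "real \<Rightarrow> real \<Rightarrow> real" where "ramp \<epsilon> y = max 0 (min 1 (y / \<epsilon>))"

lemma ramp_measurable [measurable]: "ramp \<epsilon> \<in> borel_measurable borel"
  unfolding ramp_def by measurable

lemma ramp_continuous: "isCont (ramp \<epsilon>) y"
  unfolding ramp_def by (cases "\<epsilon> = 0") (auto intro!: continuous_intros)

lemma ramp_bounds: "0 \<le> ramp \<epsilon> y" "ramp \<epsilon> y \<le> 1" "\<bar>ramp \<epsilon> y\<bar> \<le> 1" unfolding ramp_def by auto

lemma ramp_le_indicator: "0 < \<epsilon> \<Longrightarrow> ramp \<epsilon> y \<le> indicator {0..} y"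
  unfolding ramp_def by (auto simp: indicator_def divide_less_0_iff max_def min_def field_simps)

lemma indicator_le_ramp: "0 < \<epsilon> \<Longrightarrow> indicator {0..} y \<le> ramp \<epsilon> (y + \<epsilon>)"
  unfolding ramp_def by (auto simp: indicator_def max_def min_def field_simps)

lemma ramp_X_integrable: "0 \<le> s \<Longrightarrow> integrable M (\<lambda>\<omega>. ramp \<epsilon> (z + X s \<omega>))"
  using X_measurable[of s]
  by (intro integrable_const_bound[of _ 1]) (auto simp: ramp_bounds)

lemma ramp_riemann:
  "(\<lambda>i. mesh (k + i) * (\<Sum>j<2 ^ i. \<integral>\<omega>. ramp \<epsilon> (z + X (real j * mesh (k + i)) \<omega>) \<partial>M))
    \<longlonglongrightarrow> (LINT s:{0..<mesh k}|lborel. \<integral>\<omega>. ramp \<epsilon> (z + X s \<omega>) \<partial>M)"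
proof (rule riemann_dyadic)
  fix s :: real assume s: "0 \<le> s"
  show "(\<lambda>n. \<integral>\<omega>. ramp \<epsilon> (z + X (dyadic_above n s) \<omega>) \<partial>M) \<longlonglongrightarrow> (\<integral>\<omega>. ramp \<epsilon> (z + X s \<omega>) \<partial>M)"
  proof (rule integral_dominated_convergence[where w="\<lambda>_. 1"])
    show "AE \<omega> in M. (\<lambda>n. ramp \<epsilon> (z + X (dyadic_above n s) \<omega>)) \<longlonglongrightarrow> ramp \<epsilon> (z + X s \<omega>)"
      by (intro AE_I2 isCont_tendsto_compose[OF ramp_continuous] tendsto_add tendsto_const
          cadlag_dyadic_tendsto[OF X_cadlag s])
  qed (use X_measurable s dyadic_above_nonneg in \<open>auto simp: ramp_bounds\<close>)
  have "\<bar>\<integral>\<omega>. ramp \<epsilon> (z + X s \<omega>) \<partial>M\<bar> \<le> (\<integral>\<omega>. \<bar>ramp \<epsilon> (z + X s \<omega>)\<bar> \<partial>M)"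
    using integral_norm_bound[of M "\<lambda>\<omega>. ramp \<epsilon> (z + X s \<omega>)"] by simp
  also have "\<dots> \<le> (\<integral>\<omega>. 1 \<partial>M)"
    by (rule integral_mono) (use ramp_X_integrable[OF s] in \<open>auto simp: ramp_bounds\<close>)
  finally show "\<bar>\<integral>\<omega>. ramp \<epsilon> (z + X s \<omega>) \<partial>M\<bar> \<le> 1" by (simp add: prob_space)
qed

text \<open>The expected time that the process started at \<open>z\<close> spends in the nonnegative
  half-line before time \<open>mesh k\<close>.\<close>

definition occupation :: "nat \<Rightarrow> real \<Rightarrow> real" where
  "occupation k z = (LINT s:{0..<mesh k}|lborel. \<integral>\<omega>. indicator {0..} (z + traj s \<omega>) \<partial>M)"

lemma ramp_traj_set_integrable:
  "set_integrable lborel {0..<mesh k} (\<lambda>s. \<integral>\<omega>. ramp \<epsilon> (z + traj s \<omega>) \<partial>M)"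
  "set_integrable lborel {0..<mesh k} (\<lambda>s. \<integral>\<omega>. indicator {0..} (z + traj s \<omega>) \<partial>M :: real)"
proof -
  have b: "\<bar>\<integral>\<omega>. f (z + traj s \<omega>) \<partial>M\<bar> \<le> 1"
    if [measurable]: "f \<in> borel_measurable borel" and "\<And>y. \<bar>f y\<bar> \<le> 1" for f :: "real \<Rightarrow> real" and s
  proof -
    have "\<bar>\<integral>\<omega>. f (z + traj s \<omega>) \<partial>M\<bar> \<le> (\<integral>\<omega>. \<bar>f (z + traj s \<omega>)\<bar> \<partial>M)"
      using integral_norm_bound[of M "\<lambda>\<omega>. f (z + traj s \<omega>)"] by simp
    also have "\<dots> \<le> (\<integral>\<omega>. 1 \<partial>M)"
      by (rule integral_mono) (use that in \<open>auto intro!: integrable_const_bound[of _ 1]\<close>)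
    finally show ?thesis by (simp add: prob_space)
  qed
  have g: "set_integrable lborel {0..<mesh k} (\<lambda>s. \<integral>\<omega>. f (z + traj s \<omega>) \<partial>M)"
    if [measurable]: "f \<in> borel_measurable borel" and f1: "\<And>y. \<bar>f y\<bar> \<le> 1" for f :: "real \<Rightarrow> real"
    unfolding set_integrable_def
  proof (rule Bochner_Integration.integrable_bound[of _ "indicator {0..<mesh k} :: real \<Rightarrow> real"])
    show "integrable lborel (indicator {0..<mesh k} :: real \<Rightarrow> real)"
      by (rule integrable_real_indicator) auto
    show "AE s in lborel. norm (indicator {0..<mesh k} s *\<^sub>R (\<integral>\<omega>. f (z + traj s \<omega>) \<partial>M)) \<le> norm (indicator {0..<mesh k} s :: real)"
      using b[OF that] by (intro AE_I2) (auto simp: indicator_def)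
  qed measurable
  show "set_integrable lborel {0..<mesh k} (\<lambda>s. \<integral>\<omega>. ramp \<epsilon> (z + traj s \<omega>) \<partial>M)"
    by (rule g) (auto simp: ramp_bounds)
  show "set_integrable lborel {0..<mesh k} (\<lambda>s. \<integral>\<omega>. indicator {0..} (z + traj s \<omega>) \<partial>M :: real)"
    by (rule g) (auto simp: indicator_def)
qed

lemma ramp_traj_eq:
  "(LINT s:{0..<mesh k}|lborel. \<integral>\<omega>. ramp \<epsilon> (z + X s \<omega>) \<partial>M) = (LINT s:{0..<mesh k}|lborel. \<integral>\<omega>. ramp \<epsilon> (z + traj s \<omega>) \<partial>M)"
  by (rule set_lebesgue_integral_cong) (auto simp: traj_eq)

text \<open>\<open>indicator {0..}\<close> is continuous from the right, and the shifts decrease to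
  \<open>0\<close>. The factor \<open>2\<close> matches the loss in the upper bound that
  follows.\<close>

lemma occupation_tendsto: "(\<lambda>i. occupation k (z + 2 * mesh i)) \<longlonglongrightarrow> occupation k z"
  unfolding occupation_def set_lebesgue_integral_def
proof (rule integral_dominated_convergence[where w="indicator {0..<mesh k}"])
  show "integrable lborel (indicator {0..<mesh k} :: real \<Rightarrow> real)"
    by (rule integrable_real_indicator) auto
  have sm: "0 \<le> (\<integral>\<omega>. indicator {0..} (y + traj s \<omega>) \<partial>M :: real) \<and> (\<integral>\<omega>. indicator {0..} (y + traj s \<omega>) \<partial>M) \<le> (1::real)" for y s
  proof -
    have "(\<integral>\<omega>. indicator {0..} (y + traj s \<omega>) \<partial>M :: real) \<le> (\<integral>\<omega>. 1 \<partial>M)"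
      by (rule integral_mono) (auto intro!: integrable_const_bound[of _ 1] simp: indicator_def)
    moreover have "0 \<le> (\<integral>\<omega>. indicator {0..} (y + traj s \<omega>) \<partial>M :: real)" by (intro integral_nonneg_AE) simp
    ultimately show ?thesis by (simp add: prob_space)
  qed
  show "AE s in lborel. norm (indicator {0..<mesh k} s *\<^sub>R (\<integral>\<omega>. indicator {0..} (z + 2 * mesh i + traj s \<omega>) \<partial>M :: real))
      \<le> indicator {0..<mesh k} s" for i
  proof (rule AE_I2)
    fix s
    define v where "v = (\<integral>\<omega>. indicator {0..} (z + 2 * mesh i + traj s \<omega>) \<partial>M :: real)"
    have "0 \<le> v" "v \<le> 1" unfolding v_def using sm[of "z + 2 * mesh i" s] by auto
    then show "norm (indicator {0..<mesh k} s *\<^sub>R (\<integral>\<omega>. indicator {0..} (z + 2 * mesh i + traj s \<omega>) \<partial>M :: real))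
      \<le> (indicator {0..<mesh k} s :: real)"
      unfolding v_def[symmetric] by (auto simp: indicator_def)
  qed
  show "AE s in lborel. (\<lambda>i. indicator {0..<mesh k} s *\<^sub>R (\<integral>\<omega>. indicator {0..} (z + 2 * mesh i + traj s \<omega>) \<partial>M))
      \<longlonglongrightarrow> indicator {0..<mesh k} s *\<^sub>R (\<integral>\<omega>. indicator {0..} (z + traj s \<omega>) \<partial>M :: real)"
  proof (intro AE_I2 tendsto_scaleR tendsto_const)
    fix s
    show "(\<lambda>i. \<integral>\<omega>. indicator {0..} (z + 2 * mesh i + traj s \<omega>) \<partial>M) \<longlonglongrightarrow> (\<integral>\<omega>. indicator {0..} (z + traj s \<omega>) \<partial>M :: real)"
    proof (rule integral_dominated_convergence[where w="\<lambda>_. 1"])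
      show "AE \<omega> in M. (\<lambda>i. indicator {0..} (z + 2 * mesh i + traj s \<omega>) :: real) \<longlonglongrightarrow> indicator {0..} (z + traj s \<omega>)"
      proof (intro AE_I2 tendsto_eventually)
        fix \<omega>
        have "(\<lambda>i. z + 2 * mesh i + traj s \<omega>) \<longlonglongrightarrow> z + 2 * 0 + traj s \<omega>"
          by (intro tendsto_intros half_power_tendsto_0)
        then have "\<forall>\<^sub>F i in sequentially. z + traj s \<omega> < 0 \<longrightarrow> z + 2 * mesh i + traj s \<omega> < 0"
          using order_tendstoD(2)[of _ "z + traj s \<omega>" sequentially 0] by (cases "z + traj s \<omega> < 0") auto
        then show "\<forall>\<^sub>F i in sequentially. (indicator {0..} (z + 2 * mesh i + traj s \<omega>) :: real) = indicator {0..} (z + traj s \<omega>)"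
        proof eventually_elim
          case (elim i)
          have "0 \<le> 2 * mesh i" by simp
          then have "0 \<le> z + 2 * mesh i + traj s \<omega> \<longleftrightarrow> 0 \<le> z + traj s \<omega>" using elim by linarith
          then show ?case by (simp add: indicator_def)
        qed
      qed
    qed (auto simp: indicator_def)
  qed
qed measurable

text \<open>The grid bounds are summed and passed to the limit with ramps in place of indicators.
  The upper bound is shifted by \<open>2 * \<epsilon>\<close>, one \<open>\<epsilon>\<close> from
  the grid step and one from the ramp; right-continuity of the occupation removes it. The shift by
  \<open>\<epsilon>\<close> in the lower bound is absorbed by the Lipschitz bound of the
  potential.\<close>

lemma potential_occupation:
  "(\<integral>\<omega>. potential (z + X (mesh k) \<omega>) \<partial>M) - potential z = m * occupation k z"
proof -
  let ?S = "\<lambda>f y i. mesh (k + i) * (\<Sum>j<2 ^ i. \<integral>\<omega>. f (y + X (real j * mesh (k + i)) \<omega>) \<partial>M)"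
  let ?E = "\<lambda>z i. (\<integral>\<omega>. grid_potential (k + i) (z + X (mesh k) \<omega>) \<partial>M) - grid_potential (k + i) z"
  let ?e = "\<lambda>\<epsilon> i. mesh k * (2 / \<epsilon>) * (lindley_error (k + i) 1 / mesh (k + i))"
  let ?D = "\<lambda>z. (\<integral>\<omega>. potential (z + X (mesh k) \<omega>) \<partial>M) - potential z"
  have N: "real (2 ^ i) * mesh (k + i) = mesh k" for i by (simp add: power_add)
  have pint: "integrable M (\<lambda>\<omega>. potential (z + X (mesh k) \<omega>))" for z
    using potential_X_integrable[of z 1 k] by simp
  have lim: "(\<lambda>i. ?E z i) \<longlonglongrightarrow> ?D z" for z
    using LIMSEQ_ignore_initial_segment[OF grid_potential_X_tendsto[where z=z and k=k], of k]
      LIMSEQ_ignore_initial_segment[OF grid_potential_tendsto[of z], of k]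
    by (intro tendsto_diff) (simp_all add: add.commute)
  have lower: "m * (LINT s:{0..<mesh k}|lborel. \<integral>\<omega>. ramp \<epsilon> (z + traj s \<omega>) \<partial>M) \<le> ?D z" if "0 < \<epsilon>" for \<epsilon> z
  proof (rule LIMSEQ_le)
    show "(\<lambda>i. m * ?S (ramp \<epsilon>) z i)
        \<longlonglongrightarrow> m * (LINT s:{0..<mesh k}|lborel. \<integral>\<omega>. ramp \<epsilon> (z + traj s \<omega>) \<partial>M)"
      unfolding ramp_traj_eq[symmetric] by (intro tendsto_mult_left ramp_riemann)
    show "\<exists>N. \<forall>i\<ge>N. m * ?S (ramp \<epsilon>) z i \<le> ?E z i"
    proof (intro exI allI impI)
      fix i
      have "m * ?S (ramp \<epsilon>) z i \<le> m * ?S (indicator {0..}) z i"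
        using m_pos that
        by (intro mult_left_mono sum_mono integral_mono ramp_X_integrable indicator_X_integrable ramp_le_indicator) auto
      also have "\<dots> = mesh (k + i) * m * (\<Sum>j<2 ^ i. \<integral>\<omega>. indicator {0..} (z + X (real j * mesh (k + i)) \<omega>) \<partial>M)"
        by (simp only: mult_ac)
      also have "\<dots> \<le> ?E z i"
        using grid_potential_iterate(1)[OF that, where n="k + i" and j="2 ^ i" and z=z] unfolding N .
      finally show "m * ?S (ramp \<epsilon>) z i \<le> ?E z i" .
    qed
  qed (rule lim)
  have upper: "?D z \<le> m * (LINT s:{0..<mesh k}|lborel. \<integral>\<omega>. ramp \<epsilon> (z + 2 * \<epsilon> + traj s \<omega>) \<partial>M)" if "0 < \<epsilon>" for \<epsilon> z
  proof (rule LIMSEQ_le[OF lim])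
    have "(\<lambda>i. lindley_error (i + k) 1 / mesh (i + k)) \<longlonglongrightarrow> 0"
      by (rule LIMSEQ_ignore_initial_segment[OF lindley_error_small]) simp
    then have "(\<lambda>i. ?e \<epsilon> i) \<longlonglongrightarrow> 0"
      by (intro tendsto_mult_right_zero) (simp add: add.commute)
    then have "(\<lambda>i. m * ?S (ramp \<epsilon>) (z + 2 * \<epsilon>) i + ?e \<epsilon> i)
        \<longlonglongrightarrow> m * (LINT s:{0..<mesh k}|lborel. \<integral>\<omega>. ramp \<epsilon> (z + 2 * \<epsilon> + X s \<omega>) \<partial>M) + 0"
      by (intro tendsto_add tendsto_mult_left ramp_riemann)
    then show "(\<lambda>i. m * ?S (ramp \<epsilon>) (z + 2 * \<epsilon>) i + ?e \<epsilon> i)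
        \<longlonglongrightarrow> m * (LINT s:{0..<mesh k}|lborel. \<integral>\<omega>. ramp \<epsilon> (z + 2 * \<epsilon> + traj s \<omega>) \<partial>M)"
      unfolding ramp_traj_eq by simp
    show "\<exists>N. \<forall>i\<ge>N. ?E z i
        \<le> m * ?S (ramp \<epsilon>) (z + 2 * \<epsilon>) i + ?e \<epsilon> i"
    proof (intro exI allI impI)
      fix i
      have "?E z i
          \<le> mesh (k + i) * m * (\<Sum>j<2 ^ i. \<integral>\<omega>. indicator {-\<epsilon>..} (z + X (real j * mesh (k + i)) \<omega>) \<partial>M)
            + real (2 ^ i) * (2 / \<epsilon> * lindley_error (k + i) 1)"
        using grid_potential_iterate(2)[OF that, where n="k + i" and j="2 ^ i" and z=z] unfolding N .
      also have "real (2 ^ i) * (2 / \<epsilon> * lindley_error (k + i) 1) = ?e \<epsilon> i"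
        by (simp add: power_add)
      also have "mesh (k + i) * m * (\<Sum>j<2 ^ i. \<integral>\<omega>. indicator {-\<epsilon>..} (z + X (real j * mesh (k + i)) \<omega>) \<partial>M)
          = m * ?S (indicator {-\<epsilon>..}) z i"
        by (simp only: mult_ac)
      also have "\<dots> \<le> m * ?S (ramp \<epsilon>) (z + 2 * \<epsilon>) i"
      proof (intro mult_left_mono sum_mono integral_mono ramp_X_integrable indicator_X_integrable)
        fix j \<omega>
        have "indicator {-\<epsilon>..} (z + X (real j * mesh (k + i)) \<omega>) = (indicator {0..} (z + X (real j * mesh (k + i)) \<omega> + \<epsilon>) :: real)"
          by (auto simp: indicator_def)
        also have "\<dots> \<le> ramp \<epsilon> (z + X (real j * mesh (k + i)) \<omega> + \<epsilon> + \<epsilon>)" using that by (rule indicator_le_ramp)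
        finally show "indicator {-\<epsilon>..} (z + X (real j * mesh (k + i)) \<omega>) \<le> ramp \<epsilon> (z + 2 * \<epsilon> + X (real j * mesh (k + i)) \<omega>)"
          by (simp add: algebra_simps)
      qed (use m_pos in auto)
      finally show "?E z i
        \<le> m * ?S (ramp \<epsilon>) (z + 2 * \<epsilon>) i + ?e \<epsilon> i" by simp
    qed
  qed
  have ramp_int: "integrable M (\<lambda>\<omega>. ramp \<epsilon> (y + traj s \<omega>))" "integrable M (\<lambda>\<omega>. indicator {0..} (y + traj s \<omega>) :: real)" for \<epsilon> y s
    by (auto intro!: integrable_const_bound[of _ 1] simp: ramp_bounds indicator_def)
  show ?thesis
  proof (rule antisym)
    show "?D z \<le> m * occupation k z"
    proof (rule LIMSEQ_le_const)
      show "(\<lambda>i. m * occupation k (z + 2 * mesh i)) \<longlonglongrightarrow> m * occupation k z"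
        by (intro tendsto_mult_left occupation_tendsto)
      show "\<exists>N. \<forall>i\<ge>N. ?D z \<le> m * occupation k (z + 2 * mesh i)"
      proof (intro exI allI impI)
        fix i
        have "?D z \<le> m * (LINT s:{0..<mesh k}|lborel. \<integral>\<omega>. ramp (mesh i) (z + 2 * mesh i + traj s \<omega>) \<partial>M)"
          by (rule upper) simp
        also have "\<dots> \<le> m * occupation k (z + 2 * mesh i)"
          unfolding occupation_def
          by (intro mult_left_mono set_integral_mono ramp_traj_set_integrable integral_mono ramp_int ramp_le_indicator)
             (use m_pos in auto)
        finally show "?D z \<le> m * occupation k (z + 2 * mesh i)" .
      qed
    qed
    show "m * occupation k z \<le> ?D z"
    proof (rule field_le_epsilon)
      fix \<epsilon> :: real assume e: "0 < \<epsilon>"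
      have "m * occupation k z \<le> m * (LINT s:{0..<mesh k}|lborel. \<integral>\<omega>. ramp \<epsilon> (z + \<epsilon> + traj s \<omega>) \<partial>M)"
        unfolding occupation_def
      proof (intro mult_left_mono set_integral_mono ramp_traj_set_integrable integral_mono ramp_int)
        fix s \<omega>
        show "indicator {0..} (z + traj s \<omega>) \<le> ramp \<epsilon> (z + \<epsilon> + traj s \<omega>)"
          using indicator_le_ramp[OF e, of "z + traj s \<omega>"] by (simp add: algebra_simps)
      qed (use m_pos in auto)
      also have "\<dots> \<le> ?D (z + \<epsilon>)" by (rule lower[OF e])
      also have "\<dots> \<le> ?D z + \<epsilon>"
      proof -
        have "(\<integral>\<omega>. potential (z + \<epsilon> + X (mesh k) \<omega>) \<partial>M) \<le> (\<integral>\<omega>. potential (z + X (mesh k) \<omega>) + \<epsilon> \<partial>M)"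
        proof (rule integral_mono)
          fix \<omega>
          show "potential (z + \<epsilon> + X (mesh k) \<omega>) \<le> potential (z + X (mesh k) \<omega>) + \<epsilon>"
            using potential_le_add[of "z + X (mesh k) \<omega>" "z + \<epsilon> + X (mesh k) \<omega>"] e by simp
        qed (use pint in auto)
        also have "\<dots> = (\<integral>\<omega>. potential (z + X (mesh k) \<omega>) \<partial>M) + \<epsilon>" using pint[of z] by (simp add: prob_space)
        finally show ?thesis using potential_mono[of z "z + \<epsilon>"] e by simp
      qed
      finally show "m * occupation k z \<le> ?D z + \<epsilon>" .
    qed
  qed
qed

end

subsection \<open>The convolution of the law of the overall infimum\<close>

lemma (in pair_prob_space) integrable_fst_comp:
  fixes f :: "'a \<Rightarrow> real"
  assumes "integrable M1 f"
  shows "integrable (M1 \<Otimes>\<^sub>M M2) (\<lambda>p. f (fst p))"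
proof (rule Fubini_integrable)
  have [measurable]: "f \<in> borel_measurable M1" using assms by simp
  show "(\<lambda>p. f (fst p)) \<in> borel_measurable (M1 \<Otimes>\<^sub>M M2)" by measurable
qed (use assms in \<open>auto simp: M2.prob_space\<close>)

lemma (in pair_prob_space) integrable_snd_comp:
  fixes f :: "'b \<Rightarrow> real"
  assumes "integrable M2 f"
  shows "integrable (M1 \<Otimes>\<^sub>M M2) (\<lambda>p. f (snd p))"
proof (rule Fubini_integrable)
  have [measurable]: "f \<in> borel_measurable M2" using assms by simp
  show "(\<lambda>p. f (snd p)) \<in> borel_measurable (M1 \<Otimes>\<^sub>M M2)" by measurable
qed (use assms in auto)

context snlp_exp
begin

definition inf_cdf :: "real \<Rightarrow> real" where "inf_cdf x = prob {\<omega>\<in>space M. inf_neg \<omega> \<le> x}"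

definition inf_law :: "real measure" where "inf_law = distr M borel inf_neg"

definition inf_law2 :: "real measure" where
  "inf_law2 = distr (inf_law \<Otimes>\<^sub>M inf_law) borel (\<lambda>p. fst p + snd p)"

definition conv_cdf :: "real \<Rightarrow> real" where "conv_cdf = cdf inf_law2"

definition conv_potential :: "real \<Rightarrow> real" where
  "conv_potential x = (\<integral>w. max 0 (x - w) \<partial>inf_law2)"

sublocale inf_law: real_distribution inf_law
  unfolding inf_law_def by (rule real_distribution_distr) measurable

sublocale inf_pair: pair_prob_space inf_law inf_law ..

sublocale inf_law2: real_distribution inf_law2
  unfolding inf_law2_def by (rule inf_pair.real_distribution_distr) measurable

lemma inf_cdf_eq: "inf_cdf = cdf inf_law"
proof (rule ext)
  fix x show "inf_cdf x = cdf inf_law x"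
    unfolding inf_cdf_def inf_law_def cdf_def
    by (subst measure_distr) (auto simp: vimage_def Int_def conj_commute)
qed

lemma inf_cdf_integral: "inf_cdf x = (\<integral>\<omega>. indicator {0..} (x - inf_neg \<omega>) \<partial>M)"
proof -
  have "(\<integral>\<omega>. indicator {0..} (x - inf_neg \<omega>) \<partial>M) = (\<integral>\<omega>. indicator {\<omega>\<in>space M. inf_neg \<omega> \<le> x} \<omega> \<partial>M :: real)"
    by (rule Bochner_Integration.integral_cong) (auto simp: indicator_def)
  then show ?thesis unfolding inf_cdf_def by simp
qed

lemma inf_cdf_mono: "x \<le> y \<Longrightarrow> inf_cdf x \<le> inf_cdf y"
  unfolding inf_cdf_eq by (rule inf_law.cdf_nondecreasing)

lemma inf_cdf_measurable [measurable]: "inf_cdf \<in> borel_measurable borel"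
  by (rule borel_measurable_mono) (auto intro: monoI inf_cdf_mono)

lemma inf_cdf_bounds: "0 \<le> inf_cdf x" "inf_cdf x \<le> 1"
  unfolding inf_cdf_def by auto

lemma inf_cdf_neg: "x < 0 \<Longrightarrow> inf_cdf x = 0"
proof -
  assume "x < 0"
  then have "{\<omega>\<in>space M. inf_neg \<omega> \<le> x} = {}" using inf_neg_nonneg by force
  then show ?thesis unfolding inf_cdf_def by (simp only: measure_empty)
qed

lemma inf_law_integrable: "integrable inf_law (\<lambda>w. w)"
  unfolding inf_law_def by (subst integrable_distr_eq) (use inf_neg_integrable in auto)

lemma inf_law2_integrable: "integrable inf_law2 (\<lambda>w. w)"
proof -
  have [measurable_cong]: "sets inf_law = sets borel" unfolding inf_law_def by simp
  have "integrable (inf_law \<Otimes>\<^sub>M inf_law) (\<lambda>p. fst p + snd p)"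
    by (intro Bochner_Integration.integrable_add inf_pair.integrable_fst_comp inf_pair.integrable_snd_comp
        inf_law_integrable)
  then show ?thesis
    unfolding inf_law2_def by (subst integrable_distr_eq) auto
qed

lemma inf_law2_integral:
  fixes f :: "real \<Rightarrow> real"
  assumes [measurable]: "f \<in> borel_measurable borel" and int: "integrable inf_law2 f"
  shows "(\<integral>w. f w \<partial>inf_law2) = (\<integral>\<omega>. \<integral>\<omega>'. f (inf_neg \<omega> + inf_neg \<omega>') \<partial>M \<partial>M)"
proof -
  have [measurable_cong]: "sets inf_law = sets borel" unfolding inf_law_def by simp
  have i: "integrable (inf_law \<Otimes>\<^sub>M inf_law) (\<lambda>p. f (fst p + snd p))"
    using int unfolding inf_law2_def by (subst (asm) integrable_distr_eq) auto
  have "(\<integral>w. f w \<partial>inf_law2) = (\<integral>p. f (fst p + snd p) \<partial>(inf_law \<Otimes>\<^sub>M inf_law))"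
    unfolding inf_law2_def by (subst integral_distr) auto
  also have "\<dots> = (\<integral>a. \<integral>b. f (a + b) \<partial>inf_law \<partial>inf_law)"
    using inf_pair.integral_fst'[OF i] by simp
  also have "\<dots> = (\<integral>\<omega>. \<integral>b. f (inf_neg \<omega> + b) \<partial>inf_law \<partial>M)"
    unfolding inf_law_def
  proof (subst integral_distr)
    interpret L: prob_space "distr M borel inf_neg" by (rule prob_space_distr) measurable
    show "(\<lambda>a. \<integral>b. f (a + b) \<partial>distr M borel inf_neg) \<in> borel_measurable borel" by measurable
  qed auto
  also have "\<dots> = (\<integral>\<omega>. \<integral>\<omega>'. f (inf_neg \<omega> + inf_neg \<omega>') \<partial>M \<partial>M)"
    unfolding inf_law_def by (intro Bochner_Integration.integral_cong refl) (subst integral_distr, auto)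
  finally show ?thesis .
qed

lemma conv_potential_eq: "conv_potential x = (\<integral>\<omega>. potential (x - inf_neg \<omega>) \<partial>M)"
  unfolding conv_potential_def potential_def
  by (subst inf_law2_integral) (auto intro!: inf_law2.integrable_pos_part_diff inf_law2_integrable simp: diff_diff_eq)

lemma conv_cdf_eq: "conv_cdf x = (\<integral>\<omega>. inf_cdf (x - inf_neg \<omega>) \<partial>M)"
proof -
  have "conv_cdf x = (\<integral>w. indicator {0..} (x - w) \<partial>inf_law2)"
  proof -
    have "(\<integral>w. indicator {0..} (x - w) \<partial>inf_law2) = (\<integral>w. indicator {..x} w \<partial>inf_law2 :: real)"
      by (rule Bochner_Integration.integral_cong) (auto simp: indicator_def)
    then show ?thesis unfolding conv_cdf_def cdf_def by simp
  qed
  also have "\<dots> = (\<integral>\<omega>. \<integral>\<omega>'. indicator {0..} (x - (inf_neg \<omega> + inf_neg \<omega>')) \<partial>M \<partial>M)"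
    by (rule inf_law2_integral) (auto intro!: inf_law2.integrable_const_bound[of _ 1])
  also have "\<dots> = (\<integral>\<omega>. inf_cdf (x - inf_neg \<omega>) \<partial>M)"
    unfolding inf_cdf_integral by (simp add: diff_diff_eq)
  finally show ?thesis .
qed

lemma inf_cdf_shift_integrable: "integrable M (\<lambda>\<omega>. inf_cdf (x - inf_neg \<omega>))"
  by (rule integrable_const_bound[of _ 1]) (auto simp: inf_cdf_bounds)

lemma conv_cdf_mono: "x \<le> y \<Longrightarrow> conv_cdf x \<le> conv_cdf y"
  unfolding conv_cdf_def by (rule inf_law2.cdf_nondecreasing)

lemma conv_cdf_le: "conv_cdf x \<le> inf_cdf x"
proof -
  have "conv_cdf x \<le> (\<integral>\<omega>. inf_cdf x \<partial>M)"
    unfolding conv_cdf_eq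
    by (intro integral_mono inf_cdf_shift_integrable inf_cdf_mono) (auto simp: inf_neg_nonneg)
  then show ?thesis by (simp add: prob_space)
qed

lemma conv_cdf_neg: "x < 0 \<Longrightarrow> conv_cdf x = 0"
  using conv_cdf_le[of x] inf_cdf_neg[of x] inf_law2.cdf_nonneg[of x] unfolding conv_cdf_def by simp

lemma conv_potential_diff:
  assumes "a \<le> b"
  shows "(b - a) * conv_cdf a \<le> conv_potential b - conv_potential a"
    and "conv_potential b - conv_potential a \<le> (b - a) * conv_cdf b"
    and "(LINT y:{a..b}|lborel. conv_cdf y) = conv_potential b - conv_potential a"
  unfolding conv_potential_def conv_cdf_def
  using inf_law2.pos_part_diff_bounds[OF inf_law2_integrable assms]
    inf_law2.integral_cdf[OF inf_law2_integrable assms] by auto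

lemma conv_cdf_bounds: "0 \<le> conv_cdf x" "conv_cdf x \<le> 1"
  unfolding conv_cdf_def using inf_law2.cdf_nonneg inf_law2.cdf_bounded_prob by auto

lemma conv_potential_lipschitz: "\<bar>conv_potential a - conv_potential b\<bar> \<le> \<bar>a - b\<bar>"
proof -
  have *: "\<bar>conv_potential b - conv_potential a\<bar> \<le> b - a" if "a \<le> b" for a b
  proof -
    have "0 \<le> (b - a) * conv_cdf a" using that conv_cdf_bounds by simp
    moreover have "(b - a) * conv_cdf b \<le> (b - a) * 1" using that conv_cdf_bounds by (intro mult_left_mono) auto
    ultimately have "0 \<le> (b - a) * conv_cdf a" "(b - a) * conv_cdf b \<le> b - a" by auto
    then show ?thesis using conv_potential_diff(1,2)[OF that] by linarith
  qed
  then show ?thesis using *[of a b] *[of b a] by (cases "a \<le> b") (auto simp: abs_minus_commute)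
qed

lemma conv_potential_neg: "x \<le> 0 \<Longrightarrow> conv_potential x = 0"
proof -
  assume x: "x \<le> 0"
  have p0: "potential y = 0" if "y \<le> 0" for y using potential_bounds[of y] that by simp
  have "conv_potential x = (\<integral>\<omega>. 0 \<partial>M)"
    unfolding conv_potential_eq
    by (intro Bochner_Integration.integral_cong refl p0) (use x inf_neg_nonneg in force)
  then show ?thesis by simp
qed

text \<open>Dropping the positive part once for each copy. The resulting linear growth of the gain
  is what bounds the negative part of a cost.\<close>

lemma conv_potential_ge: "(x - 2 * (\<integral>\<omega>. inf_neg \<omega> \<partial>M)) \<le> conv_potential x"
proof -
  let ?e = "\<integral>\<omega>. inf_neg \<omega> \<partial>M"
  have pot: "y - ?e \<le> potential y" for y
  proof -
    have "y - ?e = (\<integral>\<omega>. y - inf_neg \<omega> \<partial>M)" using inf_neg_integrable by (simp add: prob_space)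
    also have "\<dots> \<le> potential y"
      unfolding potential_def by (rule integral_mono) (use potential_integrable inf_neg_integrable in auto)
    finally show ?thesis .
  qed
  have pi: "integrable M (\<lambda>\<omega>. potential (x - inf_neg \<omega>))"
  proof (rule integrable_const_bound[of _ "\<bar>x\<bar>"])
    show "AE \<omega> in M. norm (potential (x - inf_neg \<omega>)) \<le> \<bar>x\<bar>"
    proof (rule AE_I2)
      fix \<omega> assume "\<omega> \<in> space M"
      then have "max 0 (x - inf_neg \<omega>) \<le> \<bar>x\<bar>" using inf_neg_nonneg[of \<omega>] by auto
      then show "norm (potential (x - inf_neg \<omega>)) \<le> \<bar>x\<bar>"
        using potential_bounds[of "x - inf_neg \<omega>"] by simp
    qed
  qed measurable
  have "x - 2 * ?e = (\<integral>\<omega>. x - inf_neg \<omega> - ?e \<partial>M)" using inf_neg_integrable by (simp add: prob_space)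
  also have "\<dots> \<le> conv_potential x"
    unfolding conv_potential_eq by (rule integral_mono) (use pi inf_neg_integrable pot in auto)
  finally show ?thesis .
qed

lemma conv_potential_isCont: "isCont conv_potential x"
proof -
  have "conv_potential \<midarrow>x\<rightarrow> conv_potential x"
  proof (rule LIM_I)
    fix r :: real assume "0 < r"
    then show "\<exists>s>0. \<forall>y. y \<noteq> x \<and> norm (y - x) < s \<longrightarrow> norm (conv_potential y - conv_potential x) < r"
      using conv_potential_lipschitz[of _ x] by (intro exI[of _ r]) (auto intro: le_less_trans)
  qed
  then show ?thesis by (simp add: isCont_def)
qed

lemma conv_potential_measurable [measurable]: "conv_potential \<in> borel_measurable borel"
  by (rule borel_measurable_continuous_onI) (simp add: continuous_at_imp_continuous_on conv_potential_isCont)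

text \<open>Averages the occupation identity at \<open>z = x - Y'\<close> over an independent copy
  \<open>Y'\<close> of the infimum. Under the average \<open>indicator {0..} (x - Y' + X s)\<close>
  becomes \<open>inf_cdf (x + X s)\<close>.\<close>

lemma conv_potential_generator:
  "(\<integral>\<omega>. conv_potential (x + X (mesh k) \<omega>) \<partial>M) - conv_potential x
    = m * (LINT s:{0..<mesh k}|lborel. \<integral>\<omega>. inf_cdf (x + traj s \<omega>) \<partial>M)"
proof -
  interpret P: pair_prob_space M M ..
  interpret Q: pair_sigma_finite M lborel by unfold_locales
  let ?h = "mesh k"
  have meas2: "(\<lambda>(\<omega>, \<omega>'). potential (x + X ?h \<omega> - inf_neg \<omega>')) \<in> borel_measurable (M \<Otimes>\<^sub>M M)"
    by measurable
  have intp: "integrable (M \<Otimes>\<^sub>M M) (\<lambda>(\<omega>, \<omega>'). potential (x + X ?h \<omega> - inf_neg \<omega>'))"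
  proof (rule Bochner_Integration.integrable_bound[of _ "\<lambda>p. \<bar>x\<bar> + \<bar>X ?h (fst p)\<bar>"])
    show "integrable (M \<Otimes>\<^sub>M M) (\<lambda>p. \<bar>x\<bar> + \<bar>X ?h (fst p)\<bar>)"
      using X_mesh_mean(1)[of k] by (intro Bochner_Integration.integrable_add P.integrable_fst_comp) auto
    show "AE p in M \<Otimes>\<^sub>M M. norm (case p of (\<omega>, \<omega>') \<Rightarrow> potential (x + X ?h \<omega> - inf_neg \<omega>')) \<le> norm (\<bar>x\<bar> + \<bar>X ?h (fst p)\<bar>)"
    proof (rule AE_I2)
      fix p assume "p \<in> space (M \<Otimes>\<^sub>M M)"
      then have "0 \<le> inf_neg (snd p)" by (intro inf_neg_nonneg) (auto simp: space_pair_measure)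
      then have "max 0 (x + X ?h (fst p) - inf_neg (snd p)) \<le> \<bar>x\<bar> + \<bar>X ?h (fst p)\<bar>" by auto
      then show "norm (case p of (\<omega>, \<omega>') \<Rightarrow> potential (x + X ?h \<omega> - inf_neg \<omega>')) \<le> norm (\<bar>x\<bar> + \<bar>X ?h (fst p)\<bar>)"
        using potential_bounds[of "x + X ?h (fst p) - inf_neg (snd p)"] by (auto simp: case_prod_beta)
    qed
  qed (use meas2 in simp)
  have "(\<integral>\<omega>. conv_potential (x + X ?h \<omega>) \<partial>M) = (\<integral>\<omega>. \<integral>\<omega>'. potential (x + X ?h \<omega> - inf_neg \<omega>') \<partial>M \<partial>M)"
    unfolding conv_potential_eq ..
  also have "\<dots> = (\<integral>\<omega>'. \<integral>\<omega>. potential (x + X ?h \<omega> - inf_neg \<omega>') \<partial>M \<partial>M)"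
    by (rule P.Fubini_integral[symmetric, OF intp])
  also have "\<dots> = (\<integral>\<omega>'. potential (x - inf_neg \<omega>') + m * occupation k (x - inf_neg \<omega>') \<partial>M)"
  proof (rule Bochner_Integration.integral_cong[OF refl])
    fix \<omega>'
    show "(\<integral>\<omega>. potential (x + X ?h \<omega> - inf_neg \<omega>') \<partial>M) = potential (x - inf_neg \<omega>') + m * occupation k (x - inf_neg \<omega>')"
      using potential_occupation[where z="x - inf_neg \<omega>'" and k=k] by (simp add: algebra_simps)
  qed
  also have "\<dots> = conv_potential x + m * (\<integral>\<omega>'. occupation k (x - inf_neg \<omega>') \<partial>M)"
  proof -
    have om: "(\<lambda>z. occupation k z) \<in> borel_measurable borel"
      unfolding occupation_def set_lebesgue_integral_def by measurable
    have ob: "0 \<le> occupation k z \<and> occupation k z \<le> mesh k" for z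
    proof -
      have le1: "(\<integral>\<omega>. indicator {0..} (z + traj s \<omega>) \<partial>M) \<le> (1::real)" for s
      proof -
        have "(\<integral>\<omega>. indicator {0..} (z + traj s \<omega>) \<partial>M :: real) \<le> (\<integral>\<omega>. 1 \<partial>M)"
          by (rule integral_mono) (auto intro!: integrable_const_bound[of _ 1] simp: indicator_def)
        then show ?thesis by (simp add: prob_space)
      qed
      have "occupation k z \<le> (LINT s:{0..<mesh k}|lborel. (1::real))"
        unfolding occupation_def
        by (rule set_integral_mono) (use le1 ramp_traj_set_integrable(2)[of k z] in \<open>auto simp: set_integrable_def\<close>)
      moreover have "0 \<le> occupation k z"
        unfolding occupation_def set_lebesgue_integral_def by (intro integral_nonneg_AE AE_I2) simp
      ultimately show ?thesis by (simp add: set_lebesgue_integral_def)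
    qed
    have "integrable M (\<lambda>\<omega>'. occupation k (x - inf_neg \<omega>'))"
      by (rule integrable_const_bound[of _ "mesh k"]) (use ob om in auto)
    moreover have "integrable M (\<lambda>\<omega>'. potential (x - inf_neg \<omega>'))"
    proof (rule integrable_const_bound[of _ "\<bar>x\<bar>"])
      show "AE \<omega> in M. norm (potential (x - inf_neg \<omega>)) \<le> \<bar>x\<bar>"
      proof (rule AE_I2)
        fix \<omega> assume "\<omega> \<in> space M"
        then have "max 0 (x - inf_neg \<omega>) \<le> \<bar>x\<bar>" using inf_neg_nonneg[of \<omega>] by auto
        then show "norm (potential (x - inf_neg \<omega>)) \<le> \<bar>x\<bar>"
          using potential_bounds[of "x - inf_neg \<omega>"] by simp
      qed
    qed measurable
    ultimately show ?thesis unfolding conv_potential_eq by simp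
  qed
  also have "(\<integral>\<omega>'. occupation k (x - inf_neg \<omega>') \<partial>M)
      = (LINT s:{0..<?h}|lborel. \<integral>\<omega>. inf_cdf (x + traj s \<omega>) \<partial>M)"
  proof -
    let ?i = "\<lambda>\<omega>' s. indicator {0..<?h} s * (\<integral>\<omega>. indicator {0..} (x - inf_neg \<omega>' + traj s \<omega>) \<partial>M) :: real"
    have bnd: "\<bar>\<integral>\<omega>. indicator {0..} (y + traj s \<omega>) \<partial>M :: real\<bar> \<le> 1" for y s
    proof -
      have "(\<integral>\<omega>. indicator {0..} (y + traj s \<omega>) \<partial>M :: real) \<le> (\<integral>\<omega>. 1 \<partial>M)"
        by (rule integral_mono) (auto intro!: integrable_const_bound[of _ 1] simp: indicator_def)
      moreover have "0 \<le> (\<integral>\<omega>. indicator {0..} (y + traj s \<omega>) \<partial>M :: real)"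
        by (intro integral_nonneg_AE AE_I2) simp
      ultimately show ?thesis by (simp add: prob_space)
    qed
    have im: "(\<lambda>(\<omega>', s). ?i \<omega>' s) \<in> borel_measurable (M \<Otimes>\<^sub>M lborel)" by measurable
    have "integrable (M \<Otimes>\<^sub>M lborel) (\<lambda>(\<omega>', s). ?i \<omega>' s)"
    proof (rule Bochner_Integration.integrable_bound[of _ "\<lambda>p. indicator (space M \<times> {0..<?h}) p :: real"])
      have "emeasure (M \<Otimes>\<^sub>M lborel) (space M \<times> {0..<?h}) < \<infinity>"
        by (subst lborel.emeasure_pair_measure_Times) (auto simp: emeasure_space_1)
      then show "integrable (M \<Otimes>\<^sub>M lborel) (\<lambda>p. indicator (space M \<times> {0..<?h}) p :: real)"
        by (intro integrable_real_indicator) auto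
      show "AE p in M \<Otimes>\<^sub>M lborel. norm (case p of (\<omega>', s) \<Rightarrow> ?i \<omega>' s) \<le> norm (indicator (space M \<times> {0..<?h}) p :: real)"
      proof (rule AE_I2)
        fix p :: "'a \<times> real" assume p: "p \<in> space (M \<Otimes>\<^sub>M lborel)"
        show "norm (case p of (\<omega>', s) \<Rightarrow> ?i \<omega>' s) \<le> norm (indicator (space M \<times> {0..<?h}) p :: real)"
        proof (cases "snd p \<in> {0..<?h}")
          case True
          then show ?thesis using p bnd[of "x - inf_neg (fst p)" "snd p"]
            by (simp add: case_prod_beta space_pair_measure mem_Times_iff)
        qed (simp add: case_prod_beta)
      qed
    qed (use im in simp)
    then have "(\<integral>s. \<integral>\<omega>'. ?i \<omega>' s \<partial>M \<partial>lborel) = (\<integral>\<omega>'. \<integral>s. ?i \<omega>' s \<partial>lborel \<partial>M)"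
      by (rule Q.Fubini_integral)
    also have "(\<integral>s. \<integral>\<omega>'. ?i \<omega>' s \<partial>M \<partial>lborel) = (LINT s:{0..<?h}|lborel. \<integral>\<omega>. inf_cdf (x + traj s \<omega>) \<partial>M)"
      unfolding set_lebesgue_integral_def
    proof (rule Bochner_Integration.integral_cong[OF refl])
      fix s
      have "integrable (M \<Otimes>\<^sub>M M) (\<lambda>(\<omega>', \<omega>). indicator {0..} (x - inf_neg \<omega>' + traj s \<omega>) :: real)"
        by (rule P.integrable_const_bound[of _ 1]) (auto simp: case_prod_beta)
      then have "(\<integral>\<omega>'. \<integral>\<omega>. indicator {0..} (x - inf_neg \<omega>' + traj s \<omega>) \<partial>M \<partial>M)
          = (\<integral>\<omega>. \<integral>\<omega>'. indicator {0..} (x - inf_neg \<omega>' + traj s \<omega>) \<partial>M \<partial>M :: real)"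
        by (rule P.Fubini_integral[symmetric])
      also have "\<dots> = (\<integral>\<omega>. inf_cdf (x + traj s \<omega>) \<partial>M)"
        unfolding inf_cdf_integral by (simp add: algebra_simps)
      finally show "(\<integral>\<omega>'. ?i \<omega>' s \<partial>M) = indicator {0..<?h} s *\<^sub>R (\<integral>\<omega>. inf_cdf (x + traj s \<omega>) \<partial>M)" by simp
    qed
    finally show ?thesis unfolding occupation_def set_lebesgue_integral_def by simp
  qed
  finally show ?thesis by simp
qed

section \<open>Integrability of the running maximum\<close>

definition run_max :: "nat \<Rightarrow> 'a \<Rightarrow> real" where
  "run_max N \<omega> = (SUP p\<in>{(n, j). j \<le> N * 2 ^ n}. X (real (snd p) * mesh (fst p)) \<omega>)"

lemma run_max_bdd:
  assumes "\<omega> \<in> space M"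
  shows "bdd_above ((\<lambda>p. X (real (snd p) * mesh (fst p)) \<omega>) ` {(n, j). j \<le> N * 2 ^ n})"
proof -
  obtain B where B: "\<And>t. 0 \<le> t \<Longrightarrow> t \<le> real N \<Longrightarrow> \<bar>X t \<omega>\<bar> \<le> B"
    using cadlag_bounded[OF X_cadlag[OF assms]] by blast
  show ?thesis
  proof (rule bdd_aboveI2)
    fix p assume "p \<in> {(n, j). j \<le> N * 2 ^ n}"
    then have "snd p \<le> N * 2 ^ fst p" by auto
    then have "real (snd p) \<le> real (N * 2 ^ fst p)" by (simp only: of_nat_le_iff)
    then have "real (snd p) * mesh (fst p) \<le> real N" by (simp add: field_simps)
    then show "X (real (snd p) * mesh (fst p)) \<omega> \<le> B"
      using B[of "real (snd p) * mesh (fst p)"] by auto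
  qed
qed

lemma dyadic_above_bounded:
  assumes "0 \<le> s" "s < real N"
  obtains j where "j \<le> N * 2 ^ n" "dyadic_above n s = real j * mesh n"
proof -
  obtain j :: nat where j: "dyadic_above n s = real j * mesh n" using dyadic_above_mesh[OF assms(1)] by blast
  have "\<lfloor>2 ^ n * s\<rfloor> < int (N * 2 ^ n)"
    using assms by (subst floor_less_iff) (simp add: mult.commute)
  then have "\<lfloor>2 ^ n * s\<rfloor> + 1 \<le> int (N * 2 ^ n)" by simp
  then have "real_of_int (\<lfloor>2 ^ n * s\<rfloor> + 1) \<le> real_of_int (int (N * 2 ^ n))" by (simp only: of_int_le_iff)
  moreover have "real j = real_of_int (\<lfloor>2 ^ n * s\<rfloor> + 1)" using j unfolding dyadic_above_def by simp
  ultimately have "real j \<le> real (N * 2 ^ n)" by simp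
  then have "j \<le> N * 2 ^ n" by (simp only: of_nat_le_iff)
  then show thesis using j by (rule that)
qed

lemma X_le_run_max:
  assumes w: "\<omega> \<in> space M" and s: "0 \<le> s" "s \<le> real N"
  shows "X s \<omega> \<le> run_max N \<omega>"
\<comment> \<open>\<open>dyadic_above n N\<close> lies beyond \<open>N\<close>, so the endpoint
  cannot be approached from the right inside the interval. It is itself a grid point of level
  \<open>0\<close>.\<close>
proof (cases "s = real N")
  case True
  have "X (real (snd (0::nat, N)) * mesh (fst (0::nat, N))) \<omega> \<le> run_max N \<omega>"
    unfolding run_max_def by (rule cSUP_upper[OF _ run_max_bdd[OF w]]) auto
  then show ?thesis using True by simp
next
  case False
  show ?thesis
  proof (rule LIMSEQ_le_const2[OF cadlag_dyadic_tendsto[OF X_cadlag[OF w] s(1)]], intro exI allI impI)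
    fix n
    obtain j where j: "j \<le> N * 2 ^ n" "dyadic_above n s = real j * mesh n"
      using dyadic_above_bounded[of s N n] s False by auto
    have "X (real (snd (n, j)) * mesh (fst (n, j))) \<omega> \<le> run_max N \<omega>"
      unfolding run_max_def by (rule cSUP_upper[OF _ run_max_bdd[OF w]]) (use j in auto)
    then show "X (dyadic_above n s) \<omega> \<le> run_max N \<omega>" using j by simp
  qed
qed

lemma run_max_nonneg: "\<omega> \<in> space M \<Longrightarrow> 0 \<le> run_max N \<omega>"
  using X_le_run_max[of \<omega> 0 N] X_0 by simp

lemma run_max_measurable [measurable]: "run_max N \<in> borel_measurable M"
  unfolding run_max_def
proof (rule borel_measurable_cSUP[OF _ _ run_max_bdd])
  fix p :: "nat \<times> nat"
  show "X (real (snd p) * mesh (fst p)) \<in> borel_measurable M" by (rule X_measurable) simp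
qed auto

lemma psi_1_nonneg: "0 \<le> \<psi> 1" using psi_pos[of 1] by simp

text \<open>Doob's argument for the submartingale \<open>exp X\<close>: split according to the first
  grid time at which \<open>c\<close> is exceeded. From there to time \<open>N\<close> the mean of
  \<open>exp\<close> of the increment is at least \<open>1\<close>, because
  \<open>0 \<le> \<psi> 1\<close>.\<close>

lemma grid_maximal_inequality:
  "prob {\<omega>\<in>space M. \<exists>j\<le>N * 2 ^ n. c < X (real j * mesh n) \<omega>} \<le> exp (real N * \<psi> 1 - c)"
proof -
  let ?J = "N * 2 ^ n" and ?d = "mesh n"
  define A where "A j = {\<omega>\<in>space M. c < X (real j * ?d) \<omega> \<and> (\<forall>i<j. X (real i * ?d) \<omega> \<le> c)}" for j
  have Ap: "A j \<in> sets (past (real j * ?d))" for j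
  proof -
    have "{\<omega>\<in>space M. X (real i * ?d) \<omega> \<le> c} \<in> sets (past (real j * ?d))" if "i < j" for i
    proof -
      have [measurable]: "X (real i * ?d) \<in> borel_measurable (past (real j * ?d))"
        using that by (intro X_measurable_past) (auto intro!: divide_right_mono)
      have "{\<omega>\<in>space (past (real j * ?d)). X (real i * ?d) \<omega> \<le> c} \<in> sets (past (real j * ?d))" by measurable
      then show ?thesis by simp
    qed
    then have "{\<omega>\<in>space (past (real j * ?d)). \<forall>i\<in>{..<j}. X (real i * ?d) \<omega> \<le> c} \<in> sets (past (real j * ?d))"
      by (intro sets.sets_Collect_finite_All) auto
    moreover have "{\<omega>\<in>space (past (real j * ?d)). c < X (real j * ?d) \<omega>} \<in> sets (past (real j * ?d))"
    proof -
      have [measurable]: "X (real j * ?d) \<in> borel_measurable (past (real j * ?d))"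
        by (intro X_measurable_past) auto
      show ?thesis by measurable
    qed
    moreover have "A j = {\<omega>\<in>space (past (real j * ?d)). c < X (real j * ?d) \<omega>}
        \<inter> {\<omega>\<in>space (past (real j * ?d)). \<forall>i\<in>{..<j}. X (real i * ?d) \<omega> \<le> c}"
      unfolding A_def by auto
    ultimately show ?thesis by simp
  qed
  then have Am [measurable]: "A j \<in> events" for j using sets_past_subset by blast
  have disj: "disjoint_family_on A {..?J}"
    unfolding disjoint_family_on_def
  proof (intro ballI impI)
    fix i j :: nat assume "i \<noteq> j"
    then show "A i \<inter> A j = {}" unfolding A_def by (cases i j rule: linorder_cases) force+
  qed
  have Un: "{\<omega>\<in>space M. \<exists>j\<le>?J. c < X (real j * ?d) \<omega>} = (\<Union>j\<in>{..?J}. A j)"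
  proof (intro equalityI subsetI)
    fix \<omega> assume "\<omega> \<in> {\<omega>\<in>space M. \<exists>j\<le>?J. c < X (real j * ?d) \<omega>}"
    then obtain j where w: "\<omega> \<in> space M" and j: "j \<le> ?J" "c < X (real j * ?d) \<omega>" by auto
    define i where "i = (LEAST j. c < X (real j * ?d) \<omega>)"
    have "c < X (real i * ?d) \<omega>" unfolding i_def by (rule LeastI[of _ j]) (rule j)
    moreover have "X (real l * ?d) \<omega> \<le> c" if "l < i" for l
      using not_less_Least[of l "\<lambda>j. c < X (real j * ?d) \<omega>"] that unfolding i_def by auto
    moreover have "i \<le> ?J" using Least_le[of "\<lambda>j. c < X (real j * ?d) \<omega>" j] j unfolding i_def by auto
    ultimately show "\<omega> \<in> (\<Union>j\<in>{..?J}. A j)" using w unfolding A_def by blast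
  next
    fix \<omega> assume "\<omega> \<in> (\<Union>j\<in>{..?J}. A j)"
    then show "\<omega> \<in> {\<omega>\<in>space M. \<exists>j\<le>?J. c < X (real j * ?d) \<omega>}" unfolding A_def by blast
  qed
  have J: "real ?J * ?d = real N" by simp
  have each: "ennreal (exp c) * emeasure M (A j) \<le> (\<integral>\<^sup>+\<omega>. indicator (A j) \<omega> * ennreal (exp (X (real N) \<omega>)) \<partial>M)"
    if "j \<le> ?J" for j
  proof -
    let ?t = "real j * ?d" and ?r = "real (?J - j) * ?d"
    have tr: "?t + ?r = real N" using that J by (simp add: of_nat_diff left_diff_distrib field_simps)
    have [measurable]: "X ?t \<in> borel_measurable M" "X ?r \<in> borel_measurable M" by (auto intro!: X_measurable)
    have one: "1 \<le> (\<integral>\<^sup>+\<omega>'. ennreal (exp (X ?r \<omega>')) \<partial>M)"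
    proof -
      have "(\<integral>\<^sup>+\<omega>'. ennreal (exp (X ?r \<omega>')) \<partial>M) = ennreal (exp (?r * \<psi> 1))"
        using exp_moment_nn[of 1 "?J - j" n] by simp
      also have "1 \<le> ennreal (exp (?r * \<psi> 1))" using psi_1_nonneg by (simp add: ennreal_ge_1)
      finally show ?thesis by simp
    qed
    have U: "(\<lambda>\<omega>. (indicator (A j) \<omega> :: real, X ?t \<omega>)) \<in> past ?t \<rightarrow>\<^sub>M borel \<Otimes>\<^sub>M borel"
      using Ap[of j] X_measurable_past[of ?t ?t] by (intro measurable_Pair borel_measurable_indicator) auto
    have "ennreal (exp c) * emeasure M (A j) = (\<integral>\<^sup>+\<omega>. ennreal (exp c) * indicator (A j) \<omega> \<partial>M)"
      by (simp add: nn_integral_cmult_indicator)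
    also have "\<dots> \<le> (\<integral>\<^sup>+\<omega>. indicator (A j) \<omega> * ennreal (exp (X ?t \<omega>)) * (\<integral>\<^sup>+\<omega>'. ennreal (exp (X ?r \<omega>')) \<partial>M) \<partial>M)"
    proof (rule nn_integral_mono)
      fix \<omega>
      show "ennreal (exp c) * indicator (A j) \<omega> \<le> indicator (A j) \<omega> * ennreal (exp (X ?t \<omega>)) * (\<integral>\<^sup>+\<omega>'. ennreal (exp (X ?r \<omega>')) \<partial>M)"
      proof (cases "\<omega> \<in> A j")
        case True
        then have "ennreal (exp c) \<le> ennreal (exp (X ?t \<omega>))" unfolding A_def by (intro ennreal_leI) auto
        then have "ennreal (exp c) * 1 \<le> ennreal (exp (X ?t \<omega>)) * (\<integral>\<^sup>+\<omega>'. ennreal (exp (X ?r \<omega>')) \<partial>M)"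
          using one by (intro mult_mono) auto
        then show ?thesis using True by simp
      qed simp
    qed
    also have "\<dots> = (\<integral>\<^sup>+\<omega>. \<integral>\<^sup>+\<omega>'. indicator (A j) \<omega> * ennreal (exp (X ?t \<omega> + X ?r \<omega>')) \<partial>M \<partial>M)"
      by (simp add: exp_add ennreal_mult nn_integral_cmult mult.assoc)
    also have "\<dots> = (\<integral>\<^sup>+\<omega>. \<integral>\<^sup>+\<omega>'. (\<lambda>p. ennreal (fst (fst p)) * ennreal (exp (snd (fst p) + snd p))) ((indicator (A j) \<omega>, X ?t \<omega>), X ?r \<omega>') \<partial>M \<partial>M)"
      by (intro nn_integral_cong) (auto simp: indicator_def)
    also have "\<dots> = (\<integral>\<^sup>+\<omega>. (\<lambda>p. ennreal (fst (fst p)) * ennreal (exp (snd (fst p) + snd p))) ((indicator (A j) \<omega>, X ?t \<omega>), X (?t + ?r) \<omega> - X ?t \<omega>) \<partial>M)"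
      by (rule markov_nn_integral[symmetric, OF U]) (simp, simp, measurable)
    also have "\<dots> = (\<integral>\<^sup>+\<omega>. indicator (A j) \<omega> * ennreal (exp (X (real N) \<omega>)) \<partial>M)"
      unfolding tr by (intro nn_integral_cong) (auto simp: indicator_def)
    finally show ?thesis .
  qed
  have [measurable]: "X (real N) \<in> borel_measurable M" by (rule X_measurable) simp
  have "ennreal (exp c) * emeasure M (\<Union>j\<in>{..?J}. A j) = (\<Sum>j\<in>{..?J}. ennreal (exp c) * emeasure M (A j))"
    using disj by (subst sum_emeasure[symmetric]) (auto simp: sum_distrib_left)
  also have "\<dots> \<le> (\<Sum>j\<in>{..?J}. \<integral>\<^sup>+\<omega>. indicator (A j) \<omega> * ennreal (exp (X (real N) \<omega>)) \<partial>M)"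
    by (intro sum_mono each) simp
  also have "\<dots> = (\<integral>\<^sup>+\<omega>. (\<Sum>j\<in>{..?J}. indicator (A j) \<omega> * ennreal (exp (X (real N) \<omega>))) \<partial>M)"
    by (rule nn_integral_sum[symmetric]) measurable
  also have "\<dots> \<le> (\<integral>\<^sup>+\<omega>. ennreal (exp (X (real N) \<omega>)) \<partial>M)"
  proof (rule nn_integral_mono)
    fix \<omega>
    have "(\<Sum>j\<in>{..?J}. indicator (A j) \<omega> :: ennreal) = indicator (\<Union>j\<in>{..?J}. A j) \<omega>"
      by (rule indicator_UN_disjoint[symmetric]) (use disj in auto)
    then have "(\<Sum>j\<in>{..?J}. indicator (A j) \<omega> * ennreal (exp (X (real N) \<omega>)))
        = indicator (\<Union>j\<in>{..?J}. A j) \<omega> * ennreal (exp (X (real N) \<omega>))"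
      by (simp add: sum_distrib_right[symmetric])
    also have "\<dots> \<le> ennreal (exp (X (real N) \<omega>))" by (auto simp: indicator_def)
    finally show "(\<Sum>j\<in>{..?J}. indicator (A j) \<omega> * ennreal (exp (X (real N) \<omega>))) \<le> ennreal (exp (X (real N) \<omega>))" .
  qed
  also have "\<dots> = ennreal (exp (real N * \<psi> 1))" using exp_moment_nn[of 1 N 0] by simp
  finally have "ennreal (exp c) * ennreal (prob (\<Union>j\<in>{..?J}. A j)) \<le> ennreal (exp (real N * \<psi> 1))"
    by (simp add: emeasure_eq_measure)
  then have "exp c * prob (\<Union>j\<in>{..?J}. A j) \<le> exp (real N * \<psi> 1)"
    by (simp add: ennreal_mult[symmetric])
  then show ?thesis unfolding Un by (simp add: exp_diff field_simps)
qed

lemma run_max_tail: "prob {\<omega>\<in>space M. c < run_max N \<omega>} \<le> exp (real N * \<psi> 1 - c)"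
proof -
  let ?B = "\<lambda>n. {\<omega>\<in>space M. \<exists>j\<le>N * 2 ^ n. c < X (real j * mesh n) \<omega>}"
  have Bm: "?B n \<in> events" for n
  proof -
    have "{\<omega>\<in>space M. c < X (real j * mesh n) \<omega>} \<in> events" for j :: nat
      using X_measurable[of "real j * mesh n"] by simp
    then have "{\<omega>\<in>space M. \<exists>j\<in>{..N * 2 ^ n}. c < X (real j * mesh n) \<omega>} \<in> events"
      by (intro sets.sets_Collect_finite_Ex) auto
    then show ?thesis by (simp add: Bex_def)
  qed
  have inc: "incseq ?B"
  proof (rule incseq_SucI, rule subsetI)
    fix n \<omega> assume "\<omega> \<in> ?B n"
    then obtain j where "\<omega> \<in> space M" "j \<le> N * 2 ^ n" "c < X (real j * mesh n) \<omega>" by auto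
    moreover have "real (2 * j) * mesh (Suc n) = real j * mesh n" by simp
    ultimately have "\<omega> \<in> space M" "2 * j \<le> N * 2 ^ Suc n" "c < X (real (2 * j) * mesh (Suc n)) \<omega>"
      by (simp_all only: power_Suc mult.left_commute mult_le_mono2)
    then show "\<omega> \<in> ?B (Suc n)" by blast
  qed
  have eq: "{\<omega>\<in>space M. c < run_max N \<omega>} = (\<Union>n. ?B n)"
  proof -
    have "c < run_max N \<omega> \<longleftrightarrow> (\<exists>n. \<exists>j\<le>N * 2 ^ n. c < X (real j * mesh n) \<omega>)" if "\<omega> \<in> space M" for \<omega>
      unfolding run_max_def by (subst less_cSUP_iff[OF _ run_max_bdd[OF that]]) auto
    then show ?thesis by auto
  qed
  have lim: "(\<lambda>n. prob (?B n)) \<longlonglongrightarrow> prob (\<Union>n. ?B n)"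
    using inc Bm by (intro finite_Lim_measure_incseq image_subsetI)
  show ?thesis
    unfolding eq by (rule LIMSEQ_le_const2[OF lim]) (intro exI allI impI grid_maximal_inequality)
qed

text \<open>Summing the exponential tail over the integers gives a geometric series. Together with
  the infimum this provides one integrable bound for the path on \<open>[0, N]\<close>, whatever the
  random time at which it is evaluated.\<close>

lemma run_max_integrable: "integrable M (run_max N)"
proof (rule integrableI_nonneg)
  let ?A = "\<lambda>k. {\<omega>\<in>space M. real k < run_max N \<omega>}"
  show "AE \<omega> in M. 0 \<le> run_max N \<omega>" using run_max_nonneg by (auto intro!: AE_I2)
  have le: "ennreal (run_max N \<omega>) \<le> (\<Sum>k. indicator (?A k) \<omega>)" if w: "\<omega> \<in> space M" for \<omega>
  proof -
    let ?c = "nat \<lceil>run_max N \<omega>\<rceil>"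
    have "run_max N \<omega> \<le> real ?c" by (rule real_nat_ceiling_ge)
    then have "ennreal (run_max N \<omega>) \<le> ennreal (real ?c)" by (rule ennreal_leI)
    also have "\<dots> = of_nat ?c" by (simp add: ennreal_of_nat_eq_real_of_nat)
    also have "\<dots> = (\<Sum>k<?c. indicator (?A k) \<omega>)"
    proof -
      have "real k < run_max N \<omega>" if "k < ?c" for k
        using that by (metis less_ceiling_iff of_int_of_nat_eq zless_nat_eq_int_zless)
      then have "(\<Sum>k<?c. indicator (?A k) \<omega> :: ennreal) = (\<Sum>k<?c. 1)"
        using w by (intro sum.cong) auto
      then show ?thesis by simp
    qed
    also have "\<dots> \<le> (\<Sum>k. indicator (?A k) \<omega>)"
      by (rule sum_le_suminf) auto
    finally show ?thesis .
  qed
  have "(\<integral>\<^sup>+\<omega>. ennreal (run_max N \<omega>) \<partial>M) \<le> (\<integral>\<^sup>+\<omega>. (\<Sum>k. indicator (?A k) \<omega>) \<partial>M)"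
    by (rule nn_integral_mono) (rule le)
  also have "\<dots> = (\<Sum>k. \<integral>\<^sup>+\<omega>. indicator (?A k) \<omega> \<partial>M)"
    by (rule nn_integral_suminf) measurable
  also have "\<dots> = (\<Sum>k. ennreal (prob (?A k)))"
    by (simp add: emeasure_eq_measure)
  also have "\<dots> \<le> (\<Sum>k. ennreal (exp (real N * \<psi> 1) * exp (- 1) ^ k))"
  proof (rule suminf_le)
    fix k
    have "prob (?A k) \<le> exp (real N * \<psi> 1 - real k)" by (rule run_max_tail)
    also have "\<dots> = exp (real N * \<psi> 1) * exp (- 1) ^ k"
      by (simp add: exp_diff exp_minus exp_of_nat_mult[symmetric] field_simps power_inverse)
    finally show "ennreal (prob (?A k)) \<le> ennreal (exp (real N * \<psi> 1) * exp (- 1) ^ k)"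
      by (rule ennreal_leI)
  qed auto
  also have "\<dots> < \<infinity>"
  proof -
    have "summable (\<lambda>k. exp (real N * \<psi> 1) * exp (- 1 :: real) ^ k)"
      by (intro summable_mult summable_geometric) simp
    then show ?thesis by (subst suminf_ennreal2) auto
  qed
  finally show "(\<integral>\<^sup>+\<omega>. ennreal (run_max N \<omega>) \<partial>M) < \<infinity>" .
qed measurable

lemma X_abs_le:
  assumes "\<omega> \<in> space M" "0 \<le> s" "s \<le> real N"
  shows "\<bar>X s \<omega>\<bar> \<le> inf_neg \<omega> + run_max N \<omega>"
  using X_le_run_max[OF assms] inf_neg_ge[OF assms(1,2)] inf_neg_nonneg[OF assms(1)] run_max_nonneg[OF assms(1), of N]
  by linarith

end

subsection \<open>Optional stopping\<close>

lemma downward_closed_eq_lessThan: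
  fixes S :: "nat set"
  assumes "finite S" and "\<And>i j. j \<in> S \<Longrightarrow> i \<le> j \<Longrightarrow> i \<in> S"
  shows "S = {..<card S}"
proof (cases "S = {}")
  case False
  have "S = {..Max S}"
    using Max_in[OF assms(1) False] assms(2)[of "Max S"] Max_ge[OF assms(1)] by auto
  then show ?thesis by (metis card_atMost lessThan_Suc_atMost)
qed simp

context snlp
begin

text \<open>Strict inequality: these are the optional times of \<open>past\<close>, that is, the
  stopping times of its right-continuous enlargement.\<close>

definition random_time :: "('a \<Rightarrow> ennreal) \<Rightarrow> bool" where
  "random_time \<tau> \<longleftrightarrow> (\<forall>t>0. {\<omega>\<in>space M. \<tau> \<omega> < ennreal t} \<in> sets (past t))"

definition trunc :: "('a \<Rightarrow> ennreal) \<Rightarrow> nat \<Rightarrow> 'a \<Rightarrow> real" where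
  "trunc \<tau> N \<omega> = enn2real (min (\<tau> \<omega>) (ennreal (real N)))"

text \<open>Counts the grid steps that begin no later than \<open>\<tau>\<close>. So
  \<open>j < round_count\<close> is, below the horizon, the event that \<open>\<tau>\<close> is at
  least the grid time \<open>j\<close>; it is the complement of a strict inequality and thus known
  at that time, and a stopped sum becomes a sum with such indicators as weights.\<close>

definition round_count :: "('a \<Rightarrow> ennreal) \<Rightarrow> nat \<Rightarrow> nat \<Rightarrow> 'a \<Rightarrow> nat" where
  "round_count \<tau> N n \<omega> = card {j. j < N * 2 ^ n \<and> ennreal (real j * mesh n) \<le> \<tau> \<omega>}"

definition round_up :: "('a \<Rightarrow> ennreal) \<Rightarrow> nat \<Rightarrow> nat \<Rightarrow> 'a \<Rightarrow> real" where
  "round_up \<tau> N n \<omega> = real (round_count \<tau> N n \<omega>) * mesh n"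

lemma ennreal_trunc: "ennreal (trunc \<tau> N \<omega>) = min (\<tau> \<omega>) (ennreal (real N))"
proof -
  have "min (\<tau> \<omega>) (ennreal (real N)) < top" by (simp add: min_less_iff_disj)
  then show ?thesis unfolding trunc_def by simp
qed

lemma trunc_nonneg: "0 \<le> trunc \<tau> N \<omega>" unfolding trunc_def by simp

lemma trunc_le: "trunc \<tau> N \<omega> \<le> real N"
proof -
  have "ennreal (trunc \<tau> N \<omega>) \<le> ennreal (real N)" unfolding ennreal_trunc by simp
  then show ?thesis by simp
qed

lemma round_count_iff: "j < round_count \<tau> N n \<omega> \<longleftrightarrow> j < N * 2 ^ n \<and> ennreal (real j * mesh n) \<le> \<tau> \<omega>"
proof -
  have "{j. j < N * 2 ^ n \<and> ennreal (real j * mesh n) \<le> \<tau> \<omega>} = {..<round_count \<tau> N n \<omega>}"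
    unfolding round_count_def
  proof (rule downward_closed_eq_lessThan)
    fix i j assume "j \<in> {j. j < N * 2 ^ n \<and> ennreal (real j * mesh n) \<le> \<tau> \<omega>}" "i \<le> j"
    then have j: "j < N * 2 ^ n" "ennreal (real j * mesh n) \<le> \<tau> \<omega>" by auto
    have "ennreal (real i * mesh n) \<le> ennreal (real j * mesh n)"
      using \<open>i \<le> j\<close> by (intro ennreal_leI mult_right_mono) auto
    then show "i \<in> {j. j < N * 2 ^ n \<and> ennreal (real j * mesh n) \<le> \<tau> \<omega>}"
      using j \<open>i \<le> j\<close> order_trans[OF \<open>ennreal (real i * mesh n) \<le> _\<close> j(2)] by simp
  qed simp
  then show ?thesis by blast
qed

lemma round_count_iff_trunc:
  "j < round_count \<tau> N n \<omega> \<longleftrightarrow> j < N * 2 ^ n \<and> real j * mesh n \<le> trunc \<tau> N \<omega>"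
proof (cases "j < N * 2 ^ n")
  case True
  then have "real j < real (N * 2 ^ n)" by (simp only: of_nat_less_iff)
  then have "real j * mesh n \<le> real N" by (simp add: field_simps)
  then have N: "ennreal (real j * mesh n) \<le> ennreal (real N)" by (rule ennreal_leI)
  have "real j * mesh n \<le> trunc \<tau> N \<omega> \<longleftrightarrow> ennreal (real j * mesh n) \<le> ennreal (trunc \<tau> N \<omega>)"
    using trunc_nonneg by (simp add: ennreal_le_iff)
  also have "\<dots> \<longleftrightarrow> ennreal (real j * mesh n) \<le> \<tau> \<omega>" unfolding ennreal_trunc using N by (simp add: min_le_iff_disj)
  finally show ?thesis unfolding round_count_iff using True by simp
qed (simp add: round_count_iff)

lemma round_count_le: "round_count \<tau> N n \<omega> \<le> N * 2 ^ n"
  using round_count_iff[of "N * 2 ^ n" \<tau> N n \<omega>] by simp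

lemma round_up_nonneg: "0 \<le> round_up \<tau> N n \<omega>" unfolding round_up_def by simp

lemma round_up_le: "round_up \<tau> N n \<omega> \<le> real N"
proof -
  have "real (round_count \<tau> N n \<omega>) \<le> real (N * 2 ^ n)" using round_count_le by (simp only: of_nat_le_iff)
  then show ?thesis unfolding round_up_def by (simp add: field_simps)
qed

text \<open>A grid point equal to \<open>\<tau>\<close> is counted too, so rounding is strict except
  at the horizon. This is what lets right-continuity apply along the rounded times.\<close>

lemma round_up_cases: "round_up \<tau> N n \<omega> = real N \<or> trunc \<tau> N \<omega> < round_up \<tau> N n \<omega>"
proof (cases "round_count \<tau> N n \<omega> = N * 2 ^ n")
  case True then show ?thesis unfolding round_up_def by simp
next
  case False
  then have "round_count \<tau> N n \<omega> < N * 2 ^ n" using round_count_le[of \<tau> N n \<omega>] by simp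
  then show ?thesis
    using round_count_iff_trunc[of "round_count \<tau> N n \<omega>" \<tau> N n \<omega>] unfolding round_up_def by auto
qed

lemma round_up_ge: "trunc \<tau> N \<omega> \<le> round_up \<tau> N n \<omega>"
  using round_up_cases[of \<tau> N n \<omega>] trunc_le[of \<tau> N \<omega>] by auto

lemma round_up_le_trunc: "round_up \<tau> N n \<omega> \<le> trunc \<tau> N \<omega> + mesh n"
proof (cases "round_count \<tau> N n \<omega>")
  case 0 then show ?thesis unfolding round_up_def using trunc_nonneg by (simp add: add_nonneg_nonneg)
next
  case (Suc j)
  then have "real j * mesh n \<le> trunc \<tau> N \<omega>" using round_count_iff_trunc[of j \<tau> N n \<omega>] by simp
  moreover have "real (Suc j) * mesh n = real j * mesh n + mesh n" by (simp add: field_simps)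
  ultimately show ?thesis unfolding round_up_def Suc by linarith
qed

lemma round_up_tendsto: "(\<lambda>n. round_up \<tau> N n \<omega>) \<longlonglongrightarrow> trunc \<tau> N \<omega>"
proof (rule real_tendsto_sandwich[of "\<lambda>_. trunc \<tau> N \<omega>" _ _ "\<lambda>n. trunc \<tau> N \<omega> + mesh n"])
  show "(\<lambda>n. trunc \<tau> N \<omega> + mesh n) \<longlonglongrightarrow> trunc \<tau> N \<omega>"
    using tendsto_add[OF tendsto_const half_power_tendsto_0, of "trunc \<tau> N \<omega>"] by simp
qed (auto intro!: always_eventually round_up_ge round_up_le_trunc)

lemma X_round_up_tendsto:
  assumes "\<omega> \<in> space M"
  shows "(\<lambda>n. X (round_up \<tau> N n \<omega>) \<omega>) \<longlonglongrightarrow> X (trunc \<tau> N \<omega>) \<omega>"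
proof (cases "trunc \<tau> N \<omega> = real N")
  case True
  then have "round_up \<tau> N n \<omega> = trunc \<tau> N \<omega>" for n
    using round_up_le[of \<tau> N n \<omega>] round_up_ge[of \<tau> N \<omega> n] by simp
  then show ?thesis by simp
next
  case False
  then have "trunc \<tau> N \<omega> < round_up \<tau> N n \<omega>" for n
    using round_up_cases[of \<tau> N n \<omega>] trunc_le[of \<tau> N \<omega>] by auto
  then have "filterlim (\<lambda>n. round_up \<tau> N n \<omega>) (at_right (trunc \<tau> N \<omega>)) sequentially"
    using round_up_tendsto by (auto simp: filterlim_at intro!: always_eventually) (metis less_irrefl)
  moreover have "((\<lambda>t. X t \<omega>) \<longlongrightarrow> X (trunc \<tau> N \<omega>) \<omega>) (at_right (trunc \<tau> N \<omega>))"
    using X_cadlag[OF assms] trunc_nonneg unfolding cadlag_def by blast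
  ultimately show ?thesis by (rule filterlim_compose[rotated])
qed

lemma random_time_ge_sets:
  assumes "random_time \<tau>" "0 \<le> t"
  shows "{\<omega>\<in>space M. ennreal t \<le> \<tau> \<omega>} \<in> sets (past t)"
proof (cases "t = 0")
  case True
  then have "{\<omega>\<in>space M. ennreal t \<le> \<tau> \<omega>} = space (past t)" by auto
  then show ?thesis using sets.top by metis
next
  case False
  then have "{\<omega>\<in>space M. \<tau> \<omega> < ennreal t} \<in> sets (past t)" using assms unfolding random_time_def by auto
  then have "space (past t) - {\<omega>\<in>space M. \<tau> \<omega> < ennreal t} \<in> sets (past t)" by (rule sets.compl_sets)
  also have "space (past t) - {\<omega>\<in>space M. \<tau> \<omega> < ennreal t} = {\<omega>\<in>space M. ennreal t \<le> \<tau> \<omega>}" by auto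
  finally show ?thesis .
qed

definition stop_set :: "('a \<Rightarrow> ennreal) \<Rightarrow> nat \<Rightarrow> nat \<Rightarrow> 'a set" where
  "stop_set \<tau> n j = {\<omega>\<in>space M. ennreal (real j * mesh n) \<le> \<tau> \<omega>}"

lemma stop_set_past: "random_time \<tau> \<Longrightarrow> stop_set \<tau> n j \<in> sets (past (real j * mesh n))"
  unfolding stop_set_def by (rule random_time_ge_sets) simp_all

lemma stop_set_events: "random_time \<tau> \<Longrightarrow> stop_set \<tau> n j \<in> events"
  using stop_set_past sets_past_subset by blast

lemma round_count_sum:
  fixes h :: "nat \<Rightarrow> real"
  assumes "\<omega> \<in> space M"
  shows "(\<Sum>j<round_count \<tau> N n \<omega>. h j) = (\<Sum>j<N * 2 ^ n. indicator (stop_set \<tau> n j) \<omega> * h j)"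
proof -
  have "(\<Sum>j<round_count \<tau> N n \<omega>. h j) = (\<Sum>j\<in>{..<N * 2 ^ n} \<inter> {j. \<omega> \<in> stop_set \<tau> n j}. h j)"
    by (rule sum.cong) (use assms in \<open>auto simp: stop_set_def round_count_iff\<close>)
  also have "\<dots> = (\<Sum>j<N * 2 ^ n. if j \<in> {j. \<omega> \<in> stop_set \<tau> n j} then h j else 0)"
    by (rule sum.inter_restrict) simp
  also have "\<dots> = (\<Sum>j<N * 2 ^ n. indicator (stop_set \<tau> n j) \<omega> * h j)"
    by (rule sum.cong) (auto simp: indicator_def)
  finally show ?thesis .
qed

lemma round_up_measurable:
  assumes "random_time \<tau>"
  shows "round_up \<tau> N n \<in> borel_measurable M"
proof -
  have "round_up \<tau> N n \<omega> = (\<Sum>j<N * 2 ^ n. indicator (stop_set \<tau> n j) \<omega> * 1) * mesh n" if "\<omega> \<in> space M" for \<omega>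
    unfolding round_up_def round_count_sum[OF that, symmetric] by simp
  moreover have "(\<lambda>\<omega>. (\<Sum>j<N * 2 ^ n. indicator (stop_set \<tau> n j) \<omega> * 1) * mesh n) \<in> borel_measurable M"
    using stop_set_events[OF assms] by measurable
  ultimately show ?thesis by (subst measurable_cong) auto
qed

lemma trunc_measurable:
  assumes "random_time \<tau>"
  shows "trunc \<tau> N \<in> borel_measurable M"
  by (rule borel_measurable_LIMSEQ_real[OF round_up_tendsto round_up_measurable[OF assms]])

definition run_cost :: "(real \<Rightarrow> real) \<Rightarrow> real \<Rightarrow> real \<Rightarrow> 'a \<Rightarrow> real" where
  "run_cost b x t \<omega> = (LINT s:{0..<t}|lborel. b (x + traj s \<omega>))"

lemma bounded_traj_set_integrable:
  fixes b :: "real \<Rightarrow> real"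
  assumes [measurable]: "b \<in> borel_measurable borel" and C: "\<And>y. \<bar>b y\<bar> \<le> C" and w: "\<omega> \<in> space M"
    and A: "A \<in> sets lborel" "emeasure lborel A < \<infinity>"
  shows "set_integrable lborel A (\<lambda>s. b (x + traj s \<omega>))"
proof -
  have [measurable]: "(\<lambda>s. traj s \<omega>) \<in> borel_measurable lborel"
    by (rule traj_measurable) (use w in auto)
  show ?thesis
    unfolding set_integrable_def
  proof (rule Bochner_Integration.integrable_bound[of _ "\<lambda>s. C * indicator A s"])
    show "integrable lborel (\<lambda>s. C * indicator A s)"
      using A by (intro integrable_mult_right integrable_real_indicator)
    show "AE s in lborel. norm (indicator A s *\<^sub>R b (x + traj s \<omega>)) \<le> norm (C * indicator A s)"
      using C by (intro AE_I2) (auto simp: indicator_def intro: order_trans[OF _ abs_ge_self])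
    show "(\<lambda>s. indicator A s *\<^sub>R b (x + traj s \<omega>)) \<in> borel_measurable lborel"
      using A(1) by measurable
  qed
qed

lemma run_cost_split:
  fixes b :: "real \<Rightarrow> real"
  assumes "b \<in> borel_measurable borel" "\<And>y. \<bar>b y\<bar> \<le> C" "\<omega> \<in> space M" "0 \<le> t" "t \<le> t'"
  shows "run_cost b x t' \<omega> = run_cost b x t \<omega> + (LINT s:{t..<t'}|lborel. b (x + traj s \<omega>))"
proof -
  have "{0..<t'} = {0..<t} \<union> {t..<t'}" using assms by auto
  then show ?thesis
    unfolding run_cost_def using assms
    by (simp only:) (rule set_integral_Un, auto intro!: bounded_traj_set_integrable)
qed

lemma traj_set_integral_le:
  fixes b :: "real \<Rightarrow> real"
  assumes "b \<in> borel_measurable borel" "\<And>y. \<bar>b y\<bar> \<le> C" "\<omega> \<in> space M" "t \<le> t'"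
  shows "\<bar>LINT s:{t..<t'}|lborel. b (x + traj s \<omega>)\<bar> \<le> C * (t' - t)"
proof -
  have i: "integrable lborel (\<lambda>s. indicator {t..<t'} s *\<^sub>R b (x + traj s \<omega>))"
    using bounded_traj_set_integrable[OF assms(1-3), of "{t..<t'}" x] assms(4) unfolding set_integrable_def by simp
  have "\<bar>LINT s:{t..<t'}|lborel. b (x + traj s \<omega>)\<bar> \<le> (\<integral>s. \<bar>indicator {t..<t'} s *\<^sub>R b (x + traj s \<omega>)\<bar> \<partial>lborel)"
    unfolding set_lebesgue_integral_def
    using integral_norm_bound[of lborel "\<lambda>s. indicator {t..<t'} s *\<^sub>R b (x + traj s \<omega>)"] by simp
  also have "\<dots> \<le> (\<integral>s. C * indicator {t..<t'} s \<partial>lborel)"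
  proof (rule integral_mono)
    show "integrable lborel (\<lambda>s. C * indicator {t..<t'} s)"
      using assms(4) by (intro integrable_mult_right integrable_real_indicator) auto
  qed (use i assms(2) in \<open>auto simp: indicator_def\<close>)
  also have "\<dots> = C * (t' - t)" using assms(4) by simp
  finally show ?thesis .
qed

lemma run_cost_measurable:
  fixes b :: "real \<Rightarrow> real"
  assumes [measurable]: "b \<in> borel_measurable borel" "T \<in> borel_measurable M"
  shows "(\<lambda>\<omega>. run_cost b x (T \<omega>) \<omega>) \<in> borel_measurable M"
proof -
  have "(\<lambda>\<omega>. \<integral>s. (if 0 \<le> s \<and> s < T \<omega> then b (x + traj s \<omega>) else 0) \<partial>lborel) \<in> borel_measurable M"
    by measurable
  moreover have "run_cost b x (T \<omega>) \<omega> = (\<integral>s. (if 0 \<le> s \<and> s < T \<omega> then b (x + traj s \<omega>) else 0) \<partial>lborel)" for \<omega>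
    unfolding run_cost_def set_lebesgue_integral_def
    by (rule Bochner_Integration.integral_cong) (auto simp: indicator_def)
  ultimately show ?thesis by simp
qed

lemma run_cost_bound:
  fixes b :: "real \<Rightarrow> real"
  assumes "b \<in> borel_measurable borel" "\<And>y. \<bar>b y\<bar> \<le> C" "\<omega> \<in> space M" "0 \<le> t"
  shows "\<bar>run_cost b x t \<omega>\<bar> \<le> C * t"
  using traj_set_integral_le[OF assms(1-4), of x] unfolding run_cost_def by simp

lemma fubini_time:
  fixes h :: "'a \<Rightarrow> real \<Rightarrow> real"
  assumes [measurable]: "(\<lambda>p. h (fst p) (snd p)) \<in> borel_measurable (M \<Otimes>\<^sub>M lborel)"
    and C: "\<And>\<omega> s. \<omega> \<in> space M \<Longrightarrow> \<bar>h \<omega> s\<bar> \<le> C" and "0 \<le> d"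
  shows "(\<integral>\<omega>. (LINT s:{0..<d}|lborel. h \<omega> s) \<partial>M) = (LINT s:{0..<d}|lborel. (\<integral>\<omega>. h \<omega> s \<partial>M))"
    and "integrable M (\<lambda>\<omega>. (LINT s:{0..<d}|lborel. h \<omega> s))"
proof -
  interpret Q: pair_sigma_finite M lborel by unfold_locales
  have i: "integrable (M \<Otimes>\<^sub>M lborel) (\<lambda>(\<omega>, s). indicator {0..<d} s * h \<omega> s)"
  proof (rule Bochner_Integration.integrable_bound[of _ "\<lambda>p. C * indicator (space M \<times> {0..<d}) p :: real"])
    have "emeasure (M \<Otimes>\<^sub>M lborel) (space M \<times> {0..<d}) < \<infinity>"
      using \<open>0 \<le> d\<close> by (subst lborel.emeasure_pair_measure_Times) (auto simp: emeasure_space_1)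
    then show "integrable (M \<Otimes>\<^sub>M lborel) (\<lambda>p. C * indicator (space M \<times> {0..<d}) p :: real)"
      by (intro integrable_mult_right integrable_real_indicator) auto
    show "AE p in M \<Otimes>\<^sub>M lborel. norm (case p of (\<omega>, s) \<Rightarrow> indicator {0..<d} s * h \<omega> s) \<le> norm (C * indicator (space M \<times> {0..<d}) p :: real)"
    proof (rule AE_I2)
      fix p :: "'a \<times> real" assume p: "p \<in> space (M \<Otimes>\<^sub>M lborel)"
      then have "\<bar>h (fst p) (snd p)\<bar> \<le> \<bar>C\<bar>" using C[of "fst p" "snd p"] by (auto simp: space_pair_measure)
      then show "norm (case p of (\<omega>, s) \<Rightarrow> indicator {0..<d} s * h \<omega> s) \<le> norm (C * indicator (space M \<times> {0..<d}) p :: real)"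
        using p by (auto simp: case_prod_beta space_pair_measure indicator_def)
    qed
  qed (simp add: case_prod_beta)
  have "(\<integral>s. \<integral>\<omega>. indicator {0..<d} s * h \<omega> s \<partial>M \<partial>lborel) = (\<integral>\<omega>. \<integral>s. indicator {0..<d} s * h \<omega> s \<partial>lborel \<partial>M)"
    by (rule Q.Fubini_integral[OF i])
  then show "(\<integral>\<omega>. (LINT s:{0..<d}|lborel. h \<omega> s) \<partial>M) = (LINT s:{0..<d}|lborel. (\<integral>\<omega>. h \<omega> s \<partial>M))"
    unfolding set_lebesgue_integral_def by simp
  show "integrable M (\<lambda>\<omega>. (LINT s:{0..<d}|lborel. h \<omega> s))"
    unfolding set_lebesgue_integral_def using Q.integrable_fst'[OF i] by simp
qed

lemma run_cost_round_up:
  fixes b :: "real \<Rightarrow> real"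
  assumes "b \<in> borel_measurable borel" "\<And>y. \<bar>b y\<bar> \<le> C" "\<omega> \<in> space M"
  shows "run_cost b x (real k * mesh n) \<omega> = (\<Sum>j<k. LINT s:{0..<mesh n}|lborel. b (x + traj (real j * mesh n + s) \<omega>))"
proof (induction k)
  case 0 then show ?case unfolding run_cost_def set_lebesgue_integral_def by simp
next
  case (Suc k)
  let ?a = "real k * mesh n"
  have Suc_eq: "real (Suc k) * mesh n = ?a + mesh n" by (simp add: field_simps)
  have "run_cost b x (real (Suc k) * mesh n) \<omega> = run_cost b x ?a \<omega> + (LINT s:{?a..<?a + mesh n}|lborel. b (x + traj s \<omega>))"
    unfolding Suc_eq by (rule run_cost_split[OF assms]) auto
  also have "(LINT s:{?a..<?a + mesh n}|lborel. b (x + traj s \<omega>)) = (LINT s:{0..<mesh n}|lborel. b (x + traj (?a + s) \<omega>))"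
    unfolding set_lebesgue_integral_def
    by (subst lborel_integral_real_affine[of 1 _ ?a]) (auto simp: indicator_def intro!: Bochner_Integration.integral_cong)
  finally show ?case using Suc by simp
qed

end

context snlp_exp
begin

text \<open>The generator in integrated form, Dynkin's formula over one mesh interval, so no domain
  or derivative is involved. A single constant controls the linear growth of \<open>f\<close> and
  the size of \<open>b\<close>.\<close>

definition has_generator :: "(real \<Rightarrow> real) \<Rightarrow> (real \<Rightarrow> real) \<Rightarrow> real \<Rightarrow> bool" where
  "has_generator f b C \<longleftrightarrow> (\<forall>y. isCont f y) \<and> b \<in> borel_measurable borel \<and>
     (\<forall>y. \<bar>f y\<bar> \<le> C * (1 + \<bar>y\<bar>)) \<and> (\<forall>y. \<bar>b y\<bar> \<le> C) \<and>
     (\<forall>k x. (\<integral>\<omega>. f (x + X (mesh k) \<omega>) \<partial>M) - f x = (LINT s:{0..<mesh k}|lborel. \<integral>\<omega>. b (x + traj s \<omega>) \<partial>M))"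

text \<open>Both sides reduce, by the Markov property at the grid time, to the same mean over the
  position there: the left one through the defining identity, the right one at each time
  \<open>s\<close> separately after Fubini.\<close>

lemma generator_step:
  assumes gen: "has_generator f b C" and A: "A \<in> sets (past (real j * mesh n))"
  shows "integrable M (\<lambda>\<omega>. indicator A \<omega> * (f (x + X (real (Suc j) * mesh n) \<omega>) - f (x + X (real j * mesh n) \<omega>)))"
    and "integrable M (\<lambda>\<omega>. indicator A \<omega> * (LINT s:{0..<mesh n}|lborel. b (x + traj (real j * mesh n + s) \<omega>)))"
    and "(\<integral>\<omega>. indicator A \<omega> * (f (x + X (real (Suc j) * mesh n) \<omega>) - f (x + X (real j * mesh n) \<omega>)) \<partial>M)
      = (\<integral>\<omega>. indicator A \<omega> * (LINT s:{0..<mesh n}|lborel. b (x + traj (real j * mesh n + s) \<omega>)) \<partial>M)"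
proof -
  let ?g = "\<lambda>s \<omega>. \<integral>\<omega>'. b (x + X (real j * mesh n) \<omega> + traj s \<omega>') \<partial>M"
  let ?t = "real j * mesh n" and ?d = "mesh n"
  have bm [measurable]: "b \<in> borel_measurable borel" and fC: "\<And>y. \<bar>f y\<bar> \<le> C * (1 + \<bar>y\<bar>)" and bC: "\<And>y. \<bar>b y\<bar> \<le> C"
    and ident: "\<And>x. (\<integral>\<omega>. f (x + X ?d \<omega>) \<partial>M) - f x = (LINT s:{0..<?d}|lborel. \<integral>\<omega>. b (x + traj s \<omega>) \<partial>M)"
    and cont: "\<And>y. isCont f y"
    using gen unfolding has_generator_def by auto
  have fm [measurable]: "f \<in> borel_measurable borel"
    by (rule borel_measurable_continuous_onI) (simp add: continuous_at_imp_continuous_on cont)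
  have C0: "0 \<le> C" using bC[of 0] by linarith
  have Am [measurable]: "A \<in> events" using A sets_past_subset by blast
  have t0: "0 \<le> ?t" by simp
  have Suc_eq: "real (Suc j) * ?d = ?t + ?d" by (simp add: field_simps)
  have fint: "integrable M (\<lambda>\<omega>. f (x + X (real k * mesh i) \<omega>))" for x k i
  proof (rule Bochner_Integration.integrable_bound[of _ "\<lambda>\<omega>. C * (1 + \<bar>x\<bar> + \<bar>X (real k * mesh i) \<omega>\<bar>)"])
    have [measurable]: "X (real k * mesh i) \<in> borel_measurable M" by (rule X_measurable) simp
    show "(\<lambda>\<omega>. f (x + X (real k * mesh i) \<omega>)) \<in> borel_measurable M" by measurable
    show "AE \<omega> in M. norm (f (x + X (real k * mesh i) \<omega>)) \<le> norm (C * (1 + \<bar>x\<bar> + \<bar>X (real k * mesh i) \<omega>\<bar>))"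
    proof (rule AE_I2)
      fix \<omega>
      have "norm (f (x + X (real k * mesh i) \<omega>)) \<le> C * (1 + \<bar>x + X (real k * mesh i) \<omega>\<bar>)" using fC by simp
      also have "\<dots> \<le> C * (1 + \<bar>x\<bar> + \<bar>X (real k * mesh i) \<omega>\<bar>)" using C0 by (intro mult_left_mono) auto
      also have "\<dots> \<le> norm (C * (1 + \<bar>x\<bar> + \<bar>X (real k * mesh i) \<omega>\<bar>))" by simp
      finally show "norm (f (x + X (real k * mesh i) \<omega>)) \<le> norm (C * (1 + \<bar>x\<bar> + \<bar>X (real k * mesh i) \<omega>\<bar>))" .
    qed
  qed (use X_integrable[of k i] in auto)
  have indint: "integrable M (\<lambda>\<omega>. indicator A \<omega> * h \<omega>)" if "integrable M h" for h :: "'a \<Rightarrow> real"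
    using integrable_mult_indicator[OF Am that] by simp
  show i1: "integrable M (\<lambda>\<omega>. indicator A \<omega> * (f (x + X (real (Suc j) * ?d) \<omega>) - f (x + X ?t \<omega>)))"
    by (intro indint Bochner_Integration.integrable_diff fint)
  have X_t [measurable]: "X ?t \<in> borel_measurable M" by (rule X_measurable[OF t0])
  have U: "(\<lambda>\<omega>. (indicator A \<omega> :: real, X ?t \<omega>)) \<in> past ?t \<rightarrow>\<^sub>M borel \<Otimes>\<^sub>M borel"
    using A X_measurable_past[of ?t ?t] by (intro measurable_Pair borel_measurable_indicator) auto
  let ?c = "\<lambda>y. LINT s:{0..<?d}|lborel. \<integral>\<omega>. b (y + traj s \<omega>) \<partial>M"
  let ?F = "\<lambda>p. fst (fst p) * (f (x + snd (fst p) + snd p) - f (x + snd (fst p)))"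
  have "(\<integral>\<omega>. indicator A \<omega> * (f (x + X (real (Suc j) * ?d) \<omega>) - f (x + X ?t \<omega>)) \<partial>M)
      = (\<integral>\<omega>. ?F ((indicator A \<omega>, X ?t \<omega>), X (?t + ?d) \<omega> - X ?t \<omega>) \<partial>M)"
    unfolding Suc_eq by simp
  also have "\<dots> = (\<integral>\<omega>. \<integral>\<omega>'. ?F ((indicator A \<omega>, X ?t \<omega>), X ?d \<omega>') \<partial>M \<partial>M)"
    by (rule markov_integral[OF U t0]) (use i1[unfolded Suc_eq] in simp_all)
  also have "\<dots> = (\<integral>\<omega>. indicator A \<omega> * ?c (x + X ?t \<omega>) \<partial>M)"
  proof (rule Bochner_Integration.integral_cong[OF refl])
    fix \<omega>
    have "integrable M (\<lambda>\<omega>'. f (x + X ?t \<omega> + X ?d \<omega>'))" using fint[of "x + X ?t \<omega>" 1 n] by simp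
    then show "(\<integral>\<omega>'. ?F ((indicator A \<omega>, X ?t \<omega>), X ?d \<omega>') \<partial>M) = indicator A \<omega> * ?c (x + X ?t \<omega>)"
      unfolding ident[symmetric] by (simp add: prob_space)
  qed
  also have "\<dots> = (\<integral>\<omega>. (LINT s:{0..<?d}|lborel. indicator A \<omega> * ?g s \<omega>) \<partial>M)"
    by simp
  also have "\<dots> = (LINT s:{0..<?d}|lborel. (\<integral>\<omega>. indicator A \<omega> * ?g s \<omega> \<partial>M))"
  proof (rule fubini_time[of _ C])
    show "\<bar>indicator A \<omega> * ?g s \<omega>\<bar> \<le> C" for \<omega> s
    proof -
      have "\<bar>?g s \<omega>\<bar> \<le> (\<integral>\<omega>'. \<bar>b (x + X ?t \<omega> + traj s \<omega>')\<bar> \<partial>M)"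
        using integral_norm_bound[of M "\<lambda>\<omega>'. b (x + X ?t \<omega> + traj s \<omega>')"] by simp
      also have "\<dots> \<le> (\<integral>\<omega>'. C \<partial>M)"
        by (rule integral_mono) (use bC in \<open>auto intro!: integrable_const_bound[of _ C]\<close>)
      finally have "\<bar>?g s \<omega>\<bar> \<le> C" by (simp add: prob_space)
      then show ?thesis using C0 by (auto simp: indicator_def abs_mult)
    qed
    show "(\<lambda>p. indicator A (fst p) * (\<integral>\<omega>'. b (x + X ?t (fst p) + traj (snd p) \<omega>') \<partial>M)) \<in> borel_measurable (M \<Otimes>\<^sub>M lborel)"
      by measurable
  qed simp
  also have "\<dots> = (LINT s:{0..<?d}|lborel. (\<integral>\<omega>. indicator A \<omega> * b (x + traj (?t + s) \<omega>) \<partial>M))"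
  proof (rule set_lebesgue_integral_cong)
    show "\<forall>s. s \<in> {0..<?d} \<longrightarrow> (\<integral>\<omega>. indicator A \<omega> * ?g s \<omega> \<partial>M)
        = (\<integral>\<omega>. indicator A \<omega> * b (x + traj (?t + s) \<omega>) \<partial>M)"
    proof (intro allI impI)
      fix s assume "s \<in> {0..<?d}"
      then have s: "0 \<le> s" by simp
      let ?B = "\<lambda>p. fst (fst p) * b (x + snd (fst p) + snd p)"
      have [measurable]: "X s \<in> borel_measurable M" "X (?t + s) \<in> borel_measurable M" using s by (auto intro!: X_measurable)
      have "(\<integral>\<omega>. ?B ((indicator A \<omega>, X ?t \<omega>), X (?t + s) \<omega> - X ?t \<omega>) \<partial>M)
          = (\<integral>\<omega>. \<integral>\<omega>'. ?B ((indicator A \<omega>, X ?t \<omega>), X s \<omega>') \<partial>M \<partial>M)"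
      proof (rule markov_integral[OF U t0 s])
        show "integrable M (\<lambda>\<omega>. ?B ((indicator A \<omega>, X ?t \<omega>), X (?t + s) \<omega> - X ?t \<omega>))"
        proof (rule integrable_const_bound[of _ C])
          show "AE \<omega> in M. norm (?B ((indicator A \<omega>, X ?t \<omega>), X (?t + s) \<omega> - X ?t \<omega>)) \<le> C"
            using bC C0 by (intro AE_I2) (auto simp: abs_mult indicator_def)
        qed measurable
      qed measurable
      then show "(\<integral>\<omega>. indicator A \<omega> * ?g s \<omega> \<partial>M)
        = (\<integral>\<omega>. indicator A \<omega> * b (x + traj (?t + s) \<omega>) \<partial>M)"
        using s t0 by (simp add: traj_eq add_nonneg_nonneg)
    qed
  qed simp
  also have "\<dots> = (\<integral>\<omega>. (LINT s:{0..<?d}|lborel. indicator A \<omega> * b (x + traj (?t + s) \<omega>)) \<partial>M)"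
    by (rule fubini_time(1)[symmetric, of _ C]) (use bC C0 in \<open>auto simp: abs_mult indicator_def\<close>)
  finally show "(\<integral>\<omega>. indicator A \<omega> * (f (x + X (real (Suc j) * ?d) \<omega>) - f (x + X ?t \<omega>)) \<partial>M)
      = (\<integral>\<omega>. indicator A \<omega> * (LINT s:{0..<?d}|lborel. b (x + traj (?t + s) \<omega>)) \<partial>M)"
    by simp
  have "integrable M (\<lambda>\<omega>. LINT s:{0..<?d}|lborel. b (x + traj (?t + s) \<omega>))"
    by (rule fubini_time(2)[of _ C]) (use bC in auto)
  then show "integrable M (\<lambda>\<omega>. indicator A \<omega> * (LINT s:{0..<?d}|lborel. b (x + traj (?t + s) \<omega>)))"
    by (rule indint)
qed

text \<open>The increments of \<open>f\<close> along the grid and the costs per mesh interval are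
  summed with the same weights \<open>stop_set\<close>, each of which belongs to the past of its
  step.\<close>

lemma discrete_dynkin:
  assumes gen: "has_generator f b C" and \<tau>: "random_time \<tau>"
  shows "(\<integral>\<omega>. f (x + X (round_up \<tau> N n \<omega>) \<omega>) \<partial>M) - f x = (\<integral>\<omega>. run_cost b x (round_up \<tau> N n \<omega>) \<omega> \<partial>M)"
    and "integrable M (\<lambda>\<omega>. f (x + X (round_up \<tau> N n \<omega>) \<omega>))"
proof -
  let ?R = "round_up \<tau> N n"
  have bm: "b \<in> borel_measurable borel" and bC: "\<And>y. \<bar>b y\<bar> \<le> C"
    using gen unfolding has_generator_def by auto
  let ?A = "stop_set \<tau> n" and ?J = "N * 2 ^ n"
  let ?f = "\<lambda>j \<omega>. indicator (?A j) \<omega> * (f (x + X (real (Suc j) * mesh n) \<omega>) - f (x + X (real j * mesh n) \<omega>))"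
  let ?b = "\<lambda>j \<omega>. indicator (?A j) \<omega> * (LINT s:{0..<mesh n}|lborel. b (x + traj (real j * mesh n + s) \<omega>))"
  note step = generator_step[OF gen stop_set_past[OF \<tau>], where x=x]
  have 1: "f (x + X (?R \<omega>) \<omega>) = f x + (\<Sum>j<?J. ?f j \<omega>)" if w: "\<omega> \<in> space M" for \<omega>
  proof -
    have "(\<Sum>j<?J. ?f j \<omega>) = (\<Sum>j<round_count \<tau> N n \<omega>. f (x + X (real (Suc j) * mesh n) \<omega>) - f (x + X (real j * mesh n) \<omega>))"
      by (rule round_count_sum[OF w, symmetric])
    also have "\<dots> = f (x + X (real (round_count \<tau> N n \<omega>) * mesh n) \<omega>) - f (x + X (real 0 * mesh n) \<omega>)"
      by (rule sum_lessThan_telescope)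
    finally show ?thesis unfolding round_up_def using X_0[OF w] by simp
  qed
  have 2: "run_cost b x (?R \<omega>) \<omega> = (\<Sum>j<?J. ?b j \<omega>)" if w: "\<omega> \<in> space M" for \<omega>
    unfolding round_up_def run_cost_round_up[OF bm bC w] by (rule round_count_sum[OF w])
  have "integrable M (\<lambda>\<omega>. f x + (\<Sum>j<?J. ?f j \<omega>))"
    by (intro Bochner_Integration.integrable_add Bochner_Integration.integrable_sum step) simp
  then show "integrable M (\<lambda>\<omega>. f (x + X (?R \<omega>) \<omega>))"
    by (subst Bochner_Integration.integrable_cong[OF refl 1])
  have "(\<integral>\<omega>. f (x + X (?R \<omega>) \<omega>) \<partial>M) = (\<integral>\<omega>. f x + (\<Sum>j<?J. ?f j \<omega>) \<partial>M)"
    by (rule Bochner_Integration.integral_cong[OF refl 1])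
  also have "\<dots> = f x + (\<Sum>j<?J. \<integral>\<omega>. ?f j \<omega> \<partial>M)"
  proof -
    have "integrable M (\<lambda>\<omega>. \<Sum>j<?J. ?f j \<omega>)" by (intro Bochner_Integration.integrable_sum step)
    then have "(\<integral>\<omega>. f x + (\<Sum>j<?J. ?f j \<omega>) \<partial>M) = f x + (\<integral>\<omega>. (\<Sum>j<?J. ?f j \<omega>) \<partial>M)"
      by (subst Bochner_Integration.integral_add) (simp_all add: prob_space)
    then show ?thesis by (subst (asm) Bochner_Integration.integral_sum) (rule step(1))
  qed
  also have "(\<Sum>j<?J. \<integral>\<omega>. ?f j \<omega> \<partial>M) = (\<Sum>j<?J. \<integral>\<omega>. ?b j \<omega> \<partial>M)"
    using step(3) by simp
  also have "\<dots> = (\<integral>\<omega>. (\<Sum>j<?J. ?b j \<omega>) \<partial>M)"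
    by (rule Bochner_Integration.integral_sum[symmetric]) (rule step(2))
  also have "\<dots> = (\<integral>\<omega>. run_cost b x (?R \<omega>) \<omega> \<partial>M)"
    by (rule Bochner_Integration.integral_cong[OF refl 2[symmetric]])
  finally show "(\<integral>\<omega>. f (x + X (?R \<omega>) \<omega>) \<partial>M) - f x = (\<integral>\<omega>. run_cost b x (?R \<omega>) \<omega> \<partial>M)"
    by simp
qed

lemma X_trunc_measurable:
  assumes "random_time \<tau>"
  shows "(\<lambda>\<omega>. X (trunc \<tau> N \<omega>) \<omega>) \<in> borel_measurable M"
proof -
  have [measurable]: "trunc \<tau> N \<in> borel_measurable M" using assms by (rule trunc_measurable)
  have "(\<lambda>\<omega>. traj (trunc \<tau> N \<omega>) \<omega>) \<in> borel_measurable M" by measurable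
  then show ?thesis by (simp add: traj_eq trunc_nonneg)
qed

text \<open>The rounded times decrease to the truncated time. The values of \<open>f\<close>
  converge by right-continuity under the bound by \<open>inf_neg\<close> and \<open>run_max\<close>;
  the costs differ by at most \<open>C\<close> times the mesh.\<close>

lemma optional_stopping:
  assumes gen: "has_generator f b C" and \<tau>: "random_time \<tau>"
  shows "(\<integral>\<omega>. f (x + X (trunc \<tau> N \<omega>) \<omega>) \<partial>M) - f x = (\<integral>\<omega>. run_cost b x (trunc \<tau> N \<omega>) \<omega> \<partial>M)"
    and "integrable M (\<lambda>\<omega>. f (x + X (trunc \<tau> N \<omega>) \<omega>))"
    and "integrable M (\<lambda>\<omega>. run_cost b x (trunc \<tau> N \<omega>) \<omega>)"
proof -
  let ?R = "round_up \<tau> N" and ?T = "trunc \<tau> N"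
  have bm [measurable]: "b \<in> borel_measurable borel" and bC: "\<And>y. \<bar>b y\<bar> \<le> C" and fC: "\<And>y. \<bar>f y\<bar> \<le> C * (1 + \<bar>y\<bar>)"
    and cont: "\<And>y. isCont f y"
    using gen unfolding has_generator_def by auto
  have C0: "0 \<le> C" using bC[of 0] by linarith
  have fm [measurable]: "f \<in> borel_measurable borel"
    by (rule borel_measurable_continuous_onI) (simp add: continuous_at_imp_continuous_on cont)
  have Xm [measurable]: "(\<lambda>\<omega>. X (?T \<omega>) \<omega>) \<in> borel_measurable M" using \<tau> by (rule X_trunc_measurable)
  let ?w = "\<lambda>\<omega>. C * (1 + \<bar>x\<bar> + (inf_neg \<omega> + run_max N \<omega>))"
  have wi: "integrable M ?w"
    using inf_neg_integrable run_max_integrable[of N] by auto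
  have fw: "norm (f (x + X t \<omega>)) \<le> ?w \<omega>" if "\<omega> \<in> space M" "0 \<le> t" "t \<le> real N" for t \<omega>
  proof -
    have "norm (f (x + X t \<omega>)) \<le> C * (1 + \<bar>x + X t \<omega>\<bar>)" using fC by simp
    also have "\<dots> \<le> ?w \<omega>" using C0 X_abs_le[OF that] by (intro mult_left_mono) auto
    finally show ?thesis .
  qed
  have l1: "(\<lambda>n. \<integral>\<omega>. f (x + X (?R n \<omega>) \<omega>) \<partial>M) \<longlonglongrightarrow> (\<integral>\<omega>. f (x + X (?T \<omega>) \<omega>) \<partial>M)"
  proof (rule integral_dominated_convergence[where w="?w"])
    show "AE \<omega> in M. (\<lambda>n. f (x + X (?R n \<omega>) \<omega>)) \<longlonglongrightarrow> f (x + X (?T \<omega>) \<omega>)"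
      by (intro AE_I2 isCont_tendsto_compose[OF cont] tendsto_add tendsto_const X_round_up_tendsto)
    show "AE \<omega> in M. norm (f (x + X (?R n \<omega>) \<omega>)) \<le> ?w \<omega>" for n
      by (intro AE_I2 fw round_up_nonneg round_up_le)
    show "(\<lambda>\<omega>. f (x + X (?R n \<omega>) \<omega>)) \<in> borel_measurable M" for n
      using discrete_dynkin(2)[OF gen \<tau>] by (rule borel_measurable_integrable)
  qed (use wi in auto)
  show "integrable M (\<lambda>\<omega>. f (x + X (?T \<omega>) \<omega>))"
  proof (rule Bochner_Integration.integrable_bound[OF wi])
    show "AE \<omega> in M. norm (f (x + X (?T \<omega>) \<omega>)) \<le> norm (?w \<omega>)"
      using fw trunc_nonneg trunc_le by (intro AE_I2) (auto intro: order_trans[OF _ abs_ge_self])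
  qed measurable
  have rm: "(\<lambda>\<omega>. run_cost b x (?T \<omega>) \<omega>) \<in> borel_measurable M"
    by (rule run_cost_measurable[OF bm trunc_measurable[OF \<tau>]])
  have rb: "\<bar>run_cost b x t \<omega>\<bar> \<le> C * real N" if "\<omega> \<in> space M" "0 \<le> t" "t \<le> real N" for t \<omega>
    using run_cost_bound[OF bm bC that(1,2), of x] mult_left_mono[OF that(3) C0] by linarith
  have l2: "(\<lambda>n. \<integral>\<omega>. run_cost b x (?R n \<omega>) \<omega> \<partial>M) \<longlonglongrightarrow> (\<integral>\<omega>. run_cost b x (?T \<omega>) \<omega> \<partial>M)"
  proof (rule integral_dominated_convergence[where w="\<lambda>_. C * real N"])
    show "AE \<omega> in M. (\<lambda>n. run_cost b x (?R n \<omega>) \<omega>) \<longlonglongrightarrow> run_cost b x (?T \<omega>) \<omega>"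
    proof (rule AE_I2)
      fix \<omega> assume w: "\<omega> \<in> space M"
      have "(\<lambda>n. run_cost b x (?R n \<omega>) \<omega> - run_cost b x (?T \<omega>) \<omega>) \<longlonglongrightarrow> 0"
      proof (rule tendsto_rabs_zero_cancel, rule real_tendsto_sandwich[of "\<lambda>_. 0" _ _ "\<lambda>n. C * mesh n"])
        show "\<forall>\<^sub>F n in sequentially. \<bar>run_cost b x (?R n \<omega>) \<omega> - run_cost b x (?T \<omega>) \<omega>\<bar> \<le> C * mesh n"
        proof (rule always_eventually, rule allI)
          fix n
          have "run_cost b x (?R n \<omega>) \<omega> - run_cost b x (?T \<omega>) \<omega>
              = (LINT s:{?T \<omega>..<?R n \<omega>}|lborel. b (x + traj s \<omega>))"
            using run_cost_split[OF bm bC w trunc_nonneg round_up_ge, of x \<tau> N n] by simp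
          also have "\<bar>\<dots>\<bar> \<le> C * (?R n \<omega> - ?T \<omega>)"
            by (rule traj_set_integral_le[OF bm bC w round_up_ge])
          also have "\<dots> \<le> C * mesh n" using C0 round_up_le_trunc[of \<tau> N n \<omega>] by (intro mult_left_mono) auto
          finally show "\<bar>run_cost b x (?R n \<omega>) \<omega> - run_cost b x (?T \<omega>) \<omega>\<bar> \<le> C * mesh n" .
        qed
        show "(\<lambda>n. C * mesh n) \<longlonglongrightarrow> 0" by (intro tendsto_mult_right_zero half_power_tendsto_0)
      qed auto
      then show "(\<lambda>n. run_cost b x (?R n \<omega>) \<omega>) \<longlonglongrightarrow> run_cost b x (?T \<omega>) \<omega>"
        by (rule LIM_zero_cancel)
    qed
    show "AE \<omega> in M. norm (run_cost b x (?R n \<omega>) \<omega>) \<le> C * real N" for n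
      using rb round_up_nonneg round_up_le by (intro AE_I2) auto
    show "(\<lambda>\<omega>. run_cost b x (?R n \<omega>) \<omega>) \<in> borel_measurable M" for n
      by (rule run_cost_measurable[OF bm round_up_measurable[OF \<tau>]])
  qed (use rm in auto)
  show "integrable M (\<lambda>\<omega>. run_cost b x (?T \<omega>) \<omega>)"
    by (rule integrable_const_bound[of _ "C * real N"]) (use rb trunc_nonneg trunc_le rm in auto)
  have "(\<lambda>n. (\<integral>\<omega>. f (x + X (?R n \<omega>) \<omega>) \<partial>M) - f x) \<longlonglongrightarrow> (\<integral>\<omega>. f (x + X (?T \<omega>) \<omega>) \<partial>M) - f x"
    by (intro tendsto_diff l1 tendsto_const)
  then show "(\<integral>\<omega>. f (x + X (?T \<omega>) \<omega>) \<partial>M) - f x = (\<integral>\<omega>. run_cost b x (?T \<omega>) \<omega> \<partial>M)"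
    unfolding discrete_dynkin(1)[OF gen \<tau>] using l2 by (rule LIMSEQ_unique)
qed

section \<open>Two functions with explicit generator\<close>

lemma generator_id: "has_generator (\<lambda>y. y) (\<lambda>_. m) (1 + m)"
proof -
  have "(\<integral>\<omega>. x + X (mesh k) \<omega> \<partial>M) - x = (LINT s:{0..<mesh k}|lborel. \<integral>\<omega>. m \<partial>M)" for k x
    using X_mesh_mean[of k] by (simp add: prob_space set_lebesgue_integral_def)
  moreover have "\<bar>y\<bar> \<le> (1 + m) * (1 + \<bar>y\<bar>)" for y
    using m_pos mult_right_mono[of 1 "1 + m" "1 + \<bar>y\<bar>"] by simp
  ultimately show ?thesis unfolding has_generator_def using m_pos by auto
qed

definition gain :: "real \<Rightarrow> real" where "gain y = (2 * conv_potential y - y) / m"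

definition rate :: "real \<Rightarrow> real" where "rate y = 2 * inf_cdf y - 1"

lemma rate_bound: "\<bar>rate y\<bar> \<le> 1" unfolding rate_def using inf_cdf_bounds[of y] by auto

lemma rate_measurable [measurable]: "rate \<in> borel_measurable borel" unfolding rate_def by measurable

text \<open>In the constant, \<open>1\<close> bounds the rate, and \<open>3 / m\<close> bounds the
  growth, since \<open>conv_potential\<close> is 1-Lipschitz and vanishes at
  \<open>0\<close>.\<close>

lemma generator_gain: "has_generator gain rate (max 1 (3 / m))"
proof -
  let ?C = "max 1 (3 / m)"
  have cont: "isCont gain y" for y
    unfolding gain_def using m_pos by (intro continuous_intros conv_potential_isCont) auto
  have bnd: "\<bar>gain y\<bar> \<le> ?C * (1 + \<bar>y\<bar>)" for y
  proof -
    have "\<bar>conv_potential y\<bar> \<le> \<bar>y\<bar>" using conv_potential_lipschitz[of y 0] conv_potential_neg[of 0] by simp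
    then have "\<bar>2 * conv_potential y - y\<bar> \<le> 3 * \<bar>y\<bar>" by linarith
    then have "\<bar>gain y\<bar> \<le> 3 * \<bar>y\<bar> / m" unfolding gain_def using m_pos by (simp add: abs_divide divide_right_mono)
    also have "\<dots> = (3 / m) * \<bar>y\<bar>" by simp
    also have "\<dots> \<le> ?C * (1 + \<bar>y\<bar>)" by (intro mult_mono) auto
    finally show ?thesis .
  qed
  have gen: "(\<integral>\<omega>. gain (x + X (mesh k) \<omega>) \<partial>M) - gain x = (LINT s:{0..<mesh k}|lborel. \<integral>\<omega>. rate (x + traj s \<omega>) \<partial>M)" for k x
  proof -
    have pint: "integrable M (\<lambda>\<omega>. conv_potential (x + X (mesh k) \<omega>))"
    proof (rule Bochner_Integration.integrable_bound[of _ "\<lambda>\<omega>. \<bar>x\<bar> + \<bar>X (mesh k) \<omega>\<bar>"])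
      have "\<bar>conv_potential y\<bar> \<le> \<bar>y\<bar>" for y using conv_potential_lipschitz[of y 0] conv_potential_neg[of 0] by simp
      then show "AE \<omega> in M. norm (conv_potential (x + X (mesh k) \<omega>)) \<le> norm (\<bar>x\<bar> + \<bar>X (mesh k) \<omega>\<bar>)"
        by (intro AE_I2) (use abs_triangle_ineq order_trans in fastforce)
    qed (use X_mesh_mean(1)[of k] in auto)
    have Fint: "integrable M (\<lambda>\<omega>. inf_cdf (x + traj s \<omega>))" for s
      by (rule integrable_const_bound[of _ 1]) (auto simp: inf_cdf_bounds)
    let ?F = "\<lambda>s. \<integral>\<omega>. inf_cdf (x + traj s \<omega>) \<partial>M"
    have F1: "0 \<le> ?F s \<and> ?F s \<le> 1" for s
    proof -
      have "?F s \<le> (\<integral>\<omega>. 1 \<partial>M)" by (rule integral_mono) (use Fint in \<open>auto simp: inf_cdf_bounds\<close>)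
      moreover have "0 \<le> ?F s" by (intro integral_nonneg_AE AE_I2 inf_cdf_bounds)
      ultimately show ?thesis by (simp add: prob_space)
    qed
    have Fsi: "set_integrable lborel {0..<mesh k} ?F"
      unfolding set_integrable_def
    proof (rule Bochner_Integration.integrable_bound[of _ "indicator {0..<mesh k} :: real \<Rightarrow> real"])
      show "integrable lborel (indicator {0..<mesh k} :: real \<Rightarrow> real)" by (rule integrable_real_indicator) auto
      show "AE s in lborel. norm (indicator {0..<mesh k} s *\<^sub>R ?F s) \<le> norm (indicator {0..<mesh k} s :: real)"
        using F1 by (intro AE_I2) (auto simp: indicator_def)
    qed measurable
    have E: "(\<integral>\<omega>. gain (x + X (mesh k) \<omega>) \<partial>M) = (2 * (\<integral>\<omega>. conv_potential (x + X (mesh k) \<omega>) \<partial>M) - (x + mesh k * m)) / m"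
    proof -
      have 1: "(\<integral>\<omega>. 2 * conv_potential (x + X (mesh k) \<omega>) - (x + X (mesh k) \<omega>) \<partial>M)
          = 2 * (\<integral>\<omega>. conv_potential (x + X (mesh k) \<omega>) \<partial>M) - (x + mesh k * m)"
        using pint X_mesh_mean[of k] by (simp add: prob_space)
      show ?thesis unfolding gain_def by (simp only: integral_divide_zero 1)
    qed
    have "(\<integral>\<omega>. gain (x + X (mesh k) \<omega>) \<partial>M) - gain x = (2 * (m * (LINT s:{0..<mesh k}|lborel. ?F s)) - mesh k * m) / m"
      unfolding E gain_def[of x] conv_potential_generator[symmetric] using m_pos by (simp add: field_simps)
    also have "\<dots> = 2 * (LINT s:{0..<mesh k}|lborel. ?F s) - mesh k" using m_pos by (simp add: field_simps)
    also have "\<dots> = (LINT s:{0..<mesh k}|lborel. 2 * ?F s - 1)"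
    proof -
      have "(LINT s:{0..<mesh k}|lborel. 2 * ?F s - 1) = (LINT s:{0..<mesh k}|lborel. 2 * ?F s) - (LINT s:{0..<mesh k}|lborel. 1)"
        by (intro set_integral_diff set_integrable_mult_right Fsi) (auto simp: set_integrable_def)
      then show ?thesis by (simp add: set_lebesgue_integral_def)
    qed
    also have "\<dots> = (LINT s:{0..<mesh k}|lborel. \<integral>\<omega>. rate (x + traj s \<omega>) \<partial>M)"
      unfolding rate_def using Fint by (simp add: prob_space)
    finally show ?thesis .
  qed
  show ?thesis unfolding has_generator_def using cont bnd gen rate_bound by (auto simp: le_max_iff_disj)
qed

end

subsection \<open>Lower bound for the cost\<close>

lemma abs_max_0_le: "\<bar>max 0 r\<bar> \<le> \<bar>r :: real\<bar>"
  by (simp add: max_def)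

context snlp
begin

text \<open>\<open>ennreal\<close> sends negative reals to \<open>0\<close>, so only the positive
  part of \<open>b\<close> is integrated. Taken for \<open>b\<close> and for \<open>- b\<close> this
  gives the two halves of \<open>ext_integral\<close>.\<close>

definition time_integral :: "(real \<Rightarrow> real) \<Rightarrow> ('a \<Rightarrow> ennreal) \<Rightarrow> real \<Rightarrow> 'a \<Rightarrow> ennreal" where
  "time_integral b \<tau> x \<omega> =
     (\<integral>\<^sup>+s. ennreal (indicator {s. 0 \<le> s \<and> ennreal s \<le> \<tau> \<omega>} s * b (x + traj s \<omega>)) \<partial>lborel)"

lemma incseq_trunc: "incseq (\<lambda>N. trunc \<tau> N \<omega>)"
proof (rule incseq_SucI)
  fix N
  have "ennreal (trunc \<tau> N \<omega>) \<le> ennreal (trunc \<tau> (Suc N) \<omega>)"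
    unfolding ennreal_trunc by (intro min.mono ennreal_leI) auto
  then show "trunc \<tau> N \<omega> \<le> trunc \<tau> (Suc N) \<omega>" using trunc_nonneg by simp
qed

lemma less_trunc_iff: "0 \<le> s \<Longrightarrow> s < trunc \<tau> N \<omega> \<longleftrightarrow> ennreal s < \<tau> \<omega> \<and> s < real N"
proof -
  assume s: "0 \<le> s"
  have "s < trunc \<tau> N \<omega> \<longleftrightarrow> ennreal s < ennreal (trunc \<tau> N \<omega>)" using s by (simp add: ennreal_less_iff)
  then show ?thesis unfolding ennreal_trunc using s by (simp add: ennreal_less_iff)
qed

lemma time_integral_SUP:
  fixes b :: "real \<Rightarrow> real"
  assumes [measurable]: "b \<in> borel_measurable borel" and C: "\<And>y. \<bar>b y\<bar> \<le> C" and w: "\<omega> \<in> space M"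
  shows "time_integral b \<tau> x \<omega> = (SUP N. ennreal (run_cost (\<lambda>y. max 0 (b y)) x (trunc \<tau> N \<omega>) \<omega>))"
proof -
  have [measurable]: "(\<lambda>s. traj s \<omega>) \<in> borel_measurable lborel"
    by (rule traj_measurable) (use w in auto)
  let ?g = "\<lambda>N s. indicator {0..<trunc \<tau> N \<omega>} s * ennreal (b (x + traj s \<omega>))"
  have "(\<integral>\<^sup>+s. ?g N s \<partial>lborel) = ennreal (run_cost (\<lambda>y. max 0 (b y)) x (trunc \<tau> N \<omega>) \<omega>)" for N
  proof -
    have "set_integrable lborel {0..<trunc \<tau> N \<omega>} (\<lambda>s. (\<lambda>y. max 0 (b y)) (x + traj s \<omega>))"
      by (rule bounded_traj_set_integrable[of _ C])
         (use w trunc_nonneg[of \<tau> N \<omega>] order_trans[OF abs_max_0_le C] in auto)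
    then have "(\<integral>\<^sup>+s. ennreal (indicator {0..<trunc \<tau> N \<omega>} s *\<^sub>R max 0 (b (x + traj s \<omega>))) \<partial>lborel)
       = ennreal (run_cost (\<lambda>y. max 0 (b y)) x (trunc \<tau> N \<omega>) \<omega>)"
      unfolding run_cost_def set_lebesgue_integral_def set_integrable_def
      by (intro nn_integral_eq_integral) auto
    moreover have "ennreal (indicator {0..<trunc \<tau> N \<omega>} s *\<^sub>R max 0 (b (x + traj s \<omega>))) = ?g N s" for s
      by (auto simp: indicator_def max_def ennreal_neg)
    ultimately show ?thesis by simp
  qed
  moreover have "time_integral b \<tau> x \<omega> = (\<integral>\<^sup>+s. (SUP N. ?g N s) \<partial>lborel)"
    unfolding time_integral_def
  proof (rule nn_integral_cong_AE)
    \<comment> \<open>The cost runs over \<open>s \<le> \<tau>\<close>, the truncated cost over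
      \<open>s\<close> strictly before the truncated time. They differ only at the single point
      \<open>s = \<tau>\<close>; for infinite \<open>\<tau>\<close> the excluded point is merely
      \<open>0\<close>.\<close>
    have "AE s in lborel. s \<noteq> enn2real (\<tau> \<omega>)" by (rule AE_lborel_singleton)
    then show "AE s in lborel. ennreal (indicator {s. 0 \<le> s \<and> ennreal s \<le> \<tau> \<omega>} s * b (x + traj s \<omega>)) = (SUP N. ?g N s)"
    proof eventually_elim
      case (elim s)
      have ne: "ennreal s \<noteq> \<tau> \<omega>" if "0 \<le> s" using elim that by (metis enn2real_ennreal)
      show ?case
      proof (cases "0 \<le> s \<and> ennreal s < \<tau> \<omega>")
        case True
        obtain N :: nat where "s < real N" using reals_Archimedean2 by blast
        then have "s < trunc \<tau> N \<omega>" using True less_trunc_iff by simp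
        then have "?g N s = ennreal (b (x + traj s \<omega>))" using True by simp
        moreover have "?g N' s \<le> ennreal (b (x + traj s \<omega>))" for N' by (auto simp: indicator_def)
        ultimately have "(SUP N. ?g N s) = ennreal (b (x + traj s \<omega>))"
          by (intro antisym SUP_least) (auto intro: SUP_upper2[of N])
        then show ?thesis using True by (simp add: less_imp_le)
      next
        case False
        have "?g N s = 0" for N
        proof -
          have "s \<notin> {0..<trunc \<tau> N \<omega>}" using False less_trunc_iff[of s \<tau> N \<omega>] by auto
          then have "indicator {0..<trunc \<tau> N \<omega>} s = (0::ennreal)" by (rule indicator_simps(2))
          then show ?thesis by (metis mult_zero_left)
        qed
        then have "(SUP N. ?g N s) = 0" by (simp only: SUP_const[OF UNIV_not_empty])
        moreover have "\<not> (0 \<le> s \<and> ennreal s \<le> \<tau> \<omega>)" using False ne by (auto simp: le_less)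
        ultimately show ?thesis by simp
      qed
    qed
  qed
  moreover have "(\<integral>\<^sup>+s. (SUP N. ?g N s) \<partial>lborel) = (SUP N. \<integral>\<^sup>+s. ?g N s \<partial>lborel)"
  proof (rule nn_integral_monotone_convergence_SUP)
    show "incseq ?g"
    proof (rule incseq_SucI, rule le_funI)
      fix N s
      have "trunc \<tau> N \<omega> \<le> trunc \<tau> (Suc N) \<omega>" using incseq_trunc by (rule incseq_SucD)
      then show "?g N s \<le> ?g (Suc N) s" by (auto simp: indicator_def)
    qed
  qed measurable
  ultimately show ?thesis by simp
qed

lemma expected_time_integral:
  fixes b :: "real \<Rightarrow> real"
  assumes b [measurable]: "b \<in> borel_measurable borel" and C: "\<And>y. \<bar>b y\<bar> \<le> C" and \<tau>: "random_time \<tau>"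
  shows "(\<lambda>N. ennreal (\<integral>\<omega>. run_cost (\<lambda>y. max 0 (b y)) x (trunc \<tau> N \<omega>) \<omega> \<partial>M)) \<longlonglongrightarrow> (\<integral>\<^sup>+\<omega>. time_integral b \<tau> x \<omega> \<partial>M)"
    and "integrable M (\<lambda>\<omega>. run_cost (\<lambda>y. max 0 (b y)) x (trunc \<tau> N \<omega>) \<omega>)"
    and "\<And>\<omega>. 0 \<le> run_cost (\<lambda>y. max 0 (b y)) x (trunc \<tau> N \<omega>) \<omega>"
proof -
  let ?r = "\<lambda>N \<omega>. run_cost (\<lambda>y. max 0 (b y)) x (trunc \<tau> N \<omega>) \<omega>"
  have bp: "(\<lambda>y. max 0 (b y)) \<in> borel_measurable borel" "\<And>y. \<bar>max 0 (b y)\<bar> \<le> C"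
    using order_trans[OF abs_max_0_le C] by auto
  have C0: "0 \<le> C" using C[of 0] by linarith
  have rm [measurable]: "?r N \<in> borel_measurable M" for N by (rule run_cost_measurable[OF bp(1) trunc_measurable[OF \<tau>]])
  have nn: "0 \<le> ?r N \<omega>" for N \<omega>
    unfolding run_cost_def set_lebesgue_integral_def by (intro integral_nonneg_AE AE_I2) simp
  then show "\<And>\<omega>. 0 \<le> ?r N \<omega>" .
  have int: "integrable M (?r N)" for N
  proof (rule integrable_const_bound[of _ "C * real N"])
    show "AE \<omega> in M. norm (?r N \<omega>) \<le> C * real N"
    proof (rule AE_I2)
      fix \<omega> assume "\<omega> \<in> space M"
      then have "\<bar>?r N \<omega>\<bar> \<le> C * trunc \<tau> N \<omega>" by (rule run_cost_bound[OF bp _ trunc_nonneg])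
      also have "\<dots> \<le> C * real N" using C0 trunc_le by (rule mult_left_mono[rotated])
      finally show "norm (?r N \<omega>) \<le> C * real N" by simp
    qed
  qed measurable
  then show "integrable M (?r N)" .
  have mono: "?r N \<omega> \<le> ?r (Suc N) \<omega>" if "\<omega> \<in> space M" for N \<omega>
  proof -
    have "trunc \<tau> N \<omega> \<le> trunc \<tau> (Suc N) \<omega>" using incseq_trunc by (rule incseq_SucD)
    then have "?r (Suc N) \<omega> = ?r N \<omega> + (LINT s:{trunc \<tau> N \<omega>..<trunc \<tau> (Suc N) \<omega>}|lborel. max 0 (b (x + traj s \<omega>)))"
      using run_cost_split[OF bp that trunc_nonneg] by blast
    moreover have "0 \<le> (LINT s:{trunc \<tau> N \<omega>..<trunc \<tau> (Suc N) \<omega>}|lborel. max 0 (b (x + traj s \<omega>)))"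
      unfolding set_lebesgue_integral_def by (intro integral_nonneg_AE AE_I2) simp
    ultimately show ?thesis by simp
  qed
  have "(\<integral>\<^sup>+\<omega>. time_integral b \<tau> x \<omega> \<partial>M) = (\<integral>\<^sup>+\<omega>. (SUP N. ennreal (?r N \<omega>)) \<partial>M)"
    by (rule nn_integral_cong) (rule time_integral_SUP[OF b C])
  also have "\<dots> = (SUP N. \<integral>\<^sup>+\<omega>. ennreal (?r N \<omega>) \<partial>M)"
    by (rule nn_integral_monotone_convergence_SUP_AE)
       (auto intro!: AE_I2 ennreal_leI mono)
  also have "\<dots> = (SUP N. ennreal (\<integral>\<omega>. ?r N \<omega> \<partial>M))"
    by (intro SUP_cong refl nn_integral_eq_integral int) (simp add: nn)
  finally have eq: "(\<integral>\<^sup>+\<omega>. time_integral b \<tau> x \<omega> \<partial>M) = (SUP N. ennreal (\<integral>\<omega>. ?r N \<omega> \<partial>M))" .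
  have "incseq (\<lambda>N. ennreal (\<integral>\<omega>. ?r N \<omega> \<partial>M))"
    by (intro incseq_SucI ennreal_leI integral_mono int mono)
  then show "(\<lambda>N. ennreal (\<integral>\<omega>. ?r N \<omega> \<partial>M)) \<longlonglongrightarrow> (\<integral>\<^sup>+\<omega>. time_integral b \<tau> x \<omega> \<partial>M)"
    unfolding eq by (rule LIMSEQ_SUP)
qed

end

context snlp_exp
begin

section \<open>The median and the convexity of the gain\<close>

definition level :: real where "level = Inf {x. 1 / 2 \<le> conv_cdf x}"

text \<open>A distribution function is right-continuous, so the infimum defining
  \<open>level\<close> is attained.\<close>

lemma conv_cdf_ge_half_iff: "1 / 2 \<le> conv_cdf x \<longleftrightarrow> level \<le> x"
  and level_nonneg: "0 \<le> level"
proof -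
  let ?S = "{x. 1 / 2 \<le> conv_cdf x}"
  have pos: "0 \<le> x" if "x \<in> ?S" for x using conv_cdf_neg[of x] that by (cases "x < 0") auto
  then have bdd: "bdd_below ?S" by (auto intro!: bdd_belowI[of _ 0])
  have "(conv_cdf \<longlongrightarrow> 1) at_top" unfolding conv_cdf_def by (rule inf_law2.cdf_lim_at_top_prob)
  then have "\<forall>\<^sub>F x in at_top. 1 / 2 < conv_cdf x" by (rule order_tendstoD) simp
  then obtain z where "1 / 2 < conv_cdf z" using eventually_happens trivial_limit_at_top_linorder by blast
  then have "z \<in> ?S" by simp
  then have ne: "?S \<noteq> {}" by blast
  show "0 \<le> level" unfolding level_def by (rule cInf_greatest[OF ne]) (rule pos)
  have above: "1 / 2 \<le> conv_cdf y" if less: "level < y" for y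
  proof -
    obtain x where "x \<in> ?S" "x < y" using cInf_lessD[OF ne less[unfolded level_def]] by blast
    then show ?thesis using conv_cdf_mono[of x y] by auto
  qed
  have at: "1 / 2 \<le> conv_cdf level"
  proof (rule tendsto_lowerbound)
    show "(conv_cdf \<longlongrightarrow> conv_cdf level) (at_right level)"
      using inf_law2.cdf_is_right_cont[of level] unfolding conv_cdf_def continuous_within .
    show "\<forall>\<^sub>F y in at_right level. 1 / 2 \<le> conv_cdf y"
      using above by (auto simp: eventually_at_right_field intro!: exI[of _ "level + 1"])
  qed simp
  show "1 / 2 \<le> conv_cdf x \<longleftrightarrow> level \<le> x"
  proof
    assume "1 / 2 \<le> conv_cdf x" then show "level \<le> x" unfolding level_def by (intro cInf_lower[OF _ bdd]) simp
  next
    assume "level \<le> x" then show "1 / 2 \<le> conv_cdf x" using above at by (cases "level = x") auto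
  qed
qed

lemma gain_diff_bounds:
  assumes "y \<le> z"
  shows "(z - y) * ((2 * conv_cdf y - 1) / m) \<le> gain z - gain y"
    and "gain z - gain y \<le> (z - y) * ((2 * conv_cdf z - 1) / m)"
proof -
  have e: "gain z - gain y = (2 * (conv_potential z - conv_potential y) - (z - y)) / m"
    unfolding gain_def by (simp add: diff_divide_distrib[symmetric])
  show "(z - y) * ((2 * conv_cdf y - 1) / m) \<le> gain z - gain y"
    unfolding e times_divide_eq_right using conv_potential_diff(1)[OF assms] m_pos
    by (intro divide_right_mono) (auto simp: algebra_simps)
  show "gain z - gain y \<le> (z - y) * ((2 * conv_cdf z - 1) / m)"
    unfolding e times_divide_eq_right using conv_potential_diff(2)[OF assms] m_pos
    by (intro divide_right_mono) (auto simp: algebra_simps)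
qed

text \<open>The secant bounds on either side of \<open>b\<close> show that the slope built from
  \<open>conv_cdf b\<close> is a subgradient of the gain at \<open>b\<close>.\<close>

lemma gain_support_line: "gain b + (2 * conv_cdf b - 1) / m * (y - b) \<le> gain y"
proof -
  define \<kappa> where "\<kappa> = (2 * conv_cdf b - 1) / m"
  have "(y - b) * \<kappa> = - ((b - y) * \<kappa>)" by (simp add: algebra_simps)
  then have "(y - b) * \<kappa> \<le> gain y - gain b"
    using gain_diff_bounds(1)[of b y] gain_diff_bounds(2)[of y b] unfolding \<kappa>_def[symmetric]
    by (cases "b \<le> y") auto
  then show ?thesis unfolding \<kappa>_def[symmetric] by (simp add: mult.commute)
qed

lemma gain_isCont: "isCont gain y"
  using generator_gain unfolding has_generator_def by blast

lemma gain_strict_dec_below: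
  assumes "y < z" "z < level"
  shows "gain z < gain y"
proof -
  have "conv_cdf z < 1 / 2" using conv_cdf_ge_half_iff[of z] assms by simp
  then have "(z - y) * ((2 * conv_cdf z - 1) / m) < 0"
    using assms m_pos by (intro mult_pos_neg divide_neg_pos) auto
  then show ?thesis using gain_diff_bounds(2)[of y z] assms by simp
qed

lemma gain_level_le_below:
  assumes "z < level"
  shows "gain level \<le> gain z"
proof (rule tendsto_upperbound)
  show "(gain \<longlongrightarrow> gain level) (at_left level)"
    using gain_isCont[of level] unfolding isCont_def by (rule filterlim_mono) (simp_all add: at_le)
  show "\<forall>\<^sub>F y in at_left level. gain y \<le> gain z"
    unfolding eventually_at_left_field using assms gain_strict_dec_below[of z] by (intro exI[of _ z]) (auto intro: less_imp_le)
qed simp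

lemma gain_mono_above:
  assumes "level \<le> y" "y \<le> z"
  shows "gain y \<le> gain z"
proof -
  have "0 \<le> (z - y) * ((2 * conv_cdf y - 1) / m)"
    using assms m_pos conv_cdf_ge_half_iff[of y] by (intro mult_nonneg_nonneg divide_nonneg_pos) auto
  then show ?thesis using gain_diff_bounds(1)[OF assms(2)] by simp
qed

lemma gain_level_le: "gain level \<le> gain y"
  using gain_level_le_below[of y] gain_mono_above[of level y] by (cases "y < level") auto

definition val :: "real \<Rightarrow> real" where "val x = (if level \<le> x then 0 else gain level - gain x)"

lemma val_eq_0_iff: "val x = 0 \<longleftrightarrow> level \<le> x"
proof (cases "level \<le> x")
  case False
  then obtain z where "x < z" "z < level" using dense[of x level] by auto
  then have "gain level < gain x" using gain_strict_dec_below[of x z] gain_level_le[of z] by linarith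
  then show ?thesis using False unfolding val_def by simp
qed (simp add: val_def)

lemma wald:
  assumes "random_time \<tau>"
  shows "integrable M (\<lambda>\<omega>. X (trunc \<tau> N \<omega>) \<omega>)"
    and "(\<integral>\<omega>. X (trunc \<tau> N \<omega>) \<omega> \<partial>M) = m * (\<integral>\<omega>. trunc \<tau> N \<omega> \<partial>M)"
proof -
  have c: "run_cost (\<lambda>_. m) 0 t \<omega> = m * t" if "0 \<le> t" for t \<omega>
    unfolding run_cost_def set_lebesgue_integral_def using that by simp
  show "integrable M (\<lambda>\<omega>. X (trunc \<tau> N \<omega>) \<omega>)"
    using optional_stopping(2)[OF generator_id assms, of 0 N] by simp
  show "(\<integral>\<omega>. X (trunc \<tau> N \<omega>) \<omega> \<partial>M) = m * (\<integral>\<omega>. trunc \<tau> N \<omega> \<partial>M)"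
    using optional_stopping(1)[OF generator_id assms, of 0 N] trunc_nonneg by (simp add: c)
qed

lemma gain_stopped_ge:
  assumes \<tau>: "random_time \<tau>"
  shows "val x \<le> (\<integral>\<omega>. gain (x + X (trunc \<tau> N \<omega>) \<omega>) \<partial>M) - gain x"
proof (cases "level \<le> x")
  case True
  let ?\<kappa> = "(2 * conv_cdf x - 1) / m"
  have k0: "0 \<le> ?\<kappa>" using True conv_cdf_ge_half_iff[of x] m_pos by simp
  have "0 \<le> ?\<kappa> * (m * (\<integral>\<omega>. trunc \<tau> N \<omega> \<partial>M))"
    using k0 m_pos trunc_nonneg by (intro mult_nonneg_nonneg integral_nonneg_AE AE_I2) auto
  also have "\<dots> = (\<integral>\<omega>. gain x + ?\<kappa> * (x + X (trunc \<tau> N \<omega>) \<omega> - x) \<partial>M) - gain x"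
    using wald[OF \<tau>, of N] by (simp add: prob_space)
  also have "\<dots> \<le> (\<integral>\<omega>. gain (x + X (trunc \<tau> N \<omega>) \<omega>) \<partial>M) - gain x"
    by (intro diff_right_mono integral_mono gain_support_line)
       (use wald(1)[OF \<tau>, of N] optional_stopping(2)[OF generator_gain \<tau>, of x N] in auto)
  finally show ?thesis using True unfolding val_def by simp
next
  case False
  have "gain level = (\<integral>\<omega>. gain level \<partial>M)" by (simp add: prob_space)
  also have "\<dots> \<le> (\<integral>\<omega>. gain (x + X (trunc \<tau> N \<omega>) \<omega>) \<partial>M)"
    by (intro integral_mono gain_level_le optional_stopping(2)[OF generator_gain \<tau>]) simp
  finally show ?thesis using False unfolding val_def by simp
qed

section \<open>Positive and negative part of the expected cost\<close>

definition cost_pos :: "('a \<Rightarrow> ennreal) \<Rightarrow> real \<Rightarrow> ennreal" where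
  "cost_pos \<tau> x = (\<integral>\<^sup>+\<omega>. time_integral rate \<tau> x \<omega> \<partial>M)"

definition cost_neg :: "('a \<Rightarrow> ennreal) \<Rightarrow> real \<Rightarrow> ennreal" where
  "cost_neg \<tau> x = (\<integral>\<^sup>+\<omega>. time_integral (\<lambda>y. - rate y) \<tau> x \<omega> \<partial>M)"

lemma run_cost_rate_split:
  assumes "random_time \<tau>"
  shows "(\<integral>\<omega>. run_cost (\<lambda>y. max 0 (rate y)) x (trunc \<tau> N \<omega>) \<omega> \<partial>M) - (\<integral>\<omega>. run_cost (\<lambda>y. max 0 (- rate y)) x (trunc \<tau> N \<omega>) \<omega> \<partial>M)
    = (\<integral>\<omega>. gain (x + X (trunc \<tau> N \<omega>) \<omega>) \<partial>M) - gain x"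
proof -
  note p = expected_time_integral(2)[of rate 1, OF rate_measurable rate_bound assms]
  have n: "integrable M (\<lambda>\<omega>. run_cost (\<lambda>y. max 0 (- rate y)) x (trunc \<tau> N \<omega>) \<omega>)"
    by (rule expected_time_integral(2)[of "\<lambda>y. - rate y" 1]) (use rate_bound assms in auto)
  have "run_cost (\<lambda>y. max 0 (rate y)) x t \<omega> - run_cost (\<lambda>y. max 0 (- rate y)) x t \<omega> = run_cost rate x t \<omega>"
    if "\<omega> \<in> space M" "0 \<le> t" for t \<omega>
  proof -
    have i: "set_integrable lborel {0..<t} (\<lambda>s. (\<lambda>y. max 0 (rate y)) (x + traj s \<omega>))"
      "set_integrable lborel {0..<t} (\<lambda>s. (\<lambda>y. max 0 (- rate y)) (x + traj s \<omega>))"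
      by (rule bounded_traj_set_integrable[of _ 1]; use rate_bound that in \<open>auto simp: abs_le_iff max_def\<close>)+
    have "run_cost (\<lambda>y. max 0 (rate y)) x t \<omega> - run_cost (\<lambda>y. max 0 (- rate y)) x t \<omega>
        = (LINT s:{0..<t}|lborel. max 0 (rate (x + traj s \<omega>)) - max 0 (- rate (x + traj s \<omega>)))"
      unfolding run_cost_def using i by (subst set_integral_diff) auto
    also have "\<dots> = run_cost rate x t \<omega>"
      unfolding run_cost_def by (rule set_lebesgue_integral_cong) (auto simp: max_def)
    finally show ?thesis .
  qed
  then have "(\<integral>\<omega>. run_cost (\<lambda>y. max 0 (rate y)) x (trunc \<tau> N \<omega>) \<omega> - run_cost (\<lambda>y. max 0 (- rate y)) x (trunc \<tau> N \<omega>) \<omega> \<partial>M)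
      = (\<integral>\<omega>. run_cost rate x (trunc \<tau> N \<omega>) \<omega> \<partial>M)"
    by (intro Bochner_Integration.integral_cong refl) (simp add: trunc_nonneg)
  then show ?thesis
    using p n optional_stopping(1)[OF generator_gain assms, of x N] by simp
qed

text \<open>The negative part of the rate is at most \<open>(1 - rate) / 2\<close>, which is
  nonnegative, so the integral may be extended from the truncated time to \<open>N\<close>. Optional
  stopping evaluates it as \<open>(N - E gain (x + X N) + gain x) / 2\<close>. Since
  \<open>gain y\<close> is at least \<open>(y - 4 * E Y) / m\<close> and \<open>X N\<close> has mean
  \<open>N * m\<close>, the term \<open>N\<close> cancels and the bound \<open>B\<close> is free of
  \<open>N\<close>.\<close>

lemma cost_neg_finite:
  assumes \<tau>: "random_time \<tau>"
  shows "cost_neg \<tau> x < \<infinity>"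
proof -
  let ?e = "\<integral>\<omega>. inf_neg \<omega> \<partial>M"
  define B where "B = (gain x - (x - 4 * ?e) / m) / 2"
  have inf_time: "random_time (\<lambda>_. \<infinity>)" unfolding random_time_def by simp
  have tr: "trunc (\<lambda>_. \<infinity>) N \<omega> = real N" for N \<omega> unfolding trunc_def by simp
  have bound: "(\<integral>\<omega>. run_cost (\<lambda>y. max 0 (- rate y)) x (trunc \<tau> N \<omega>) \<omega> \<partial>M) \<le> B" for N
  proof -
    let ?c = "\<lambda>\<omega>. (real N - run_cost rate x (real N) \<omega>) / 2"
    have ci: "integrable M ?c"
      using optional_stopping(3)[OF generator_gain inf_time, of x N] unfolding tr by simp
    have le: "run_cost (\<lambda>y. max 0 (- rate y)) x (trunc \<tau> N \<omega>) \<omega> \<le> ?c \<omega>" if w: "\<omega> \<in> space M" for \<omega>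
    proof -
      have rn: "(\<lambda>y. max 0 (- rate y)) \<in> borel_measurable borel" "\<And>y. \<bar>max 0 (- rate y)\<bar> \<le> 1"
        using rate_bound by (auto simp: abs_le_iff max_def)
      have "run_cost (\<lambda>y. max 0 (- rate y)) x (real N) \<omega> = run_cost (\<lambda>y. max 0 (- rate y)) x (trunc \<tau> N \<omega>) \<omega>
          + (LINT s:{trunc \<tau> N \<omega>..<real N}|lborel. max 0 (- rate (x + traj s \<omega>)))"
        by (rule run_cost_split[OF rn w trunc_nonneg trunc_le])
      moreover have "0 \<le> (LINT s:{trunc \<tau> N \<omega>..<real N}|lborel. max 0 (- rate (x + traj s \<omega>)))"
        unfolding set_lebesgue_integral_def by (intro integral_nonneg_AE AE_I2) simp
      ultimately have "run_cost (\<lambda>y. max 0 (- rate y)) x (trunc \<tau> N \<omega>) \<omega> \<le> run_cost (\<lambda>y. max 0 (- rate y)) x (real N) \<omega>" by simp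
      also have "\<dots> \<le> (LINT s:{0..<real N}|lborel. (1 - rate (x + traj s \<omega>)) / 2)"
        unfolding run_cost_def
      proof (rule set_integral_mono)
        show "set_integrable lborel {0..<real N} (\<lambda>s. max 0 (- rate (x + traj s \<omega>)))"
          using bounded_traj_set_integrable[OF rn w, of "{0..<real N}" x] by simp
        have "set_integrable lborel {0..<real N} (\<lambda>s. (\<lambda>y. (1 - rate y) / 2) (x + traj s \<omega>))"
          by (rule bounded_traj_set_integrable[of _ 1]) (use rate_bound w in \<open>auto simp: abs_le_iff\<close>)
        then show "set_integrable lborel {0..<real N} (\<lambda>s. (1 - rate (x + traj s \<omega>)) / 2)" by simp
        show "max 0 (- rate (x + traj s \<omega>)) \<le> (1 - rate (x + traj s \<omega>)) / 2" for s
          using rate_bound[of "x + traj s \<omega>"] by (auto simp: max_def)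
      qed
      also have "\<dots> = ?c \<omega>"
      proof -
        have i: "set_integrable lborel {0..<real N} (\<lambda>s. rate (x + traj s \<omega>))"
          by (rule bounded_traj_set_integrable[of _ 1]) (use rate_bound w in auto)
        have "(LINT s:{0..<real N}|lborel. 1 - rate (x + traj s \<omega>)) = (LINT s:{0..<real N}|lborel. 1) - run_cost rate x (real N) \<omega>"
          unfolding run_cost_def by (intro set_integral_diff i) (auto simp: set_integrable_def)
        then show ?thesis by (simp add: set_lebesgue_integral_def)
      qed
      finally show ?thesis .
    qed
    have "(\<integral>\<omega>. run_cost (\<lambda>y. max 0 (- rate y)) x (trunc \<tau> N \<omega>) \<omega> \<partial>M) \<le> (\<integral>\<omega>. ?c \<omega> \<partial>M)"
      by (rule integral_mono[OF _ ci le])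
         (rule expected_time_integral(2)[of "\<lambda>y. - rate y" 1], use rate_bound \<tau> in auto)
    also have "\<dots> = (real N - ((\<integral>\<omega>. gain (x + X (real N) \<omega>) \<partial>M) - gain x)) / 2"
      using optional_stopping(1,3)[OF generator_gain inf_time, of x N] unfolding tr by (simp add: prob_space)
    also have "\<dots> \<le> B"
    proof -
      have gi: "integrable M (\<lambda>\<omega>. gain (x + X (real N) \<omega>))"
        using optional_stopping(2)[OF generator_gain inf_time, of x N] unfolding tr .
      have XN: "integrable M (X (real N))" "(\<integral>\<omega>. X (real N) \<omega> \<partial>M) = real N * m"
        using X_mean[of N 0] by auto
      have "(x + real N * m - 4 * ?e) / m = (\<integral>\<omega>. (x + X (real N) \<omega> - 4 * ?e) / m \<partial>M)"
        using XN by (simp add: prob_space)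
      also have "\<dots> \<le> (\<integral>\<omega>. gain (x + X (real N) \<omega>) \<partial>M)"
      proof (rule integral_mono[OF _ gi])
        fix \<omega>
        show "(x + X (real N) \<omega> - 4 * ?e) / m \<le> gain (x + X (real N) \<omega>)"
          unfolding gain_def using conv_potential_ge[of "x + X (real N) \<omega>"] m_pos
          by (intro divide_right_mono) auto
      qed (use XN in auto)
      finally have "real N + (x - 4 * ?e) / m \<le> (\<integral>\<omega>. gain (x + X (real N) \<omega>) \<partial>M)"
        using m_pos by (simp add: add_divide_distrib diff_divide_distrib)
      then show ?thesis unfolding B_def by (intro divide_right_mono) linarith+
    qed
    finally show ?thesis .
  qed
  have "cost_neg \<tau> x \<le> ennreal B"
    unfolding cost_neg_def
  proof (rule LIMSEQ_le_const2[OF expected_time_integral(1)[of "\<lambda>y. - rate y" 1]])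
    show "\<exists>N. \<forall>n\<ge>N. ennreal (\<integral>\<omega>. run_cost (\<lambda>y. max 0 (- rate y)) x (trunc \<tau> n \<omega>) \<omega> \<partial>M) \<le> ennreal B"
      using bound by (auto intro: ennreal_leI)
  qed (use rate_bound \<tau> in auto)
  then show ?thesis by (simp add: le_less_trans)
qed

lemma cost_limit:
  assumes \<tau>: "random_time \<tau>"
  obtains Q where "cost_neg \<tau> x = ennreal Q" "0 \<le> Q"
    "(\<lambda>N. \<integral>\<omega>. run_cost (\<lambda>y. max 0 (- rate y)) x (trunc \<tau> N \<omega>) \<omega> \<partial>M) \<longlonglongrightarrow> Q"
proof -
  have fin: "cost_neg \<tau> x < \<infinity>" by (rule cost_neg_finite[OF \<tau>])
  then obtain Q where Q: "cost_neg \<tau> x = ennreal Q" "0 \<le> Q" by (cases "cost_neg \<tau> x") auto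
  have l: "(\<lambda>N. ennreal (\<integral>\<omega>. run_cost (\<lambda>y. max 0 (- rate y)) x (trunc \<tau> N \<omega>) \<omega> \<partial>M)) \<longlonglongrightarrow> ennreal Q"
    unfolding Q(1)[symmetric] cost_neg_def
    by (rule expected_time_integral(1)[of "\<lambda>y. - rate y" 1]) (use rate_bound \<tau> in auto)
  have "0 \<le> (\<integral>\<omega>. run_cost (\<lambda>y. max 0 (- rate y)) x (trunc \<tau> N \<omega>) \<omega> \<partial>M)" for N
    by (intro integral_nonneg_AE AE_I2 expected_time_integral(3)[of "\<lambda>y. - rate y" 1]) (use rate_bound \<tau> in auto)
  then have "(\<lambda>N. \<integral>\<omega>. run_cost (\<lambda>y. max 0 (- rate y)) x (trunc \<tau> N \<omega>) \<omega> \<partial>M) \<longlonglongrightarrow> Q"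
    using l Q(2) by (subst (asm) tendsto_ennreal_iff) auto
  then show thesis using Q that by blast
qed

lemma cost_pos_tendsto:
  assumes \<tau>: "random_time \<tau>"
  shows "(\<lambda>N. ennreal (\<integral>\<omega>. run_cost (\<lambda>y. max 0 (rate y)) x (trunc \<tau> N \<omega>) \<omega> \<partial>M)) \<longlonglongrightarrow> cost_pos \<tau> x"
    and "0 \<le> (\<integral>\<omega>. run_cost (\<lambda>y. max 0 (rate y)) x (trunc \<tau> N \<omega>) \<omega> \<partial>M)"
  unfolding cost_pos_def
  by (rule expected_time_integral(1)[of rate 1, OF rate_measurable rate_bound \<tau>])
     (intro integral_nonneg_AE AE_I2 expected_time_integral(3)[of rate 1, OF rate_measurable rate_bound \<tau>])

lemma cost_lower_bound:
  assumes \<tau>: "random_time \<tau>"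
  shows "ereal (val x) \<le> enn2ereal (cost_pos \<tau> x) - enn2ereal (cost_neg \<tau> x)"
proof -
  obtain Q where Q: "cost_neg \<tau> x = ennreal Q" "0 \<le> Q"
    and limQ: "(\<lambda>N. \<integral>\<omega>. run_cost (\<lambda>y. max 0 (- rate y)) x (trunc \<tau> N \<omega>) \<omega> \<partial>M) \<longlonglongrightarrow> Q"
    using cost_limit[OF \<tau>] by blast
  show ?thesis
  proof (cases "cost_pos \<tau> x")
    case (real P)
    have limP: "(\<lambda>N. \<integral>\<omega>. run_cost (\<lambda>y. max 0 (rate y)) x (trunc \<tau> N \<omega>) \<omega> \<partial>M) \<longlonglongrightarrow> P"
    proof -
      have "(\<lambda>N. ennreal (\<integral>\<omega>. run_cost (\<lambda>y. max 0 (rate y)) x (trunc \<tau> N \<omega>) \<omega> \<partial>M)) \<longlonglongrightarrow> ennreal P"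
        using cost_pos_tendsto(1)[OF \<tau>, of x] real by simp
      then show ?thesis
        using cost_pos_tendsto(2)[OF \<tau>, of x] real by (subst (asm) tendsto_ennreal_iff) auto
    qed
    have "val x \<le> P - Q"
    proof (rule LIMSEQ_le_const[OF tendsto_diff[OF limP limQ]], intro exI allI impI)
      fix N
      show "val x \<le> (\<integral>\<omega>. run_cost (\<lambda>y. max 0 (rate y)) x (trunc \<tau> N \<omega>) \<omega> \<partial>M)
         - (\<integral>\<omega>. run_cost (\<lambda>y. max 0 (- rate y)) x (trunc \<tau> N \<omega>) \<omega> \<partial>M)"
        unfolding run_cost_rate_split[OF \<tau>] by (rule gain_stopped_ge[OF \<tau>])
    qed
    then show ?thesis using real Q by (simp add: enn2ereal_ennreal)
  next
    case top
    then show ?thesis using Q by (simp add: enn2ereal_ennreal)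
  qed
qed

text \<open>The truncated negative parts converge to a finite limit, so convergence of the stopped
  gains forces convergence of the truncated positive parts.\<close>

lemma cost_eqI:
  assumes \<tau>: "random_time \<tau>"
    and lim: "(\<lambda>N. (\<integral>\<omega>. gain (x + X (trunc \<tau> N \<omega>) \<omega>) \<partial>M) - gain x) \<longlonglongrightarrow> v"
  shows "enn2ereal (cost_pos \<tau> x) - enn2ereal (cost_neg \<tau> x) = ereal v"
proof -
  obtain Q where Q: "cost_neg \<tau> x = ennreal Q" "0 \<le> Q"
    and limQ: "(\<lambda>N. \<integral>\<omega>. run_cost (\<lambda>y. max 0 (- rate y)) x (trunc \<tau> N \<omega>) \<omega> \<partial>M) \<longlonglongrightarrow> Q"
    using cost_limit[OF \<tau>] by blast
  let ?P = "\<lambda>N. \<integral>\<omega>. run_cost (\<lambda>y. max 0 (rate y)) x (trunc \<tau> N \<omega>) \<omega> \<partial>M"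
  have "?P \<longlonglongrightarrow> v + Q"
    using tendsto_add[OF lim limQ] unfolding run_cost_rate_split[OF \<tau>, symmetric] by simp
  moreover have "0 \<le> v + Q"
    using cost_pos_tendsto(2)[OF \<tau>] by (intro LIMSEQ_le_const[OF \<open>?P \<longlonglongrightarrow> v + Q\<close>]) auto
  ultimately have "(\<lambda>N. ennreal (?P N)) \<longlonglongrightarrow> ennreal (v + Q)" by (intro tendsto_ennrealI)
  then have "cost_pos \<tau> x = ennreal (v + Q)"
    using cost_pos_tendsto(1)[OF \<tau>, of x] LIMSEQ_unique by blast
  then show ?thesis using Q \<open>0 \<le> v + Q\<close> by (simp add: enn2ereal_ennreal)
qed

end

subsection \<open>The first passage time is optimal\<close>

context snlp
begin

text \<open>Entry into the open half-line above \<open>c\<close>. An excess over \<open>c\<close>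
  persists at dyadic times slightly later, which makes this time measurable directly.\<close>

definition passage :: "real \<Rightarrow> real \<Rightarrow> 'a \<Rightarrow> ennreal" where
  "passage x c \<omega> = Inf {ennreal t | t. 0 \<le> t \<and> c < x + X t \<omega>}"

lemma passage_less_iff:
  "passage x c \<omega> < ennreal t \<longleftrightarrow> (\<exists>s. 0 \<le> s \<and> s < t \<and> c < x + X s \<omega>)"
  unfolding passage_def Inf_less_iff using ennreal_less_iff by auto

lemma passage_le: "0 \<le> s \<Longrightarrow> c < x + X s \<omega> \<Longrightarrow> passage x c \<omega> \<le> ennreal s"
  unfolding passage_def by (rule Inf_lower) auto

lemma passage_mono: "c \<le> d \<Longrightarrow> passage x c \<omega> \<le> passage x d \<omega>"
  unfolding passage_def by (rule Inf_superset_mono) (auto intro: le_less_trans)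

text \<open>By right-continuity, a level exceeded before \<open>t\<close> is also exceeded at some
  dyadic time before \<open>t\<close>.\<close>

lemma random_time_passage: "random_time (passage x c)"
  unfolding random_time_def
proof (intro allI impI)
  fix t :: real assume "0 < t"
  have "{\<omega>\<in>space M. passage x c \<omega> < ennreal t}
      = (\<Union>p\<in>{(n, k). real k * mesh n < t}. {\<omega>\<in>space (past t). c < x + X (real (snd p) * mesh (fst p)) \<omega>})"
  proof (intro equalityI subsetI)
    fix \<omega> assume "\<omega> \<in> {\<omega>\<in>space M. passage x c \<omega> < ennreal t}"
    then obtain s where w: "\<omega> \<in> space M" and s: "0 \<le> s" "s < t" "c < x + X s \<omega>"
      by (auto simp: passage_less_iff)
    have "(\<lambda>n. x + X (dyadic_above n s) \<omega>) \<longlonglongrightarrow> x + X s \<omega>"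
      by (intro tendsto_add tendsto_const cadlag_dyadic_tendsto[OF X_cadlag[OF w] s(1)])
    then have "\<forall>\<^sub>F n in sequentially. c < x + X (dyadic_above n s) \<omega>" using s(3) by (rule order_tendstoD)
    moreover have "(\<lambda>n. dyadic_above n s) \<longlonglongrightarrow> s"
      using dyadic_above_tendsto[of s] by (simp add: filterlim_at)
    then have "\<forall>\<^sub>F n in sequentially. dyadic_above n s < t" using s(2) by (rule order_tendstoD)
    ultimately have "\<forall>\<^sub>F n in sequentially. c < x + X (dyadic_above n s) \<omega> \<and> dyadic_above n s < t"
      by (rule eventually_conj)
    then obtain n where n: "c < x + X (dyadic_above n s) \<omega>" "dyadic_above n s < t"
      using eventually_happens'[OF sequentially_bot] by blast
    obtain k :: nat where k: "dyadic_above n s = real k * mesh n" using dyadic_above_mesh[OF s(1)] by blast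
    then have "(n, k) \<in> {(n, k). real k * mesh n < t}" using n by simp
    then show "\<omega> \<in> (\<Union>p\<in>{(n, k). real k * mesh n < t}. {\<omega>\<in>space (past t). c < x + X (real (snd p) * mesh (fst p)) \<omega>})"
      using n w k by (intro UN_I) auto
  next
    fix \<omega> assume "\<omega> \<in> (\<Union>p\<in>{(n, k). real k * mesh n < t}. {\<omega>\<in>space (past t). c < x + X (real (snd p) * mesh (fst p)) \<omega>})"
    then obtain n k where "\<omega> \<in> space M" "real k * mesh n < t" "c < x + X (real k * mesh n) \<omega>" by auto
    then show "\<omega> \<in> {\<omega>\<in>space M. passage x c \<omega> < ennreal t}"
      unfolding passage_less_iff using grid_point_nonneg[of k n] by blast
  qed
  also have "\<dots> \<in> sets (past t)"
  proof (rule sets.countable_UN'')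
    fix p assume p: "p \<in> {(n, k). real k * mesh n < t}"
    have [measurable]: "X (real (snd p) * mesh (fst p)) \<in> borel_measurable (past t)"
      using p by (intro X_measurable_past) auto
    show "{\<omega>\<in>space (past t). c < x + X (real (snd p) * mesh (fst p)) \<omega>} \<in> sets (past t)" by measurable
  qed auto
  finally show "{\<omega>\<in>space M. passage x c \<omega> < ennreal t} \<in> sets (past t)" .
qed

definition below :: "real \<Rightarrow> nat \<Rightarrow> real" where "below a n = a - 1 / real (Suc n)"

lemma below_less: "below a n < a" unfolding below_def by simp

lemma below_Suc: "below a n < below a (Suc n)"
  unfolding below_def by (simp add: field_simps)

lemma below_tendsto: "(\<lambda>n. below a n) \<longlonglongrightarrow> a"
  unfolding below_def using tendsto_diff[OF tendsto_const LIMSEQ_inverse_real_of_nat, of a]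
  by (simp add: inverse_eq_divide)

text \<open>The limit of the passage times of levels strictly below \<open>a\<close>. Unlike the
  first entry into \<open>{a..}\<close>, it is a random time by construction, and these passage
  times announce it; the two agree almost surely.\<close>

definition hit :: "real \<Rightarrow> real \<Rightarrow> 'a \<Rightarrow> ennreal" where
  "hit x a \<omega> = (SUP n. passage x (below a n) \<omega>)"

lemma passage_le_hit: "passage x (below a n) \<omega> \<le> hit x a \<omega>"
  unfolding hit_def by (rule SUP_upper) simp

text \<open>A strict bound on a supremum leaves a gap of some \<open>1 / (k + 1)\<close>, which
  turns the event into a countable union of countable intersections.\<close>

lemma random_time_hit: "random_time (hit x a)"
  unfolding random_time_def
proof (intro allI impI)
  fix t :: real assume t: "0 < t"
  let ?I = "{k::nat. 0 < t - 1 / real (Suc k)}"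
  have "hit x a \<omega> < ennreal t \<longleftrightarrow> (\<exists>k\<in>?I. \<forall>n. passage x (below a n) \<omega> < ennreal (t - 1 / real (Suc k)))" for \<omega>
  proof
    assume less: "hit x a \<omega> < ennreal t"
    then obtain u where u: "hit x a \<omega> = ennreal u" "0 \<le> u" by (cases "hit x a \<omega>") auto
    then have "u < t" using less by (simp add: ennreal_less_iff)
    then obtain k where k: "1 / real (Suc k) < t - u"
      using nat_approx_posE[of "t - u"] by auto
    then have "passage x (below a n) \<omega> < ennreal (t - 1 / real (Suc k))" for n
      using passage_le_hit[of x a n \<omega>] u by (auto simp: ennreal_less_iff intro: le_less_trans)
    then show "\<exists>k\<in>?I. \<forall>n. passage x (below a n) \<omega> < ennreal (t - 1 / real (Suc k))"
      using k u(2) by (intro bexI[of _ k]) auto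
  next
    assume "\<exists>k\<in>?I. \<forall>n. passage x (below a n) \<omega> < ennreal (t - 1 / real (Suc k))"
    then obtain k where k: "0 < t - 1 / real (Suc k)" "\<And>n. passage x (below a n) \<omega> < ennreal (t - 1 / real (Suc k))" by blast
    have "hit x a \<omega> \<le> ennreal (t - 1 / real (Suc k))"
      unfolding hit_def by (rule SUP_least) (use k(2) less_imp_le in blast)
    also have "\<dots> < ennreal t" using k(1) by (subst ennreal_less_iff) auto
    finally show "hit x a \<omega> < ennreal t" .
  qed
  then have "{\<omega>\<in>space M. hit x a \<omega> < ennreal t}
      = (\<Union>k\<in>?I. \<Inter>n. {\<omega>\<in>space M. passage x (below a n) \<omega> < ennreal (t - 1 / real (Suc k))})"
    by auto
  also have "\<dots> \<in> sets (past t)"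
  proof (rule sets.countable_UN'')
    fix k assume k: "k \<in> ?I"
    have "{\<omega>\<in>space M. passage x (below a n) \<omega> < ennreal (t - 1 / real (Suc k))} \<in> sets (past t)" for n
      using random_time_passage[of x "below a n"] k sets_past_mono[of "t - 1 / real (Suc k)" t]
      unfolding random_time_def by auto
    then show "(\<Inter>n. {\<omega>\<in>space M. passage x (below a n) \<omega> < ennreal (t - 1 / real (Suc k))}) \<in> sets (past t)"
      by (intro sets.countable_INT) auto
  qed auto
  finally show "{\<omega>\<in>space M. hit x a \<omega> < ennreal t} \<in> sets (past t)" .
qed

lemma passage_value:
  assumes w: "\<omega> \<in> space M" and p: "passage x c \<omega> = ennreal p" "0 \<le> p"
  shows "c \<le> x + X p \<omega>"
proof (rule ccontr)
  assume "\<not> c \<le> x + X p \<omega>"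
  then have "X p \<omega> < c - x" by simp
  moreover have "((\<lambda>t. X t \<omega>) \<longlongrightarrow> X p \<omega>) (at_right p)"
    using X_cadlag[OF w] p(2) unfolding cadlag_def by blast
  ultimately have "\<forall>\<^sub>F t in at_right p. X t \<omega> < c - x" by (rule order_tendstoD(2)[rotated])
  then obtain b where b: "b > p" "\<And>t. p < t \<Longrightarrow> t < b \<Longrightarrow> X t \<omega> < c - x"
    by (auto simp: eventually_at_right_field)
  have "passage x c \<omega> < ennreal b" using p b(1) by (simp add: ennreal_less_iff)
  then obtain s where s: "0 \<le> s" "s < b" "c < x + X s \<omega>" by (auto simp: passage_less_iff)
  then have "p \<le> s" using passage_le[of s c x \<omega>] p by simp
  then show False using s b(2)[of s] \<open>X p \<omega> < c - x\<close> by (cases "p = s") auto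
qed

text \<open>The passage times of the lower levels approach \<open>s\<close> strictly from the left,
  so the left limit of \<open>X\<close> at \<open>s\<close> is exactly \<open>a - x\<close>. Without
  positive jumps, the only possible defect at \<open>s\<close> is a jump downwards.\<close>

lemma hit_path:
  assumes w: "\<omega> \<in> space M" and "x < a"
  obtains s p where "hit x a \<omega> = ennreal s" "0 < s"
    "\<And>r. 0 \<le> r \<Longrightarrow> r < s \<Longrightarrow> x + X r \<omega> < a" "x + X s \<omega> \<le> a"
    "\<And>n. passage x (below a n) \<omega> = ennreal (p n)" "\<And>n. 0 \<le> p n" "\<And>n. p n < s" "p \<longlonglongrightarrow> s"
    "(\<lambda>n. X (p n) \<omega>) \<longlonglongrightarrow> a - x"
proof -
  have "\<forall>\<^sub>F t in at_top. a - x < X t \<omega>"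
    using X_at_top[OF w] by (auto simp: filterlim_at_top_dense)
  then have "\<forall>\<^sub>F t in at_top. a - x < X t \<omega> \<and> 0 \<le> t"
    using eventually_ge_at_top[of "0::real"] by (rule eventually_conj)
  then obtain s0 where "a - x < X s0 \<omega>" and s0_nonneg: "0 \<le> s0"
    using eventually_happens'[OF trivial_limit_at_top_linorder] by blast
  then have s0: "a < x + X s0 \<omega>" "0 \<le> s0" by auto
  have le0: "passage x (below a n) \<omega> \<le> ennreal s0" for n
    by (rule passage_le[OF s0(2)]) (use s0(1) below_less[of a n] in simp)
  then have "hit x a \<omega> \<le> ennreal s0" unfolding hit_def by (rule SUP_least)
  then have "hit x a \<omega> < top" by (rule le_less_trans) simp
  then obtain s where s: "hit x a \<omega> = ennreal s" "0 \<le> s" by (cases "hit x a \<omega>") auto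
  have "\<exists>q. passage x (below a n) \<omega> = ennreal q \<and> 0 \<le> q" for n
    using le0[of n] by (cases "passage x (below a n) \<omega>") (auto simp: top_unique)
  then obtain p where p: "\<And>n. passage x (below a n) \<omega> = ennreal (p n)" "\<And>n. 0 \<le> p n" by metis
  have ps: "p n \<le> s" for n using passage_le_hit[of x a n \<omega>] p(1)[of n] s by simp
  have pinc: "incseq p"
  proof (rule incseq_SucI)
    fix n
    have "passage x (below a n) \<omega> \<le> passage x (below a (Suc n)) \<omega>"
      by (rule passage_mono) (use below_Suc[of a n] in simp)
    then show "p n \<le> p (Suc n)" using p by simp
  qed
  have lim: "p \<longlonglongrightarrow> s"
  proof -
    have "incseq (\<lambda>n. ennreal (p n))" using pinc by (auto simp: incseq_def intro: ennreal_leI)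
    then have "(\<lambda>n. ennreal (p n)) \<longlonglongrightarrow> (SUP n. ennreal (p n))" by (rule LIMSEQ_SUP)
    also have "(SUP n. ennreal (p n)) = ennreal s" using s(1) unfolding hit_def p(1) .
    finally show ?thesis using p(2) s(2) by (subst (asm) tendsto_ennreal_iff) auto
  qed
  have before: "x + X r \<omega> < a" if "0 \<le> r" "r < s" for r
  proof (rule ccontr)
    assume "\<not> x + X r \<omega> < a"
    then have "passage x (below a n) \<omega> \<le> ennreal r" for n
      using below_less[of a n] by (intro passage_le that) auto
    then have "hit x a \<omega> \<le> ennreal r" unfolding hit_def by (rule SUP_least)
    then show False using that s by simp
  qed
  have val: "below a n \<le> x + X (p n) \<omega>" for n by (rule passage_value[OF w p])
  have s_pos: "0 < s"
  proof (rule ccontr)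
    assume "\<not> 0 < s"
    then have "p n = 0" for n using ps[of n] p(2)[of n] by simp
    then have "below a n \<le> x" for n using val[of n] X_0[OF w] by simp
    then have "a \<le> x" using below_tendsto by (intro LIMSEQ_le_const2[of "\<lambda>n. below a n"]) auto
    then show False using \<open>x < a\<close> by simp
  qed
  obtain l where l: "((\<lambda>t. X t \<omega>) \<longlongrightarrow> l) (at_left s)"
    using X_cadlag[OF w] s_pos unfolding cadlag_def by blast
  have Xs_l: "X s \<omega> \<le> l"
    using X_no_positive_jumps[OF w] s_pos l unfolding no_positive_jumps_def by blast
  \<comment> \<open>If \<open>p n\<close> were \<open>s\<close>, then \<open>p (Suc n)\<close> would
    be \<open>s\<close> too: the path stays at or below level \<open>n\<close> before
    \<open>s\<close> and reaches level \<open>n + 1\<close> at \<open>s\<close>, a positive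
    jump.\<close>
  have p_less: "p n < s" for n
  proof (rule ccontr)
    assume "\<not> p n < s"
    then have pn: "p n = s" using ps[of n] by simp
    have "p n \<le> p (Suc n)" using pinc by (rule incseq_SucD)
    then have "p (Suc n) = s" using pn ps[of "Suc n"] by simp
    then have ge: "below a (Suc n) \<le> x + X s \<omega>" using val[of "Suc n"] by simp
    have "X r \<omega> \<le> below a n - x" if "0 \<le> r" "r < s" for r
      using passage_le[OF that(1), of "below a n" x \<omega>] p(1)[of n] pn that by (cases "below a n < x + X r \<omega>") auto
    then have "\<forall>\<^sub>F r in at_left s. X r \<omega> \<le> below a n - x"
      unfolding eventually_at_left_field using s_pos by (intro exI[of _ 0]) auto
    then have "l \<le> below a n - x" by (intro tendsto_upperbound[OF l]) auto
    then show False using Xs_l ge below_Suc[of a n] by simp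
  qed
  have "filterlim p (at_left s) sequentially"
    using lim p_less by (auto simp: filterlim_at intro!: always_eventually)
  then have pl: "(\<lambda>n. X (p n) \<omega>) \<longlonglongrightarrow> l" by (rule filterlim_compose[OF l])
  have "l \<le> a - x"
  proof (rule tendsto_upperbound[OF l])
    show "\<forall>\<^sub>F r in at_left s. X r \<omega> \<le> a - x"
      unfolding eventually_at_left_field using s_pos before
      by (intro exI[of _ 0]) (auto intro!: less_imp_le simp: less_diff_eq add.commute)
  qed simp
  moreover have "a - x \<le> l"
  proof (rule LIMSEQ_le[OF _ pl])
    show "(\<lambda>n. below a n - x) \<longlonglongrightarrow> a - x" by (intro tendsto_diff tendsto_const below_tendsto)
    show "\<exists>N. \<forall>n\<ge>N. below a n - x \<le> X (p n) \<omega>" using val by (auto simp: algebra_simps)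
  qed
  ultimately have "l = a - x" by simp
  then show thesis using that[OF s(1) s_pos before _ p(1) p(2) p_less lim] pl Xs_l by auto
qed

lemma trunc_ennreal:
  assumes "\<tau> \<omega> = ennreal s" "0 \<le> s"
  shows "trunc \<tau> N \<omega> = min s (real N)"
proof -
  have "min (ennreal s) (ennreal (real N)) = ennreal (min s (real N))"
    using assms(2) by (simp add: min_def)
  then show ?thesis unfolding trunc_def assms(1) using assms(2) by simp
qed

end

context snlp_exp
begin

text \<open>The process is quasi-left-continuous at its hitting time: the downward jump of
  \<open>X\<close> there is a nonnegative random variable whose mean vanishes by Wald's identity.\<close>

lemma hit_value:
  assumes "x < a"
  shows "AE \<omega> in M. x + X (enn2real (hit x a \<omega>)) \<omega> = a"
proof -
  let ?\<sigma> = "hit x a"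
  \<comment> \<open>The limit of \<open>X\<close> along the truncated passage times. If the hitting
    time is at most \<open>N\<close>, this is the left limit there, namely
    \<open>a - x\<close>.\<close>
  define L where "L N \<omega> = (if enn2real (?\<sigma> \<omega>) \<le> real N then a - x else X (real N) \<omega>)" for N \<omega>
  have each: "AE \<omega> in M. L N \<omega> - X (trunc ?\<sigma> N \<omega>) \<omega> = 0" for N
  proof -
    let ?p = "\<lambda>n. passage x (below a n)"
    have Xm: "(\<lambda>\<omega>. X (trunc (?p n) N \<omega>) \<omega>) \<in> borel_measurable M" for n
      by (rule X_trunc_measurable[OF random_time_passage])
    have ptL: "(\<lambda>n. X (trunc (?p n) N \<omega>) \<omega>) \<longlonglongrightarrow> L N \<omega>"
      and ptT: "(\<lambda>n. trunc (?p n) N \<omega>) \<longlonglongrightarrow> trunc ?\<sigma> N \<omega>"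
      and nn: "0 \<le> L N \<omega> - X (trunc ?\<sigma> N \<omega>) \<omega>"
      if w: "\<omega> \<in> space M" for \<omega>
    proof -
      obtain s p where s: "?\<sigma> \<omega> = ennreal s" "0 < s" "x + X s \<omega> \<le> a"
        and p: "\<And>n. ?p n \<omega> = ennreal (p n)" "\<And>n. 0 \<le> p n" "\<And>n. p n < s" "p \<longlonglongrightarrow> s"
        and lim: "(\<lambda>n. X (p n) \<omega>) \<longlonglongrightarrow> a - x"
        using hit_path[OF w assms] by metis
      have tp: "trunc (?p n) N \<omega> = min (p n) (real N)" for n
        by (rule trunc_ennreal[of "?p n" \<omega> "p n" N, OF p(1)[of n] p(2)[of n]])
      have ts: "trunc ?\<sigma> N \<omega> = min s (real N)" by (rule trunc_ennreal) (use s in auto)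
      have sr: "enn2real (?\<sigma> \<omega>) = s" using s by simp
      show "(\<lambda>n. trunc (?p n) N \<omega>) \<longlonglongrightarrow> trunc ?\<sigma> N \<omega>"
        unfolding tp ts by (intro tendsto_min p tendsto_const)
      show "0 \<le> L N \<omega> - X (trunc ?\<sigma> N \<omega>) \<omega>"
        unfolding L_def sr ts using s(3) by (auto simp: min_def)
      show "(\<lambda>n. X (trunc (?p n) N \<omega>) \<omega>) \<longlonglongrightarrow> L N \<omega>"
      proof (cases "s \<le> real N")
        case True
        then have "trunc (?p n) N \<omega> = p n" for n unfolding tp using p(3)[of n] by simp
        then show ?thesis unfolding L_def sr using True lim by simp
      next
        case False
        then have "\<forall>\<^sub>F n in sequentially. real N < p n" by (intro order_tendstoD(1)[OF p(4)]) simp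
        then have "\<forall>\<^sub>F n in sequentially. X (trunc (?p n) N \<omega>) \<omega> = L N \<omega>"
          by eventually_elim (use False in \<open>simp add: tp L_def sr\<close>)
        then show ?thesis by (rule tendsto_eventually)
      qed
    qed
    have Lm: "L N \<in> borel_measurable M" by (rule borel_measurable_LIMSEQ_real[OF ptL Xm])
    have wi: "integrable M (\<lambda>\<omega>. inf_neg \<omega> + run_max N \<omega>)"
      using inf_neg_integrable run_max_integrable[of N] by simp
    have conv: "(\<lambda>n. \<integral>\<omega>. X (trunc (?p n) N \<omega>) \<omega> \<partial>M) \<longlonglongrightarrow> (\<integral>\<omega>. L N \<omega> \<partial>M)"
      by (rule integral_dominated_convergence[OF Lm Xm wi])
         (auto intro!: AE_I2 ptL X_abs_le trunc_nonneg trunc_le)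
    have Li: "integrable M (L N)"
      by (rule integrable_dominated_convergence[OF Lm Xm wi])
         (auto intro!: AE_I2 ptL X_abs_le trunc_nonneg trunc_le)
    have "(\<lambda>n. \<integral>\<omega>. trunc (?p n) N \<omega> \<partial>M) \<longlonglongrightarrow> (\<integral>\<omega>. trunc ?\<sigma> N \<omega> \<partial>M)"
      by (rule integral_dominated_convergence[where w="\<lambda>_. real N"])
         (auto intro!: AE_I2 ptT trunc_measurable random_time_hit random_time_passage simp: trunc_nonneg trunc_le)
    then have "(\<lambda>n. \<integral>\<omega>. X (trunc (?p n) N \<omega>) \<omega> \<partial>M) \<longlonglongrightarrow> m * (\<integral>\<omega>. trunc ?\<sigma> N \<omega> \<partial>M)"
      unfolding wald(2)[OF random_time_passage] by (rule tendsto_mult_left)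
    then have "(\<integral>\<omega>. L N \<omega> \<partial>M) = (\<integral>\<omega>. X (trunc ?\<sigma> N \<omega>) \<omega> \<partial>M)"
      unfolding wald(2)[OF random_time_hit] using conv LIMSEQ_unique by blast
    then have "(\<integral>\<omega>. L N \<omega> - X (trunc ?\<sigma> N \<omega>) \<omega> \<partial>M) = 0"
      using Li wald(1)[OF random_time_hit] by simp
    then show ?thesis
      using Li wald(1)[OF random_time_hit] nn by (subst (asm) integral_nonneg_eq_0_iff_AE) auto
  qed
  then have "AE \<omega> in M. \<forall>N. L N \<omega> - X (trunc ?\<sigma> N \<omega>) \<omega> = 0" by (simp add: AE_all_countable)
  then show ?thesis
  proof (rule AE_mp, intro AE_I2 impI)
    fix \<omega> assume w: "\<omega> \<in> space M" and L: "\<forall>N. L N \<omega> - X (trunc ?\<sigma> N \<omega>) \<omega> = 0"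
    obtain s where s: "?\<sigma> \<omega> = ennreal s" "0 < s" using hit_path[OF w assms] by metis
    obtain N :: nat where N: "s \<le> real N" using real_arch_simple by blast
    have "trunc ?\<sigma> N \<omega> = s" using trunc_ennreal[of ?\<sigma> \<omega> s N] s N by simp
    then show "x + X (enn2real (?\<sigma> \<omega>)) \<omega> = a" using L[rule_format, of N] s N unfolding L_def by simp
  qed
qed

text \<open>Once the value at \<open>hit\<close> is \<open>a\<close>, that time is admissible for
  the first entry. Conversely, a time at which the path is at least \<open>a\<close> bounds every
  passage time of a lower level.\<close>

lemma first_entry_eq_hit:
  assumes "x < a"
  shows "AE \<omega> in M. first_entry {a..} (\<lambda>t. x + X t \<omega>) = hit x a \<omega>"
  using hit_value[OF assms]
proof (rule AE_mp, intro AE_I2 impI)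
  fix \<omega> assume w: "\<omega> \<in> space M" and eq: "x + X (enn2real (hit x a \<omega>)) \<omega> = a"
  obtain s where s: "hit x a \<omega> = ennreal s" "0 < s" using hit_path[OF w assms] by metis
  show "first_entry {a..} (\<lambda>t. x + X t \<omega>) = hit x a \<omega>"
  proof (rule antisym)
    show "first_entry {a..} (\<lambda>t. x + X t \<omega>) \<le> hit x a \<omega>"
      unfolding first_entry_def using s eq by (intro Inf_lower) auto
    show "hit x a \<omega> \<le> first_entry {a..} (\<lambda>t. x + X t \<omega>)"
      unfolding first_entry_def
    proof (rule Inf_greatest)
      fix y assume "y \<in> {ennreal t | t. 0 \<le> t \<and> x + X t \<omega> \<in> {a..}}"
      then obtain t where t: "y = ennreal t" "0 \<le> t" "a \<le> x + X t \<omega>" by auto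
      have "passage x (below a n) \<omega> \<le> ennreal t" for n
        using t below_less[of a n] by (intro passage_le) auto
      then show "hit x a \<omega> \<le> y" unfolding hit_def t(1) by (rule SUP_least)
    qed
  qed
qed

text \<open>Up to the hitting time the path lies between \<open>- inf_neg\<close> and
  \<open>a - x\<close>. This dominates for all horizons at once, which the running maximum,
  depending on \<open>N\<close>, does not.\<close>

lemma gain_hit_tendsto:
  assumes "x < a"
  shows "(\<lambda>N. \<integral>\<omega>. gain (x + X (trunc (hit x a) N \<omega>) \<omega>) \<partial>M) \<longlonglongrightarrow> gain a"
proof -
  let ?C = "max 1 (3 / m)"
  have gC: "\<bar>gain y\<bar> \<le> ?C * (1 + \<bar>y\<bar>)" for y using generator_gain unfolding has_generator_def by blast
  have [measurable]: "gain \<in> borel_measurable borel"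
    by (rule borel_measurable_continuous_onI) (simp add: continuous_at_imp_continuous_on gain_isCont)
  have Xm [measurable]: "(\<lambda>\<omega>. X (trunc (hit x a) N \<omega>) \<omega>) \<in> borel_measurable M" for N
    by (rule X_trunc_measurable[OF random_time_hit])
  have "(\<lambda>N. \<integral>\<omega>. gain (x + X (trunc (hit x a) N \<omega>) \<omega>) \<partial>M) \<longlonglongrightarrow> (\<integral>\<omega>. gain a \<partial>M)"
  proof (rule integral_dominated_convergence[where w="\<lambda>\<omega>. ?C * (1 + \<bar>x\<bar> + \<bar>a - x\<bar> + inf_neg \<omega>)"])
    show "integrable M (\<lambda>\<omega>. ?C * (1 + \<bar>x\<bar> + \<bar>a - x\<bar> + inf_neg \<omega>))"
      using inf_neg_integrable by auto
    show "AE \<omega> in M. (\<lambda>N. gain (x + X (trunc (hit x a) N \<omega>) \<omega>)) \<longlonglongrightarrow> gain a"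
      using hit_value[OF assms]
    proof (rule AE_mp, intro AE_I2 impI)
      fix \<omega> assume w: "\<omega> \<in> space M" and eq: "x + X (enn2real (hit x a \<omega>)) \<omega> = a"
      obtain s where s: "hit x a \<omega> = ennreal s" "0 < s" using hit_path[OF w assms] by metis
      obtain N0 :: nat where N0: "s \<le> real N0" using real_arch_simple by blast
      have "\<forall>\<^sub>F N in sequentially. gain (x + X (trunc (hit x a) N \<omega>) \<omega>) = gain a"
        using eventually_ge_at_top[of N0]
      proof eventually_elim
        case (elim N)
        then have "s \<le> real N" using N0 by simp
        then have "trunc (hit x a) N \<omega> = s" using trunc_ennreal[of "hit x a" \<omega> s N] s by simp
        then show ?case using eq s by simp
      qed
      then show "(\<lambda>N. gain (x + X (trunc (hit x a) N \<omega>) \<omega>)) \<longlonglongrightarrow> gain a" by (rule tendsto_eventually)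
    qed
    show "AE \<omega> in M. norm (gain (x + X (trunc (hit x a) N \<omega>) \<omega>)) \<le> ?C * (1 + \<bar>x\<bar> + \<bar>a - x\<bar> + inf_neg \<omega>)" for N
    proof (rule AE_I2)
      fix \<omega> assume w: "\<omega> \<in> space M"
      obtain s where s: "hit x a \<omega> = ennreal s" "0 < s" "x + X s \<omega> \<le> a"
        and before: "\<And>r. 0 \<le> r \<Longrightarrow> r < s \<Longrightarrow> x + X r \<omega> < a" using hit_path[OF w assms] by metis
      let ?t = "trunc (hit x a) N \<omega>"
      have t: "?t = min s (real N)" by (rule trunc_ennreal) (use s in auto)
      have "X ?t \<omega> \<le> a - x" using before[of ?t] s(3) trunc_nonneg[of "hit x a" N \<omega>] unfolding t
        by (cases "s \<le> real N") auto
      moreover have "- X ?t \<omega> \<le> inf_neg \<omega>" by (rule inf_neg_ge[OF w trunc_nonneg])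
      ultimately have "1 + \<bar>x + X ?t \<omega>\<bar> \<le> 1 + \<bar>x\<bar> + \<bar>a - x\<bar> + inf_neg \<omega>" using inf_neg_nonneg[OF w] by linarith
      then have "?C * (1 + \<bar>x + X ?t \<omega>\<bar>) \<le> ?C * (1 + \<bar>x\<bar> + \<bar>a - x\<bar> + inf_neg \<omega>)"
        by (intro mult_left_mono) auto
      then show "norm (gain (x + X ?t \<omega>)) \<le> ?C * (1 + \<bar>x\<bar> + \<bar>a - x\<bar> + inf_neg \<omega>)"
        using gC[of "x + X ?t \<omega>"] by simp
    qed
  qed auto
  then show ?thesis by (simp add: prob_space)
qed

lemma optimal_random_time:
  obtains \<sigma> where "random_time \<sigma>"
    "AE \<omega> in M. first_entry {level..} (\<lambda>t. x + X t \<omega>) = \<sigma> \<omega>"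
    "enn2ereal (cost_pos \<sigma> x) - enn2ereal (cost_neg \<sigma> x) = ereal (val x)"
proof (cases "x < level")
  case True
  show thesis
  proof (rule that[OF random_time_hit first_entry_eq_hit[OF True]])
    show "enn2ereal (cost_pos (hit x level) x) - enn2ereal (cost_neg (hit x level) x) = ereal (val x)"
      by (rule cost_eqI[OF random_time_hit])
         (use tendsto_diff[OF gain_hit_tendsto[OF True] tendsto_const, of "gain x"] True in \<open>simp add: val_def\<close>)
  qed
next
  case False
  have r0: "random_time (\<lambda>_. 0)"
    unfolding random_time_def
  proof (intro allI impI)
    fix t :: real assume "0 < t"
    then have "{\<omega>\<in>space M. 0 < ennreal t} = space (past t)" by auto
    then show "{\<omega>\<in>space M. 0 < ennreal t} \<in> sets (past t)" using sets.top by metis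
  qed
  show thesis
  proof (rule that[OF r0])
    show "AE \<omega> in M. first_entry {level..} (\<lambda>t. x + X t \<omega>) = 0"
    proof (rule AE_I2)
      fix \<omega> assume "\<omega> \<in> space M"
      then have "0 \<in> {ennreal t | t. 0 \<le> t \<and> x + X t \<omega> \<in> {level..}}" using False X_0 by (intro CollectI exI[of _ 0]) auto
      then have "first_entry {level..} (\<lambda>t. x + X t \<omega>) \<le> 0" unfolding first_entry_def by (rule Inf_lower)
      then show "first_entry {level..} (\<lambda>t. x + X t \<omega>) = 0" by simp
    qed
    show "enn2ereal (cost_pos (\<lambda>_. 0) x) - enn2ereal (cost_neg (\<lambda>_. 0) x) = ereal (val x)"
    proof (rule cost_eqI[OF r0])
      have "(\<integral>\<omega>. gain (x + X (trunc (\<lambda>_. 0) N \<omega>) \<omega>) \<partial>M) = (\<integral>\<omega>. gain x \<partial>M)" for N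
        by (rule Bochner_Integration.integral_cong) (auto simp: trunc_def X_0)
      then show "(\<lambda>N. (\<integral>\<omega>. gain (x + X (trunc (\<lambda>_. 0) N \<omega>) \<omega>) \<partial>M) - gain x) \<longlonglongrightarrow> val x"
        using False by (simp add: prob_space val_def)
    qed
  qed
qed

end

subsection \<open>Scale function and atom at the origin\<close>

text \<open>\<open>f t - d * t\<close> is nonincreasing, hence
  \<open>\<bar>f t - f s\<bar> \<le> 2 * d * (t - s) - (f t - f s)\<close>, and the right-hand side
  telescopes.\<close>

lemma bounded_variation_drift_minus_mono:
  assumes dec: "\<And>s t. 0 \<le> s \<Longrightarrow> s \<le> t \<Longrightarrow> f t - f s \<le> d * (t - s)" and "0 \<le> d"
  shows "bounded_variation_on {0..T} f"
  unfolding bounded_variation_on_def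
proof (intro exI[of _ "f 0 - f T + 2 * d * T"] allI impI)
  fix n :: nat and t :: "nat \<Rightarrow> real" assume "mono t \<and> range t \<subseteq> {0..T}"
  then have mono: "mono t" and range: "\<And>i. 0 \<le> t i" "\<And>i. t i \<le> T" by (auto simp: image_subset_iff)
  have "(\<Sum>i<n. \<bar>f (t (Suc i)) - f (t i)\<bar>) \<le> (\<Sum>i<n. (2 * d * t (Suc i) - f (t (Suc i))) - (2 * d * t i - f (t i)))"
  proof (rule sum_mono)
    fix i
    have le: "t i \<le> t (Suc i)" using mono by (simp add: monoD)
    then have "f (t (Suc i)) - f (t i) \<le> d * (t (Suc i) - t i)" using dec range by simp
    moreover have "0 \<le> d * (t (Suc i) - t i)" using le \<open>0 \<le> d\<close> by simp
    ultimately show "\<bar>f (t (Suc i)) - f (t i)\<bar> \<le> (2 * d * t (Suc i) - f (t (Suc i))) - (2 * d * t i - f (t i))"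
      by (simp add: algebra_simps abs_le_iff)
  qed
  also have "\<dots> = (2 * d * t n - f (t n)) - (2 * d * t 0 - f (t 0))"
    by (rule sum_lessThan_telescope)
  also have "\<dots> \<le> f 0 - f T + 2 * d * T"
  proof -
    have "f (t 0) - f 0 \<le> d * (t 0 - 0)" by (rule dec) (use range in auto)
    moreover have "f T - f (t n) \<le> d * (T - t n)" by (rule dec) (use range in auto)
    moreover have "d * t n \<le> d * T" "0 \<le> d * t 0" using range \<open>0 \<le> d\<close> by (auto intro: mult_left_mono)
    ultimately show ?thesis by (simp add: algebra_simps)
  qed
  finally show "(\<Sum>i<n. \<bar>f (t (Suc i)) - f (t i)\<bar>) \<le> f 0 - f T + 2 * d * T" .
qed

context snlp_exp
begin

lemma nn_integral_exp_tail:
  assumes "0 < \<beta>"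
  shows "(\<integral>\<^sup>+x. ennreal (exp (- \<beta> * x)) * indicator {y..} x \<partial>lborel) = ennreal (exp (- \<beta> * y) / \<beta>)"
proof -
  have "((\<lambda>x. - exp (- \<beta> * x) / \<beta>) \<longlongrightarrow> - 0 / \<beta>) at_top"
  proof (intro tendsto_divide tendsto_minus tendsto_const)
    show "((\<lambda>x. exp (- \<beta> * x)) \<longlongrightarrow> 0) at_top"
      by (rule filterlim_compose[OF exp_at_bot])
         (use assms in \<open>auto simp: filterlim_uminus_at_bot intro!: filterlim_tendsto_pos_mult_at_top filterlim_ident\<close>)
  qed (use assms in auto)
  then have "(\<integral>\<^sup>+x. ennreal (exp (- \<beta> * x)) * indicator {y..} x \<partial>lborel) = ennreal (- 0 / \<beta> - (- exp (- \<beta> * y) / \<beta>))"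
    by (intro nn_integral_FTC_atLeast) (use assms in \<open>auto intro!: derivative_eq_intros\<close>)
  then show ?thesis by simp
qed

text \<open>By Tonelli the integral is the mean of the exponential tail from \<open>inf_neg\<close>
  on, that is \<open>E exp (- \<beta> * Y) / \<beta>\<close>.\<close>

lemma inf_cdf_laplace:
  assumes "0 < \<beta>"
  shows "set_integrable lborel {0..} (\<lambda>x. exp (- \<beta> * x) * inf_cdf x)"
    and "(LINT x:{0..}|lborel. exp (- \<beta> * x) * inf_cdf x) = m / \<psi> \<beta>"
proof -
  interpret Q: pair_sigma_finite M lborel by unfold_locales
  have pt: "ennreal (indicator {0..} x *\<^sub>R (exp (- \<beta> * x) * inf_cdf x))
      = (\<integral>\<^sup>+\<omega>. ennreal (exp (- \<beta> * x)) * indicator {inf_neg \<omega>..} x \<partial>M)" for x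
  proof -
    have "(\<integral>\<^sup>+\<omega>. ennreal (exp (- \<beta> * x)) * indicator {inf_neg \<omega>..} x \<partial>M)
        = (\<integral>\<^sup>+\<omega>. ennreal (exp (- \<beta> * x)) * indicator {\<omega>\<in>space M. inf_neg \<omega> \<le> x} \<omega> \<partial>M)"
      by (rule nn_integral_cong) (auto simp: indicator_def)
    also have "\<dots> = ennreal (exp (- \<beta> * x)) * ennreal (inf_cdf x)"
      unfolding inf_cdf_def by (simp add: nn_integral_cmult_indicator emeasure_eq_measure)
    also have "\<dots> = ennreal (indicator {0..} x *\<^sub>R (exp (- \<beta> * x) * inf_cdf x))"
      using inf_cdf_neg[of x] inf_cdf_bounds[of x] by (auto simp: indicator_def ennreal_mult)
    finally show ?thesis ..
  qed
  have "(\<integral>\<^sup>+x. ennreal (indicator {0..} x *\<^sub>R (exp (- \<beta> * x) * inf_cdf x)) \<partial>lborel)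
      = (\<integral>\<^sup>+x. \<integral>\<^sup>+\<omega>. ennreal (exp (- \<beta> * x)) * indicator {inf_neg \<omega>..} x \<partial>M \<partial>lborel)"
    unfolding pt ..
  also have "\<dots> = (\<integral>\<^sup>+\<omega>. \<integral>\<^sup>+x. ennreal (exp (- \<beta> * x)) * indicator {inf_neg \<omega>..} x \<partial>lborel \<partial>M)"
  proof (rule Q.Fubini')
    have "(\<lambda>p. ennreal (exp (- \<beta> * snd p)) * (if inf_neg (fst p) \<le> snd p then 1 else 0)) \<in> borel_measurable (M \<Otimes>\<^sub>M lborel)"
      by measurable
    then show "(\<lambda>(\<omega>, x). ennreal (exp (- \<beta> * x)) * indicator {inf_neg \<omega>..} x) \<in> borel_measurable (M \<Otimes>\<^sub>M lborel)"
      by (simp add: indicator_def case_prod_beta of_bool_def)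
  qed
  also have "\<dots> = (\<integral>\<^sup>+\<omega>. ennreal (exp (- \<beta> * inf_neg \<omega>) / \<beta>) \<partial>M)"
    unfolding nn_integral_exp_tail[OF assms] ..
  also have "\<dots> = ennreal (\<integral>\<omega>. exp (- \<beta> * inf_neg \<omega>) / \<beta> \<partial>M)"
    by (rule nn_integral_eq_integral) (use exp_inf_neg_integrable[of \<beta>] assms in auto)
  also have "(\<integral>\<omega>. exp (- \<beta> * inf_neg \<omega>) / \<beta> \<partial>M) = m / \<psi> \<beta>"
    using laplace_inf_neg_eq[OF assms] assms by simp
  finally have nn: "(\<integral>\<^sup>+x. ennreal (indicator {0..} x *\<^sub>R (exp (- \<beta> * x) * inf_cdf x)) \<partial>lborel) = ennreal (m / \<psi> \<beta>)" .
  have nonneg: "0 \<le> indicator {0..} x *\<^sub>R (exp (- \<beta> * x) * inf_cdf x)" for x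
    using inf_cdf_bounds[of x] by simp
  have i: "integrable lborel (\<lambda>x. indicator {0..} x *\<^sub>R (exp (- \<beta> * x) * inf_cdf x))"
    by (rule integrableI_nonneg) (use nn nonneg in auto)
  then show "set_integrable lborel {0..} (\<lambda>x. exp (- \<beta> * x) * inf_cdf x)" unfolding set_integrable_def .
  have "ennreal (\<integral>x. indicator {0..} x *\<^sub>R (exp (- \<beta> * x) * inf_cdf x) \<partial>lborel) = ennreal (m / \<psi> \<beta>)"
    using nn nn_integral_eq_integral[OF i] nonneg by simp
  then show "(LINT x:{0..}|lborel. exp (- \<beta> * x) * inf_cdf x) = m / \<psi> \<beta>"
    unfolding set_lebesgue_integral_def
    using nonneg m_pos psi_pos[OF assms] by (subst (asm) ennreal_inj) (auto intro!: integral_nonneg_AE)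
qed

lemma inf_cdf_right_cont: "(inf_cdf \<longlongrightarrow> inf_cdf x) (at_right x)"
  using inf_law.cdf_is_right_cont[of x] unfolding inf_cdf_eq continuous_within .

text \<open>The difference \<open>inf_cdf - m * W\<close> has vanishing Laplace transform and is
  right-continuous on the half-line.\<close>

lemma inf_cdf_eq_scale:
  assumes W: "continuous_on {0..} W"
    and int: "\<And>\<beta>. 0 < \<beta> \<Longrightarrow> set_integrable lborel {0..} (\<lambda>x. exp (- \<beta> * x) * W x)"
    and lap: "\<And>\<beta>. 0 < \<beta> \<Longrightarrow> (LINT x:{0..}|lborel. exp (- \<beta> * x) * W x) = 1 / \<psi> \<beta>"
    and "0 \<le> x"
  shows "inf_cdf x = m * W x"
proof -
  have "(\<lambda>x. inf_cdf x - m * W x) x = 0"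
  proof (rule laplace_transform_zero[OF _ _ _ \<open>0 \<le> x\<close>])
    fix \<beta> :: real assume b: "0 < \<beta>"
    have i2: "set_integrable lborel {0..} (\<lambda>x. m * (exp (- \<beta> * x) * W x))"
      using int[OF b] by (rule set_integrable_mult_right)
    have e: "exp (- \<beta> * x) * (inf_cdf x - m * W x) = exp (- \<beta> * x) * inf_cdf x - m * (exp (- \<beta> * x) * W x)" for x
      by (simp add: algebra_simps)
    show "set_integrable lborel {0..} (\<lambda>x. exp (- \<beta> * x) * (inf_cdf x - m * W x))"
      unfolding e by (rule set_integral_diff(1)[OF inf_cdf_laplace(1)[OF b] i2])
    have "(LINT x:{0..}|lborel. exp (- \<beta> * x) * (inf_cdf x - m * W x))
        = (LINT x:{0..}|lborel. exp (- \<beta> * x) * inf_cdf x) - (LINT x:{0..}|lborel. m * (exp (- \<beta> * x) * W x))"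
      unfolding e by (rule set_integral_diff(2)[OF inf_cdf_laplace(1)[OF b] i2])
    also have "(LINT x:{0..}|lborel. m * (exp (- \<beta> * x) * W x)) = m * (LINT x:{0..}|lborel. exp (- \<beta> * x) * W x)"
      by (rule set_integral_mult_right)
    finally show "(LINT x:{0..}|lborel. exp (- \<beta> * x) * (inf_cdf x - m * W x)) = 0"
      unfolding inf_cdf_laplace(2)[OF b] lap[OF b] by simp
  next
    fix y :: real assume "0 \<le> y"
    then have "(W \<longlongrightarrow> W y) (at y within {0..})" using W unfolding continuous_on_def by simp
    then have "(W \<longlongrightarrow> W y) (at_right y)"
      by (rule tendsto_within_subset) (use \<open>0 \<le> y\<close> in auto)
    then show "((\<lambda>x. inf_cdf x - m * W x) \<longlongrightarrow> inf_cdf y - m * W y) (at_right y)"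
      by (intro tendsto_diff tendsto_mult_left inf_cdf_right_cont)
  qed
  then show ?thesis by simp
qed

text \<open>If the infimum avoided \<open>[0, \<eta>]\<close>, its Laplace transform would be at
  most \<open>exp (- \<beta> * \<eta>)\<close>. But it equals
  \<open>\<beta> * m / \<psi> \<beta>\<close> with \<open>\<psi>\<close> at most quadratic, so it
  decays only polynomially.\<close>

lemma inf_cdf_pos:
  assumes "0 < \<eta>"
  shows "0 < inf_cdf \<eta>"
proof (rule ccontr)
  assume "\<not> 0 < inf_cdf \<eta>"
  then have "inf_cdf \<eta> = 0" using inf_cdf_bounds[of \<eta>] by simp
  then have "AE \<omega> in M. \<not> inf_neg \<omega> \<le> \<eta>"
    unfolding inf_cdf_def by (intro AE_I[of _ _ "{\<omega>\<in>space M. inf_neg \<omega> \<le> \<eta>}"]) (auto simp: emeasure_eq_measure)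
  then have big: "AE \<omega> in M. \<eta> \<le> inf_neg \<omega>" by eventually_elim simp
  have ineq: "m * (\<eta>\<^sup>2 * \<beta>) \<le> 2 * K" if b: "0 < \<beta>" for \<beta>
  proof -
    have "(\<integral>\<omega>. exp (- \<beta> * inf_neg \<omega>) \<partial>M) \<le> (\<integral>\<omega>. exp (- \<beta> * \<eta>) \<partial>M)"
    proof (rule integral_mono_AE)
      show "AE \<omega> in M. exp (- \<beta> * inf_neg \<omega>) \<le> exp (- \<beta> * \<eta>)"
        using big by eventually_elim (use b in auto)
    qed (use exp_inf_neg_integrable[of \<beta>] b in auto)
    then have "\<beta> * m / \<psi> \<beta> \<le> exp (- \<beta> * \<eta>)" using laplace_inf_neg_eq[OF b] by (simp add: prob_space)
    then have "\<beta> * m \<le> exp (- \<beta> * \<eta>) * \<psi> \<beta>" using psi_pos[OF b] by (simp add: pos_divide_le_eq)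
    also have "\<dots> \<le> exp (- \<beta> * \<eta>) * (\<beta> * m + K * \<beta>\<^sup>2)"
      using psi_le[of \<beta>] b by (intro mult_left_mono) auto
    finally have "exp (\<beta> * \<eta>) * (\<beta> * m) \<le> exp (\<beta> * \<eta>) * (exp (- \<beta> * \<eta>) * (\<beta> * m + K * \<beta>\<^sup>2))"
      by (intro mult_left_mono) auto
    then have 1: "exp (\<beta> * \<eta>) * (\<beta> * m) \<le> \<beta> * m + K * \<beta>\<^sup>2"
      by (simp add: mult.assoc[symmetric] exp_add[symmetric])
    have "1 + (\<beta> * \<eta>)\<^sup>2 / 2 \<le> exp (\<beta> * \<eta>)"
      using exp_ge_quadratic_nonneg[of "\<beta> * \<eta>"] b assms mult_pos_pos[OF b assms] by linarith
    then have "(1 + (\<beta> * \<eta>)\<^sup>2 / 2) * (\<beta> * m) \<le> exp (\<beta> * \<eta>) * (\<beta> * m)"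
      using b m_pos by (intro mult_right_mono) auto
    then have "\<beta>\<^sup>2 * (m * (\<eta>\<^sup>2 * \<beta>)) \<le> \<beta>\<^sup>2 * (2 * K)"
      using 1 by (simp add: algebra_simps power2_eq_square)
    then show ?thesis using b by simp
  qed
  \<comment> \<open>The inequality at \<open>\<beta> = (2 * K + 1) / (m * \<eta>^2)\<close> would
    read \<open>2 * K + 1 \<le> 2 * K\<close>.\<close>
  have "m * (\<eta>\<^sup>2 * ((2 * K + 1) / (m * \<eta>\<^sup>2))) \<le> 2 * K"
    using K_nonneg m_pos assms by (intro ineq divide_pos_pos) auto
  then show False using m_pos assms by simp
qed

text \<open>If a drop below \<open>- \<epsilon>\<close> over some dyadic time had probability
  \<open>p > 0\<close>, then \<open>j\<close> independent repetitions would have probability at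
  least \<open>p ^ j\<close> and carry the path to \<open>- j * \<epsilon>\<close>, below any bound
  on the infimum. So a bounded infimum is \<open>0\<close> almost surely.\<close>

lemma inf_cdf_0_eq_1:
  assumes "inf_cdf u = 1"
  shows "inf_cdf 0 = 1"
proof -
  have dy: "prob {\<omega>\<in>space M. X (real k * mesh n) \<omega> < - \<epsilon>} = 0" if "0 < \<epsilon>" for k n \<epsilon>
  proof (rule ccontr)
    let ?t = "real k * mesh n"
    let ?A = "\<lambda>j. {\<omega>\<in>space M. X (real j * ?t) \<omega> \<le> - (real j * \<epsilon>)}"
    have tj: "0 \<le> real j * ?t" for j :: nat by simp
    define p where "p = prob {\<omega>\<in>space M. X ?t \<omega> < - \<epsilon>}"
    assume "prob {\<omega>\<in>space M. X ?t \<omega> < - \<epsilon>} \<noteq> 0"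
    then have p: "0 < p" unfolding p_def by (simp add: zero_less_measure_iff)
    have pow: "p ^ j \<le> prob (?A j)" for j
    proof (induction j)
      case 0
      have "{\<omega>\<in>space M. X (real 0 * ?t) \<omega> \<le> - (real 0 * \<epsilon>)} = space M" using X_0 by auto
      then show ?case by (simp only: prob_space power_0)
    next
      case (Suc j)
      have [measurable]: "X (real j * ?t) \<in> borel_measurable M" "X ?t \<in> borel_measurable M"
        "X (real j * ?t + ?t) \<in> borel_measurable M"
        using tj by (auto intro!: X_measurable)
      let ?f = "\<lambda>q. indicator {..- (real j * \<epsilon>)} (fst q) * indicator {..<- \<epsilon>} (snd q) :: real"
      have m0: "(\<integral>\<omega>. ?f (X (real j * ?t) \<omega>, X (real j * ?t + ?t) \<omega> - X (real j * ?t) \<omega>) \<partial>M)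
          = (\<integral>\<omega>. \<integral>\<omega>'. ?f (X (real j * ?t) \<omega>, X ?t \<omega>') \<partial>M \<partial>M)"
      proof (rule markov_integral[where S=borel])
        show "X (real j * ?t) \<in> past (real j * ?t) \<rightarrow>\<^sub>M borel" using tj by (rule X_measurable_past) simp
        show "integrable M (\<lambda>\<omega>. ?f (X (real j * ?t) \<omega>, X (real j * ?t + ?t) \<omega> - X (real j * ?t) \<omega>))"
          by (rule integrable_const_bound[of _ 1]) (auto simp: indicator_def)
      qed (use tj in auto)
      have p_int: "p = (\<integral>\<omega>'. indicator {..<- \<epsilon>} (X ?t \<omega>') \<partial>M)"
      proof -
        have "(\<integral>\<omega>'. indicator {..<- \<epsilon>} (X ?t \<omega>') \<partial>M) = (\<integral>\<omega>'. indicator {\<omega>\<in>space M. X ?t \<omega> < - \<epsilon>} \<omega>' \<partial>M :: real)"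
          by (rule Bochner_Integration.integral_cong) (auto simp: indicator_def)
        then show ?thesis unfolding p_def by simp
      qed
      have j_int: "prob (?A j) = (\<integral>\<omega>. indicator {..- (real j * \<epsilon>)} (X (real j * ?t) \<omega>) \<partial>M)"
      proof -
        have "(\<integral>\<omega>. indicator {..- (real j * \<epsilon>)} (X (real j * ?t) \<omega>) \<partial>M)
            = (\<integral>\<omega>. indicator (?A j) \<omega> \<partial>M :: real)"
          by (rule Bochner_Integration.integral_cong) (auto simp: indicator_def)
        then show ?thesis by simp
      qed
      have "p ^ Suc j \<le> prob (?A j) * p"
        using Suc p by (simp add: mult.commute mult_left_mono)
      also have "\<dots> = (\<integral>\<omega>. \<integral>\<omega>'. ?f (X (real j * ?t) \<omega>, X ?t \<omega>') \<partial>M \<partial>M)"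
        unfolding j_int p_int by simp
      also have "\<dots> = (\<integral>\<omega>. ?f (X (real j * ?t) \<omega>, X (real j * ?t + ?t) \<omega> - X (real j * ?t) \<omega>) \<partial>M)"
        by (rule m0[symmetric])
      also have "\<dots> \<le> (\<integral>\<omega>. indicator {\<omega>\<in>space M. X (real j * ?t + ?t) \<omega> \<le> - (real (Suc j) * \<epsilon>)} \<omega> \<partial>M)"
      proof (rule integral_mono)
        show "integrable M (\<lambda>\<omega>. ?f (X (real j * ?t) \<omega>, X (real j * ?t + ?t) \<omega> - X (real j * ?t) \<omega>))"
          by (rule integrable_const_bound[of _ 1]) (auto simp: indicator_def)
        show "integrable M (indicator {\<omega>\<in>space M. X (real j * ?t + ?t) \<omega> \<le> - (real (Suc j) * \<epsilon>)} :: 'a \<Rightarrow> real)"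
          by (rule integrable_real_indicator) (auto simp: emeasure_eq_measure)
        fix \<omega> assume "\<omega> \<in> space M"
        then show "?f (X (real j * ?t) \<omega>, X (real j * ?t + ?t) \<omega> - X (real j * ?t) \<omega>)
          \<le> indicator {\<omega>\<in>space M. X (real j * ?t + ?t) \<omega> \<le> - (real (Suc j) * \<epsilon>)} \<omega>"
          by (auto simp: indicator_def algebra_simps)
      qed
      also have "\<dots> = prob {\<omega>\<in>space M. X (real (Suc j) * ?t) \<omega> \<le> - (real (Suc j) * \<epsilon>)}"
      proof -
        have "real j * ?t + ?t = real (Suc j) * ?t" by (simp only: of_nat_Suc distrib_right mult_1_left add.commute)
        then show ?thesis by simp
      qed
      finally show ?case .
    qed
    have "\<exists>j::nat. u < real j * \<epsilon>" using \<open>0 < \<epsilon>\<close> by (rule ex_less_of_nat_mult)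
    then obtain j :: nat where j: "u < real j * \<epsilon>" ..
    have "prob (?A j) \<le> prob {\<omega>\<in>space M. \<not> inf_neg \<omega> \<le> u}"
    proof (rule finite_measure_mono)
      show "(?A j) \<subseteq> {\<omega>\<in>space M. \<not> inf_neg \<omega> \<le> u}"
        using inf_neg_ge[OF _ tj[of j]] j by fastforce
    qed measurable
    also have "\<dots> = 0"
    proof -
      have "prob {\<omega>\<in>space M. \<not> inf_neg \<omega> \<le> u} = 1 - prob {\<omega>\<in>space M. inf_neg \<omega> \<le> u}"
        by (rule prob_neg) measurable
      then show ?thesis using assms unfolding inf_cdf_def by simp
    qed
    finally show False using pow[of j] p by (smt (verit) zero_less_power)
  qed
  have "AE \<omega> in M. \<forall>i n k. \<not> X (real k * mesh n) \<omega> < - mesh i"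
    unfolding AE_all_countable
  proof (intro allI)
    fix i n k
    have [measurable]: "X (real k * mesh n) \<in> borel_measurable M" by (rule X_measurable) simp
    show "AE \<omega> in M. \<not> X (real k * mesh n) \<omega> < - mesh i"
      by (rule AE_I[of _ _ "{\<omega>\<in>space M. X (real k * mesh n) \<omega> < - mesh i}"])
         (use dy[of "mesh i" k n] in \<open>auto simp: emeasure_eq_measure\<close>)
  qed
  then have "AE \<omega> in M. inf_neg \<omega> \<le> 0"
  proof (rule AE_mp, intro AE_I2 impI)
    fix \<omega> assume w: "\<omega> \<in> space M" and ge: "\<forall>i n k. \<not> X (real k * mesh n) \<omega> < - mesh i"
    have "0 \<le> X (real k * mesh n) \<omega>" for k n
      by (rule LIMSEQ_le_const2[OF tendsto_minus[OF half_power_tendsto_0], unfolded minus_zero])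
         (use ge not_less in blast)
    then have "grid_inf_neg n \<omega> \<le> 0" for n by (intro grid_inf_neg_le) simp
    then show "inf_neg \<omega> \<le> 0" by (intro LIMSEQ_le_const2[OF grid_inf_neg_tendsto[OF w]]) auto
  qed
  then show ?thesis unfolding inf_cdf_def by (subst prob_Collect_eq_1) auto
qed

text \<open>If the infimum avoided \<open>(u, v]\<close>, then a path staying above \<open>-u\<close> while moving up by a
  suitable amount, followed by a path with a deep infimum, would contradict independence.\<close>

lemma inf_cdf_strict:
  assumes u: "0 \<le> u" "u < v" and F0: "inf_cdf 0 < 1"
  shows "inf_cdf u < inf_cdf v"
proof (rule ccontr)
  assume "\<not> inf_cdf u < inf_cdf v"
  then have flat: "inf_cdf u = inf_cdf v" using inf_cdf_mono[of u v] u by simp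
  then have Fu: "0 < inf_cdf u" using inf_cdf_pos[of v] u by simp
  \<comment> \<open>A quarter of the gap leaves room for an uncertainty of \<open>\<eta>\<close> in
    the upward move, one of \<open>\<eta>\<close> in the later drop, and a margin of
    \<open>\<eta>\<close> at either end.\<close>
  define \<eta> where "\<eta> = (v - u) / 4"
  have e: "0 < \<eta>" "v = u + 4 * \<eta>" using u unfolding \<eta>_def by (simp_all add: field_simps)
  have Fv: "inf_cdf v \<noteq> 1" using inf_cdf_0_eq_1[of v] F0 by auto
  \<comment> \<open>The infimum exceeds \<open>v\<close> with positive probability, so its
    distribution function must still increase across some interval of length \<open>\<eta>\<close>
    beyond \<open>v\<close>.\<close>
  obtain b where b: "v \<le> b" "inf_cdf b < inf_cdf (b + \<eta>)"
  proof -
    have "\<exists>j::nat. inf_cdf (v + real j * \<eta>) < inf_cdf (v + real j * \<eta> + \<eta>)"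
    proof (rule ccontr)
      assume "\<not> ?thesis"
      then have eq: "inf_cdf (v + real j * \<eta> + \<eta>) \<le> inf_cdf (v + real j * \<eta>)" for j :: nat by (simp add: not_less)
      have le: "inf_cdf (v + real j * \<eta>) \<le> inf_cdf v" for j :: nat
      proof (induction j)
        case (Suc j)
        have "v + real (Suc j) * \<eta> = v + real j * \<eta> + \<eta>" by (simp add: algebra_simps)
        then show ?case using eq[of j] Suc by (metis order_trans)
      qed simp
      have "(inf_cdf \<longlongrightarrow> 1) at_top" unfolding inf_cdf_eq by (rule inf_law.cdf_lim_at_top_prob)
      moreover have "inf_cdf v < 1" using Fv inf_cdf_bounds[of v] by simp
      ultimately have "\<forall>\<^sub>F y in at_top. inf_cdf v < inf_cdf y" by (rule order_tendstoD)
      then obtain y where y: "inf_cdf v < inf_cdf y"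
        using eventually_happens'[OF trivial_limit_at_top_linorder] by blast
      obtain j :: nat where "y - v < real j * \<eta>" using e(1) ex_less_of_nat_mult by blast
      then have "inf_cdf y \<le> inf_cdf (v + real j * \<eta>)" by (intro inf_cdf_mono) simp
      then show False using le[of j] y by simp
    qed
    then obtain j :: nat where "inf_cdf (v + real j * \<eta>) < inf_cdf (v + real j * \<eta> + \<eta>)" by blast
    moreover have "v \<le> v + real j * \<eta>" using e(1) by simp
    ultimately show thesis by (intro that)
  qed
  \<comment> \<open>Starting from a height between \<open>c\<close> and \<open>c + \<eta>\<close>, a
    drop between \<open>b\<close> and \<open>b + \<eta>\<close> ends at a depth between
    \<open>u + \<eta>\<close> and \<open>u + 3 * \<eta>\<close>, inside the forbidden gap.\<close>
  define c where "c = b - u - 2 * \<eta>"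
  have c: "0 < c" using b(1) e unfolding c_def by simp
  \<comment> \<open>Only dyadic times are tested, so that the event is a countable intersection in
    \<open>past s\<close>. Right-continuity recovers all times before \<open>s\<close>.\<close>
  define A where "A s = {\<omega>\<in>space M. (\<forall>p\<in>{(n, k). real k * mesh n \<le> s}. - X (real (snd p) * mesh (fst p)) \<omega> \<le> u)
      \<and> X s \<omega> \<in> {c<..<c + \<eta>}}" for s
  have AP: "A s \<in> sets (past s)" if s: "0 \<le> s" for s
  proof -
    have "{\<omega>\<in>space (past s). p \<in> {(n, k). real k * mesh n \<le> s} \<longrightarrow> - X (real (snd p) * mesh (fst p)) \<omega> \<le> u}
        \<in> sets (past s)" for p
    proof (cases "p \<in> {(n, k). real k * mesh n \<le> s}")
      case True
      have [measurable]: "X (real (snd p) * mesh (fst p)) \<in> borel_measurable (past s)"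
        using True by (intro X_measurable_past) auto
      have "{\<omega>\<in>space (past s). - X (real (snd p) * mesh (fst p)) \<omega> \<le> u} \<in> sets (past s)" by measurable
      then show ?thesis using True by simp
    qed (simp add: sets.top[of "past s", simplified])
    then have 1: "{\<omega>\<in>space (past s). \<forall>p\<in>{(n, k). real k * mesh n \<le> s}. - X (real (snd p) * mesh (fst p)) \<omega> \<le> u} \<in> sets (past s)"
      unfolding Ball_def by (rule sets.sets_Collect_countable_All)
    have 2: "{\<omega>\<in>space (past s). X s \<omega> \<in> {c<..<c + \<eta>}} \<in> sets (past s)"
    proof -
      have [measurable]: "X s \<in> borel_measurable (past s)" using s by (intro X_measurable_past) auto
      show ?thesis by measurable
    qed
    have "A s = {\<omega>\<in>space (past s). \<forall>p\<in>{(n, k). real k * mesh n \<le> s}. - X (real (snd p) * mesh (fst p)) \<omega> \<le> u}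
        \<inter> {\<omega>\<in>space (past s). X s \<omega> \<in> {c<..<c + \<eta>}}" unfolding A_def space_past by blast
    then show ?thesis using sets.Int[OF 1 2] by (simp only:)
  qed
  have Am: "A (real k * mesh n) \<in> events" for k n using AP[of "real k * mesh n"] sets_past_subset by auto
  have cover: "{\<omega>\<in>space M. inf_neg \<omega> \<le> u} \<subseteq> (\<Union>p. A (real (snd p) * mesh (fst p)))"
  proof
    fix \<omega> assume "\<omega> \<in> {\<omega>\<in>space M. inf_neg \<omega> \<le> u}"
    then have w: "\<omega> \<in> space M" and Y: "inf_neg \<omega> \<le> u" by auto
    have "\<forall>\<^sub>F t in at_top. c + \<eta> / 2 \<le> X t \<omega>" using X_at_top[OF w] by (auto simp: filterlim_at_top)
    then have "\<forall>\<^sub>F t in at_top. c + \<eta> / 2 \<le> X t \<omega> \<and> 0 \<le> t"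
      using eventually_ge_at_top[of "0::real"] by (rule eventually_conj)
    then obtain t where t: "c + \<eta> / 2 \<le> X t \<omega>" "0 \<le> t"
      using eventually_happens'[OF trivial_limit_at_top_linorder] by blast
    \<comment> \<open>The path creeps through \<open>c + \<eta> / 2\<close>. By right-continuity it
      is still in the window at a dyadic time shortly after, so countably many events
      \<open>A\<close> cover.\<close>
    obtain s where s: "0 < s" "X s \<omega> = c + \<eta> / 2"
      by (rule first_passage_creeps[OF X_cadlag[OF w] X_no_positive_jumps[OF w] _ t(2) t(1)])
         (use c e X_0[OF w] in auto)
    have l: "(\<lambda>n. X (dyadic_above n s) \<omega>) \<longlonglongrightarrow> c + \<eta> / 2"
      using cadlag_dyadic_tendsto[OF X_cadlag[OF w], of s] s by simp
    have "\<forall>\<^sub>F n in sequentially. c < X (dyadic_above n s) \<omega>" "\<forall>\<^sub>F n in sequentially. X (dyadic_above n s) \<omega> < c + \<eta>"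
      using e by (auto intro: order_tendstoD[OF l])
    then have "\<forall>\<^sub>F n in sequentially. c < X (dyadic_above n s) \<omega> \<and> X (dyadic_above n s) \<omega> < c + \<eta>"
      by (rule eventually_conj)
    then obtain n where n: "c < X (dyadic_above n s) \<omega>" "X (dyadic_above n s) \<omega> < c + \<eta>"
      using eventually_happens'[OF sequentially_bot] by blast
    obtain k :: nat where k: "dyadic_above n s = real k * mesh n" using dyadic_above_mesh[of s n] s by auto
    have "- X (real (snd p) * mesh (fst p)) \<omega> \<le> u" for p
      using inf_neg_ge[OF w, of "real (snd p) * mesh (fst p)"] Y by simp
    then have "\<omega> \<in> A (real k * mesh n)" unfolding A_def using n w unfolding k by auto
    then show "\<omega> \<in> (\<Union>p. A (real (snd p) * mesh (fst p)))" by (intro UN_I[of "(n, k)"]) auto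
  qed
  have "\<exists>p. prob (A (real (snd p) * mesh (fst p))) \<noteq> 0"
  proof (rule ccontr)
    assume "\<not> ?thesis"
    then have "A (real (snd p) * mesh (fst p)) \<in> null_sets M" for p :: "nat \<times> nat"
      using Am[of "snd p" "fst p"] by (auto simp: null_sets_def emeasure_eq_measure)
    then have "(\<Union>p. A (real (snd p) * mesh (fst p))) \<in> null_sets M" by (rule null_sets_UN)
    then have "prob (\<Union>p. A (real (snd p) * mesh (fst p))) = 0" by (rule measure_eq_0_null_sets)
    moreover have "inf_cdf u \<le> prob (\<Union>p. A (real (snd p) * mesh (fst p)))"
      unfolding inf_cdf_def using cover Am by (intro finite_measure_mono) auto
    ultimately show False using Fu by simp
  qed
  then obtain p where "prob (A (real (snd p) * mesh (fst p))) \<noteq> 0" by blast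
  then obtain s where s: "0 \<le> s" "0 < prob (A s)"
    using zero_less_measure_iff grid_point_nonneg by metis
  let ?E = "\<lambda>y. {\<omega>\<in>A s. \<forall>r\<ge>0. X s \<omega> - X (s + r) \<omega> \<le> y}"
  have E: "prob (?E y) = prob (A s) * inf_cdf y" "?E y \<in> events" for y
    using past_indep_inf_neg[OF AP[OF s(1)] s(1), of y] unfolding inf_cdf_def by auto
  have "prob (?E (b + \<eta>) - ?E b) = prob (?E (b + \<eta>)) - prob (?E b)"
    by (rule finite_measure_Diff[OF E(2) E(2)]) (use e(1) in force)
  also have "\<dots> = prob (A s) * (inf_cdf (b + \<eta>) - inf_cdf b)" unfolding E(1) by (simp add: algebra_simps)
  also have "\<dots> > 0" using s(2) b(2) by simp
  finally have pos: "0 < prob (?E (b + \<eta>) - ?E b)" .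
  have "?E (b + \<eta>) - ?E b \<subseteq> {\<omega>\<in>space M. inf_neg \<omega> \<le> v} - {\<omega>\<in>space M. inf_neg \<omega> \<le> u}"
  proof
    fix \<omega> assume w: "\<omega> \<in> ?E (b + \<eta>) - ?E b"
    then have wA: "\<omega> \<in> A s" and up: "\<And>r. 0 \<le> r \<Longrightarrow> X s \<omega> - X (s + r) \<omega> \<le> b + \<eta>" by auto
    have wM: "\<omega> \<in> space M" and Xs: "c < X s \<omega>" "X s \<omega> < c + \<eta>"
      and gr: "\<And>n k. real k * mesh n \<le> s \<Longrightarrow> - X (real k * mesh n) \<omega> \<le> u"
      using wA unfolding A_def by auto
    obtain r where r: "0 \<le> r" "b < X s \<omega> - X (s + r) \<omega>" using w wA by (auto simp: not_le)
    have "- X (s + r) \<omega> \<le> inf_neg \<omega>" using s(1) r(1) by (intro inf_neg_ge[OF wM]) simp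
    then have "u < inf_neg \<omega>" using r(2) Xs e unfolding c_def by simp
    moreover have "inf_neg \<omega> \<le> v"
    proof (rule inf_neg_le)
      fix t :: real assume t: "0 \<le> t"
      show "- X t \<omega> \<le> v"
      proof (cases "t < s")
        case True
        have "(\<lambda>n. dyadic_above n t) \<longlonglongrightarrow> t" using dyadic_above_tendsto[of t] by (simp add: filterlim_at)
        then have ev: "\<forall>\<^sub>F n in sequentially. dyadic_above n t < s" using True by (rule order_tendstoD)
        have "- X t \<omega> \<le> u"
        proof (rule tendsto_upperbound[OF tendsto_minus[OF cadlag_dyadic_tendsto[OF X_cadlag[OF wM] t]]])
          show "\<forall>\<^sub>F n in sequentially. - X (dyadic_above n t) \<omega> \<le> u"
            using ev
          proof eventually_elim
            case (elim n)
            obtain k :: nat where "dyadic_above n t = real k * mesh n" using dyadic_above_mesh[OF t] by blast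
            then show ?case using gr[of k n] elim by simp
          qed
        qed simp
        then show ?thesis using u by simp
      next
        case False
        then have "X s \<omega> - X t \<omega> \<le> b + \<eta>" using up[of "t - s"] by simp
        then show ?thesis using Xs e unfolding c_def by simp
      qed
    qed
    ultimately show "\<omega> \<in> {\<omega>\<in>space M. inf_neg \<omega> \<le> v} - {\<omega>\<in>space M. inf_neg \<omega> \<le> u}" using wM by auto
  qed
  then have "prob (?E (b + \<eta>) - ?E b) \<le> prob ({\<omega>\<in>space M. inf_neg \<omega> \<le> v} - {\<omega>\<in>space M. inf_neg \<omega> \<le> u})"
    by (rule finite_measure_mono) auto
  also have "\<dots> = inf_cdf v - inf_cdf u"
    unfolding inf_cdf_def by (rule finite_measure_Diff) (use u in auto)
  finally show False using pos flat by simp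
qed

lemma conv_cdf_0: "conv_cdf 0 = (inf_cdf 0)\<^sup>2"
proof -
  have "conv_cdf 0 = (\<integral>\<omega>. inf_cdf 0 * indicator {\<omega>\<in>space M. inf_neg \<omega> \<le> 0} \<omega> \<partial>M)"
    unfolding conv_cdf_eq
  proof (rule Bochner_Integration.integral_cong[OF refl])
    fix \<omega> assume w: "\<omega> \<in> space M"
    show "inf_cdf (0 - inf_neg \<omega>) = inf_cdf 0 * indicator {\<omega>\<in>space M. inf_neg \<omega> \<le> 0} \<omega>"
      using inf_neg_nonneg[OF w] w inf_cdf_neg[of "- inf_neg \<omega>"] by (cases "inf_neg \<omega> = 0") (auto simp: indicator_def)
  qed
  also have "\<dots> = inf_cdf 0 * inf_cdf 0" unfolding inf_cdf_def by simp
  finally show ?thesis by (simp add: power2_eq_square)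
qed

text \<open>\<open>inf_cdf\<close> can jump only at \<open>0\<close>. For \<open>x > 0\<close> the
  event \<open>inf_neg = x\<close> is null, so dominated convergence never meets that jump.\<close>

lemma conv_cdf_isCont:
  assumes cont: "continuous_on {0..} inf_cdf" and "0 < x"
  shows "isCont conv_cdf x"
proof -
  have F_cont: "isCont inf_cdf y" if "y \<noteq> 0" for y
  proof (cases "0 < y")
    case True
    then show ?thesis using continuous_on_interior[OF cont] by simp
  next
    case False
    then have "y < 0" using that by simp
    then have "\<forall>\<^sub>F z in nhds y. inf_cdf z = 0"
      using eventually_nhds_in_open[of "{..<0}" y] by (auto elim: eventually_mono simp: inf_cdf_neg)
    then show ?thesis by (subst isCont_cong[of _ "\<lambda>_. 0"]) auto
  qed
  have "prob {\<omega>\<in>space M. inf_neg \<omega> = x} = 0"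
  proof -
    have "isCont (cdf inf_law) x" using F_cont[of x] \<open>0 < x\<close> unfolding inf_cdf_eq by simp
    then have "measure inf_law {x} = 0" using inf_law.isCont_cdf by simp
    then show ?thesis
      unfolding inf_law_def by (subst (asm) measure_distr) (auto simp: vimage_def Int_def conj_commute)
  qed
  then have ne: "AE \<omega> in M. inf_neg \<omega> \<noteq> x"
    by (intro AE_I[of _ _ "{\<omega>\<in>space M. inf_neg \<omega> = x}"]) (auto simp: emeasure_eq_measure)
  show ?thesis
    unfolding continuous_at_sequentially comp_def
  proof (intro allI impI)
    fix y :: "nat \<Rightarrow> real" assume y: "y \<longlonglongrightarrow> x"
    show "(\<lambda>n. conv_cdf (y n)) \<longlonglongrightarrow> conv_cdf x"
      unfolding conv_cdf_eq
    proof (rule integral_dominated_convergence[where w="\<lambda>_. 1"])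
      show "AE \<omega> in M. (\<lambda>n. inf_cdf (y n - inf_neg \<omega>)) \<longlonglongrightarrow> inf_cdf (x - inf_neg \<omega>)"
        using ne
      proof eventually_elim
        case (elim \<omega>)
        then show ?case by (intro isCont_tendsto_compose[OF F_cont] tendsto_diff y tendsto_const) simp
      qed
    qed (auto simp: inf_cdf_bounds)
  qed
qed

text \<open>Equality would force \<open>inf_cdf (y - Y) = inf_cdf (x - Y)\<close> almost surely. On
  the event \<open>Y \<le> x\<close>, which has positive probability, strict monotonicity of
  \<open>inf_cdf\<close> on the half-line forbids this.\<close>

lemma conv_cdf_strict:
  assumes F0: "inf_cdf 0 < 1" and "0 < x" "x < y"
  shows "conv_cdf x < conv_cdf y"
proof (rule ccontr)
  assume "\<not> conv_cdf x < conv_cdf y"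
  then have "conv_cdf y - conv_cdf x = 0" using conv_cdf_mono[of x y] assms by simp
  then have "(\<integral>\<omega>. inf_cdf (y - inf_neg \<omega>) - inf_cdf (x - inf_neg \<omega>) \<partial>M) = 0"
    unfolding conv_cdf_eq using inf_cdf_shift_integrable by simp
  then have "AE \<omega> in M. inf_cdf (y - inf_neg \<omega>) - inf_cdf (x - inf_neg \<omega>) = 0"
    using inf_cdf_shift_integrable inf_cdf_mono assms
    by (subst (asm) integral_nonneg_eq_0_iff_AE) auto
  then have "AE \<omega> in M. \<not> inf_neg \<omega> \<le> x"
  proof eventually_elim
    case (elim \<omega>)
    show ?case
    proof
      assume "inf_neg \<omega> \<le> x"
      then have "inf_cdf (x - inf_neg \<omega>) < inf_cdf (y - inf_neg \<omega>)"
        using assms by (intro inf_cdf_strict[OF _ _ F0]) auto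
      then show False using elim by simp
    qed
  qed
  then have "prob {\<omega>\<in>space M. inf_neg \<omega> \<le> x} = 0"
    by (subst prob_Collect_eq_0) auto
  then show False using inf_cdf_pos[OF \<open>0 < x\<close>] unfolding inf_cdf_def by simp
qed

lemma level_pos_iff: "0 < level \<longleftrightarrow> (inf_cdf 0)\<^sup>2 < 1 / 2"
  using conv_cdf_ge_half_iff[of 0] level_nonneg unfolding conv_cdf_0 by auto

lemma conv_cdf_level:
  assumes cont: "continuous_on {0..} inf_cdf" and "0 < level"
  shows "conv_cdf level = 1 / 2"
proof (rule antisym)
  show "conv_cdf level \<le> 1 / 2"
  proof (rule tendsto_upperbound)
    show "(conv_cdf \<longlongrightarrow> conv_cdf level) (at_left level)"
      using conv_cdf_isCont[OF assms] unfolding isCont_def by (rule filterlim_mono) (simp_all add: at_le)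
    have "conv_cdf y \<le> 1 / 2" if "y < level" for y using conv_cdf_ge_half_iff[of y] that by simp
    then show "\<forall>\<^sub>F y in at_left level. conv_cdf y \<le> 1 / 2"
      unfolding eventually_at_left_field by (intro exI[of _ "level - 1"]) auto
  qed simp
  show "1 / 2 \<le> conv_cdf level" using conv_cdf_ge_half_iff[of level] by simp
qed

lemma conv_cdf_eq_half_iff:
  assumes cont: "continuous_on {0..} inf_cdf" and "0 < level"
  shows "conv_cdf x = 1 / 2 \<longleftrightarrow> x = level"
proof
  assume x: "conv_cdf x = 1 / 2"
  then have "level \<le> x" using conv_cdf_ge_half_iff[of x] by simp
  moreover have "\<not> level < x"
  proof
    assume "level < x"
    moreover have "inf_cdf 0 < 1"
    proof (rule ccontr)
      assume "\<not> inf_cdf 0 < 1"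
      then have "inf_cdf 0 = 1" using inf_cdf_bounds[of 0] by simp
      then show False using level_pos_iff assms(2) by simp
    qed
    ultimately have "conv_cdf level < conv_cdf x" by (intro conv_cdf_strict assms)
    then show False using x conv_cdf_level[OF assms] by simp
  qed
  ultimately show "x = level" by simp
qed (use conv_cdf_level[OF assms] in simp)

text \<open>An atom at \<open>0\<close> bounds the Laplace transform
  \<open>\<beta> * m / \<psi> \<beta>\<close> below by \<open>inf_cdf 0\<close>, hence
  \<open>\<psi> \<beta> \<le> d * \<beta>\<close>. An exponential Chebyshev bound with exponent
  tending to infinity gives \<open>X t \<le> d * t\<close>, and stationarity carries this over to
  all increments.\<close>

lemma bounded_variation_if_atom:
  assumes "0 < inf_cdf 0"
  shows "AE \<omega> in M. \<forall>T\<ge>0. bounded_variation_on {0..T} (\<lambda>t. X t \<omega>)"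
proof -
  define d where "d = m / inf_cdf 0"
  have d0: "0 \<le> d" unfolding d_def using m_pos assms by simp
  have psi_d: "\<psi> \<beta> \<le> d * \<beta>" if b: "0 < \<beta>" for \<beta>
  proof -
    have "inf_cdf 0 = (\<integral>\<omega>. indicator {\<omega>\<in>space M. inf_neg \<omega> \<le> 0} \<omega> \<partial>M)" unfolding inf_cdf_def by simp
    also have "\<dots> \<le> (\<integral>\<omega>. exp (- \<beta> * inf_neg \<omega>) \<partial>M)"
    proof (rule integral_mono)
      fix \<omega> assume "\<omega> \<in> space M"
      then show "indicator {\<omega>\<in>space M. inf_neg \<omega> \<le> 0} \<omega> \<le> exp (- \<beta> * inf_neg \<omega>)"
        using b by (auto simp: indicator_def mult_nonneg_nonpos)
    qed (use exp_inf_neg_integrable[of \<beta>] b in \<open>auto intro!: integrable_real_indicator simp: emeasure_eq_measure\<close>)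
    also have "\<dots> = \<beta> * m / \<psi> \<beta>" by (rule laplace_inf_neg_eq[OF b])
    finally have "inf_cdf 0 * \<psi> \<beta> \<le> \<beta> * m" using psi_pos[OF b] by (simp add: pos_le_divide_eq)
    then show ?thesis unfolding d_def using assms by (simp add: field_simps)
  qed
  have incr: "AE \<omega> in M. X (real k * mesh n) \<omega> \<le> d * (real k * mesh n)" for k n
  proof -
    let ?t = "real k * mesh n"
    let ?A = "\<lambda>i. {\<omega>\<in>space M. d * ?t + mesh i < X ?t \<omega>}"
    have [measurable]: "X ?t \<in> borel_measurable M" by (rule X_measurable) simp
    have "prob (?A i) = 0" for i
    proof -
      have "prob (?A i) \<le> exp (- (real j * mesh i))" if j: "0 < j" for j :: nat
      proof -
        have "prob (?A i) = (\<integral>\<omega>. indicator (?A i) \<omega> \<partial>M)" by simp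
        also have "\<dots> \<le> (\<integral>\<omega>. exp (- (real j * (d * ?t + mesh i))) * exp (real j * X ?t \<omega>) \<partial>M)"
        proof (rule integral_mono)
          show "integrable M (indicator (?A i) :: 'a \<Rightarrow> real)"
            by (rule integrable_real_indicator) (auto simp: emeasure_eq_measure)
          show "integrable M (\<lambda>\<omega>. exp (- (real j * (d * ?t + mesh i))) * exp (real j * X ?t \<omega>))"
            by (intro integrable_mult_right exp_moment(1)) simp
          fix \<omega>
          show "indicator (?A i) \<omega> \<le> exp (- (real j * (d * ?t + mesh i))) * exp (real j * X ?t \<omega>)"
          proof (cases "d * ?t + mesh i < X ?t \<omega>")
            case True
            then have "0 \<le> real j * (X ?t \<omega> - (d * ?t + mesh i))" by simp
            then have "1 \<le> exp (real j * (X ?t \<omega> - (d * ?t + mesh i)))" by simp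
            also have "\<dots> = exp (- (real j * (d * ?t + mesh i))) * exp (real j * X ?t \<omega>)"
              by (simp add: exp_add[symmetric] algebra_simps)
            finally show ?thesis by (auto simp: indicator_def)
          qed simp
        qed
        also have "\<dots> = exp (- (real j * (d * ?t + mesh i))) * exp (?t * \<psi> (real j))"
          using exp_moment[of "real j" k n] by simp
        also have "\<dots> \<le> exp (- (real j * (d * ?t + mesh i))) * exp (?t * (d * real j))"
          using psi_d[of "real j"] j by (intro mult_left_mono) (auto intro!: mult_left_mono divide_right_mono)
        also have "\<dots> = exp (- (real j * mesh i))" by (simp add: exp_add[symmetric] algebra_simps)
        finally show ?thesis .
      qed
      moreover have "(\<lambda>j. exp (- (real j * mesh i))) \<longlonglongrightarrow> 0"
      proof (rule filterlim_compose[OF exp_at_bot])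
        have "filterlim (\<lambda>j. mesh i * real j) at_top sequentially"
          by (rule filterlim_tendsto_pos_mult_at_top[OF tendsto_const _ filterlim_real_sequentially]) simp
        then show "filterlim (\<lambda>j. - (real j * mesh i)) at_bot sequentially"
          by (simp add: filterlim_uminus_at_bot mult.commute)
      qed
      ultimately have "prob (?A i) \<le> 0"
        by (intro LIMSEQ_le_const[where a="prob _"]) (auto intro!: exI[of _ 1])
      then show ?thesis by (simp add: measure_le_0_iff)
    qed
    then have "AE \<omega> in M. \<not> d * ?t + mesh i < X ?t \<omega>" for i
      by (intro AE_I[of _ _ "(?A i)"]) (auto simp: emeasure_eq_measure)
    then have "AE \<omega> in M. \<forall>i. \<not> d * ?t + mesh i < X ?t \<omega>" by (simp add: AE_all_countable)
    then show ?thesis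
    proof eventually_elim
      case (elim \<omega>)
      have "(\<lambda>i. d * ?t + mesh i) \<longlonglongrightarrow> d * ?t + 0" by (intro tendsto_add tendsto_const half_power_tendsto_0)
      then show ?case using elim by (intro LIMSEQ_le_const[where a="X ?t \<omega>"]) (auto simp: not_less)
    qed
  qed
  have "AE \<omega> in M. X (real j * mesh n + real k * mesh n) \<omega> - X (real j * mesh n) \<omega> \<le> d * (real k * mesh n)" for j k n
  proof -
    let ?s = "real j * mesh n" and ?t = "real k * mesh n"
    have [measurable]: "X ?t \<in> borel_measurable M" "X ?s \<in> borel_measurable M" "X (?s + ?t) \<in> borel_measurable M"
      by (auto intro!: X_measurable add_nonneg_nonneg)
    have eq: "distr M borel (\<lambda>\<omega>. X (?s + ?t) \<omega> - X ?s \<omega>) = distr M borel (X ?t)"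
      using X_stationary[of ?s "?s + ?t"] by simp
    have "AE y in distr M borel (X ?t). y \<le> d * ?t"
      by (subst AE_distr_iff) (use incr[of k n] in auto)
    then show ?thesis unfolding eq[symmetric] by (subst (asm) AE_distr_iff) auto
  qed
  then have "AE \<omega> in M. \<forall>n j k. X (real j * mesh n + real k * mesh n) \<omega> - X (real j * mesh n) \<omega> \<le> d * (real k * mesh n)"
    by (simp add: AE_all_countable)
  then show ?thesis
  proof (rule AE_mp, intro AE_I2 impI allI)
    fix \<omega> and T :: real assume w: "\<omega> \<in> space M" and
      inc: "\<forall>n j k. X (real j * mesh n + real k * mesh n) \<omega> - X (real j * mesh n) \<omega> \<le> d * (real k * mesh n)"
    show "bounded_variation_on {0..T} (\<lambda>t. X t \<omega>)"
    proof (rule bounded_variation_drift_minus_mono[OF _ d0])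
      fix s t :: real assume st: "0 \<le> s" "s \<le> t"
      have dl: "(\<lambda>n. dyadic_above n y) \<longlonglongrightarrow> y" for y using dyadic_above_tendsto[of y] by (simp add: filterlim_at)
      have "(\<lambda>n. X (dyadic_above n t) \<omega> - X (dyadic_above n s) \<omega>) \<longlonglongrightarrow> X t \<omega> - X s \<omega>"
        using st by (intro tendsto_diff cadlag_dyadic_tendsto[OF X_cadlag[OF w]]) auto
      moreover have "(\<lambda>n. d * (dyadic_above n t - dyadic_above n s)) \<longlonglongrightarrow> d * (t - s)"
        by (intro tendsto_mult_left tendsto_diff dl)
      ultimately show "X t \<omega> - X s \<omega> \<le> d * (t - s)"
      proof (rule LIMSEQ_le, intro exI allI impI)
        fix n :: nat
        obtain j where j: "dyadic_above n s = real j * mesh n" using dyadic_above_mesh[OF st(1)] by blast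
        have "0 \<le> t" using st by simp
        then obtain i where i: "dyadic_above n t = real i * mesh n" using dyadic_above_mesh by blast
        have "2 ^ n * s \<le> 2 ^ n * t" using st by simp
        then have "\<lfloor>2 ^ n * s\<rfloor> \<le> \<lfloor>2 ^ n * t\<rfloor>" by (rule floor_mono)
        then have "dyadic_above n s \<le> dyadic_above n t" unfolding dyadic_above_def by (simp add: divide_right_mono)
        then have "j \<le> i" unfolding i j by (simp add: divide_le_cancel)
        then have diff: "real (i - j) * mesh n = real i * mesh n - real j * mesh n"
          by (simp add: of_nat_diff diff_divide_distrib)
        have "real j * mesh n + real (i - j) * mesh n = real i * mesh n" unfolding diff by simp
        then show "X (dyadic_above n t) \<omega> - X (dyadic_above n s) \<omega> \<le> d * (dyadic_above n t - dyadic_above n s)"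
          using inc[rule_format, of j n "i - j"] unfolding i j diff by (simp add: right_diff_distrib)
      qed
    qed
  qed
qed

end

subsection \<open>Passage to the completed space\<close>

lemma distr_completion_cong:
  assumes f: "f \<in> M \<rightarrow>\<^sub>M L" and g: "g \<in> completion M \<rightarrow>\<^sub>M L"
    and eq: "AE \<omega> in completion M. g \<omega> = f \<omega>"
  shows "distr (completion M) L g = distr M L f"
proof -
  have fc: "f \<in> completion M \<rightarrow>\<^sub>M L" using f by (rule measurable_completion)
  have "distr (completion M) L g = distr (completion M) L f"
    using eq fc g by (intro distr_cong_AE) auto
  also have "\<dots> = distr M L f"
  proof (rule measure_eqI)
    fix A assume "A \<in> sets (distr (completion M) L f)"
    then have A: "A \<in> sets L" by simp
    then have "f -` A \<inter> space M \<in> sets M" using f by (rule measurable_sets[rotated])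
    then show "emeasure (distr (completion M) L f) A = emeasure (distr M L f) A"
      using A f fc by (simp add: emeasure_distr)
  qed simp
  finally show ?thesis .
qed

text \<open>Independence says that the joint law is the product of the marginals, and laws are
  unaffected by completion and by changes on null sets.\<close>

lemma indep_vars_completion_cong:
  assumes "prob_space M" and indep: "prob_space.indep_vars M (\<lambda>_. L) Y I"
    and Z: "\<And>i. i \<in> I \<Longrightarrow> Z i \<in> completion M \<rightarrow>\<^sub>M L"
    and eq: "AE \<omega> in completion M. \<forall>i\<in>I. Z i \<omega> = Y i \<omega>"
  shows "prob_space.indep_vars (completion M) (\<lambda>_. L) Z I"
proof -
  interpret prob_space M by fact
  interpret C: prob_space "completion M" by (rule prob_space_completion)
  have Y: "\<And>i. i \<in> I \<Longrightarrow> Y i \<in> M \<rightarrow>\<^sub>M L" using indep unfolding indep_vars_def by auto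
  show ?thesis
  proof (cases "I = {}")
    case True
    then show ?thesis unfolding C.indep_vars_def C.indep_sets_def by auto
  next
    case False
    have "distr (completion M) (PiM I (\<lambda>_. L)) (\<lambda>\<omega>. \<lambda>i\<in>I. Z i \<omega>)
        = distr M (PiM I (\<lambda>_. L)) (\<lambda>\<omega>. \<lambda>i\<in>I. Y i \<omega>)"
      using Y Z eq by (intro distr_completion_cong measurable_restrict) (auto elim!: eventually_mono intro!: restrict_ext)
    also have "\<dots> = PiM I (\<lambda>i. distr M L (Y i))"
      using indep indep_vars_iff_distr_eq_PiM'[OF False, where M'="\<lambda>_. L" and X=Y] Y by simp
    also have "\<dots> = PiM I (\<lambda>i. distr (completion M) L (Z i))"
    proof (rule PiM_cong)
      fix i assume i: "i \<in> I"
      have "distr (completion M) L (Z i) = distr M L (Y i)"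
        using eq i by (intro distr_completion_cong Y Z) (auto elim: eventually_mono)
      then show "distr M L (Y i) = distr (completion M) L (Z i)" by simp
    qed simp
    finally show ?thesis using C.indep_vars_iff_distr_eq_PiM'[OF False, where M'="\<lambda>_. L" and X=Z] Z by simp
  qed
qed

text \<open>The two sets differ within a null set, all of whose subsets are null sets of the
  completion and belong to \<open>F\<close>.\<close>

lemma sets_AE_cong:
  assumes space: "space F = space (completion M)" and null: "null_sets (completion M) \<subseteq> sets F"
    and A: "A \<in> sets F" and B: "B \<subseteq> space (completion M)"
    and eq: "AE \<omega> in completion M. \<omega> \<in> A \<longleftrightarrow> \<omega> \<in> B"
  shows "B \<in> sets F"
proof -
  let ?D = "{\<omega>\<in>space (completion M). \<not> (\<omega> \<in> A \<longleftrightarrow> \<omega> \<in> B)}"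
  have D: "?D \<in> null_sets (completion M)" using eq by (simp only: completion.AE_iff_null_sets)
  have "B \<inter> ?D \<in> sets F" "?D \<in> sets F"
    using null D completion.complete2[of "B \<inter> ?D" ?D] by auto
  then have "(A - ?D) \<union> (B \<inter> ?D) \<in> sets F" using A by (intro sets.Un sets.Diff)
  moreover have "(A - ?D) \<union> (B \<inter> ?D) = B" using B sets.sets_into_space[OF A] space by auto
  ultimately show ?thesis by (simp only:)
qed

text \<open>With the truncated subtraction of \<open>ennreal\<close>,
  \<open>P + (Q - P) = Q + (P - Q)\<close> pointwise. Integrating this and cancelling the finite
  integrals of \<open>Q\<close> and \<open>Q - P\<close> gives the claim, also when the integral of
  \<open>P\<close> is infinite.\<close>

lemma ext_integral_diff:
  fixes P Q :: "'a \<Rightarrow> ennreal"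
  assumes [measurable]: "P \<in> borel_measurable N" "Q \<in> borel_measurable N"
    and fin: "(\<integral>\<^sup>+\<omega>. Q \<omega> \<partial>N) < \<infinity>"
    and f: "AE \<omega> in N. f \<omega> = enn2ereal (P \<omega>) - enn2ereal (Q \<omega>)"
  shows "ext_integral N f = enn2ereal (\<integral>\<^sup>+\<omega>. P \<omega> \<partial>N) - enn2ereal (\<integral>\<^sup>+\<omega>. Q \<omega> \<partial>N)"
proof -
  let ?P = "\<integral>\<^sup>+\<omega>. P \<omega> \<partial>N" and ?Q = "\<integral>\<^sup>+\<omega>. Q \<omega> \<partial>N"
  let ?PQ = "\<integral>\<^sup>+\<omega>. P \<omega> - Q \<omega> \<partial>N" and ?QP = "\<integral>\<^sup>+\<omega>. Q \<omega> - P \<omega> \<partial>N"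
  have minus: "e2ennreal (enn2ereal a - enn2ereal b) = a - b" for a b
    by (rule e2eenreal_enn2ereal_diff)
  have fQ: "AE \<omega> in N. Q \<omega> \<noteq> \<infinity>" using fin by (intro nn_integral_noteq_infinite) auto
  have pos: "(\<integral>\<^sup>+\<omega>. e2ennreal (f \<omega>) \<partial>N) = ?PQ"
    using f by (intro nn_integral_cong_AE) (auto elim!: eventually_mono simp: minus)
  have neg: "(\<integral>\<^sup>+\<omega>. e2ennreal (- f \<omega>) \<partial>N) = ?QP"
  proof (rule nn_integral_cong_AE)
    show "AE \<omega> in N. e2ennreal (- f \<omega>) = Q \<omega> - P \<omega>"
      using f fQ
    proof eventually_elim
      case (elim \<omega>)
      have "- f \<omega> = enn2ereal (Q \<omega>) - enn2ereal (P \<omega>)"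
        using elim by (cases "P \<omega>"; cases "Q \<omega>") (auto simp: enn2ereal_ennreal)
      then show ?case by (simp add: minus)
    qed
  qed
  have "?P + ?QP = (\<integral>\<^sup>+\<omega>. P \<omega> + (Q \<omega> - P \<omega>) \<partial>N)"
    by (rule nn_integral_add[symmetric]) auto
  also have "\<dots> = (\<integral>\<^sup>+\<omega>. Q \<omega> + (P \<omega> - Q \<omega>) \<partial>N)"
  proof (rule nn_integral_cong)
    show "P \<omega> + (Q \<omega> - P \<omega>) = Q \<omega> + (P \<omega> - Q \<omega>)" for \<omega>
      by (auto simp: add_diff_self_ennreal)
  qed
  also have "\<dots> = ?Q + ?PQ" by (rule nn_integral_add) auto
  finally have eq: "?P + ?QP = ?Q + ?PQ" .
  have "?QP \<le> ?Q" by (intro nn_integral_mono) (simp add: diff_le_self_ennreal)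
  then obtain q q' where q: "?Q = ennreal q" "0 \<le> q" "?QP = ennreal q'" "0 \<le> q'"
    using fin by (metis ennreal_cases infinity_ennreal_def less_le_not_le order_le_less_trans top.extremum)
  show ?thesis
  proof (cases "?P")
    case (real p)
    then obtain p' where p': "?PQ = ennreal p'" "0 \<le> p'"
      using eq q by (cases "?PQ") (auto simp: ennreal_plus[symmetric] simp del: ennreal_plus)
    have "p + q' = q + p'" using eq real q p' by (simp add: ennreal_plus[symmetric] del: ennreal_plus)
    then show ?thesis unfolding ext_integral_def pos neg using real q p' by (simp add: enn2ereal_ennreal)
  next
    case top
    then have "?PQ = \<top>"
      using eq q by (cases "?PQ") (auto simp: ennreal_plus[symmetric] simp del: ennreal_plus)
    then show ?thesis unfolding ext_integral_def pos neg using top q by (simp add: enn2ereal_ennreal)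
  qed
qed

context snlp
begin

lemma time_integral_measurable:
  fixes b :: "real \<Rightarrow> real"
  assumes [measurable]: "b \<in> borel_measurable borel" and C: "\<And>y. \<bar>b y\<bar> \<le> C" and \<tau>: "random_time \<tau>"
  shows "time_integral b \<tau> x \<in> borel_measurable M"
proof -
  have [measurable]: "trunc \<tau> N \<in> borel_measurable M" for N by (rule trunc_measurable[OF \<tau>])
  have [measurable]: "(\<lambda>\<omega>. run_cost (\<lambda>y. max 0 (b y)) x (trunc \<tau> N \<omega>) \<omega>) \<in> borel_measurable M" for N
    by (rule run_cost_measurable) auto
  have "(\<lambda>\<omega>. SUP N. ennreal (run_cost (\<lambda>y. max 0 (b y)) x (trunc \<tau> N \<omega>) \<omega>)) \<in> borel_measurable M"
    by measurable
  then show ?thesis by (subst measurable_cong[OF time_integral_SUP[OF _ C]]) auto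
qed

end

definition good_path :: "(real \<Rightarrow> real) \<Rightarrow> bool" where
  "good_path f \<longleftrightarrow> f 0 = 0 \<and> cadlag f \<and> no_positive_jumps f \<and> filterlim f at_top at_top"

text \<open>The path substituted on the exceptional set, so that every path of
  \<open>version\<close> is good.\<close>

lemma good_path_id: "good_path (\<lambda>t. t)"
  unfolding good_path_def cadlag_def no_positive_jumps_def
proof (intro conjI allI impI filterlim_ident)
  fix t l :: real assume "((\<lambda>t. t) \<longlongrightarrow> l) (at_left t)"
  then show "t \<le> l" using tendsto_unique[OF _ tendsto_ident_at] by (metis order_refl trivial_limit_at_left_real)
qed (auto intro!: tendsto_ident_at)

text \<open>All path properties hold surely for \<open>version\<close>, on the completed space.\<close>

locale drifting_snlp =
  fixes M :: "'a measure" and X :: "real \<Rightarrow> 'a \<Rightarrow> real" and m K :: real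
  assumes levy: "spectrally_negative_levy M X" and drift: "drifts_to_infinity M X"
    and exp_integrable: "\<And>\<beta>. 0 \<le> \<beta> \<Longrightarrow> integrable M (\<lambda>\<omega>. exp (\<beta> * X 1 \<omega>))"
    and exponent_ge: "\<And>\<beta>. 0 \<le> \<beta> \<Longrightarrow> \<beta> * m \<le> laplace_exponent M X \<beta>"
    and exponent_le: "\<And>\<beta>. 0 \<le> \<beta> \<Longrightarrow> laplace_exponent M X \<beta> \<le> \<beta> * m + K * \<beta>\<^sup>2"
    and K0: "0 \<le> K"
begin

definition version :: "real \<Rightarrow> 'a \<Rightarrow> real" where
  "version t \<omega> = (if good_path (\<lambda>s. X s \<omega>) then X t \<omega> else t)"

lemma version_good: "good_path (\<lambda>t. version t \<omega>)"
  unfolding version_def using good_path_id by (cases "good_path (\<lambda>s. X s \<omega>)") auto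

lemma X_prob_space: "prob_space M"
  using levy unfolding spectrally_negative_levy_def levy_process_def by auto

lemma X_borel: "0 \<le> t \<Longrightarrow> X t \<in> borel_measurable M"
  using levy unfolding spectrally_negative_levy_def levy_process_def by auto

lemma AE_good: "AE \<omega> in completion M. good_path (\<lambda>s. X s \<omega>)"
  using levy drift
  unfolding spectrally_negative_levy_def levy_process_def drifts_to_infinity_def good_path_def
  by (auto simp: AE_completion_iff)

lemma AE_version: "AE \<omega> in completion M. \<forall>t. version t \<omega> = X t \<omega>"
  using AE_good by eventually_elim (auto simp: version_def)

lemma version_borel: "0 \<le> t \<Longrightarrow> version t \<in> borel_measurable (completion M)"
proof -
  assume t: "0 \<le> t"
  have [measurable]: "X t \<in> borel_measurable (completion M)" using X_borel[OF t] by (rule measurable_completion)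
  have "{\<omega>\<in>space (completion M). \<not> good_path (\<lambda>s. X s \<omega>)} \<in> null_sets (completion M)"
    using AE_good by (simp only: completion.AE_iff_null_sets)
  then have "{\<omega>\<in>space (completion M). \<not> good_path (\<lambda>s. X s \<omega>)} \<in> sets (completion M)" by auto
  then have "{\<omega>\<in>space (completion M). \<not> \<not> good_path (\<lambda>s. X s \<omega>)} \<in> sets (completion M)"
    by (rule sets.sets_Collect_neg)
  then have [measurable]: "Measurable.pred (completion M) (\<lambda>\<omega>. good_path (\<lambda>s. X s \<omega>))"
    by (simp add: pred_def)
  show ?thesis unfolding version_def by measurable
qed

sublocale L: snlp_exp "completion M" version "laplace_exponent M X" m K
proof -
  interpret prob_space M by (rule X_prob_space)
  interpret C: prob_space "completion M" by (rule prob_space_completion)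
  have [measurable]: "X 1 \<in> borel_measurable M" by (rule X_borel) simp
  have exp1: "(\<integral>\<omega>. exp (\<beta> * version 1 \<omega>) \<partial>completion M) = (\<integral>\<omega>. exp (\<beta> * X 1 \<omega>) \<partial>M)"
    "integrable (completion M) (\<lambda>\<omega>. exp (\<beta> * version 1 \<omega>)) \<longleftrightarrow> integrable M (\<lambda>\<omega>. exp (\<beta> * X 1 \<omega>))" for \<beta>
  proof -
    have [measurable]: "version 1 \<in> borel_measurable (completion M)" by (rule version_borel) simp
    have [measurable]: "X 1 \<in> borel_measurable (completion M)" using X_borel[of 1] by (intro measurable_completion) simp
    have ae: "AE \<omega> in completion M. exp (\<beta> * version 1 \<omega>) = exp (\<beta> * X 1 \<omega>)"
      using AE_version by eventually_elim simp
    show "(\<integral>\<omega>. exp (\<beta> * version 1 \<omega>) \<partial>completion M) = (\<integral>\<omega>. exp (\<beta> * X 1 \<omega>) \<partial>M)"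
      by (subst integral_cong_AE[OF _ _ ae]) (auto simp: integral_completion)
    show "integrable (completion M) (\<lambda>\<omega>. exp (\<beta> * version 1 \<omega>)) \<longleftrightarrow> integrable M (\<lambda>\<omega>. exp (\<beta> * X 1 \<omega>))"
      by (subst integrable_cong_AE[OF _ _ ae]) (auto simp: integrable_completion)
  qed
  show "snlp_exp (completion M) version (laplace_exponent M X) m K"
  proof
    fix n and t :: "nat \<Rightarrow> real" assume t: "mono t" "0 \<le> t 0"
    have t0: "0 \<le> t i" for i using monoD[OF t(1), of 0 i] t(2) by simp
    show "C.indep_vars (\<lambda>_. borel) (\<lambda>i \<omega>. version (t (Suc i)) \<omega> - version (t i) \<omega>) {..<n}"
    proof (rule indep_vars_completion_cong)
      show "indep_vars (\<lambda>_. borel) (\<lambda>i \<omega>. X (t (Suc i)) \<omega> - X (t i) \<omega>) {..<n}"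
        using levy t unfolding spectrally_negative_levy_def levy_process_def by blast
      show "AE \<omega> in completion M. \<forall>i\<in>{..<n}. version (t (Suc i)) \<omega> - version (t i) \<omega> = X (t (Suc i)) \<omega> - X (t i) \<omega>"
        using AE_version by eventually_elim simp
    qed (use t0 version_borel in \<open>auto intro: prob_space_axioms borel_measurable_diff\<close>)
  next
    fix s t :: real assume st: "0 \<le> s" "s \<le> t"
    have "distr (completion M) borel (\<lambda>\<omega>. version t \<omega> - version s \<omega>) = distr M borel (\<lambda>\<omega>. X t \<omega> - X s \<omega>)"
      using st AE_version
      by (intro distr_completion_cong borel_measurable_diff X_borel version_borel) (auto elim!: eventually_mono)
    also have "\<dots> = distr M borel (X (t - s))"
      using levy st unfolding spectrally_negative_levy_def levy_process_def by blast
    also have "\<dots> = distr (completion M) borel (version (t - s))"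
      using st AE_version
      by (intro distr_completion_cong[symmetric] X_borel version_borel) (auto elim!: eventually_mono)
    finally show "distr (completion M) borel (\<lambda>\<omega>. version t \<omega> - version s \<omega>) = distr (completion M) borel (version (t - s))" .
  next
    fix \<beta> :: real assume \<beta>: "0 \<le> \<beta>"
    \<comment> \<open>Strict positivity of the moment lets \<open>exp\<close> undo the
      \<open>ln\<close> in \<open>laplace_exponent\<close>.\<close>
    have "(\<integral>\<omega>. exp (\<beta> * X 1 \<omega>) \<partial>M) \<noteq> 0"
      using integral_nonneg_eq_0_iff_AE[OF exp_integrable[OF \<beta>]] AE_False by simp
    moreover have "0 \<le> (\<integral>\<omega>. exp (\<beta> * X 1 \<omega>) \<partial>M)" by (intro integral_nonneg_AE) simp
    ultimately have "0 < (\<integral>\<omega>. exp (\<beta> * X 1 \<omega>) \<partial>M)" by (simp add: less_le)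
    then show "(\<integral>\<omega>. exp (\<beta> * version 1 \<omega>) \<partial>completion M) = exp (laplace_exponent M X \<beta>)"
      unfolding exp1 laplace_exponent_def by simp
    show "integrable (completion M) (\<lambda>\<omega>. exp (\<beta> * version 1 \<omega>))" unfolding exp1 using \<beta> by (rule exp_integrable)
  qed (use version_good version_borel exponent_ge exponent_le K0 in \<open>auto simp: good_path_def\<close>)
qed

lemma F_inf_eq: "F_inf M X = L.inf_cdf"
proof
  fix x
  let ?A = "{\<omega>\<in>space (completion M). L.inf_neg \<omega> \<le> x}"
  let ?B = "{\<omega>\<in>space M. - (INF t\<in>{0..}. ereal (X t \<omega>)) \<le> ereal x}"
  have eq: "AE \<omega> in completion M. \<omega> \<in> ?A \<longleftrightarrow> \<omega> \<in> ?B"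
    using AE_version AE_space
  proof eventually_elim
    case (elim \<omega>)
    have "- (INF t\<in>{0..}. ereal (X t \<omega>)) \<le> ereal x \<longleftrightarrow> ereal (- x) \<le> (INF t\<in>{0..}. ereal (X t \<omega>))"
      by (simp add: ereal_uminus_le_reorder)
    also have "\<dots> \<longleftrightarrow> (\<forall>t\<ge>0. - version t \<omega> \<le> x)"
      using elim by (auto simp: le_INF_iff minus_le_iff)
    also have "\<dots> \<longleftrightarrow> L.inf_neg \<omega> \<le> x"
      using L.inf_neg_ge[OF elim(2)] L.inf_neg_le[of \<omega> x] by (meson order_trans)
    finally show ?case using elim by simp
  qed
  have A: "?A \<in> sets (completion M)" by measurable
  moreover have "?B \<in> sets (completion M)" by (rule completion.in_sets_AE[OF eq A]) auto
  ultimately show "F_inf M X x = L.inf_cdf x"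
    unfolding F_inf_def L.inf_cdf_def using eq by (intro measure_eq_AE[symmetric]) (auto elim!: eventually_mono)
qed

text \<open>\<open>interval_measure\<close> of the distribution function is the law of the infimum,
  and outside \<open>{0..x}\<close> the integrand contributes nothing: the infimum variable is
  nonnegative and \<open>inf_cdf\<close> vanishes on negative arguments.\<close>

lemma self_convolution_eq: "self_convolution L.inf_cdf = L.conv_cdf"
proof
  fix x
  have bot: "(L.inf_cdf \<longlongrightarrow> 0) at_bot" unfolding L.inf_cdf_eq by (rule L.inf_law.cdf_lim_at_bot)
  have top: "(L.inf_cdf \<longlongrightarrow> 1) at_top" unfolding L.inf_cdf_eq by (rule L.inf_law.cdf_lim_at_top_prob)
  have rc: "continuous (at_right a) L.inf_cdf" for a unfolding L.inf_cdf_eq by (rule L.inf_law.cdf_is_right_cont)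
  have "real_distribution (interval_measure L.inf_cdf)"
    using L.inf_cdf_mono rc bot top by (intro real_distribution_interval_measure) auto
  then have law: "interval_measure L.inf_cdf = L.inf_law"
    using L.inf_cdf_mono rc bot
    by (intro cdf_unique L.inf_law.real_distribution_axioms) (auto simp: cdf_interval_measure L.inf_cdf_eq[symmetric])
  have "self_convolution L.inf_cdf x = (\<integral>\<omega>. indicator {0..x} (L.inf_neg \<omega>) * L.inf_cdf (x - L.inf_neg \<omega>) \<partial>completion M)"
    unfolding self_convolution_def law set_lebesgue_integral_def L.inf_law_def
    by (subst integral_distr) auto
  also have "\<dots> = (\<integral>\<omega>. L.inf_cdf (x - L.inf_neg \<omega>) \<partial>completion M)"
    using L.inf_neg_nonneg
    by (intro Bochner_Integration.integral_cong) (auto simp: indicator_def L.inf_cdf_neg)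
  finally show "self_convolution L.inf_cdf x = L.conv_cdf x" by (simp add: L.conv_cdf_eq)
qed

section \<open>Stopping times of the enlarged filtration as random times\<close>

lemma space_null_augmented: "space (null_augmented_filtration M X u) = space M"
  unfolding null_augmented_filtration_def
  by (rule space_measure_of) (use sets.sets_into_space[of _ "completion M"] in auto)

lemma sets_null_augmented: "sets (null_augmented_filtration M X u) = sigma_sets (space M)
    ({X s -` B \<inter> space M | s B. 0 \<le> s \<and> ennreal s \<le> u \<and> B \<in> sets borel} \<union> null_sets (completion M))"
  unfolding null_augmented_filtration_def
  by (rule sets_measure_of) (use sets.sets_into_space[of _ "completion M"] in auto)

lemma null_augmented_null: "null_sets (completion M) \<subseteq> sets (null_augmented_filtration M X u)"
  unfolding sets_null_augmented by auto

lemma version_vimage_AE: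
  "AE \<omega> in completion M. \<omega> \<in> X s -` B \<inter> space M \<longleftrightarrow> \<omega> \<in> version s -` B \<inter> space M"
  using AE_version by eventually_elim auto

text \<open>The preimages under \<open>X s\<close> and \<open>version s\<close> differ by null sets
  of the completion, which both sigma-algebras contain.\<close>

lemma null_augmented_eq_past:
  assumes "0 \<le> r"
  shows "sets (null_augmented_filtration M X (ennreal r)) = sets (L.past r)"
proof
  show "sets (null_augmented_filtration M X (ennreal r)) \<subseteq> sets (L.past r)"
    unfolding sets_null_augmented
  proof (rule sets.sigma_sets_subset'[of _ "L.past r", simplified], safe)
    fix s B assume s: "0 \<le> s" "ennreal s \<le> ennreal r" "B \<in> sets (borel :: real measure)"
    then have "s \<le> r" using assms by (simp add: ennreal_le_iff)
    then have "version s -` B \<inter> space (L.past r) \<in> sets (L.past r)"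
      using s L.X_measurable_past[of s r] by (intro measurable_sets[of _ _ borel]) auto
    then show "X s -` B \<inter> space M \<in> sets (L.past r)"
      using version_vimage_AE[of s B] L.null_sets_past
      by (intro sets_AE_cong[of "L.past r" M "version s -` B \<inter> space M" "X s -` B \<inter> space M"]) (simp_all add: subset_eq eq_commute)
  qed (use sets.top[of "L.past r"] in \<open>auto intro: L.null_sets_past\<close>)
next
  show "sets (L.past r) \<subseteq> sets (null_augmented_filtration M X (ennreal r))"
    unfolding L.sets_past
  proof (rule sets.sigma_sets_subset'[of _ "null_augmented_filtration M X (ennreal r)", simplified space_null_augmented space_completion], safe)
    fix s B assume s: "0 \<le> s" "s \<le> r" "B \<in> sets (borel :: real measure)"
    then have "X s -` B \<inter> space M \<in> sets (null_augmented_filtration M X (ennreal r))"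
      unfolding sets_null_augmented by (intro sigma_sets.Basic) (auto intro: ennreal_leI)
    then show "version s -` B \<inter> space (completion M) \<in> sets (null_augmented_filtration M X (ennreal r))"
      using version_vimage_AE[of s B] null_augmented_null
      by (intro sets_AE_cong[of _ M "X s -` B \<inter> space M" "version s -` B \<inter> space (completion M)"]) (simp_all add: space_null_augmented)
  qed (use null_augmented_null sets.top[of "null_augmented_filtration M X (ennreal r)"] in \<open>auto simp: space_null_augmented\<close>)
qed


lemma space_enlarged: "space (enlarged_filtration M X t) = space M"
  and sets_enlarged: "sets (enlarged_filtration M X t) =
    sigma_sets (space M) (\<Inter>u\<in>{u. t < u \<or> u = \<infinity>}. sets (null_augmented_filtration M X u))"
proof -
  have "(\<Inter>u\<in>{u. t < u \<or> u = \<infinity>}. sets (null_augmented_filtration M X u)) \<subseteq> sets (null_augmented_filtration M X \<infinity>)"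
    by (intro INF_lower) simp
  also have "\<dots> \<subseteq> Pow (space M)"
    using sets.space_closed[of "null_augmented_filtration M X \<infinity>"] by (simp only: space_null_augmented)
  finally have sub: "(\<Inter>u\<in>{u. t < u \<or> u = \<infinity>}. sets (null_augmented_filtration M X u)) \<subseteq> Pow (space M)" .
  show "space (enlarged_filtration M X t) = space M"
    unfolding enlarged_filtration_def by (rule space_measure_of[OF sub])
  show "sets (enlarged_filtration M X t) =
    sigma_sets (space M) (\<Inter>u\<in>{u. t < u \<or> u = \<infinity>}. sets (null_augmented_filtration M X u))"
    unfolding enlarged_filtration_def by (rule sets_measure_of[OF sub])
qed

text \<open>\<open>\<tau> < t\<close> is the union of the events \<open>\<tau> \<le> s\<close> for a
  sequence of \<open>s < t\<close>, and the right limit at \<open>s\<close> is contained in the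
  sigma-algebra at \<open>t\<close>.\<close>

lemma random_time_if_stopping_time:
  assumes "stopping_time (enlarged_filtration M X) \<tau>"
  shows "L.random_time \<tau>"
  unfolding L.random_time_def
proof (intro allI impI)
  fix t :: real assume t: "0 < t"
  let ?s = "\<lambda>n. ennreal (max 0 (t - 1 / real (Suc n)))"
  have le: "{\<omega>\<in>space M. \<tau> \<omega> \<le> ennreal s} \<in> sets (L.past t)" if s: "0 \<le> s" "s < t" for s
  proof -
    have "Measurable.pred (enlarged_filtration M X (ennreal s)) (\<lambda>\<omega>. \<tau> \<omega> \<le> ennreal s)"
      using assms by (rule stopping_timeD)
    then have "{\<omega>\<in>space M. \<tau> \<omega> \<le> ennreal s} \<in> sets (enlarged_filtration M X (ennreal s))"
      by (simp add: pred_def space_enlarged)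
    also have "\<dots> \<subseteq> sets (null_augmented_filtration M X (ennreal t))"
      unfolding sets_enlarged
    proof (rule sets.sigma_sets_subset'[of _ "null_augmented_filtration M X (ennreal t)", simplified space_null_augmented])
      show "(\<Inter>u\<in>{u. ennreal s < u \<or> u = \<infinity>}. sets (null_augmented_filtration M X u)) \<subseteq> sets (null_augmented_filtration M X (ennreal t))"
        by (intro INF_lower) (use s in \<open>simp add: ennreal_lessI\<close>)
      show "space M \<in> sets (null_augmented_filtration M X (ennreal t))"
        using sets.top[of "null_augmented_filtration M X (ennreal t)"] by (simp only: space_null_augmented)
    qed
    also have "\<dots> = sets (L.past t)" using t by (intro null_augmented_eq_past) simp
    finally show ?thesis .
  qed
  have "{\<omega>\<in>space M. \<tau> \<omega> \<le> ?s n} \<in> sets (L.past t)" for n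
    by (rule le) (use t in auto)
  then have "(\<Union>n. {\<omega>\<in>space M. \<tau> \<omega> \<le> ?s n}) \<in> sets (L.past t)"
    by (intro sets.countable_UN) blast
  also have "(\<Union>n. {\<omega>\<in>space M. \<tau> \<omega> \<le> ?s n}) = {\<omega>\<in>space (completion M). \<tau> \<omega> < ennreal t}"
  proof -
    have "(\<exists>n. \<tau> \<omega> \<le> ?s n) \<longleftrightarrow> \<tau> \<omega> < ennreal t" for \<omega>
    proof
      assume "\<exists>n. \<tau> \<omega> \<le> ?s n"
      then obtain n where "\<tau> \<omega> \<le> ?s n" ..
      also have "\<dots> < ennreal t" using t by (intro ennreal_lessI) auto
      finally show "\<tau> \<omega> < ennreal t" .
    next
      assume lt: "\<tau> \<omega> < ennreal t"
      then obtain r where r: "\<tau> \<omega> = ennreal r" "0 \<le> r" by (cases "\<tau> \<omega>") auto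
      then have "0 < t - r" using lt by (simp add: ennreal_less_iff)
      then obtain n where "1 / real (Suc n) < t - r" using nat_approx_posE by blast
      then have "ennreal r \<le> ?s n" by (intro ennreal_leI) linarith
      then show "\<exists>n. \<tau> \<omega> \<le> ?s n" unfolding r by (rule exI)
    qed
    then show ?thesis by auto
  qed
  finally show "{\<omega>\<in>space (completion M). \<tau> \<omega> < ennreal t} \<in> sets (L.past t)" .
qed

text \<open>For finite \<open>t\<close> the event \<open>\<sigma> \<le> t\<close> is an intersection
  of strict events at times decreasing to \<open>t\<close> and not beyond a given
  \<open>v > t\<close>; hence it lies in every later sigma-algebra. The null sets these contain
  allow the passage from \<open>\<sigma>\<close> to \<open>\<tau>\<close>, as needed for the first
  entry time of the original paths.\<close>

lemma stopping_time_if_AE_eq: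
  assumes \<sigma>: "L.random_time \<sigma>" and eq: "AE \<omega> in completion M. \<tau> \<omega> = \<sigma> \<omega>"
  shows "stopping_time (enlarged_filtration M X) \<tau>"
  unfolding stopping_time_def
proof
  fix t :: ennreal
  have "{\<omega>\<in>space M. \<tau> \<omega> \<le> t} \<in> sets (null_augmented_filtration M X u)" if u: "t < u \<or> u = \<infinity>" for u
  proof (cases t)
    case top
    then show ?thesis using sets.top[of "null_augmented_filtration M X u"] by (simp add: space_null_augmented)
  next
    case (real r)
    obtain v where v: "r < v" "ennreal v \<le> u"
    proof (cases u)
      case (real w)
      then show thesis using u \<open>t = ennreal r\<close> \<open>0 \<le> r\<close> by (intro that[of w]) (auto simp: ennreal_less_iff)
    qed (use that[of "r + 1"] in simp)
    let ?s = "\<lambda>n. r + (v - r) / real (Suc n)"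
    have "{\<omega>\<in>space (completion M). \<sigma> \<omega> < ennreal ((?s n))} \<in> sets (L.past v)" for n
    proof -
      have "0 < (v - r) / real (Suc n)" "(v - r) / real (Suc n) \<le> v - r" using v by (auto simp: divide_le_eq mult_le_cancel_left1)
      then have "0 < (?s n)" "(?s n) \<le> v" using \<open>0 \<le> r\<close> by linarith+
      then show ?thesis
        using \<sigma> L.sets_past_mono[of "(?s n)" v] unfolding L.random_time_def by blast
    qed
    then have "(\<Inter>n. {\<omega>\<in>space (completion M). \<sigma> \<omega> < ennreal ((?s n))}) \<in> sets (L.past v)"
      by (intro sets.countable_INT) auto
    also have "(\<Inter>n. {\<omega>\<in>space (completion M). \<sigma> \<omega> < ennreal ((?s n))}) = {\<omega>\<in>space M. \<sigma> \<omega> \<le> t}"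
    proof -
      have "(\<forall>n. \<sigma> \<omega> < ennreal ((?s n))) \<longleftrightarrow> \<sigma> \<omega> \<le> t" for \<omega>
      proof
        assume "\<sigma> \<omega> \<le> t"
        moreover have "t < ennreal ((?s n))" for n
          unfolding real using v \<open>0 \<le> r\<close> by (intro ennreal_lessI) (auto intro: add_nonneg_pos)
        ultimately show "\<forall>n. \<sigma> \<omega> < ennreal ((?s n))" using order_le_less_trans by blast
      next
        assume lt: "\<forall>n. \<sigma> \<omega> < ennreal ((?s n))"
        then obtain s where s: "\<sigma> \<omega> = ennreal s" "0 \<le> s" by (cases "\<sigma> \<omega>") auto
        have "(\<lambda>n. (?s n)) \<longlonglongrightarrow> r + 0"
          by (intro tendsto_add tendsto_const LIMSEQ_Suc[OF lim_const_over_n])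
        moreover have "s \<le> (?s n)" for n
          using lt[rule_format, of n] s by (simp add: ennreal_less_iff)
        ultimately have "s \<le> r + 0" by (intro LIMSEQ_le_const) auto
        then show "\<sigma> \<omega> \<le> t" using s real by (simp add: ennreal_leI)
      qed
      then show ?thesis by auto
    qed
    also have "sets (L.past v) = sets (null_augmented_filtration M X (ennreal v))"
      using v \<open>0 \<le> r\<close> by (intro null_augmented_eq_past[symmetric]) simp
    also have "\<dots> \<subseteq> sets (null_augmented_filtration M X u)"
      unfolding sets_null_augmented using v by (intro sigma_sets_mono') (auto intro: order_trans)
    finally have "{\<omega>\<in>space M. \<sigma> \<omega> \<le> t} \<in> sets (null_augmented_filtration M X u)" .
    then show ?thesis
      using eq null_augmented_null
      by (intro sets_AE_cong[of _ M "{\<omega>\<in>space M. \<sigma> \<omega> \<le> t}" "{\<omega>\<in>space M. \<tau> \<omega> \<le> t}"])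
         (auto simp: space_null_augmented elim: eventually_rev_mp)
  qed
  then have "{\<omega>\<in>space M. \<tau> \<omega> \<le> t} \<in> sets (enlarged_filtration M X t)"
    unfolding sets_enlarged by (intro sigma_sets.Basic) auto
  then show "Measurable.pred (enlarged_filtration M X t) (\<lambda>\<omega>. \<tau> \<omega> \<le> t)"
    by (simp add: pred_def space_enlarged)
qed

lemma stopping_cost_eq:
  assumes \<tau>: "L.random_time \<tau>"
  shows "stopping_cost M X L.rate x \<tau> = enn2ereal (L.cost_pos \<tau> x) - enn2ereal (L.cost_neg \<tau> x)"
  unfolding stopping_cost_def L.cost_pos_def L.cost_neg_def
proof (rule ext_integral_diff)
  show "L.time_integral L.rate \<tau> x \<in> borel_measurable (completion M)"
    by (rule L.time_integral_measurable[OF _ L.rate_bound \<tau>]) simp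
  show "L.time_integral (\<lambda>y. - L.rate y) \<tau> x \<in> borel_measurable (completion M)"
    by (rule L.time_integral_measurable[of _ 1, OF _ _ \<tau>]) (use L.rate_bound in auto)
  show "(\<integral>\<^sup>+\<omega>. L.time_integral (\<lambda>y. - L.rate y) \<tau> x \<omega> \<partial>completion M) < \<infinity>"
    using L.cost_neg_finite[OF \<tau>] unfolding L.cost_neg_def .
  show "AE \<omega> in completion M. ext_integral lborel (\<lambda>s. ereal (indicator {s. 0 \<le> s \<and> ennreal s \<le> \<tau> \<omega>} s * L.rate (x + X s \<omega>)))
    = enn2ereal (L.time_integral L.rate \<tau> x \<omega>) - enn2ereal (L.time_integral (\<lambda>y. - L.rate y) \<tau> x \<omega>)"
    using AE_version
  proof eventually_elim
    case (elim \<omega>)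
    have eq: "indicator {s. 0 \<le> s \<and> ennreal s \<le> \<tau> \<omega>} s * b (x + X s \<omega>)
        = indicator {s. 0 \<le> s \<and> ennreal s \<le> \<tau> \<omega>} s * b (x + L.traj s \<omega>)" for s and b :: "real \<Rightarrow> real"
      using elim by (auto simp: indicator_def L.traj_eq)
    show ?case unfolding ext_integral_def L.time_integral_def eq by simp
  qed
qed

lemma optimal_first_entry:
  shows "optimal_value M X L.rate x = ereal (L.val x)"
    and "optimal_stopping_time M X L.rate x (\<lambda>\<omega>. first_entry {L.level..} (\<lambda>t. x + X t \<omega>))"
proof -
  let ?T = "\<lambda>\<omega>. first_entry {L.level..} (\<lambda>t. x + X t \<omega>)"
  obtain \<sigma> where \<sigma>: "L.random_time \<sigma>"
    "AE \<omega> in completion M. first_entry {L.level..} (\<lambda>t. x + version t \<omega>) = \<sigma> \<omega>"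
    "enn2ereal (L.cost_pos \<sigma> x) - enn2ereal (L.cost_neg \<sigma> x) = ereal (L.val x)"
    by (rule L.optimal_random_time)
  have eq: "AE \<omega> in completion M. ?T \<omega> = \<sigma> \<omega>" using \<sigma>(2) AE_version by eventually_elim simp
  then have st: "stopping_time (enlarged_filtration M X) ?T" by (rule stopping_time_if_AE_eq[OF \<sigma>(1)])
  have "L.cost_pos ?T x = L.cost_pos \<sigma> x" "L.cost_neg ?T x = L.cost_neg \<sigma> x"
    unfolding L.cost_pos_def L.cost_neg_def L.time_integral_def
    using eq by (auto intro!: nn_integral_cong_AE elim!: eventually_mono)
  then have cost: "stopping_cost M X L.rate x ?T = ereal (L.val x)"
    using stopping_cost_eq[OF random_time_if_stopping_time[OF st], of x] \<sigma>(3) by simp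
  show val: "optimal_value M X L.rate x = ereal (L.val x)"
    unfolding optimal_value_def
  proof (rule antisym)
    show "(INF \<tau>\<in>{\<tau>. stopping_time (enlarged_filtration M X) \<tau>}. stopping_cost M X L.rate x \<tau>) \<le> ereal (L.val x)"
      by (rule INF_lower2[of ?T]) (use st cost in auto)
    show "ereal (L.val x) \<le> (INF \<tau>\<in>{\<tau>. stopping_time (enlarged_filtration M X) \<tau>}. stopping_cost M X L.rate x \<tau>)"
      by (rule INF_greatest) (auto simp: stopping_cost_eq dest!: random_time_if_stopping_time intro: L.cost_lower_bound)
  qed
  show "optimal_stopping_time M X L.rate x ?T"
    unfolding optimal_stopping_time_def using st cost val by simp
qed

lemma finite_variation_if_atom:
  assumes "0 < L.inf_cdf 0"
  shows "finite_variation M X"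
proof -
  have "AE \<omega> in completion M. \<forall>T\<ge>0. bounded_variation_on {0..T} (\<lambda>t. X t \<omega>)"
    using L.bounded_variation_if_atom[OF assms] AE_version by eventually_elim simp
  then show ?thesis unfolding finite_variation_def AE_completion_iff .
qed

end

subsection \<open>Value function\<close>

context snlp_exp
begin

text \<open>Written with \<open>min\<close> there is no case distinction left, and continuity of the
  value follows from that of the gain.\<close>

lemma val_eq: "val x = gain level - gain (min level x)"
  unfolding val_def by (auto simp: min_def)

lemma val_mono: "mono val"
proof (rule monoI)
  fix x y :: real assume "x \<le> y"
  then show "val x \<le> val y"
    using gain_level_le[of x] gain_strict_dec_below[of x y]
    by (cases "x = y") (auto simp: val_def)
qed

lemma val_continuous: "continuous_on UNIV val"
proof -
  have "isCont (\<lambda>x. gain level - gain (min level x)) x" for x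
    by (intro continuous_diff continuous_const isCont_o2[OF _ gain_isCont] continuous_min continuous_ident)
  then show ?thesis unfolding val_eq[abs_def] by (simp add: continuous_on_eq_continuous_at)
qed

lemma val_formula:
  "val x = (2 / m * (LINT y:{x..level}|lborel. conv_cdf y) - (level - x) / m) * indicator {..level} x"
proof (cases "x \<le> level")
  case True
  then show ?thesis
    unfolding val_eq gain_def conv_potential_diff(3)[OF True]
    using m_pos by (simp add: field_simps)
qed (simp add: val_def)

text \<open>The secant bound squeezes the difference quotient between \<open>0\<close> and
  \<open>- (2 * conv_cdf y - 1) / m\<close>. The latter tends to \<open>0\<close> because
  \<open>conv_cdf\<close> is continuous at \<open>level\<close> with value \<open>1 / 2\<close>
  there.\<close>

lemma val_deriv_left:
  assumes "continuous_on {0..} inf_cdf" and "0 < level"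
  shows "(val has_real_derivative 0) (at_left level)"
  unfolding has_field_derivative_iff
proof (rule tendsto_sandwich[where f="\<lambda>_. 0" and h="\<lambda>y. - ((2 * conv_cdf y - 1) / m)"])
  have "(conv_cdf \<longlongrightarrow> 1 / 2) (at_left level)"
    using conv_cdf_isCont[OF assms] conv_cdf_level[OF assms] unfolding isCont_def
    by (metis at_le filterlim_mono order_refl subset_UNIV)
  then have "((\<lambda>y. - ((2 * conv_cdf y - 1) / m)) \<longlongrightarrow> - ((2 * (1 / 2) - 1) / m)) (at_left level)"
    using m_pos by (intro tendsto_intros) auto
  then show "((\<lambda>y. - ((2 * conv_cdf y - 1) / m)) \<longlongrightarrow> 0) (at_left level)" by simp
  have quot: "(val y - val level) / (y - level) = - ((gain level - gain y) / (level - y))" if "y < level" for y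
    using that by (simp add: val_def divide_simps) (simp add: algebra_simps)
  have lt: "\<forall>\<^sub>F y in at_left level. y < level" unfolding eventually_at_filter by simp
  show "\<forall>\<^sub>F y in at_left level. 0 \<le> (val y - val level) / (y - level)"
    using lt
  proof eventually_elim
    case (elim y)
    then have "(gain level - gain y) / (level - y) \<le> 0"
      using gain_level_le[of y] by (intro divide_nonpos_pos) auto
    then show ?case unfolding quot[OF elim] by simp
  qed
  show "\<forall>\<^sub>F y in at_left level. (val y - val level) / (y - level) \<le> - ((2 * conv_cdf y - 1) / m)"
    using lt
  proof eventually_elim
    case (elim y)
    then have "(2 * conv_cdf y - 1) / m \<le> (gain level - gain y) / (level - y)"
      using gain_diff_bounds(1)[of y level] by (simp add: pos_le_divide_eq mult.commute)
    then show ?case unfolding quot[OF elim] by simp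
  qed
qed simp

lemma val_deriv_right: "(val has_real_derivative 0) (at_right level)"
  unfolding has_field_derivative_iff
  by (rule tendsto_eventually) (simp add: eventually_at_filter val_def)

text \<open>\<open>conv_potential\<close> vanishes on the nonpositive half-line, so there the gain
  is just \<open>- x / m\<close>.\<close>

lemma val_level_0:
  assumes "level = 0"
  shows "val x = x / m * indicator {..0} x"
  using assms conv_potential_neg[of x] conv_potential_neg[of 0] m_pos
  by (auto simp: val_eq gain_def min_def indicator_def split: if_splits)

lemma val_deriv_left_level_0:
  assumes "level = 0"
  shows "(val has_real_derivative 1 / m) (at_left 0)"
  unfolding has_field_derivative_iff
  by (rule tendsto_eventually) (simp add: eventually_at_filter val_level_0[OF assms] indicator_def)

end

theorem theorem3p4:
  fixes M :: "'a measure" and X :: "real \<Rightarrow> 'a \<Rightarrow> real"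
    and c \<sigma> :: real and \<nu> :: "real measure" and W :: "real \<Rightarrow> real"
  defines "\<psi>' \<equiv> psi_prime_0 M X"
    and "F \<equiv> F_inf M X"
  defines "H \<equiv> self_convolution F"
    and "G \<equiv> (\<lambda>x. 2 * \<psi>' * W x - 1)"
  defines "V \<equiv> (\<lambda>x. real_of_ereal (optimal_value M X G x))"
    and "x\<^sub>0 \<equiv> Inf {x. 0 \<le> G x}"
  assumes "spectrally_negative_levy M X"
    and "levy_triple M X c \<sigma> \<nu>"
    and "drifts_to_infinity M X"
    and "(\<integral>\<^sup>+x\<in>{..< -1}. ennreal (x\<^sup>2) \<partial>\<nu>) < \<infinity>"
    and "finite_variation M X \<Longrightarrow> no_atoms \<nu>"
    and "scale_function M X W"
  shows "(\<forall>x. G x = 2 * F x - 1) \<and>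
    (\<forall>x. \<bar>optimal_value M X G x\<bar> \<noteq> \<infinity>) \<and>
    (\<exists>a\<ge>x\<^sub>0.
      (\<forall>x. \<forall>\<omega>\<in>space M.
         first_entry {y. V y = 0} (\<lambda>t. x + X t \<omega>) = first_entry {a..} (\<lambda>t. x + X t \<omega>)) \<and>
      (\<forall>x. optimal_stopping_time M X G x (\<lambda>\<omega>. first_entry {y. V y = 0} (\<lambda>t. x + X t \<omega>))) \<and>
      a = Inf {x. 1 / 2 \<le> H x} \<and>
      mono V \<and> continuous_on UNIV V \<and>
      (\<not> finite_variation M X \<or> finite_variation M X \<and> (F 0)\<^sup>2 < 1 / 2 \<longrightarrow>
         0 < a \<and> (\<forall>x. H x = 1 / 2 \<longleftrightarrow> x = a) \<and>
         (\<forall>x. V x = (2 / \<psi>' * (LINT y:{x..a}|lborel. H y) - (a - x) / \<psi>') * indicator {..a} x) \<and>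
         (V has_real_derivative 0) (at_left a) \<and> (V has_real_derivative 0) (at_right a)) \<and>
      (finite_variation M X \<and> 1 / 2 \<le> (F 0)\<^sup>2 \<longrightarrow>
         a = 0 \<and>
         (\<forall>x. V x = x / \<psi>' * indicator {..0} x) \<and>
         (V \<longlongrightarrow> 0) (at_left 0) \<and>
         (\<exists>D>0. (V has_real_derivative D) (at_left 0))))"
proof -
  note triple = \<open>levy_triple M X c \<sigma> \<nu>\<close> and scale = \<open>scale_function M X W\<close>
  obtain m K where mK: "0 \<le> K" "\<And>\<beta>. 0 \<le> \<beta> \<Longrightarrow> \<beta> * m \<le> laplace_exponent M X \<beta>"
    "\<And>\<beta>. 0 \<le> \<beta> \<Longrightarrow> laplace_exponent M X \<beta> \<le> \<beta> * m + K * \<beta>\<^sup>2"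
    by (rule laplace_exponent_bounds[OF triple \<open>(\<integral>\<^sup>+x\<in>{..< -1}. ennreal (x\<^sup>2) \<partial>\<nu>) < \<infinity>\<close>]) (rule that)
  interpret drifting_snlp M X m K
    using triple mK by unfold_locales
      (use \<open>spectrally_negative_levy M X\<close> \<open>drifts_to_infinity M X\<close> in \<open>auto simp: levy_triple_def\<close>)
  have \<psi>': "\<psi>' = m" unfolding \<psi>'_def using mK by (intro psi_prime_0_eqI[of m M X K])
  have F: "F = L.inf_cdf" unfolding F_def by (rule F_inf_eq)
  have H: "H = L.conv_cdf" unfolding H_def F by (rule self_convolution_eq)
  have FW: "L.inf_cdf x = m * W x" if "0 \<le> x" for x
    using scale that by (intro L.inf_cdf_eq_scale) (auto simp: scale_function_def)
  have cont: "continuous_on {0..} L.inf_cdf"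
  proof -
    have "continuous_on {0..} (\<lambda>x. m * W x)" using scale by (intro continuous_intros) (auto simp: scale_function_def)
    then show ?thesis by (rule continuous_on_cong[THEN iffD1, rotated -1]) (auto simp: FW)
  qed
  have G: "G = L.rate"
  proof
    fix x show "G x = L.rate x"
      using scale by (cases "0 \<le> x") (auto simp: G_def L.rate_def \<psi>' FW L.inf_cdf_neg scale_function_def)
  qed
  have V: "V = L.val" unfolding V_def G optimal_first_entry(1) by simp
  have zero: "{y. V y = 0} = {L.level..}" unfolding V by (auto simp: L.val_eq_0_iff)
  \<comment> \<open>At the median, \<open>F\<close> is at least \<open>H\<close>, hence at least
    \<open>1 / 2\<close>, so the rate is nonnegative there.\<close>
  have x0: "x\<^sub>0 \<le> L.level"
    unfolding x\<^sub>0_def G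
  proof (rule cInf_lower)
    show "L.level \<in> {x. 0 \<le> L.rate x}"
      using L.conv_cdf_ge_half_iff[of L.level] L.conv_cdf_le[of L.level] by (simp add: L.rate_def)
    show "bdd_below {x. 0 \<le> L.rate x}"
    proof (rule bdd_belowI[of _ 0])
      fix x assume "x \<in> {x. 0 \<le> L.rate x}"
      then show "0 \<le> x" using L.inf_cdf_neg[of x] by (cases "x < 0") (auto simp: L.rate_def)
    qed
  qed
  \<comment> \<open>In the case of infinite variation the distribution function has no atom at
    \<open>0\<close>, because an atom would make the variation finite.\<close>
  have pos: "0 < L.level" if "\<not> finite_variation M X \<or> finite_variation M X \<and> (F 0)\<^sup>2 < 1 / 2"
  proof -
    have "(L.inf_cdf 0)\<^sup>2 < 1 / 2"
    proof (rule ccontr)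
      assume ge: "\<not> (L.inf_cdf 0)\<^sup>2 < 1 / 2"
      then have "L.inf_cdf 0 \<noteq> 0" by auto
      then have "0 < L.inf_cdf 0" using L.inf_cdf_bounds(1)[of 0] by simp
      then show False using finite_variation_if_atom that ge F by auto
    qed
    then show ?thesis by (simp add: L.level_pos_iff)
  qed
  have zero_level: "L.level = 0" if "1 / 2 \<le> (F 0)\<^sup>2"
    using that L.level_pos_iff L.level_nonneg unfolding F by linarith
  have V0: "(L.val \<longlongrightarrow> 0) (at_left 0)" if "L.level = 0"
  proof -
    have "isCont L.val 0" using L.val_continuous by (simp add: continuous_on_eq_continuous_at)
    then have "(L.val \<longlongrightarrow> L.val 0) (at_left 0)"
      unfolding isCont_def by (rule tendsto_within_subset) simp
    then show ?thesis using that by (simp add: L.val_def)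
  qed
  have "x\<^sub>0 \<le> L.level \<and>
      (\<forall>x. \<forall>\<omega>\<in>space M.
         first_entry {y. V y = 0} (\<lambda>t. x + X t \<omega>) = first_entry {L.level..} (\<lambda>t. x + X t \<omega>)) \<and>
      (\<forall>x. optimal_stopping_time M X G x (\<lambda>\<omega>. first_entry {y. V y = 0} (\<lambda>t. x + X t \<omega>))) \<and>
      L.level = Inf {x. 1 / 2 \<le> H x} \<and> mono V \<and> continuous_on UNIV V"
    unfolding zero
  proof (intro conjI allI ballI)
    show "optimal_stopping_time M X G x (\<lambda>\<omega>. first_entry {L.level..} (\<lambda>t. x + X t \<omega>))" for x
      unfolding G by (rule optimal_first_entry(2))
    show "L.level = Inf {x. 1 / 2 \<le> H x}" unfolding H by (rule L.level_def)
    show "mono V" "continuous_on UNIV V" unfolding V by (rule L.val_mono L.val_continuous)+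
  qed (use x0 in simp_all)
  moreover have "0 < L.level \<and> (\<forall>x. H x = 1 / 2 \<longleftrightarrow> x = L.level) \<and>
         (\<forall>x. V x = (2 / \<psi>' * (LINT y:{x..L.level}|lborel. H y) - (L.level - x) / \<psi>') * indicator {..L.level} x) \<and>
         (V has_real_derivative 0) (at_left L.level) \<and> (V has_real_derivative 0) (at_right L.level)"
    if "\<not> finite_variation M X \<or> finite_variation M X \<and> (F 0)\<^sup>2 < 1 / 2"
  proof (intro conjI allI)
    have pos: "0 < L.level" using that by (rule pos)
    show "0 < L.level" by (rule pos)
    show "H x = 1 / 2 \<longleftrightarrow> x = L.level" for x unfolding H by (rule L.conv_cdf_eq_half_iff[OF cont pos])
    show "V x = (2 / \<psi>' * (LINT y:{x..L.level}|lborel. H y) - (L.level - x) / \<psi>') * indicator {..L.level} x" for x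
      unfolding V H \<psi>' by (rule L.val_formula)
    show "(V has_real_derivative 0) (at_left L.level)" unfolding V by (rule L.val_deriv_left[OF cont pos])
    show "(V has_real_derivative 0) (at_right L.level)" unfolding V by (rule L.val_deriv_right)
  qed
  moreover have "L.level = 0 \<and> (\<forall>x. V x = x / \<psi>' * indicator {..0} x) \<and> (V \<longlongrightarrow> 0) (at_left 0) \<and>
         (\<exists>D>0. (V has_real_derivative D) (at_left 0))"
    if "finite_variation M X \<and> 1 / 2 \<le> (F 0)\<^sup>2"
  proof (intro conjI allI)
    have lv: "L.level = 0" using zero_level that by blast
    show "L.level = 0" by (rule lv)
    show "V x = x / \<psi>' * indicator {..0} x" for x unfolding V \<psi>' by (rule L.val_level_0[OF lv])
    show "(V \<longlongrightarrow> 0) (at_left 0)" unfolding V by (rule V0[OF lv])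
    show "\<exists>D>0. (V has_real_derivative D) (at_left 0)"
      unfolding V using L.val_deriv_left_level_0[OF lv] L.m_pos by (intro exI[of _ "1 / m"]) simp
  qed
  moreover have "G x = 2 * F x - 1" for x by (simp add: G F L.rate_def)
  moreover have "\<bar>optimal_value M X G x\<bar> \<noteq> \<infinity>" for x unfolding G optimal_first_entry(1) by simp
  ultimately show ?thesis by blast
qed

end
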